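(* Let $g\ge 1$ and $n\ge 0$ be integers, let $\mathcal A=(a_0,\dots,a_n,m)$ be a sequence of $n+2$ integers, put $d:=\sum_{0\le i\le n}a_i+m(2g-2)$, and let $\mu$ be a universal genus-$g$ polarization of degree $d$. Let $\alpha^{\mathrm{trop}}_{\mathcal A,\mu}\colon M^{\mathrm{trop}}_{g,n+1}\to J^{\mathrm{trop}}_{\mu,g}$ be the universal tropical Abel map and let $\beta^{\mathrm{trop}}_{\mathcal A,\mu}\colon M^{\mathrm{trop}}_{\mathcal A,\mu}\to M^{\mathrm{trop}}_{g,n+1}$ be the natural forgetful morphism from the generalized cone complex $M^{\mathrm{trop}}_{\mathcal A,\mu}$ (all defined in the context). Then the map $$\alpha^{\mathrm{trop}}_{\mathcal A,\mu}\circ\beta^{\mathrm{trop}}_{\mathcal A,\mu}\colon M^{\mathrm{trop}}_{\mathcal A,\mu}\to J^{\mathrm{trop}}_{\mu,g}$$ is a morphism of generalized cone complexes.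
   Context: **Cone complexes.** A cone means a rational polyhedral cone in some $\mathbb R^n$; a morphism of cones is the restriction of an integral linear map sending one cone into the other; a face morphism is an isomorphism onto a (not necessarily proper) face. A generalized cone complex is the colimit (as a topological space) of a finite diagram of cones with face morphisms. A morphism of generalized cone complexes $\Sigma\to\Sigma'$ is a continuous map such that for every cone $\sigma$ of the diagram of $\Sigma$ there is a cone $\sigma'$ of the diagram of $\Sigma'$ such that $\sigma\to\Sigma'$ factors through a cone morphism $\sigma\to\sigma'$. **Graphs.** Graphs are finite and connected; loops and multiple edges are allowed. For $S\subset E(\Gamma)$: $\Gamma/S$ is the contraction of $S$, $\Gamma_S$ the removal of $S$ (keeping all vertices), and $\Gamma^S$ (the $S$-subdivision) is obtained by inserting exactly one new vertex (called exceptional) in the interior of each edge of $S$. $S$ is nondisconnecting if $\Gamma_S$ is connected. A refinement of $\Gamma$ is a graph obtained by successive subdivisions. A specialization $\iota\colon\Gamma\to\Gamma'$ is a contraction of a set of edges, up to isomorphism; it induces $V(\Gamma)\to V(\Gamma')$ surjective and $E(\Gamma')\subset E(\Gamma)$. A weighted graph carries $w\colon V(\Gamma)\to\mathbb Z_{\ge0}$; its genus is $\sum_v w(v)+b_1(\Gamma)$. A graph with $n$ legs carries a map $\mathrm{leg}_\Gamma\colon\{0,\dots,n-1\}\to V(\Gamma)$; put $v_0:=\mathrm{leg}_\Gamma(0)$. Specializations of weighted graphs with legs are required to be compatible with legs and to satisfy $w'(v')=$ genus of $\iota^{-1}(v')$. A weighted graph with legs is stable if $\mathrm{val}(v)+2w(v)+\#\{\text{legs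 at }v\}\ge3$ for all $v$. The stable reduction $\mathrm{st}(\Gamma)$ of a graph with legs is obtained by repeatedly contracting an edge incident to a vertex of valence 1, weight 0 with at most one leg (this gives $\mathrm{red}_\Gamma\colon\Gamma\to\widehat{\Gamma}$, and $\widehat\Gamma$ is also naturally a subgraph of $\Gamma$), and then forgetting the valence-2, weight-0 vertices without legs, so that $\widehat\Gamma$ is a refinement of $\mathrm{st}(\Gamma)$. **Divisors, polarizations, quasistability.** A divisor on $\Gamma$ is a function $D\colon V(\Gamma)\to\mathbb Z$, with $\deg D=\sum_vD(v)$; for a specialization $\iota$, $\iota_*(D)(v')=\sum_{\iota(v)=v'}D(v)$, and likewise for polarizations. A degree-$d$ polarization is a function $\mu\colon V(\Gamma)\to\mathbb R$ with sum $d$. For $V\subset V(\Gamma)$ let $\delta_V$ be the number of edges between $V$ and its complement and $\beta_D(V)=\deg(D|_V)-\mu(V)+\delta_V/2$. A degree-$d$ divisor $D$ is $(v_0,\mu)$-quasistable if $\beta_D(V)\ge0$ for all $V\subsetneq V(\Gamma)$, with strict inequality if $v_0\in V$. A pseudo-divisor on $\Gamma$ is a pair $(\mathcal E,D)$ with $\mathcal E\subset E(\Gamma)$ and $D$ a divisor on $\Gamma^{\mathcal E}$ equal to $-1$ at each exceptional vertex; it is $(v_0,\mu)$-quasistable if $D$ is quasistable on $\Gamma^{\mathcal E}$ for $\mu$ extended by $0$ at exceptional vertices. A universal genus-$g$ polarization of degree $d$ is a collection of degree-$d$ polarizations $\mu_\Gamma$, one for each genus-$g$ stable weighted graph with 1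 leg, with $\mu_{\Gamma'}=\iota_*(\mu_\Gamma)$ for every specialization $\iota\colon\Gamma\to\Gamma'$. For a graph $\Gamma$ of genus $g$ with $n+1$ legs, $\mu$ induces a polarization on $\Gamma$: take the stable reduction of $\Gamma$ with only leg $0$ kept, use $\mu$ on its vertices (viewed in $V(\Gamma)$) and $0$ on all other vertices. **Flows and cones.** A flow on $\Gamma$ is an orientation of $\Gamma$ (sources $s(e)$, targets $t(e)$) with a function $\phi\colon E(\Gamma)\to\mathbb Z_{\ge0}$; flows differing only in the orientation of edges with $\phi(e)=0$ are identified. $\phi$ is acyclic if the digraph obtained by contracting $\{e:\phi(e)=0\}$ has no directed cycle (a loop is a directed cycle). $\operatorname{div}(\phi)(v)=\sum_{t(e)=v}\phi(e)-\sum_{s(e)=v}\phi(e)$. For a cycle $\gamma$ with a chosen direction of travel, $\gamma(e)=1,-1,0$ according to whether $e$ is traversed along its orientation, against it, or is not in $\gamma$. Cycles of $\Gamma$ and $\Gamma^{\mathcal E}$ are identified. For $\mathcal E\subset E(\Gamma)$ and an acyclic flow $\phi$ on $\Gamma^{\mathcal E}$ let $C_{\Gamma,\mathcal E,\phi}=\{x\in\mathbb R_{\ge0}^{E(\Gamma^{\mathcal E})}:\sum_e\gamma(e)\phi(e)x_e=0\ \forall\text{ cycles }\gamma\}$ and let $K_{\Gamma,\mathcal E,\phi}\subset\mathbb R^{E(\Gamma)}_{\ge0}$ be its image under $F\colon\mathbb R^{E(\Gamma^{\mathcal E})}\to\mathbb R^{E(\Gamma)}$, $F(x)_e=\sum_{e'\text{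 over }e}x_{e'}$. For a degree-$d$ divisor $D_0$ on $\Gamma$ (with leg vertex $v_0$ and polarization $\mu$), $\mathrm{Adm}_\Gamma(D_0)$ is the set of pairs $(\mathcal E,\phi)$ with $\mathcal E$ nondisconnecting and $\phi$ an acyclic flow on $\Gamma^{\mathcal E}$ such that $(\mathcal E,D_0^{\mathcal E}+\operatorname{div}(\phi))$ is a $(v_0,\mu)$-quasistable pseudo-divisor, where $D_0^{\mathcal E}$ is $D_0$ extended by $0$. A specialization $(\Gamma,\mathcal E,\phi)\to(\Gamma',\mathcal E',\phi')$ is a specialization $\iota\colon\Gamma\to\Gamma'$ with $\mathcal E'\subset\mathcal E\cap E(\Gamma')$ and a specialization $\Gamma^{\mathcal E}\to\Gamma'^{\mathcal E'}$ compatible with $\iota$ such that $\phi'$ is the restriction of $\phi$; it induces an inclusion $K_{\Gamma',\mathcal E',\phi'}\to K_{\Gamma,\mathcal E,\phi}$. Similarly $(\Gamma,\mathcal E,D)\to(\Gamma',\mathcal E',D')$ is such a pair with $D'$ the push-forward of $D$. **Tropical curves.** A tropical curve $X$ is the metric space of a graph with positive edge lengths (a model of $X$); an $n$-pointed weighted tropical curve also carries $n$ marked points and a finitely supported weight $w\colon X\to\mathbb Z_{\ge0}$. $M^{\mathrm{trop}}_{g,n}$, the moduli space of stable $n$-pointed genus-$g$ tropical curves, is the colimit of the cones $\mathbb R^{E(\Gamma)}_{\ge0}$ over genus-$g$ stable weighted graphs with $n$ legs, with face morphisms from specializations. Divisors on $X$ are finitely supported functions $X\to\mathbb Z$; two are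 equivalent if they differ by $\operatorname{div}(f)=\sum_p(\text{sum of incoming slopes of }f\text{ at }p)\,p$ with $f$ continuous piecewise linear with integer slopes. For a subcurve $Y\subset X$ let $\delta_Y$ be the number of directions leaving $Y$; with a finitely supported $\mu\colon X\to\mathbb R$ of total $d$, a degree-$d$ divisor $\mathcal D$ is $(p_0,\mu)$-quasistable if $\deg(\mathcal D|_Y)-\mu(Y)+\delta_Y/2\ge0$ for all subcurves $Y$, with strict inequality if $Y\ne X$ and $p_0\in Y$. Known: every degree-$d$ divisor is equivalent to a unique $(p_0,\mu)$-quasistable one, and a quasistable divisor has at most one support point, with value $-1$, in the interior of each edge of a model containing $\operatorname{supp}\mu$ and $p_0$; so it induces a quasistable pseudo-divisor on the model. The canonical divisor is $\omega_X(p)=2w(p)-2+\delta_{X,p}$ ($\delta_{X,p}$ the valence of $p$); similarly $\omega_\Gamma(v)=2w(v)-2+\mathrm{val}(v)$. The stable reduction $\mathrm{red}_X\colon X\to\mathrm{st}(X,p_0)$ of $(X,p_0)$ contracts trees of weight $0$ (with at most the marked point $p_0$). **The spaces and maps.** $J^{\mathrm{trop}}_{\mu,g}$ is the colimit of the cones $\sigma_{(\Gamma,\mathcal E,D)}=\mathbb R^{E(\Gamma^{\mathcal E})}_{\ge0}$ over all genus-$g$ stable graphs $\Gamma$ with 1 leg and $(v_0,\mu_\Gamma)$-quasistable pseudo-divisors $(\mathcal E,D)$ on $\Gamma$, with face morphisms from specializations; its points are pairs (stable 1-pointed tropical curve, quasistable divisor on it) up to isomorphism. The map $\alpha^{\mathrm{trop}}_{\mathcal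 A,\mu}$ sends $(X,p_0,\dots,p_n)$ to $(\mathrm{st}(X,p_0),\mathcal D)$, where $\mathcal D$ is the unique $(p_0,\mu)$-quasistable divisor on $\mathrm{st}(X,p_0)$ equivalent to $\mathrm{red}_{X,*}(m\omega_X+\sum_i a_ip_i)$. For a genus-$g$ weighted graph $\Gamma$ with $n+1$ legs put $D_{\Gamma,\mathcal A}=m\omega_\Gamma+\sum_i a_i\,\mathrm{leg}_\Gamma(i)$. $M^{\mathrm{trop}}_{\mathcal A,\mu}$ is the colimit of the cones $K_{\Gamma,\mathcal E,\phi}$ over all genus-$g$ stable weighted graphs $\Gamma$ with $n+1$ legs and $(\mathcal E,\phi)\in\mathrm{Adm}_\Gamma(D_{\Gamma,\mathcal A})$, with morphisms induced by specializations. The map $\beta^{\mathrm{trop}}_{\mathcal A,\mu}$ is induced by the inclusions $K_{\Gamma,\mathcal E,\phi}\subset\mathbb R^{E(\Gamma)}_{\ge0}$. *)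

theory Defs
  imports "HOL-Analysis.Analysis"
begin

section \<open>Cones and generalized cone complexes\<close>

text \<open>A cone in \<open>\<real>\<^sup>I\<close>, \<open>I\<close> a finite set of coordinates, is a set of functions
  vanishing outside \<open>I\<close>.  Its topology is the one induced by the product topology on functions,
  i.e. that of \<open>\<real>\<^sup>I\<close>.\<close>

definition rational_polyhedral_cone :: "'i set \<Rightarrow> ('i \<Rightarrow> real) set \<Rightarrow> bool" where
  "rational_polyhedral_cone I C \<longleftrightarrow> finite I \<and>
     (\<exists>A :: ('i \<Rightarrow> int) set. finite A \<and>
        C = {x. (\<forall>i. i \<notin> I \<longrightarrow> x i = 0) \<and> (\<forall>a\<in>A. (\<Sum>i\<in>I. of_int (a i) * x i) \<ge> 0)})"

definition cone_morphism ::
  "'i set \<Rightarrow> ('i \<Rightarrow> real) set \<Rightarrow> 'j set \<Rightarrow> ('j \<Rightarrow> real) set \<Rightarrow> (('i \<Rightarrow> real) \<Rightarrow> 'j \<Rightarrow> real) \<Rightarrow> bool" where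
  "cone_morphism I C J C' f \<longleftrightarrow>
     (\<exists>M :: 'j \<Rightarrow> 'i \<Rightarrow> int. \<forall>x\<in>C. f x = (\<lambda>j. if j \<in> J then \<Sum>i\<in>I. of_int (M j i) * x i else 0)) \<and>
     f ` C \<subseteq> C'"

definition cone_face :: "'i set \<Rightarrow> ('i \<Rightarrow> real) set \<Rightarrow> ('i \<Rightarrow> real) set \<Rightarrow> bool" where
  "cone_face I T C \<longleftrightarrow>
     (\<exists>a :: 'i \<Rightarrow> real. (\<forall>x\<in>C. (\<Sum>i\<in>I. a i * x i) \<ge> 0) \<and> T = {x\<in>C. (\<Sum>i\<in>I. a i * x i) = 0})"

definition face_morphism ::
  "'i set \<Rightarrow> ('i \<Rightarrow> real) set \<Rightarrow> 'j set \<Rightarrow> ('j \<Rightarrow> real) set \<Rightarrow> (('i \<Rightarrow> real) \<Rightarrow> 'j \<Rightarrow> real) \<Rightarrow> bool" where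
  "face_morphism I C J C' f \<longleftrightarrow>
     (\<exists>T h. cone_face J T C' \<and> cone_morphism I C J T f \<and> cone_morphism J T I C h \<and>
            (\<forall>x\<in>C. h (f x) = x) \<and> (\<forall>y\<in>T. f (h y) = y))"

record ('o, 'i) cone_diagram =
  objs :: "'o set"
  coords :: "'o \<Rightarrow> 'i set"
  cone :: "'o \<Rightarrow> ('i \<Rightarrow> real) set"
  mors :: "'o \<Rightarrow> 'o \<Rightarrow> (('i \<Rightarrow> real) \<Rightarrow> ('i \<Rightarrow> real)) set"

definition finite_face_diagram :: "('o, 'i) cone_diagram \<Rightarrow> bool" where
  "finite_face_diagram \<D> \<longleftrightarrow> finite (objs \<D>) \<and>
     (\<forall>s\<in>objs \<D>. rational_polyhedral_cone (coords \<D> s) (cone \<D> s)) \<and>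
     (\<forall>s\<in>objs \<D>. \<forall>t\<in>objs \<D>. \<forall>f\<in>mors \<D> s t.
        face_morphism (coords \<D> s) (cone \<D> s) (coords \<D> t) (cone \<D> t) f)"

text \<open>The colimit is the quotient of the disjoint union of the cones by the equivalence
  relation generated by \<open>(s, x) ~ (t, f x)\<close> for the morphisms \<open>f\<close> of the diagram.\<close>

definition cone_points :: "('o, 'i) cone_diagram \<Rightarrow> ('o \<times> ('i \<Rightarrow> real)) set" where
  "cone_points \<D> = Sigma (objs \<D>) (cone \<D>)"

definition glue_step :: "('o, 'i) cone_diagram \<Rightarrow> ('o \<times> ('i \<Rightarrow> real)) rel" where
  "glue_step \<D> = {((s, x), (t, f x)) | s x t f.
     s \<in> objs \<D> \<and> t \<in> objs \<D> \<and> f \<in> mors \<D> s t \<and> x \<in> cone \<D> s \<and> f x \<in> cone \<D> t}"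

definition glue :: "('o, 'i) cone_diagram \<Rightarrow> ('o \<times> ('i \<Rightarrow> real)) rel" where
  "glue \<D> = (glue_step \<D> \<union> (glue_step \<D>)\<inverse>)\<^sup>*"

definition colim_class :: "('o, 'i) cone_diagram \<Rightarrow> 'o \<times> ('i \<Rightarrow> real) \<Rightarrow> ('o \<times> ('i \<Rightarrow> real)) set" where
  "colim_class \<D> z = glue \<D> `` {z}"

definition colim_points :: "('o, 'i) cone_diagram \<Rightarrow> ('o \<times> ('i \<Rightarrow> real)) set set" where
  "colim_points \<D> = cone_points \<D> // glue \<D>"

definition colim_topology :: "('o, 'i) cone_diagram \<Rightarrow> ('o \<times> ('i \<Rightarrow> real)) set topology" where
  "colim_topology \<D> = topology (\<lambda>U. U \<subseteq> colim_points \<D> \<and>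
     openin (sum_topology (\<lambda>s. top_of_set (cone \<D> s)) (objs \<D>))
            {z \<in> cone_points \<D>. colim_class \<D> z \<in> U})"

lemma openin_colim_topology:
  "openin (colim_topology \<D>) U \<longleftrightarrow> U \<subseteq> colim_points \<D> \<and>
     openin (sum_topology (\<lambda>s. top_of_set (cone \<D> s)) (objs \<D>))
            {z \<in> cone_points \<D>. colim_class \<D> z \<in> U}" (is "_ \<longleftrightarrow> ?L U")
proof -
  have "istopology ?L"
    unfolding istopology_def
  proof (intro conjI allI impI)
    fix S T assume "?L S" "?L T"
    moreover have "{z \<in> cone_points \<D>. colim_class \<D> z \<in> S \<inter> T} =
      {z \<in> cone_points \<D>. colim_class \<D> z \<in> S} \<inter> {z \<in> cone_points \<D>. colim_class \<D> z \<in> T}"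
      by blast
    ultimately show "S \<inter> T \<subseteq> colim_points \<D>"
      "openin (sum_topology (\<lambda>s. top_of_set (cone \<D> s)) (objs \<D>))
         {z \<in> cone_points \<D>. colim_class \<D> z \<in> S \<inter> T}"
      by (auto intro: openin_Int)
  next
    fix \<K> assume *: "\<forall>K\<in>\<K>. ?L K"
    then show "\<Union>\<K> \<subseteq> colim_points \<D>" by blast
    have "{z \<in> cone_points \<D>. colim_class \<D> z \<in> \<Union>\<K>} =
      \<Union> ((\<lambda>K. {z \<in> cone_points \<D>. colim_class \<D> z \<in> K}) ` \<K>)"
      by blast
    then show "openin (sum_topology (\<lambda>s. top_of_set (cone \<D> s)) (objs \<D>))
         {z \<in> cone_points \<D>. colim_class \<D> z \<in> \<Union>\<K>}"
      using * by (metis (no_types, lifting) imageE openin_Union)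
  qed
  then show ?thesis
    by (simp add: colim_topology_def)
qed

definition cone_complex_morphism ::
  "('o, 'i) cone_diagram \<Rightarrow> ('p, 'j) cone_diagram \<Rightarrow>
   (('o \<times> ('i \<Rightarrow> real)) set \<Rightarrow> ('p \<times> ('j \<Rightarrow> real)) set) \<Rightarrow> bool" where
  "cone_complex_morphism \<D> \<D>' f \<longleftrightarrow>
     finite_face_diagram \<D> \<and> finite_face_diagram \<D>' \<and>
     continuous_map (colim_topology \<D>) (colim_topology \<D>') f \<and>
     (\<forall>s\<in>objs \<D>. \<exists>t\<in>objs \<D>'. \<exists>h.
        cone_morphism (coords \<D> s) (cone \<D> s) (coords \<D>' t) (cone \<D>' t) h \<and>
        (\<forall>x\<in>cone \<D> s. f (colim_class \<D> (s, x)) = colim_class \<D>' (t, h x)))"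

definition orthant :: "'i set \<Rightarrow> ('i \<Rightarrow> real) set" where
  "orthant I = {x. (\<forall>i\<in>I. x i \<ge> 0) \<and> (\<forall>i. i \<notin> I \<longrightarrow> x i = 0)}"

section \<open>Weighted graphs with legs\<close>

text \<open>Multigraphs with loops.  Every edge carries a reference direction from \<open>src\<close> to \<open>tgt\<close>,
  which is not part of the structure: isomorphisms and specializations need not respect it.\<close>

record ('v, 'e) lgraph =
  verts :: "'v set"
  edges :: "'e set"
  src :: "'e \<Rightarrow> 'v"
  tgt :: "'e \<Rightarrow> 'v"
  wt :: "'v \<Rightarrow> nat"
  nlegs :: nat
  leg :: "nat \<Rightarrow> 'v"

definition adj :: "('v, 'e) lgraph \<Rightarrow> 'e set \<Rightarrow> 'v rel" where
  "adj \<Gamma> S = {(u, v). \<exists>e\<in>S. (src \<Gamma> e = u \<and> tgt \<Gamma> e = v) \<or> (src \<Gamma> e = v \<and> tgt \<Gamma> e = u)}"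

definition connected_graph :: "('v, 'e) lgraph \<Rightarrow> bool" where
  "connected_graph \<Gamma> \<longleftrightarrow> verts \<Gamma> \<noteq> {} \<and>
     (\<forall>u\<in>verts \<Gamma>. \<forall>v\<in>verts \<Gamma>. (u, v) \<in> (adj \<Gamma> (edges \<Gamma>))\<^sup>*)"

definition wf_graph :: "('v, 'e) lgraph \<Rightarrow> bool" where
  "wf_graph \<Gamma> \<longleftrightarrow> finite (verts \<Gamma>) \<and> finite (edges \<Gamma>) \<and>
     src \<Gamma> ` edges \<Gamma> \<subseteq> verts \<Gamma> \<and> tgt \<Gamma> ` edges \<Gamma> \<subseteq> verts \<Gamma> \<and>
     (\<forall>i<nlegs \<Gamma>. leg \<Gamma> i \<in> verts \<Gamma>) \<and> connected_graph \<Gamma>"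

definition nondisconnecting :: "('v, 'e) lgraph \<Rightarrow> 'e set \<Rightarrow> bool" where
  "nondisconnecting \<Gamma> S \<longleftrightarrow> S \<subseteq> edges \<Gamma> \<and> connected_graph (\<Gamma>\<lparr>edges := edges \<Gamma> - S\<rparr>)"

definition valence :: "('v, 'e) lgraph \<Rightarrow> 'v \<Rightarrow> nat" where
  "valence \<Gamma> v = card {e\<in>edges \<Gamma>. src \<Gamma> e = v} + card {e\<in>edges \<Gamma>. tgt \<Gamma> e = v}"

definition legs_at :: "('v, 'e) lgraph \<Rightarrow> 'v \<Rightarrow> nat" where
  "legs_at \<Gamma> v = card {i. i < nlegs \<Gamma> \<and> leg \<Gamma> i = v}"

text \<open>Genus of the subgraph with vertices \<open>V\<close> and edges \<open>E\<close>; it is only used for connected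
  subgraphs, for which \<open>b\<^sub>1 = |E| - |V| + 1\<close>.\<close>

definition sub_genus :: "('v, 'e) lgraph \<Rightarrow> 'v set \<Rightarrow> 'e set \<Rightarrow> int" where
  "sub_genus \<Gamma> V E = (\<Sum>v\<in>V. int (wt \<Gamma> v)) + (int (card E) - int (card V) + 1)"

definition genus :: "('v, 'e) lgraph \<Rightarrow> int" where
  "genus \<Gamma> = sub_genus \<Gamma> (verts \<Gamma>) (edges \<Gamma>)"

definition stable :: "('v, 'e) lgraph \<Rightarrow> bool" where
  "stable \<Gamma> \<longleftrightarrow> (\<forall>v\<in>verts \<Gamma>. valence \<Gamma> v + 2 * wt \<Gamma> v + legs_at \<Gamma> v \<ge> 3)"

text \<open>Every finite graph is isomorphic to one on initial segments of the natural numbers.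
  Diagrams are indexed by such graphs only (isomorphisms are among the specializations), so that
  they are finite.\<close>

definition standard_graph :: "(nat, nat) lgraph \<Rightarrow> bool" where
  "standard_graph \<Gamma> \<longleftrightarrow> wf_graph \<Gamma> \<and>
     verts \<Gamma> = {..<card (verts \<Gamma>)} \<and> edges \<Gamma> = {..<card (edges \<Gamma>)} \<and>
     (\<forall>e. e \<notin> edges \<Gamma> \<longrightarrow> src \<Gamma> e = 0 \<and> tgt \<Gamma> e = 0) \<and>
     (\<forall>v. v \<notin> verts \<Gamma> \<longrightarrow> wt \<Gamma> v = 0) \<and> (\<forall>i\<ge>nlegs \<Gamma>. leg \<Gamma> i = 0)"

definition stable_graphs :: "nat \<Rightarrow> nat \<Rightarrow> (nat, nat) lgraph set" where
  "stable_graphs g n = {\<Gamma>. standard_graph \<Gamma> \<and> stable \<Gamma> \<and> genus \<Gamma> = int g \<and> nlegs \<Gamma> = n}"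

text \<open>A specialization \<open>\<Gamma> \<rightarrow> \<Gamma>'\<close> is given by \<open>V(\<Gamma>) \<rightarrow> V(\<Gamma>')\<close> and the inclusion
  \<open>E(\<Gamma>') \<rightarrow> E(\<Gamma>)\<close>; the edges outside the image of the latter are contracted, so the fibres on
  vertices are the connected components of the graph they form.\<close>

definition specialization ::
  "('v, 'e) lgraph \<Rightarrow> ('w, 'f) lgraph \<Rightarrow> ('v \<Rightarrow> 'w) \<Rightarrow> ('f \<Rightarrow> 'e) \<Rightarrow> bool" where
  "specialization \<Gamma> \<Gamma>' \<iota>V \<iota>E \<longleftrightarrow>
     \<iota>V ` verts \<Gamma> = verts \<Gamma>' \<and> inj_on \<iota>E (edges \<Gamma>') \<and> \<iota>E ` edges \<Gamma>' \<subseteq> edges \<Gamma> \<and>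
     (\<forall>e\<in>edges \<Gamma>'. {\<iota>V (src \<Gamma> (\<iota>E e)), \<iota>V (tgt \<Gamma> (\<iota>E e))} = {src \<Gamma>' e, tgt \<Gamma>' e}) \<and>
     (\<forall>u\<in>verts \<Gamma>. \<forall>v\<in>verts \<Gamma>.
        \<iota>V u = \<iota>V v \<longleftrightarrow> (u, v) \<in> (adj \<Gamma> (edges \<Gamma> - \<iota>E ` edges \<Gamma>'))\<^sup>*) \<and>
     nlegs \<Gamma>' = nlegs \<Gamma> \<and> (\<forall>i<nlegs \<Gamma>. leg \<Gamma>' i = \<iota>V (leg \<Gamma> i)) \<and>
     (\<forall>v'\<in>verts \<Gamma>'. int (wt \<Gamma>' v') =
        sub_genus \<Gamma> {v\<in>verts \<Gamma>. \<iota>V v = v'} {e\<in>edges \<Gamma> - \<iota>E ` edges \<Gamma>'. \<iota>V (src \<Gamma> e) = v'})"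

definition push_forward :: "'v set \<Rightarrow> ('v \<Rightarrow> 'w) \<Rightarrow> ('v \<Rightarrow> 'a::comm_monoid_add) \<Rightarrow> 'w \<Rightarrow> 'a" where
  "push_forward V f D w = (\<Sum>v\<in>{v\<in>V. f v = w}. D v)"

text \<open>The inclusion \<open>\<real>\<^bsup>E(\<Gamma>')\<^esup> \<rightarrow> \<real>\<^bsup>E(\<Gamma>)\<^esup>\<close> (extension by zero) induced by a specialization is
  the push-forward along the injection of edges.\<close>

abbreviation extend_zero :: "'f set \<Rightarrow> ('f \<Rightarrow> 'e) \<Rightarrow> ('f \<Rightarrow> real) \<Rightarrow> 'e \<Rightarrow> real" where
  "extend_zero E' \<iota>E \<equiv> push_forward E' \<iota>E"

text \<open>The subdivision \<open>\<Gamma>\<^sup>S\<close>: \<open>Inr e\<close> is the exceptional vertex in \<open>e \<in> S\<close>, which splits \<open>e\<close> into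
  the half \<open>(e, False)\<close> at \<open>src e\<close> and the half \<open>(e, True)\<close> at \<open>tgt e\<close>; an edge \<open>e \<notin> S\<close> becomes
  \<open>(e, False)\<close>.\<close>

definition subdivide :: "('v, 'e) lgraph \<Rightarrow> 'e set \<Rightarrow> ('v + 'e, 'e \<times> bool) lgraph" where
  "subdivide \<Gamma> S = \<lparr>
     verts = Inl ` verts \<Gamma> \<union> Inr ` S,
     edges = {(e, b). e \<in> edges \<Gamma> \<and> (b \<longrightarrow> e \<in> S)},
     src = (\<lambda>(e, b). if b then Inr e else Inl (src \<Gamma> e)),
     tgt = (\<lambda>(e, b). if e \<in> S \<and> \<not> b then Inr e else Inl (tgt \<Gamma> e)),
     wt = case_sum (wt \<Gamma>) (\<lambda>_. 0),
     nlegs = nlegs \<Gamma>,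
     leg = (\<lambda>i. Inl (leg \<Gamma> i))\<rparr>"

definition merge_halves :: "('v, 'e) lgraph \<Rightarrow> 'e set \<Rightarrow> ('e \<times> bool \<Rightarrow> real) \<Rightarrow> 'e \<Rightarrow> real" where
  "merge_halves \<Gamma> S = push_forward (edges (subdivide \<Gamma> S)) fst"

text \<open>A dart is an edge with a direction of travel, \<open>True\<close> being the reference direction.\<close>

definition dart_src :: "('v, 'e) lgraph \<Rightarrow> 'e \<times> bool \<Rightarrow> 'v" where
  "dart_src \<Gamma> d = (if snd d then src \<Gamma> (fst d) else tgt \<Gamma> (fst d))"

definition dart_tgt :: "('v, 'e) lgraph \<Rightarrow> 'e \<times> bool \<Rightarrow> 'v" where
  "dart_tgt \<Gamma> d = (if snd d then tgt \<Gamma> (fst d) else src \<Gamma> (fst d))"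

fun walk :: "('v, 'e) lgraph \<Rightarrow> 'v \<Rightarrow> ('e \<times> bool) list \<Rightarrow> 'v \<Rightarrow> bool" where
  "walk \<Gamma> u [] v \<longleftrightarrow> u \<in> verts \<Gamma> \<and> u = v"
| "walk \<Gamma> u (d # p) v \<longleftrightarrow> fst d \<in> edges \<Gamma> \<and> dart_src \<Gamma> d = u \<and> walk \<Gamma> (dart_tgt \<Gamma> d) p v"

definition graph_cycle :: "('v, 'e) lgraph \<Rightarrow> ('e \<times> bool) list \<Rightarrow> bool" where
  "graph_cycle \<Gamma> p \<longleftrightarrow> p \<noteq> [] \<and> (\<exists>u. walk \<Gamma> u p u) \<and>
     distinct (map (dart_src \<Gamma>) p) \<and> distinct (map fst p)"

section \<open>Stable reduction of graphs\<close>

text \<open>Contracting an edge \<open>e\<close> between a vertex \<open>v\<close> of valence 1 and weight 0 and a vertex \<open>u\<close>; the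
  new vertex is called \<open>u\<close>, so that the result is a subgraph.  The map is the contraction on
  vertices.\<close>

inductive prunes :: "('v, 'e) lgraph \<Rightarrow> ('v, 'e) lgraph \<Rightarrow> ('v \<Rightarrow> 'v) \<Rightarrow> bool" for \<Gamma> where
  prunes_refl: "prunes \<Gamma> \<Gamma> id"
| prunes_step: "\<lbrakk>prunes \<Gamma> \<Delta> r; v \<in> verts \<Delta>; valence \<Delta> v = 1; wt \<Delta> v = 0; legs_at \<Delta> v \<le> 1;
     e \<in> edges \<Delta>; {src \<Delta> e, tgt \<Delta> e} = {v, u}\<rbrakk> \<Longrightarrow>
   prunes \<Gamma>
     (\<Delta>\<lparr>verts := verts \<Delta> - {v}, edges := edges \<Delta> - {e},
         leg := (\<lambda>i. if leg \<Delta> i = v then u else leg \<Delta> i)\<rparr>)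
     (\<lambda>x. if r x = v then u else r x)"

definition fully_pruned :: "('v, 'e) lgraph \<Rightarrow> bool" where
  "fully_pruned \<Delta> \<longleftrightarrow>
     \<not> (\<exists>v\<in>verts \<Delta>. valence \<Delta> v = 1 \<and> wt \<Delta> v = 0 \<and> legs_at \<Delta> v \<le> 1)"

text \<open>\<open>\<Delta>\<close> is a refinement of \<open>\<Gamma>'\<close>: \<open>j\<close> includes \<open>V(\<Gamma>')\<close> into \<open>V(\<Delta>)\<close>, and the edge \<open>e\<close> of \<open>\<Gamma>'\<close>,
  in its reference direction, is subdivided into the path \<open>P e\<close>.  Each edge of \<open>\<Delta>\<close> occurs exactly
  once on these paths, and each new vertex exactly once as an interior vertex of them.\<close>

definition refinement ::
  "('w, 'f) lgraph \<Rightarrow> ('v, 'e) lgraph \<Rightarrow> ('w \<Rightarrow> 'v) \<Rightarrow> ('f \<Rightarrow> ('e \<times> bool) list) \<Rightarrow> bool" where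
  "refinement \<Gamma>' \<Delta> j P \<longleftrightarrow>
     inj_on j (verts \<Gamma>') \<and> j ` verts \<Gamma>' \<subseteq> verts \<Delta> \<and>
     (\<forall>e\<in>edges \<Gamma>'. P e \<noteq> [] \<and> walk \<Delta> (j (src \<Gamma>' e)) (P e) (j (tgt \<Gamma>' e))) \<and>
     bij_betw (\<lambda>(e, i). fst (P e ! i)) (SIGMA e:edges \<Gamma>'. {..<length (P e)}) (edges \<Delta>) \<and>
     bij_betw (\<lambda>(e, i). dart_tgt \<Delta> (P e ! i)) (SIGMA e:edges \<Gamma>'. {..<length (P e) - 1})
       (verts \<Delta> - j ` verts \<Gamma>') \<and>
     (\<forall>v\<in>verts \<Gamma>'. wt \<Delta> (j v) = wt \<Gamma>' v) \<and> (\<forall>v\<in>verts \<Delta> - j ` verts \<Gamma>'. wt \<Delta> v = 0) \<and>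
     nlegs \<Delta> = nlegs \<Gamma>' \<and> (\<forall>i<nlegs \<Gamma>'. leg \<Delta> i = j (leg \<Gamma>' i))"

text \<open>\<open>\<Gamma>'\<close> is the stable reduction of \<open>\<Gamma>\<close>; \<open>\<Delta>\<close> is the graph \<open>\<Gamma>\<close>-hat and \<open>r\<close> is \<open>red\<^sub>\<Gamma>\<close> on vertices.\<close>

definition stable_reduction ::
  "('v, 'e) lgraph \<Rightarrow> ('v, 'e) lgraph \<Rightarrow> ('v \<Rightarrow> 'v) \<Rightarrow>
   (nat, nat) lgraph \<Rightarrow> (nat \<Rightarrow> 'v) \<Rightarrow> (nat \<Rightarrow> ('e \<times> bool) list) \<Rightarrow> bool" where
  "stable_reduction \<Gamma> \<Delta> r \<Gamma>' j P \<longleftrightarrow>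
     prunes \<Gamma> \<Delta> r \<and> fully_pruned \<Delta> \<and> standard_graph \<Gamma>' \<and> refinement \<Gamma>' \<Delta> j P \<and>
     verts \<Delta> - j ` verts \<Gamma>' = {v\<in>verts \<Delta>. valence \<Delta> v = 2 \<and> wt \<Delta> v = 0 \<and> legs_at \<Delta> v = 0}"

definition only_leg0 :: "('v, 'e) lgraph \<Rightarrow> ('v, 'e) lgraph" where
  "only_leg0 \<Gamma> = \<Gamma>\<lparr>nlegs := 1\<rparr>"

section \<open>Divisors, polarizations and quasistability on graphs\<close>

definition cut_size :: "('v, 'e) lgraph \<Rightarrow> 'v set \<Rightarrow> nat" where
  "cut_size \<Gamma> W = card {e\<in>edges \<Gamma>. (src \<Gamma> e \<in> W) \<noteq> (tgt \<Gamma> e \<in> W)}"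

definition beta :: "('v, 'e) lgraph \<Rightarrow> ('v \<Rightarrow> real) \<Rightarrow> ('v \<Rightarrow> int) \<Rightarrow> 'v set \<Rightarrow> real" where
  "beta \<Gamma> \<mu> D W = of_int (\<Sum>v\<in>W. D v) - (\<Sum>v\<in>W. \<mu> v) + real (cut_size \<Gamma> W) / 2"

definition quasistable :: "('v, 'e) lgraph \<Rightarrow> 'v \<Rightarrow> ('v \<Rightarrow> real) \<Rightarrow> ('v \<Rightarrow> int) \<Rightarrow> bool" where
  "quasistable \<Gamma> v0 \<mu> D \<longleftrightarrow>
     of_int (\<Sum>v\<in>verts \<Gamma>. D v) = (\<Sum>v\<in>verts \<Gamma>. \<mu> v) \<and>
     (\<forall>W. W \<subset> verts \<Gamma> \<longrightarrow> beta \<Gamma> \<mu> D W \<ge> 0 \<and> (v0 \<in> W \<longrightarrow> beta \<Gamma> \<mu> D W > 0))"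

text \<open>Divisors, flows and polarizations are extended by zero outside the graph.\<close>

definition pseudo_divisor :: "('v, 'e) lgraph \<Rightarrow> 'e set \<Rightarrow> ('v + 'e \<Rightarrow> int) \<Rightarrow> bool" where
  "pseudo_divisor \<Gamma> \<E> D \<longleftrightarrow> \<E> \<subseteq> edges \<Gamma> \<and> (\<forall>e\<in>\<E>. D (Inr e) = -1) \<and>
     (\<forall>v. v \<notin> verts (subdivide \<Gamma> \<E>) \<longrightarrow> D v = 0)"

definition quasistable_pseudo ::
  "('v, 'e) lgraph \<Rightarrow> ('v \<Rightarrow> real) \<Rightarrow> 'e set \<Rightarrow> ('v + 'e \<Rightarrow> int) \<Rightarrow> bool" where
  "quasistable_pseudo \<Gamma> \<mu> \<E> D \<longleftrightarrow> pseudo_divisor \<Gamma> \<E> D \<and>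
     quasistable (subdivide \<Gamma> \<E>) (Inl (leg \<Gamma> 0)) (case_sum \<mu> (\<lambda>_. 0)) D"

definition universal_polarization ::
  "nat \<Rightarrow> int \<Rightarrow> ((nat, nat) lgraph \<Rightarrow> nat \<Rightarrow> real) \<Rightarrow> bool" where
  "universal_polarization g d \<mu> \<longleftrightarrow>
     (\<forall>\<Gamma>\<in>stable_graphs g 1. (\<Sum>v\<in>verts \<Gamma>. \<mu> \<Gamma> v) = of_int d) \<and>
     (\<forall>\<Gamma>\<in>stable_graphs g 1. \<forall>\<Gamma>'\<in>stable_graphs g 1. \<forall>\<iota>V \<iota>E. specialization \<Gamma> \<Gamma>' \<iota>V \<iota>E \<longrightarrow>
        (\<forall>v'\<in>verts \<Gamma>'. \<mu> \<Gamma>' v' = push_forward (verts \<Gamma>) \<iota>V (\<mu> \<Gamma>) v'))"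

definition induced_polarization ::
  "((nat, nat) lgraph \<Rightarrow> nat \<Rightarrow> real) \<Rightarrow> ('v, 'e) lgraph \<Rightarrow> 'v \<Rightarrow> real" where
  "induced_polarization \<mu> \<Gamma> = (THE \<nu>. \<exists>\<Delta> r \<Gamma>' j P. stable_reduction (only_leg0 \<Gamma>) \<Delta> r \<Gamma>' j P \<and>
     \<nu> = push_forward (verts \<Gamma>') j (\<mu> \<Gamma>'))"

section \<open>Flows and admissible pairs\<close>

text \<open>A flow, up to the orientation of the edges where it vanishes, is an integer function \<open>\<phi>\<close> on the
  edges: \<open>e\<close> carries \<open>\<bar>\<phi> e\<bar>\<close> and is oriented by its reference direction if \<open>\<phi> e > 0\<close> and against it
  if \<open>\<phi> e < 0\<close>.  Reversing an edge changes the signs of both \<open>\<phi> e\<close> and \<open>\<gamma>(e)\<close>, so neither the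
  divergence nor \<open>\<gamma>(e) \<phi>(e)\<close> depends on the reference direction.\<close>

definition is_flow :: "('v, 'e) lgraph \<Rightarrow> ('e \<Rightarrow> int) \<Rightarrow> bool" where
  "is_flow \<Gamma> \<phi> \<longleftrightarrow> (\<forall>e. e \<notin> edges \<Gamma> \<longrightarrow> \<phi> e = 0)"

definition flow_src :: "('v, 'e) lgraph \<Rightarrow> ('e \<Rightarrow> int) \<Rightarrow> 'e \<Rightarrow> 'v" where
  "flow_src \<Gamma> \<phi> e = dart_src \<Gamma> (e, \<phi> e \<ge> 0)"

definition flow_tgt :: "('v, 'e) lgraph \<Rightarrow> ('e \<Rightarrow> int) \<Rightarrow> 'e \<Rightarrow> 'v" where
  "flow_tgt \<Gamma> \<phi> e = dart_tgt \<Gamma> (e, \<phi> e \<ge> 0)"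

definition acyclic_flow :: "('v, 'e) lgraph \<Rightarrow> ('e \<Rightarrow> int) \<Rightarrow> bool" where
  "acyclic_flow \<Gamma> \<phi> \<longleftrightarrow> is_flow \<Gamma> \<phi> \<and>
     (let comp = (\<lambda>v. (adj \<Gamma> {e\<in>edges \<Gamma>. \<phi> e = 0})\<^sup>* `` {v})
      in acyclic {(comp (flow_src \<Gamma> \<phi> e), comp (flow_tgt \<Gamma> \<phi> e)) | e. e \<in> edges \<Gamma> \<and> \<phi> e \<noteq> 0})"

definition flow_div :: "('v, 'e) lgraph \<Rightarrow> ('e \<Rightarrow> int) \<Rightarrow> 'v \<Rightarrow> int" where
  "flow_div \<Gamma> \<phi> v = (\<Sum>e\<in>{e\<in>edges \<Gamma>. flow_tgt \<Gamma> \<phi> e = v}. \<bar>\<phi> e\<bar>)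
                   - (\<Sum>e\<in>{e\<in>edges \<Gamma>. flow_src \<Gamma> \<phi> e = v}. \<bar>\<phi> e\<bar>)"

definition flow_restricts ::
  "('v, 'e) lgraph \<Rightarrow> ('w, 'f) lgraph \<Rightarrow> ('v \<Rightarrow> 'w) \<Rightarrow> ('f \<Rightarrow> 'e) \<Rightarrow> ('e \<Rightarrow> int) \<Rightarrow> ('f \<Rightarrow> int) \<Rightarrow> bool" where
  "flow_restricts \<Gamma> \<Gamma>' \<iota>V \<iota>E \<phi> \<phi>' \<longleftrightarrow>
     (\<forall>e\<in>edges \<Gamma>'. \<bar>\<phi>' e\<bar> = \<bar>\<phi> (\<iota>E e)\<bar> \<and>
        (\<phi>' e \<noteq> 0 \<longrightarrow> flow_src \<Gamma>' \<phi>' e = \<iota>V (flow_src \<Gamma> \<phi> (\<iota>E e)) \<and>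
                      flow_tgt \<Gamma>' \<phi>' e = \<iota>V (flow_tgt \<Gamma> \<phi> (\<iota>E e))))"

definition flow_cone :: "('v, 'e) lgraph \<Rightarrow> 'e set \<Rightarrow> ('e \<times> bool \<Rightarrow> int) \<Rightarrow> ('e \<times> bool \<Rightarrow> real) set" where
  "flow_cone \<Gamma> \<E> \<phi> = {x \<in> orthant (edges (subdivide \<Gamma> \<E>)).
     \<forall>p. graph_cycle (subdivide \<Gamma> \<E>) p \<longrightarrow>
       (\<Sum>(e, b)\<leftarrow>p. (if b then 1 else -1) * of_int (\<phi> e) * x e) = 0}"

definition K_cone :: "('v, 'e) lgraph \<Rightarrow> 'e set \<Rightarrow> ('e \<times> bool \<Rightarrow> int) \<Rightarrow> ('e \<Rightarrow> real) set" where
  "K_cone \<Gamma> \<E> \<phi> = merge_halves \<Gamma> \<E> ` flow_cone \<Gamma> \<E> \<phi>"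

definition Adm ::
  "('v, 'e) lgraph \<Rightarrow> ('v \<Rightarrow> real) \<Rightarrow> ('v \<Rightarrow> int) \<Rightarrow> ('e set \<times> ('e \<times> bool \<Rightarrow> int)) set" where
  "Adm \<Gamma> \<mu> D0 = {(\<E>, \<phi>). nondisconnecting \<Gamma> \<E> \<and> acyclic_flow (subdivide \<Gamma> \<E>) \<phi> \<and>
     quasistable_pseudo \<Gamma> \<mu> \<E> (\<lambda>v. case_sum D0 (\<lambda>_. 0) v + flow_div (subdivide \<Gamma> \<E>) \<phi> v)}"

definition compatible_specialization ::
  "('v, 'e) lgraph \<Rightarrow> 'e set \<Rightarrow> ('w, 'f) lgraph \<Rightarrow> 'f set \<Rightarrow> ('v \<Rightarrow> 'w) \<Rightarrow> ('f \<Rightarrow> 'e) \<Rightarrow>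
   ('v + 'e \<Rightarrow> 'w + 'f) \<Rightarrow> ('f \<times> bool \<Rightarrow> 'e \<times> bool) \<Rightarrow> bool" where
  "compatible_specialization \<Gamma> \<E> \<Gamma>' \<E>' \<iota>V \<iota>E gV gE \<longleftrightarrow>
     specialization \<Gamma> \<Gamma>' \<iota>V \<iota>E \<and> \<iota>E ` \<E>' \<subseteq> \<E> \<and>
     specialization (subdivide \<Gamma> \<E>) (subdivide \<Gamma>' \<E>') gV gE \<and>
     (\<forall>v\<in>verts \<Gamma>. gV (Inl v) = Inl (\<iota>V v)) \<and>
     (\<forall>e\<in>edges (subdivide \<Gamma>' \<E>'). fst (gE e) = \<iota>E (fst e))"

definition omega_graph :: "('v, 'e) lgraph \<Rightarrow> 'v \<Rightarrow> int" where
  "omega_graph \<Gamma> v = 2 * int (wt \<Gamma> v) - 2 + int (valence \<Gamma> v)"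

definition D_graph :: "nat \<Rightarrow> (nat \<Rightarrow> int) \<Rightarrow> int \<Rightarrow> ('v, 'e) lgraph \<Rightarrow> 'v \<Rightarrow> int" where
  "D_graph n a m \<Gamma> v =
     (if v \<in> verts \<Gamma> then m * omega_graph \<Gamma> v + (\<Sum>i\<in>{i. i \<le> n \<and> leg \<Gamma> i = v}. a i) else 0)"

section \<open>The three diagrams\<close>

definition M_trop :: "nat \<Rightarrow> nat \<Rightarrow> ((nat, nat) lgraph, nat) cone_diagram" where
  "M_trop g n = \<lparr>
     objs = stable_graphs g n,
     coords = edges,
     cone = (\<lambda>\<Gamma>. orthant (edges \<Gamma>)),
     mors = (\<lambda>\<Gamma>' \<Gamma>. {extend_zero (edges \<Gamma>') \<iota>E | \<iota>V \<iota>E. specialization \<Gamma> \<Gamma>' \<iota>V \<iota>E})\<rparr>"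

definition J_trop ::
  "nat \<Rightarrow> ((nat, nat) lgraph \<Rightarrow> nat \<Rightarrow> real) \<Rightarrow>
   ((nat, nat) lgraph \<times> nat set \<times> (nat + nat \<Rightarrow> int), nat \<times> bool) cone_diagram" where
  "J_trop g \<mu> = \<lparr>
     objs = {(\<Gamma>, \<E>, D). \<Gamma> \<in> stable_graphs g 1 \<and> quasistable_pseudo \<Gamma> (\<mu> \<Gamma>) \<E> D},
     coords = (\<lambda>(\<Gamma>, \<E>, D). edges (subdivide \<Gamma> \<E>)),
     cone = (\<lambda>(\<Gamma>, \<E>, D). orthant (edges (subdivide \<Gamma> \<E>))),
     mors = (\<lambda>(\<Gamma>', \<E>', D') (\<Gamma>, \<E>, D).
       {extend_zero (edges (subdivide \<Gamma>' \<E>')) gE | \<iota>V \<iota>E gV gE.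
          compatible_specialization \<Gamma> \<E> \<Gamma>' \<E>' \<iota>V \<iota>E gV gE \<and>
          (\<forall>v\<in>verts (subdivide \<Gamma>' \<E>'). D' v = push_forward (verts (subdivide \<Gamma> \<E>)) gV D v)})\<rparr>"

definition MA_trop ::
  "nat \<Rightarrow> nat \<Rightarrow> (nat \<Rightarrow> int) \<Rightarrow> int \<Rightarrow> ((nat, nat) lgraph \<Rightarrow> nat \<Rightarrow> real) \<Rightarrow>
   ((nat, nat) lgraph \<times> nat set \<times> (nat \<times> bool \<Rightarrow> int), nat) cone_diagram" where
  "MA_trop g n a m \<mu> = \<lparr>
     objs = {(\<Gamma>, \<E>, \<phi>). \<Gamma> \<in> stable_graphs g (n + 1) \<and>
               (\<E>, \<phi>) \<in> Adm \<Gamma> (induced_polarization \<mu> \<Gamma>) (D_graph n a m \<Gamma>)},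
     coords = (\<lambda>(\<Gamma>, \<E>, \<phi>). edges \<Gamma>),
     cone = (\<lambda>(\<Gamma>, \<E>, \<phi>). K_cone \<Gamma> \<E> \<phi>),
     mors = (\<lambda>(\<Gamma>', \<E>', \<phi>') (\<Gamma>, \<E>, \<phi>).
       {extend_zero (edges \<Gamma>') \<iota>E | \<iota>V \<iota>E gV gE.
          compatible_specialization \<Gamma> \<E> \<Gamma>' \<E>' \<iota>V \<iota>E gV gE \<and>
          flow_restricts (subdivide \<Gamma> \<E>) (subdivide \<Gamma>' \<E>') gV gE \<phi> \<phi>'})\<rparr>"

definition beta_trop ::
  "nat \<Rightarrow> nat \<Rightarrow> (((nat, nat) lgraph \<times> nat set \<times> (nat \<times> bool \<Rightarrow> int)) \<times> (nat \<Rightarrow> real)) set \<Rightarrow>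
   ((nat, nat) lgraph \<times> (nat \<Rightarrow> real)) set" where
  "beta_trop g n q = the_elem ((\<lambda>((\<Gamma>, \<E>, \<phi>), x). colim_class (M_trop g (n + 1)) (\<Gamma>, x)) ` q)"

section \<open>Tropical curves\<close>

text \<open>The tropical curve with model \<open>\<Gamma>\<close> and positive edge lengths \<open>l\<close>: its points are the vertices
  and the points \<open>Inner e t\<close> of the edge \<open>e\<close> at distance \<open>t\<close> from \<open>src e\<close>.  The metric enters
  through the arc length parametrizations of the edges.\<close>

datatype ('v, 'e) point = Vertex 'v | Inner 'e real

definition curve_points :: "('v, 'e) lgraph \<Rightarrow> ('e \<Rightarrow> real) \<Rightarrow> ('v, 'e) point set" where
  "curve_points \<Gamma> l = Vertex ` verts \<Gamma> \<union> {Inner e t | e t. e \<in> edges \<Gamma> \<and> 0 < t \<and> t < l e}"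

definition along :: "('v, 'e) lgraph \<Rightarrow> ('e \<Rightarrow> real) \<Rightarrow> 'e \<times> bool \<Rightarrow> real \<Rightarrow> ('v, 'e) point" where
  "along \<Gamma> l d s =
     (if s \<le> 0 then Vertex (dart_src \<Gamma> d)
      else if s \<ge> l (fst d) then Vertex (dart_tgt \<Gamma> d)
      else Inner (fst d) (if snd d then s else l (fst d) - s))"

text \<open>Tangent directions \<open>(d, s)\<close> on the curve, based at the point \<open>along \<Gamma> l d s\<close>.\<close>

definition directions :: "('v, 'e) lgraph \<Rightarrow> ('e \<Rightarrow> real) \<Rightarrow> (('e \<times> bool) \<times> real) set" where
  "directions \<Gamma> l = {(d, s). fst d \<in> edges \<Gamma> \<and> 0 \<le> s \<and> s < l (fst d)}"

definition directions_at ::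
  "('v, 'e) lgraph \<Rightarrow> ('e \<Rightarrow> real) \<Rightarrow> ('v, 'e) point \<Rightarrow> (('e \<times> bool) \<times> real) set" where
  "directions_at \<Gamma> l p = {(d, s) \<in> directions \<Gamma> l. along \<Gamma> l d s = p}"

definition curve_divisor :: "('v, 'e) lgraph \<Rightarrow> ('e \<Rightarrow> real) \<Rightarrow> (('v, 'e) point \<Rightarrow> int) \<Rightarrow> bool" where
  "curve_divisor \<Gamma> l D \<longleftrightarrow> finite {p. D p \<noteq> 0} \<and> {p. D p \<noteq> 0} \<subseteq> curve_points \<Gamma> l"

definition rational_function :: "('v, 'e) lgraph \<Rightarrow> ('e \<Rightarrow> real) \<Rightarrow> (('v, 'e) point \<Rightarrow> real) \<Rightarrow> bool" where
  "rational_function \<Gamma> l f \<longleftrightarrow> (\<forall>e\<in>edges \<Gamma>. let h = (\<lambda>t. f (along \<Gamma> l (e, True) t)) in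
     continuous_on {0..l e} h \<and>
     (\<exists>B. finite B \<and> (\<forall>s t. 0 \<le> s \<and> s < t \<and> t \<le> l e \<and> {s<..<t} \<inter> B = {} \<longrightarrow>
        (\<exists>k::int. \<forall>u\<in>{s..t}. h u = h s + of_int k * (u - s)))))"

definition outgoing_slope ::
  "('v, 'e) lgraph \<Rightarrow> ('e \<Rightarrow> real) \<Rightarrow> (('v, 'e) point \<Rightarrow> real) \<Rightarrow> ('e \<times> bool) \<times> real \<Rightarrow> real" where
  "outgoing_slope \<Gamma> l f = (\<lambda>(d, s).
     THE k. ((\<lambda>u. f (along \<Gamma> l d u)) has_real_derivative k) (at_right s))"

definition rational_div ::
  "('v, 'e) lgraph \<Rightarrow> ('e \<Rightarrow> real) \<Rightarrow> (('v, 'e) point \<Rightarrow> real) \<Rightarrow> ('v, 'e) point \<Rightarrow> real" where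
  "rational_div \<Gamma> l f p = (\<Sum>t\<in>directions_at \<Gamma> l p. - outgoing_slope \<Gamma> l f t)"

definition equivalent_divisors ::
  "('v, 'e) lgraph \<Rightarrow> ('e \<Rightarrow> real) \<Rightarrow> (('v, 'e) point \<Rightarrow> int) \<Rightarrow> (('v, 'e) point \<Rightarrow> int) \<Rightarrow> bool" where
  "equivalent_divisors \<Gamma> l D D' \<longleftrightarrow> (\<exists>f. rational_function \<Gamma> l f \<and>
     (\<forall>p\<in>curve_points \<Gamma> l. of_int (D' p - D p) = rational_div \<Gamma> l f p))"

text \<open>Subcurves are the realizations of (not necessarily connected) subgraphs of models of the
  curve, i.e. they meet every edge in finitely many points and closed segments.\<close>

definition subcurve :: "('v, 'e) lgraph \<Rightarrow> ('e \<Rightarrow> real) \<Rightarrow> ('v, 'e) point set \<Rightarrow> bool" where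
  "subcurve \<Gamma> l Y \<longleftrightarrow> Y \<subseteq> curve_points \<Gamma> l \<and>
     (\<forall>e\<in>edges \<Gamma>. \<exists>A :: (real \<times> real) set. finite A \<and>
        {t\<in>{0..l e}. along \<Gamma> l (e, True) t \<in> Y} = (\<Union>(a, b)\<in>A. {a..b}))"

definition leaving_directions ::
  "('v, 'e) lgraph \<Rightarrow> ('e \<Rightarrow> real) \<Rightarrow> ('v, 'e) point set \<Rightarrow> (('e \<times> bool) \<times> real) set" where
  "leaving_directions \<Gamma> l Y = {(d, s) \<in> directions \<Gamma> l. along \<Gamma> l d s \<in> Y \<and>
     (\<forall>\<^sub>F u in at_right s. along \<Gamma> l d u \<notin> Y)}"

text \<open>Here \<open>\<mu>\<close> is supported on the vertices of the model.\<close>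

definition curve_quasistable ::
  "('v, 'e) lgraph \<Rightarrow> ('e \<Rightarrow> real) \<Rightarrow> ('v, 'e) point \<Rightarrow> ('v \<Rightarrow> real) \<Rightarrow> (('v, 'e) point \<Rightarrow> int) \<Rightarrow> bool" where
  "curve_quasistable \<Gamma> l p0 \<mu> D \<longleftrightarrow> curve_divisor \<Gamma> l D \<and>
     of_int (\<Sum>p\<in>{p. D p \<noteq> 0}. D p) = (\<Sum>v\<in>verts \<Gamma>. \<mu> v) \<and>
     (\<forall>Y. subcurve \<Gamma> l Y \<longrightarrow>
        (let b = of_int (\<Sum>p\<in>{p\<in>Y. D p \<noteq> 0}. D p) - (\<Sum>v\<in>{v\<in>verts \<Gamma>. Vertex v \<in> Y}. \<mu> v)
                 + real (card (leaving_directions \<Gamma> l Y)) / 2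
         in b \<ge> 0 \<and> (Y \<noteq> curve_points \<Gamma> l \<and> p0 \<in> Y \<longrightarrow> b > 0)))"

definition omega_curve :: "('v, 'e) lgraph \<Rightarrow> ('e \<Rightarrow> real) \<Rightarrow> ('v, 'e) point \<Rightarrow> int" where
  "omega_curve \<Gamma> l p =
     2 * (case p of Vertex v \<Rightarrow> int (wt \<Gamma> v) | Inner e t \<Rightarrow> 0) - 2 + int (card (directions_at \<Gamma> l p))"

definition D_curve ::
  "nat \<Rightarrow> (nat \<Rightarrow> int) \<Rightarrow> int \<Rightarrow> ('v, 'e) lgraph \<Rightarrow> ('e \<Rightarrow> real) \<Rightarrow> ('v, 'e) point \<Rightarrow> int" where
  "D_curve n a m \<Gamma> l p = (if p \<in> curve_points \<Gamma> l
     then m * omega_curve \<Gamma> l p + (\<Sum>i\<in>{i. i \<le> n \<and> Vertex (leg \<Gamma> i) = p}. a i) else 0)"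

definition curve_push_forward ::
  "(('v, 'e) point \<Rightarrow> ('w, 'f) point) \<Rightarrow> (('v, 'e) point \<Rightarrow> int) \<Rightarrow> ('w, 'f) point \<Rightarrow> int" where
  "curve_push_forward \<rho> D = push_forward {p. D p \<noteq> 0} \<rho> D"

section \<open>The universal tropical Abel map\<close>

text \<open>Lengths on the stable reduction \<open>\<Gamma>'\<close> whose edges \<open>e\<close> are the paths \<open>P e\<close>.\<close>

definition path_lengths ::
  "('w, 'f) lgraph \<Rightarrow> ('f \<Rightarrow> ('e \<times> bool) list) \<Rightarrow> ('e \<Rightarrow> real) \<Rightarrow> 'f \<Rightarrow> real" where
  "path_lengths \<Gamma>' P l e = (if e \<in> edges \<Gamma>' then \<Sum>d\<leftarrow>P e. l (fst d) else 0)"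

text \<open>For the data of a stable reduction, the following determines the map \<open>\<rho> = red\<^sub>X\<close> on all points
  of \<open>X\<close>: it is constant on the contracted edges and maps the path \<open>P e\<close> isometrically onto \<open>e\<close>.\<close>

definition curve_reduction_map ::
  "('v, 'e) lgraph \<Rightarrow> ('e \<Rightarrow> real) \<Rightarrow> ('v, 'e) lgraph \<Rightarrow> ('v \<Rightarrow> 'v) \<Rightarrow>
   ('w, 'f) lgraph \<Rightarrow> ('w \<Rightarrow> 'v) \<Rightarrow> ('f \<Rightarrow> ('e \<times> bool) list) \<Rightarrow>
   (('v, 'e) point \<Rightarrow> ('w, 'f) point) \<Rightarrow> bool" where
  "curve_reduction_map \<Gamma> l \<Delta> r \<Gamma>' j P \<rho> \<longleftrightarrow>
     (\<forall>v\<in>verts \<Gamma>'. \<rho> (Vertex (j v)) = Vertex v) \<and>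
     (\<forall>v\<in>verts \<Gamma>. \<rho> (Vertex v) = \<rho> (Vertex (r v))) \<and>
     (\<forall>e\<in>edges \<Gamma> - edges \<Delta>. \<forall>s\<in>{0..l e}. \<rho> (along \<Gamma> l (e, True) s) = \<rho> (Vertex (src \<Gamma> e))) \<and>
     (\<forall>e\<in>edges \<Gamma>'. \<forall>i<length (P e). \<forall>s\<in>{0..l (fst (P e ! i))}.
        \<rho> (along \<Gamma> l (P e ! i) s) =
        along \<Gamma>' (path_lengths \<Gamma>' P l) (e, True) ((\<Sum>k<i. l (fst (P e ! k))) + s))"

text \<open>The divisor on the tropical curve of \<open>(\<Gamma>, merge_halves \<Gamma> \<E> y)\<close> given by a pseudo-divisor.\<close>

definition pseudo_divisor_on_curve ::
  "('v, 'e) lgraph \<Rightarrow> 'e set \<Rightarrow> ('v + 'e \<Rightarrow> int) \<Rightarrow> ('e \<times> bool \<Rightarrow> real) \<Rightarrow> ('v, 'e) point \<Rightarrow> int" where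
  "pseudo_divisor_on_curve \<Gamma> \<E> D y p = (case p of
       Vertex v \<Rightarrow> D (Inl v)
     | Inner e t \<Rightarrow> if e \<in> \<E> \<and> t = y (e, False) then D (Inr e) else 0)"

definition abel_relation ::
  "nat \<Rightarrow> nat \<Rightarrow> (nat \<Rightarrow> int) \<Rightarrow> int \<Rightarrow> ((nat, nat) lgraph \<Rightarrow> nat \<Rightarrow> real) \<Rightarrow>
   (nat, nat) lgraph \<Rightarrow> (nat \<Rightarrow> real) \<Rightarrow>
   ((nat, nat) lgraph \<times> nat set \<times> (nat + nat \<Rightarrow> int)) \<Rightarrow> (nat \<times> bool \<Rightarrow> real) \<Rightarrow> bool" where
  "abel_relation g n a m \<mu> \<Gamma> l = (\<lambda>(\<Gamma>', \<E>, D) y.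
     \<exists>\<Delta> r j P \<rho>. stable_reduction (only_leg0 \<Gamma>) \<Delta> r \<Gamma>' j P \<and>
       curve_reduction_map \<Gamma> l \<Delta> r \<Gamma>' j P \<rho> \<and>
       (\<Gamma>', \<E>, D) \<in> objs (J_trop g \<mu>) \<and> y \<in> cone (J_trop g \<mu>) (\<Gamma>', \<E>, D) \<and>
       (\<forall>e\<in>edges (subdivide \<Gamma>' \<E>). y e > 0) \<and>
       (let l' = path_lengths \<Gamma>' P l in
          merge_halves \<Gamma>' \<E> y = l' \<and>
          pseudo_divisor_on_curve \<Gamma>' \<E> D y =
            (THE \<D>. curve_quasistable \<Gamma>' l' (Vertex (leg \<Gamma>' 0)) (\<mu> \<Gamma>') \<D> \<and>
                    equivalent_divisors \<Gamma>' l' (curve_push_forward \<rho> (D_curve n a m \<Gamma> l)) \<D>)))"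

text \<open>Every point of \<open>M_trop g (n + 1)\<close> is represented by a graph with positive edge lengths, i.e. by
  a tropical curve, which is unique up to isomorphism.\<close>

definition alpha_trop ::
  "nat \<Rightarrow> nat \<Rightarrow> (nat \<Rightarrow> int) \<Rightarrow> int \<Rightarrow> ((nat, nat) lgraph \<Rightarrow> nat \<Rightarrow> real) \<Rightarrow>
   ((nat, nat) lgraph \<times> (nat \<Rightarrow> real)) set \<Rightarrow>
   (((nat, nat) lgraph \<times> nat set \<times> (nat + nat \<Rightarrow> int)) \<times> (nat \<times> bool \<Rightarrow> real)) set" where
  "alpha_trop g n a m \<mu> q = (THE c. \<exists>\<Gamma> l t y. (\<Gamma>, l) \<in> q \<and> (\<forall>e\<in>edges \<Gamma>. l e > 0) \<and>
     abel_relation g n a m \<mu> \<Gamma> l t y \<and> c = colim_class (J_trop g \<mu>) (t, y))"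

end

theory Submission
 imports Defs "HOL-Library.Multiset"
begin

text \<open>For an admissible pair \<open>(\<E>, \<phi>)\<close> on \<open>\<G>\<close>, the stable reduction \<open>\<G>'\<close> of \<open>\<G>\<close> with leg 0 is obtained
from its core by straightening chains of edges. Quasistability forces the partial sums
of the divisor along a chain to lie in \<open>{-1, 0}\<close>: each chain carries at most one point, of value \<open>-1\<close>, and one gets a quasistable pseudo-divisor on
\<open>\<G>'\<close>. The lengths of its edges are integral linear functions on the cone of
\<open>(\<G>, \<E>, \<phi>)\<close>, because the position of an exceptional vertex is determined by a potential
difference computed along a path that avoids \<open>\<E>\<close>. The potential of \<open>\<phi>\<close> is a rational function
with divisor \<open>div \<phi>\<close>, so the resulting divisor is the unique quasistable one that is equivalent to the
push-forward of the Abel divisor. Faces reduce to positive lengths by specialization.\<close>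

text \<open>\<open>alpha_trop\<close> is a definite description that ranges over positive
  representatives, stable reductions, reduction maps and divisors. Linearity on a cone is therefore
  the easy half; most of the work shows that no choice matters. Two difficulties shape the proof.
  First, lengths vanish on the faces of \<open>K_cone\<close> and the curve changes its
  combinatorial type there, while the linear formula refers to the full graph. So pruning,
  forgetting vertices, subdividing and straightening are all shown to commute with specializations.
  This rests on quantities that add up over fibres with a constant sign (\<open>omega_graph\<close>,
  \<open>stability\<close>, the divisor at interior points of chains): a sum over a fibre vanishes
  only if each term does. Second, acyclicity of a flow does not survive contractions by itself; it
  is recovered from a potential with positive lengths. The hypothesis g \<ge> 1 enters through the
  core: a tree of weight 0 would be pruned to a point where \<open>omega_graph\<close> is negative.
  Integrality comes from the slopes on the two halves of a subdivided edge, which differ by exactly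
  1.\<close>

lemma push_forward_inj:
 assumes "inj_on f V" "v:V"
 shows "push_forward V f D (f v) = D v"
proof -
 have "{v':V. f v' = f v} = {v}" using assms by (auto dest: inj_onD)
 thus ?thesis by (simp add: push_forward_def)
qed

lemma push_forward_outside: "w ~: f`V ==> push_forward V f D w = 0" unfolding push_forward_def by (rule sum.neutral) auto

lemma sum_push_forward:
 assumes "finite V" "finite W" "f`V <= W"
 shows "(SUM w:W. push_forward V f D w) = (SUM v:V. D v)" unfolding push_forward_def using sum.group[OF assms] by simp

lemma sum_push_forward_subset:
 assumes "finite V" "finite W"
 shows "(SUM w:W. push_forward V f D w) = (SUM v:{v:V. f v:W}. D v)"
proof -
 have "{v:V. f v = w} = {v:{v:V. f v:W}. f v = w}" if "w:W" for w using that by auto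
 hence "(SUM w:W. push_forward V f D w) = (SUM w:W. push_forward {v:V. f v:W} f D w)" unfolding push_forward_def by (intro sum.cong) auto
 also have "... = (SUM v:{v:V. f v:W}. D v)" by (rule sum_push_forward) (use assms in auto)
 finally show ?thesis .
qed

lemma push_forward_comp:
 assumes "finite V" "finite W" "f`V <= W"
 shows "push_forward W h (push_forward V f D) u = push_forward V (h \<circ> f) D u"
proof -
 have "push_forward W h (push_forward V f D) u = (SUM w:{w:W. h w = u}. push_forward V f D w)" by (simp add: push_forward_def)
 also have "... = (SUM v:{v:V. f v:{w:W. h w = u}}. D v)" by (rule sum_push_forward_subset) (use assms in auto)
 also have "{v:V. f v:{w:W. h w = u}} = {v:V. (h \<circ> f) v = u}" using assms by auto
 finally show ?thesis by (simp add: push_forward_def)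
qed

lemma push_forward_cong:
 "(!!v. v:V ==> f v = f' v) ==> (!!v. v:V ==> D v = D' v) ==>
  push_forward V f D w = push_forward V f' D' w" unfolding push_forward_def by (rule sum.cong) auto

lemma push_forward_add:
 "push_forward V f (%v. D v + D' v) w = push_forward V f D w + push_forward V f D' w" by (simp add: push_forward_def sum.distrib)

subsection \<open>Integral functionals and cones\<close>

text \<open>The functional lives on the whole function space rather than on a cone, and its
  coefficients are existential. This gives closure under sums and integer multiples, so that each
  row of an integer matrix can be built separately.\<close>

definition int_functional :: "'i set => (('i => real) => real) => bool" where
 "int_functional I L \<longleftrightarrow> (\<exists>a :: 'i => int. \<forall>x. L x = (SUM i:I. of_int (a i) * x i))"

lemma int_functional_coord:
 assumes "finite I" "i:I" shows "int_functional I (%x. x i)" unfolding int_functional_def by (rule exI[of _ "%j. if j = i then 1 else 0"])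
   (use assms in "simp add: if_distrib if_distribR sum.delta cong: if_cong")

lemma int_functional_zero: "int_functional I (%x. 0)" unfolding int_functional_def by (rule exI[of _ "%j. 0"]) simp

lemma int_functional_add:
 assumes "int_functional I L" "int_functional I L'" shows "int_functional I (%x. L x + L' x)"
proof -
 from assms obtain a b where "!!x. L x = (SUM i:I. of_int (a i) * x i)" "!!x. L' x = (SUM i:I. of_int (b i) * x i)" unfolding int_functional_def by blast
 thus ?thesis unfolding int_functional_def by (intro exI[of _ "%i. a i + b i"]) (simp add: sum.distrib distrib_right)
qed

lemma int_functional_cmult:
 assumes "int_functional I L" shows "int_functional I (%x. of_int c * L x)"
proof -
 from assms obtain a where "!!x. L x = (SUM i:I. of_int (a i) * x i)" unfolding int_functional_def by blast
 thus ?thesis unfolding int_functional_def by (intro exI[of _ "%i. c * a i"]) (simp add: sum_distrib_left mult.assoc)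
qed

lemma int_functional_minus: "int_functional I L ==> int_functional I (%x. - L x)" using int_functional_cmult[of I L "-1"] by simp

lemma int_functional_diff:
 "int_functional I L ==> int_functional I L' ==> int_functional I (%x. L x - L' x)" using int_functional_add[of I L "%x. - L' x"] int_functional_minus[of I L'] by simp

lemma int_functional_sum:
 "(!!k. k:S ==> int_functional I (L k)) ==> int_functional I (%x. SUM k:S. L k x)"
 by (induction S rule: infinite_finite_induct) (auto intro: int_functional_zero int_functional_add)

lemma int_functional_sum_list:
 "(!!k. k:set ks ==> int_functional I (L k)) ==> int_functional I (%x. \<Sum>k\<leftarrow>ks. L k x)"
 by (induction ks) (auto intro: int_functional_zero int_functional_add)

lemma cone_morphismI:
 assumes "!!x. x:C ==> f x:C'"
  and "!!x j. x:C ==> j ~: J ==> f x j = 0"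
  and "!!j. j:J ==> \<exists>L. int_functional I L & (ALL x:C. f x j = L x)"
 shows "cone_morphism I C J C' f"
proof -
 have "\<exists>a :: _ => int. ALL x:C. f x j = (SUM i:I. of_int (a i) * x i)" if "j:J" for j using assms(3)[OF that] unfolding int_functional_def by metis
 then obtain M :: "_ => _ => int" where "!!j x. j:J ==> x:C ==> f x j = (SUM i:I. of_int (M j i) * x i)" by metis
 thus ?thesis unfolding cone_morphism_def using assms(1,2) by (intro conjI exI[of _ M]) (auto simp: fun_eq_iff)
qed

lemma rational_polyhedral_coneI:
 assumes "finite I" "finite \<L>" "!!L. L:\<L> ==> int_functional I L"
  and "C = {x. (\<forall>i. i ~: I --> x i = 0) & (ALL L:\<L>. L x >= 0)}"
 shows "rational_polyhedral_cone I C"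
proof -
 obtain a :: "_ => _ => int" where a: "!!L x. L:\<L> ==> L x = (SUM i:I. of_int (a L i) * x i)" using assms(3) unfolding int_functional_def by metis
 show ?thesis unfolding rational_polyhedral_cone_def using assms(1,2,4) a by (intro conjI exI[of _ "a`\<L>"]) auto
qed

lemma orthant_rational_polyhedral:
 assumes "finite I" shows "rational_polyhedral_cone I (orthant I)" by (rule rational_polyhedral_coneI[where \<L> = "(%i x. x i)`I"])
   (use assms in "auto simp: orthant_def intro: int_functional_coord")

text \<open>The face is the zero locus of \<open>L\<close>, and the inverse map reads off the
  coordinates along \<open>g\<close>, again with integer entries. The target cone is arbitrary, so
  that the statement serves the orthants as well as the cones \<open>K_cone\<close>.\<close>

lemma face_morphism_extend_zero:
 assumes fin: "finite I" "finite J" and inj: "inj_on g I" "g`I <= J"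
  and supp: "!!x i. x:C ==> i ~: I ==> x i = 0"
  and L: "int_functional J L" "!!y. y:C' ==> L y >= 0"
  and into: "!!x. x:C ==> extend_zero I g x:C' & L (extend_zero I g x) = 0"
  and onto: "!!y. y:C' ==> L y = 0 ==> EX x:C. y = extend_zero I g x"
 shows "face_morphism I C J C' (extend_zero I g)"
proof -
 let ?T = "{y:C'. L y = 0}"
 let ?h = "%y i. if i:I then y (g i) else (0::real)"
 have hf: "?h (extend_zero I g x) = x" if "x:C" for x using supp[OF that] inj(1) by (auto simp: push_forward_inj)
 have *: "cone_face J ?T C'"
 proof -
  obtain a :: "_ => int" where "!!x. L x = (SUM i:J. of_int (a i) * x i)" using L(1) unfolding int_functional_def by blast
  thus ?thesis using L(2) unfolding cone_face_def by (intro exI[of _ "%i. of_int (a i)"]) auto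
 qed
 have "cone_morphism I C J ?T (extend_zero I g)"
 proof (rule cone_morphismI)
  show "extend_zero I g x:?T" if "x:C" for x using into that by auto
  show "extend_zero I g x j = 0" if "j ~: J" for x j using inj(2) that by (intro push_forward_outside) auto
  show "\<exists>L. int_functional I L & (ALL x:C. extend_zero I g x j = L x)" for j unfolding push_forward_def by (rule exI[of _ "%x. \<Sum>v | v:I & g v = j. x v"])
     (auto intro!: int_functional_sum int_functional_coord fin)
 qed
 moreover have "cone_morphism J ?T I C ?h"
 proof (rule cone_morphismI)
  show "?h y:C" if "y:?T" for y using onto[of y] that hf by fastforce
  show "\<exists>L. int_functional J L & (ALL x:?T. ?h x i = L x)" if "i:I" for i
   using that inj(2) fin by (intro exI[of _ "%x. x (g i)"]) (auto intro!: int_functional_coord)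
 qed auto
 moreover have "extend_zero I g (?h y) = y" if "y:?T" for y
 proof -
  from onto[of y] that obtain x where "x:C" "y = extend_zero I g x" by auto
  thus ?thesis using hf[of x] by (simp only:)
 qed
 ultimately show ?thesis unfolding face_morphism_def using * hf by blast
qed

text \<open>The face is cut out by the sum of the coordinates outside the image, which vanishes on
  the orthant only if each of them does.\<close>

lemma face_morphism_orthant:
 assumes fin: "finite I" "finite J" and inj: "inj_on g I" "g`I <= J"
 shows "face_morphism I (orthant I) J (orthant J) (extend_zero I g)"
proof (rule face_morphism_extend_zero[OF fin inj, where L = "%y. SUM j:J - g`I. y j"])
 show "int_functional J (%y. SUM j:J - g`I. y j)" using fin by (intro int_functional_sum int_functional_coord) auto
 show "extend_zero I g x:orthant J & (SUM j:J - g`I. extend_zero I g x j) = 0" if "x:orthant I" for x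
 proof
  have "extend_zero I g x j >= 0" for j unfolding push_forward_def using that by (auto simp: orthant_def intro!: sum_nonneg)
  moreover have "extend_zero I g x j = 0" if "j ~: J" for j using inj(2) that by (intro push_forward_outside) auto
  ultimately show "extend_zero I g x:orthant J" by (auto simp: orthant_def)
  show "(SUM j:J - g`I. extend_zero I g x j) = 0" by (rule sum.neutral) (auto intro: push_forward_outside)
 qed
 show "EX x:orthant I. y = extend_zero I g x" if y: "y:orthant J" "(SUM j:J - g`I. y j) = 0" for y
 proof (rule bexI[of _ "%i. if i:I then y (g i) else 0"])
  have z: "y j = 0" if "j:J - g`I" for j using y fin that sum_nonneg_eq_0_iff[of "J - g`I" y] by (auto simp: orthant_def)
  show "y = extend_zero I g (%i. if i:I then y (g i) else 0)"
  proof
   fix j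
   show "y j = extend_zero I g (%i. if i:I then y (g i) else 0) j"
   proof (cases "j:g`I")
    case True thus ?thesis using inj by (auto simp: push_forward_inj)
   next
    case False thus ?thesis using z y by (cases "j:J") (auto simp: push_forward_outside orthant_def)
   qed
  qed
  show "(%i. if i:I then y (g i) else 0):orthant I" using y inj by (auto simp: orthant_def)
 qed
qed (auto simp: orthant_def intro: sum_nonneg)

section \<open>Colimits of cone diagrams\<close>

lemma colim_class_in_points: "s:objs \<D> ==> x:cone \<D> s ==> colim_class \<D> (s, x):colim_points \<D>"
 unfolding colim_points_def colim_class_def cone_points_def by (auto intro: quotientI)

lemma colim_points_cases:
 assumes "q:colim_points \<D>"
 obtains s x where "s:objs \<D>" "x:cone \<D> s" "q = colim_class \<D> (s, x)"
 using assms unfolding colim_points_def colim_class_def cone_points_def by (auto elim!: quotientE)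

lemma topspace_colim_topology [simp]: "topspace (colim_topology \<D>) = colim_points \<D>"
proof -
 have "{z:cone_points \<D>. colim_class \<D> z:colim_points \<D>} = cone_points \<D>" using colim_class_in_points[of _ \<D>] by (auto simp: cone_points_def)
 moreover have "cone_points \<D> = topspace (sum_topology (%s. top_of_set (cone \<D> s)) (objs \<D>))" by (simp add: cone_points_def) (simp add: comp_def)
 ultimately have "openin (sum_topology (%s. top_of_set (cone \<D> s)) (objs \<D>))
   {z:cone_points \<D>. colim_class \<D> z:colim_points \<D>}" using openin_topspace by metis
 hence "openin (colim_topology \<D>) (colim_points \<D>)" unfolding openin_colim_topology by simp
 moreover have "topspace (colim_topology \<D>) <= colim_points \<D>" using openin_topspace[of "colim_topology \<D>"] unfolding openin_colim_topology by blast
 ultimately show ?thesis using openin_subset by blast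
qed

text \<open>Continuity comes for free: openness in a colimit is tested on each cone, and there the
  map is a linear, hence continuous, map into one cone of the target followed by the quotient
  map.\<close>

lemma cone_complex_morphismI:
 assumes "finite_face_diagram \<D>" "finite_face_diagram \<D>'"
  and f: "!!s. s:objs \<D> ==> EX t:objs \<D>'. \<exists>h.
    cone_morphism (coords \<D> s) (cone \<D> s) (coords \<D>' t) (cone \<D>' t) h &
    (ALL x:cone \<D> s. f (colim_class \<D> (s, x)) = colim_class \<D>' (t, h x))"
 shows "cone_complex_morphism \<D> \<D>' f"
proof -
 have "continuous_map (colim_topology \<D>) (colim_topology \<D>') f" unfolding continuous_map
 proof (intro conjI allI impI)
  show "f`topspace (colim_topology \<D>) <= topspace (colim_topology \<D>')"
  proof
   fix p assume "p:f`topspace (colim_topology \<D>)"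
   then obtain s x where s: "s:objs \<D>" "x:cone \<D> s" "p = f (colim_class \<D> (s, x))" by (auto elim!: colim_points_cases)
   with f[OF s(1)] show "p:topspace (colim_topology \<D>')" unfolding cone_morphism_def by (auto intro!: colim_class_in_points)
  qed
 next
  fix U assume U: "openin (colim_topology \<D>') U"
  have "openin (top_of_set (cone \<D> s)) {x. (s, x):{z:cone_points \<D>. f (colim_class \<D> z):U}}"
   if s: "s:objs \<D>" for s
  proof -
   obtain t h where t: "t:objs \<D>'" and h: "cone_morphism (coords \<D> s) (cone \<D> s) (coords \<D>' t) (cone \<D>' t) h"
    and fh: "ALL x:cone \<D> s. f (colim_class \<D> (s, x)) = colim_class \<D>' (t, h x)" using f[OF s] by blast
   obtain M :: "_ => _ => int" where M: "ALL x:cone \<D> s. h x = (%j. if j:coords \<D>' t then SUM i:coords \<D> s. of_int (M j i) * x i else 0)"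
    and im: "h`cone \<D> s <= cone \<D>' t" using h unfolding cone_morphism_def by blast
   have "continuous_on (cone \<D> s) (%x j. if j:coords \<D>' t then SUM i:coords \<D> s. of_int (M j i) * x i else 0)"
   proof (rule continuous_on_coordinatewise_then_product)
    fix j show "continuous_on (cone \<D> s) (%x. if j:coords \<D>' t then SUM i:coords \<D> s. of_int (M j i) * x i else 0)"
     by (cases "j:coords \<D>' t") (auto intro!: continuous_intros continuous_on_subset[OF continuous_on_product_coordinates])
   qed
   moreover have "continuous_on (cone \<D> s) h \<longleftrightarrow> continuous_on (cone \<D> s)
     (%x j. if j:coords \<D>' t then SUM i:coords \<D> s. of_int (M j i) * x i else 0)" by (rule continuous_on_cong[OF refl]) (rule bspec[OF M])
   ultimately have cont: "continuous_on (cone \<D> s) h" by blast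
   have "openin (top_of_set (cone \<D>' t)) {y. (t, y):{z:cone_points \<D>'. colim_class \<D>' z:U}}" using U t by (auto simp: openin_colim_topology openin_sum_topology)
   hence "openin (top_of_set (cone \<D> s)) (cone \<D> s \<inter> h -` {y. (t, y):{z:cone_points \<D>'. colim_class \<D>' z:U}})"
    using cont im by (intro continuous_openin_preimage[of _ _ "cone \<D>' t"]) auto
   also have "cone \<D> s \<inter> h -` {y. (t, y):{z:cone_points \<D>'. colim_class \<D>' z:U}} =
     {x. (s, x):{z:cone_points \<D>. f (colim_class \<D> z):U}}" using fh im s t by (auto simp: cone_points_def)
   finally show ?thesis .
  qed
  moreover have "{z:cone_points \<D>. colim_class \<D> z:{p:topspace (colim_topology \<D>). f p:U}} =
    {z:cone_points \<D>. f (colim_class \<D> z):U}" by (auto simp: cone_points_def intro: colim_class_in_points)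
  ultimately show "openin (colim_topology \<D>) {p:topspace (colim_topology \<D>). f p:U}" by (auto simp: openin_colim_topology openin_sum_topology cone_points_def)
 qed
 thus ?thesis unfolding cone_complex_morphism_def using assms by blast
qed

text \<open>\<open>glue\<close> is a reflexive closure, so it relates every pair to itself, even
  those that are not points of a cone. Hence equality of classes amounts to \<open>glue\<close>
  without side conditions.\<close>

lemma equiv_glue: "equiv UNIV (glue \<D>)"
proof (rule equivI)
 show "sym (glue \<D>)" unfolding glue_def by (rule sym_rtrancl) (auto simp: sym_def)
qed (auto simp: glue_def refl_on_def trans_rtrancl)

lemma colim_class_eq_iff: "colim_class \<D> z = colim_class \<D> z' \<longleftrightarrow> (z, z'):glue \<D>"
 unfolding colim_class_def using eq_equiv_class_iff[OF equiv_glue UNIV_I UNIV_I] .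

lemma mem_colim_class: "z':colim_class \<D> z \<longleftrightarrow> (z, z'):glue \<D>" by (simp add: colim_class_def)

lemma glue_morI:
 "s:objs \<D> ==> t:objs \<D> ==> f:mors \<D> s t ==> x:cone \<D> s ==> f x:cone \<D> t ==>
  ((s, x), (t, f x)):glue \<D>" unfolding glue_def by (rule r_into_rtrancl) (auto simp: glue_step_def)

subsection \<open>Walks and potentials\<close>

definition rev_path :: "('e \<times> bool) list => ('e \<times> bool) list" where
 "rev_path p = rev (map (%(e, b). (e, \<not> b)) p)"

lemma dart_src_flip [simp]: "dart_src \<G> (e, \<not> b) = dart_tgt \<G> (e, b)"
 and dart_tgt_flip [simp]: "dart_tgt \<G> (e, \<not> b) = dart_src \<G> (e, b)" by (auto simp: dart_src_def dart_tgt_def)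

definition closed_edges :: "('v, 'e) lgraph => bool" where
 "closed_edges \<G> \<longleftrightarrow> src \<G>`edges \<G> <= verts \<G> & tgt \<G>`edges \<G> <= verts \<G>"

lemma closed_edgesD:
 "closed_edges \<G> ==> e:edges \<G> ==> src \<G> e:verts \<G>"
 "closed_edges \<G> ==> e:edges \<G> ==> tgt \<G> e:verts \<G>" by (auto simp: closed_edges_def)

lemma walk_append:
 "walk \<G> u (p @ q) v \<longleftrightarrow> (\<exists>w. walk \<G> u p w & walk \<G> w q v)" if "closed_edges \<G>"
proof (induction p arbitrary: u)
 case Nil
 have "u:verts \<G>" if "walk \<G> u q v" using that \<open>closed_edges \<G>\<close>
  by (cases q) (auto simp: dart_src_def closed_edges_def image_subset_iff)
 thus ?case by auto
next
 case (Cons d p) thus ?case by auto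
qed

lemma walk_verts:
 assumes "closed_edges \<G>" "walk \<G> u p v" shows "u:verts \<G>" "v:verts \<G>"
proof -
 show "u:verts \<G>" using assms by (cases p) (auto simp: dart_src_def closed_edges_def image_subset_iff)
 show "v:verts \<G>" using assms(2) by (induction p arbitrary: u) auto
qed

lemma walk_rev_path: "walk \<G> u p v ==> walk \<G> v (rev_path p) u" if "closed_edges \<G>"
proof (induction p arbitrary: u)
 case Nil thus ?case by (auto simp: rev_path_def)
next
 case (Cons d p)
 obtain e b where d: "d = (e, b)" by force
 have "walk \<G> (dart_tgt \<G> d) [(e, \<not> b)] u" using Cons.prems d that walk_verts(1)[OF that Cons.prems] by auto
 thus ?case using Cons d that by (auto simp: rev_path_def walk_append)
qed

lemma walk_exists:
 assumes "closed_edges \<G>" "(u, v):(adj \<G> S)^*" "S <= edges \<G>" "u:verts \<G>"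
 shows "\<exists>p. walk \<G> u p v" using assms(2)
proof (induction rule: rtrancl_induct)
 case base thus ?case using assms(4) by (intro exI[of _ "[]"]) auto
next
 case (step v w)
 then obtain p e where p: "walk \<G> u p v" and e: "e:S" "(src \<G> e = v & tgt \<G> e = w) \<or> (src \<G> e = w & tgt \<G> e = v)" by (auto simp: adj_def)
 have "walk \<G> v [(e, src \<G> e = v)] w" using e assms(1,3) by (auto simp: dart_src_def dart_tgt_def closed_edges_def image_subset_iff)
 thus ?case using p walk_append[OF assms(1)] by blast
qed

definition dart_slope :: "('e => int) => ('e => real) => 'e \<times> bool => real" where
 "dart_slope \<phi> x = (%(e, b). (if b then 1 else -1) * of_int (\<phi> e) * x e)"

text \<open>The vertex values of a piecewise linear function with slope \<open>\<phi> e\<close>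
  along an edge of length \<open>x e\<close>; the divisor of that function is
  \<open>flow_div\<close>.\<close>

definition potential :: "('v, 'e) lgraph => ('e => int) => ('e => real) => ('v => real) => bool" where
 "potential \<G> \<phi> x f \<longleftrightarrow> (ALL e:edges \<G>. f (tgt \<G> e) - f (src \<G> e) = of_int (\<phi> e) * x e)"

lemma potential_walk:
 assumes "potential \<G> \<phi> x f" "walk \<G> u p v"
 shows "(\<Sum>d\<leftarrow>p. dart_slope \<phi> x d) = f v - f u" using assms(2)
proof (induction p arbitrary: u)
 case (Cons d p)
 obtain e b where "d = (e, b)" by force
 thus ?case using Cons assms(1) by (fastforce simp: potential_def dart_slope_def dart_src_def dart_tgt_def split: if_splits)
qed simp

lemma rev_path_slope: "(\<Sum>d\<leftarrow>rev_path p. dart_slope \<phi> x d) = - (\<Sum>d\<leftarrow>p. dart_slope \<phi> x d)"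
 by (induction p) (auto simp: rev_path_def dart_slope_def)

text \<open>By induction on the length. A repeated vertex splits the walk into two shorter closed
  walks. If all vertices are distinct, a repeated edge is run through back and forth, its two darts
  cancel, and what is left is shorter. A walk without either repetition is empty or a
  \<open>graph_cycle\<close>.\<close>

lemma closed_walk_slope:
 assumes cl: "closed_edges \<G>" and cyc: "!!p. graph_cycle \<G> p ==> (\<Sum>d\<leftarrow>p. dart_slope \<phi> x d) = 0"
  and "walk \<G> u p u"
 shows "(\<Sum>d\<leftarrow>p. dart_slope \<phi> x d) = 0" using assms(3)
proof (induction "length p" arbitrary: p u rule: less_induct)
 case less
 show ?case
 proof (cases "distinct (map (dart_src \<G>) p)")
  case False
  then obtain xs y ys zs where "map (dart_src \<G>) p = xs @ [y] @ ys @ [y] @ zs" using not_distinct_decomp by blast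
  then obtain p1 d p2 d' p3 where p: "p = p1 @ (d # p2) @ (d' # p3)" "dart_src \<G> d = y" "dart_src \<G> d' = y"
   by (auto simp: map_eq_append_conv append_eq_map_conv map_eq_Cons_conv Cons_eq_map_conv)
  then obtain v w where w: "walk \<G> u p1 v" "walk \<G> v (d # p2) w" "walk \<G> w (d' # p3) u" using less.prems by (auto simp only: walk_append[OF cl])
  hence "v = y" "w = y" using p by auto
  hence "walk \<G> u (p1 @ d' # p3) u" "walk \<G> y (d # p2) y" using w by (auto simp only: walk_append[OF cl])
  hence "(\<Sum>d\<leftarrow>p1 @ d' # p3. dart_slope \<phi> x d) = 0" "(\<Sum>d\<leftarrow>d # p2. dart_slope \<phi> x d) = 0"
   using p by (simp_all only: less.hyps length_append list.size)
  thus ?thesis using p by simp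
 next
  case dist: True
  show ?thesis
  proof (cases "distinct (map fst p)")
   case True
   thus ?thesis using cyc[of p] dist less.prems by (cases "p = []") (auto simp: graph_cycle_def)
  next
   case False
   then obtain xs e ys zs where "map fst p = xs @ [e] @ ys @ [e] @ zs" using not_distinct_decomp by blast
   then obtain p1 b p2 b' p3 where p: "p = p1 @ ((e, b) # p2) @ ((e, b') # p3)" by (auto simp: map_eq_append_conv append_eq_map_conv map_eq_Cons_conv Cons_eq_map_conv)
   with dist have bb: "b' = (\<not> b)" by auto
   obtain v w where w: "walk \<G> u p1 v" "walk \<G> v ((e, b) # p2) w" "walk \<G> w ((e, b') # p3) u" using less.prems by (auto simp only: p walk_append[OF cl])
   \<comment> \<open>The dart \<open>(e, b)\<close> ends where \<open>(e, b')\<close> starts, so a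
     dart in between would repeat that source.\<close>
   have "p2 = []"
   proof (rule ccontr)
    assume "p2 ~= []"
    then obtain d p2' where "p2 = d # p2'" by (cases p2) auto
    with w dist p bb show False by auto
   qed
   hence "walk \<G> u (p1 @ p3) u" using w bb by (auto simp: walk_append[OF cl])
   hence "(\<Sum>d\<leftarrow>p1 @ p3. dart_slope \<phi> x d) = 0" using p by (intro less.hyps) auto
   thus ?thesis using p bb \<open>p2 = []\<close> by (auto simp: dart_slope_def)
  qed
 qed
qed

text \<open>The value at \<open>v\<close> is the slope sum along a chosen walk from a base vertex;
  an edge together with the walks to its ends is a closed walk. Potentials replace the cycle
  conditions of \<open>flow_cone\<close> from here on, since they move along contractions more
  easily than cycles.\<close>

lemma potential_iff_cycles:
 assumes cl: "closed_edges \<G>" and conn: "connected_graph \<G>"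
 shows "(\<exists>f. potential \<G> \<phi> x f) \<longleftrightarrow> (\<forall>p. graph_cycle \<G> p --> (\<Sum>d\<leftarrow>p. dart_slope \<phi> x d) = 0)"
proof
 assume "\<exists>f. potential \<G> \<phi> x f"
 thus "\<forall>p. graph_cycle \<G> p --> (\<Sum>d\<leftarrow>p. dart_slope \<phi> x d) = 0" by (auto simp: graph_cycle_def dest!: potential_walk)
next
 assume "\<forall>p. graph_cycle \<G> p --> (\<Sum>d\<leftarrow>p. dart_slope \<phi> x d) = 0"
 hence cyc: "!!p. graph_cycle \<G> p ==> (\<Sum>d\<leftarrow>p. dart_slope \<phi> x d) = 0" by blast
 obtain u where u: "u:verts \<G>" using conn by (auto simp: connected_graph_def)
 have "\<exists>p. walk \<G> u p v" if "v:verts \<G>" for v using conn u that by (intro walk_exists[OF cl]) (auto simp: connected_graph_def)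
 then obtain P where P: "!!v. v:verts \<G> ==> walk \<G> u (P v) v" by metis
 define f where "f v = (\<Sum>d\<leftarrow>P v. dart_slope \<phi> x d)" for v
 have "f (tgt \<G> e) - f (src \<G> e) = of_int (\<phi> e) * x e" if e: "e:edges \<G>" for e
 proof -
  have v: "src \<G> e:verts \<G>" "tgt \<G> e:verts \<G>" using closed_edgesD[OF cl e] by auto
  have "walk \<G> u (P (src \<G> e) @ [(e, True)] @ rev_path (P (tgt \<G> e))) u" unfolding walk_append[OF cl] using P[OF v(1)] walk_rev_path[OF cl P[OF v(2)]] v e
   by (intro exI[of _ "src \<G> e"] exI[of _ "tgt \<G> e"] conjI) (auto simp: dart_src_def dart_tgt_def)
  from closed_walk_slope[OF cl cyc this] show ?thesis by (simp add: f_def rev_path_slope) (simp add: dart_slope_def)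
 qed
 thus "\<exists>f. potential \<G> \<phi> x f" by (auto simp: potential_def)
qed

lemma adj_rtrancl_map:
 assumes "(x, y):(adj \<G> S)^*"
  and "!!e. e:S ==> (f (src \<G> e), f (tgt \<G> e)):(adj \<C> T)^*"
 shows "(f x, f y):(adj \<C> T)^*" using assms(1)
proof (induction rule: rtrancl_induct)
 case (step y z)
 have "sym ((adj \<C> T)^*)" by (rule sym_rtrancl) (auto simp: sym_def adj_def)
 hence "(f y, f z):(adj \<C> T)^*" using step(2) assms(2) by (auto simp: adj_def dest: symD)
 thus ?case using step by simp
qed simp

lemma adj_rtrancl_sym: "(x, y):(adj \<G> S)^* ==> (y, x):(adj \<G> S)^*"
proof -
 have "sym ((adj \<G> S)^*)" by (rule sym_rtrancl) (auto simp: sym_def adj_def)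
 thus "(x, y):(adj \<G> S)^* ==> (y, x):(adj \<G> S)^*" by (rule symD)
qed

lemma adj_rtrancl_invariant:
 assumes "(x, y):(adj \<G> S)^*" "!!e. e:S ==> f (src \<G> e) = f (tgt \<G> e)"
 shows "f x = f y" using assms(1) by (induction rule: rtrancl_induct) (use assms(2) in "auto simp: adj_def")

lemma adj_edge: "e:S ==> (src \<G> e, tgt \<G> e):(adj \<G> S)^*" "e:S ==> (tgt \<G> e, src \<G> e):(adj \<G> S)^*" by (auto simp: adj_def intro!: r_into_rtrancl)

lemma wf_graph_closed: "wf_graph \<G> ==> closed_edges \<G>" by (simp add: wf_graph_def closed_edges_def)

subsection \<open>Counting at vertices\<close>

lemma card_filter_sum: "finite A ==> card {x:A. P x} = (SUM x:A. of_bool (P x))" by (simp add: of_bool_def sum.If_cases Collect_conj_eq)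

text \<open>In a sum over edges a loop counts twice by itself, and the sum can be split into
  contracted and surviving edges.\<close>

lemma valence_sum:
 "finite (edges \<G>) ==> valence \<G> v = (SUM e:edges \<G>. of_bool (src \<G> e = v) + of_bool (tgt \<G> e = v))" by (simp add: valence_def card_filter_sum sum.distrib)

lemma cut_size_sum:
 "finite (edges \<G>) ==> cut_size \<G> W = (SUM e:edges \<G>. of_bool ((src \<G> e:W) ~= (tgt \<G> e:W)))" by (simp add: cut_size_def card_filter_sum)

text \<open>The orientation by the sign of \<open>\<phi> e\<close> and the absolute value compensate
  each other, so the divergence is linear in \<open>\<phi>\<close>.\<close>

lemma flow_div_sum:
 assumes "finite (edges \<G>)"
 shows "flow_div \<G> \<phi> v = (SUM e:edges \<G>. \<phi> e * (of_bool (tgt \<G> e = v) - of_bool (src \<G> e = v)))"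
proof -
 have "flow_div \<G> \<phi> v = (SUM e:edges \<G>. if flow_tgt \<G> \<phi> e = v then \<bar>\<phi> e\<bar> else 0)
   - (SUM e:edges \<G>. if flow_src \<G> \<phi> e = v then \<bar>\<phi> e\<bar> else 0)" using assms by (simp add: flow_div_def sum.inter_filter)
 also have "... = (SUM e:edges \<G>. (if flow_tgt \<G> \<phi> e = v then \<bar>\<phi> e\<bar> else 0) - (if flow_src \<G> \<phi> e = v then \<bar>\<phi> e\<bar> else 0))"
  by (simp add: sum_subtractf)
 also have "... = (SUM e:edges \<G>. \<phi> e * (of_bool (tgt \<G> e = v) - of_bool (src \<G> e = v)))"
  by (rule sum.cong) (auto simp: flow_tgt_def flow_src_def dart_src_def dart_tgt_def)
 finally show ?thesis .
qed

lemma doubleton_sum: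
 fixes f :: "'a => 'b::comm_monoid_add"
 assumes "{a, b} = {c, d}" shows "f a + f b = f c + f d" using assms by (auto simp: doubleton_eq_iff add.commute)

lemma sum_valence:
 assumes "finite (edges \<G>)" "finite F"
 shows "(SUM v:F. valence \<G> v) = (SUM e:edges \<G>. of_bool (src \<G> e:F) + of_bool (tgt \<G> e:F))"
proof -
 have "(SUM v:F. valence \<G> v) = (SUM e:edges \<G>. SUM v:F. of_bool (src \<G> e = v) + of_bool (tgt \<G> e = v))"
  using assms by (simp add: valence_sum sum.swap[of _ _ F])
 also have "... = (SUM e:edges \<G>. of_bool (src \<G> e:F) + of_bool (tgt \<G> e:F))" using assms by (intro sum.cong) (auto simp: sum.distrib of_bool_def sum.delta)
 finally show ?thesis .
qed

text \<open>The degree of the canonical divisor, by counting the ends of edges. Invariance of the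
  genus under specialization thus reduces to additivity of \<open>omega_graph\<close> over
  fibres.\<close>

lemma genus_omega:
 assumes "wf_graph \<G>" shows "2 * genus \<G> - 2 = (SUM v:verts \<G>. omega_graph \<G> v)"
proof -
 have fin: "finite (verts \<G>)" "finite (edges \<G>)" using assms by (auto simp: wf_graph_def)
 have "(SUM v:verts \<G>. valence \<G> v) = (SUM e:edges \<G>. 2)"
  unfolding sum_valence[OF fin(2,1)] by (rule sum.cong) (use assms in "auto simp: wf_graph_def image_subset_iff")
 hence "int (SUM v:verts \<G>. valence \<G> v) = 2 * int (card (edges \<G>))" by (simp only: sum_constant) simp
 hence "(SUM v:verts \<G>. int (valence \<G> v)) = 2 * int (card (edges \<G>))" by (simp only: of_nat_sum)
 thus ?thesis by (simp add: genus_def sub_genus_def omega_graph_def sum.distrib sum_subtractf flip: sum_distrib_left)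
qed

subsection \<open>Specializations\<close>

text \<open>The conditions on a specialization other than the one on weights, which is equivalent to the
 additivity of \<open>omega_graph\<close>.\<close>

definition contraction ::
 "('v, 'e) lgraph => ('w, 'f) lgraph => ('v => 'w) => ('f => 'e) => bool" where
 "contraction \<G> \<G>' iV iE \<longleftrightarrow>
   iV`verts \<G> = verts \<G>' & inj_on iE (edges \<G>') & iE`edges \<G>' <= edges \<G> &
   (ALL e:edges \<G>'. {iV (src \<G> (iE e)), iV (tgt \<G> (iE e))} = {src \<G>' e, tgt \<G>' e}) &
   (ALL u:verts \<G>. ALL v:verts \<G>.
    iV u = iV v \<longleftrightarrow> (u, v):(adj \<G> (edges \<G> - iE`edges \<G>'))^*) &
   nlegs \<G>' = nlegs \<G> & (\<forall>i<nlegs \<G>. leg \<G>' i = iV (leg \<G> i))"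

lemma contractionD:
 assumes "contraction \<G> \<G>' iV iE"
 shows "iV`verts \<G> = verts \<G>'" "inj_on iE (edges \<G>')" "iE`edges \<G>' <= edges \<G>"
  "!!e. e:edges \<G>' ==> {iV (src \<G> (iE e)), iV (tgt \<G> (iE e))} = {src \<G>' e, tgt \<G>' e}"
  "!!u v. u:verts \<G> ==> v:verts \<G> ==>
    iV u = iV v \<longleftrightarrow> (u, v):(adj \<G> (edges \<G> - iE`edges \<G>'))^*"
  "nlegs \<G>' = nlegs \<G>" "!!i. i < nlegs \<G> ==> leg \<G>' i = iV (leg \<G> i)"
  "!!v. v:verts \<G> ==> iV v:verts \<G>'" "!!e. e:edges \<G>' ==> iE e:edges \<G>" using assms unfolding contraction_def by blast+

lemma contraction_contracted:
 assumes "contraction \<G> \<G>' iV iE" "closed_edges \<G>" "e:edges \<G>" "e ~: iE`edges \<G>'"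
 shows "iV (src \<G> e) = iV (tgt \<G> e)" using contractionD(5)[OF assms(1) closed_edgesD[OF assms(2,3)]]
  adj_edge(1)[of e "edges \<G> - iE`edges \<G>'" \<G>] assms(3,4) by simp

lemma contraction_edge_sum:
 fixes f :: "'w => 'b::comm_monoid_add"
 assumes "contraction \<G> \<G>' iV iE" "e:edges \<G>'"
 shows "f (iV (src \<G> (iE e))) + f (iV (tgt \<G> (iE e))) = f (src \<G>' e) + f (tgt \<G>' e)" using contractionD(4)[OF assms] by (rule doubleton_sum)

lemma contraction_ends:
 assumes "contraction \<G> \<G>' iV iE" "e:edges \<G>'"
 shows "(iV (src \<G> (iE e)) = src \<G>' e & iV (tgt \<G> (iE e)) = tgt \<G>' e) \<or>
     (iV (src \<G> (iE e)) = tgt \<G>' e & iV (tgt \<G> (iE e)) = src \<G>' e)" using contractionD(4)[OF assms] by (auto simp: doubleton_eq_iff)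

lemma sum_contraction_edges:
 assumes c: "contraction \<G> \<G>' iV iE" and fin: "finite (edges \<G>)"
 shows "(SUM e:edges \<G>. h e) = (SUM e:edges \<G> - iE`edges \<G>'. h e) + (SUM e:edges \<G>'. h (iE e))"
proof -
 have "(SUM e:edges \<G>. h e) = (SUM e:edges \<G> - iE`edges \<G>'. h e) + (SUM e:iE`edges \<G>'. h e)" using sum.subset_diff[OF contractionD(3)[OF c] fin] .
 thus ?thesis using contractionD(2)[OF c] by (simp add: sum.reindex)
qed

text \<open>A contracted edge lies inside one fibre and is counted there twice; a surviving edge is
  counted as in the target.\<close>

lemma sum_valence_fibre:
 assumes c: "contraction \<G> \<G>' iV iE" and wf: "closed_edges \<G>" "finite (edges \<G>)" "finite (verts \<G>)"
 shows "(SUM v:{v:verts \<G>. iV v = v'}. valence \<G> v) =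
   valence \<G>' v' + 2 * card {e:edges \<G> - iE`edges \<G>'. iV (src \<G> e) = v'}"
proof -
 let ?F = "{v:verts \<G>. iV v = v'}"
 let ?C = "edges \<G> - iE`edges \<G>'"
 have fin': "finite (edges \<G>')" using contractionD(2,3)[OF c] wf(2) by (meson finite_imageD finite_subset)
 have "(SUM v:?F. valence \<G> v) = (SUM e:edges \<G>. of_bool (src \<G> e:?F) + of_bool (tgt \<G> e:?F))" using wf by (intro sum_valence) auto
 also have "... = (SUM e:edges \<G>. of_bool (iV (src \<G> e) = v') + of_bool (iV (tgt \<G> e) = v'))" by (rule sum.cong) (auto simp: closed_edgesD[OF wf(1)])
 also have "... = (SUM e:?C. of_bool (iV (src \<G> e) = v') + of_bool (iV (tgt \<G> e) = v')) +
   (SUM e:edges \<G>'. of_bool (iV (src \<G> (iE e)) = v') + of_bool (iV (tgt \<G> (iE e)) = v'))" by (rule sum_contraction_edges[OF c wf(2)])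
 also have "(SUM e:edges \<G>'. of_bool (iV (src \<G> (iE e)) = v') + of_bool (iV (tgt \<G> (iE e)) = v')) = valence \<G>' v'" unfolding valence_sum[OF fin']
  by (rule sum.cong[OF refl]) (rule contraction_edge_sum[OF c, where f = "%x. of_bool (x = v')"])
 also have "(SUM e:?C. of_bool (iV (src \<G> e) = v') + of_bool (iV (tgt \<G> e) = v')) = (SUM e:?C. 2 * of_bool (iV (src \<G> e) = v') :: nat)"
  by (rule sum.cong) (auto simp: contraction_contracted[OF c wf(1)])
 also have "... = 2 * card {e:?C. iV (src \<G> e) = v'}" using wf by (subst card_filter_sum) (auto simp: sum_distrib_left)
 finally show ?thesis by simp
qed

lemma specialization_iff_omega:
 assumes wf: "closed_edges \<G>" "finite (edges \<G>)" "finite (verts \<G>)"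
 shows "specialization \<G> \<G>' iV iE \<longleftrightarrow> contraction \<G> \<G>' iV iE &
  (ALL v':verts \<G>'. omega_graph \<G>' v' = push_forward (verts \<G>) iV (omega_graph \<G>) v')"
proof -
 have "int (wt \<G>' v') = sub_genus \<G> {v:verts \<G>. iV v = v'} {e:edges \<G> - iE`edges \<G>'. iV (src \<G> e) = v'}
  \<longleftrightarrow> omega_graph \<G>' v' = push_forward (verts \<G>) iV (omega_graph \<G>) v'" if c: "contraction \<G> \<G>' iV iE" for v'
 proof -
  let ?F = "{v:verts \<G>. iV v = v'}"
  have "(SUM v:?F. int (valence \<G> v)) = int (SUM v:?F. valence \<G> v)" by simp
  also have "... = int (valence \<G>' v') + 2 * int (card {e:edges \<G> - iE`edges \<G>'. iV (src \<G> e) = v'})" by (subst sum_valence_fibre[OF c wf]) simp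
  finally show ?thesis by (simp add: sub_genus_def omega_graph_def push_forward_def sum.distrib sum_subtractf flip: sum_distrib_left) linarith
 qed
 thus ?thesis unfolding specialization_def contraction_def by blast
qed

lemma specialization_contraction: "specialization \<G> \<G>' iV iE ==> contraction \<G> \<G>' iV iE" unfolding specialization_def contraction_def by blast

lemma wf_graphD:
 assumes "wf_graph \<G>"
 shows "finite (verts \<G>)" "finite (edges \<G>)" "closed_edges \<G>" "connected_graph \<G>"
  "!!i. i < nlegs \<G> ==> leg \<G> i:verts \<G>" using assms by (auto simp: wf_graph_def closed_edges_def)

lemmas edge_ends = closed_edgesD[OF wf_graphD(3)]

lemmas specializationD = contractionD[OF specialization_contraction]

lemma specialization_omega:
 assumes "specialization \<G> \<G>' iV iE" "wf_graph \<G>" "v':verts \<G>'"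
 shows "omega_graph \<G>' v' = push_forward (verts \<G>) iV (omega_graph \<G>) v'"
 using assms(3) specialization_iff_omega[OF wf_graphD(3,2,1)[OF assms(2)], THEN iffD1, OF assms(1)] by blast

lemma specializationI:
 assumes "wf_graph \<G>" "contraction \<G> \<G>' iV iE"
  "!!v'. v':verts \<G>' ==> omega_graph \<G>' v' = push_forward (verts \<G>) iV (omega_graph \<G>) v'"
 shows "specialization \<G> \<G>' iV iE" by (rule specialization_iff_omega[OF wf_graphD(3,2,1)[OF assms(1)], THEN iffD2]) (use assms in blast)

lemma adj_mono: "S <= T ==> adj \<G> S <= adj \<G> T" unfolding adj_def by blast

lemma contraction_push_path:
 assumes c: "contraction \<G> \<G>' iV iE" and wf: "closed_edges \<G>" and S: "S <= edges \<G>"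
  and p: "(u, v):(adj \<G> S)^*"
 shows "(iV u, iV v):(adj \<G>' {e:edges \<G>'. iE e:S})^*"
proof (rule adj_rtrancl_map[OF p])
 fix e assume e: "e:S"
 show "(iV (src \<G> e), iV (tgt \<G> e)):(adj \<G>' {e:edges \<G>'. iE e:S})^*"
 proof (cases "e:iE`edges \<G>'")
  case True
  then obtain e' where e': "e':edges \<G>'" "e = iE e'" by blast
  hence m: "e':{e:edges \<G>'. iE e:S}" using e by blast
  from contraction_ends[OF c e'(1)] show ?thesis unfolding e'(2) using adj_edge[OF m] by (elim disjE conjE) (simp_all only:)
 next
  case False
  thus ?thesis using contraction_contracted[OF c wf _ False] e S by auto
 qed
qed

text \<open>The edges of the path lift one by one; consecutive lifts end in the same fibre, and
  fibres are connected by contracted edges.\<close>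

lemma contraction_lift_path:
 assumes c: "contraction \<G> \<G>' iV iE" and wf: "closed_edges \<G>" and T: "T <= edges \<G>'"
  and uv: "u:verts \<G>" "v:verts \<G>" and p: "(iV u, iV v):(adj \<G>' T)^*"
 shows "(u, v):(adj \<G> (edges \<G> - iE`edges \<G>' \<union> iE`T))^*" (is "_:?A")
proof -
 have fib: "(x, y):?A" if "x:verts \<G>" "y:verts \<G>" "iV x = iV y" for x y
 proof -
  have "(adj \<G> (edges \<G> - iE`edges \<G>'))^* <= ?A" by (rule rtrancl_mono) (auto simp: adj_def)
  thus ?thesis using contractionD(5)[OF c that(1,2)] that(3) by blast
 qed
 have "ALL w:verts \<G>. iV w = y --> (u, w):?A" if "(iV u, y):(adj \<G>' T)^*" for y using that
 proof (induction rule: rtrancl_induct)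
  case base thus ?case using fib uv by auto
 next
  case (step y z)
  show ?case
  proof (intro ballI impI)
   fix w assume w: "w:verts \<G>" "iV w = z"
   from step(2) obtain e where e: "e:T" "(src \<G>' e = y & tgt \<G>' e = z) \<or> (src \<G>' e = z & tgt \<G>' e = y)" by (auto simp: adj_def)
   have e': "e:edges \<G>'" using e T by blast
   hence V: "src \<G> (iE e):verts \<G>" "tgt \<G> (iE e):verts \<G>" using closed_edgesD[OF wf] contractionD(9)[OF c] by auto
   have m: "iE e:edges \<G> - iE`edges \<G>' \<union> iE`T" using e by blast
   have "\<exists>p q. p:verts \<G> & q:verts \<G> & iV p = y & iV q = z & (p, q):?A" using contraction_ends[OF c e'] e(2) V adj_edge[OF m] by metis
   then obtain p q where pq: "p:verts \<G>" "q:verts \<G>" "iV p = y" "iV q = z" "(p, q):?A" by blast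
   have "(u, p):?A" using step.IH pq by blast
   moreover have "(q, w):?A" using fib pq w by auto
   ultimately show "(u, w):?A" using pq(5) by (meson rtrancl_trans)
  qed
 qed
 from this[OF p] uv show ?thesis by blast
qed

lemma contraction_wf:
 assumes c: "contraction \<G> \<G>' iV iE" and wf: "wf_graph \<G>"
 shows "wf_graph \<G>'"
proof -
 have cl: "closed_edges \<G>" using wf by (rule wf_graph_closed)
 have "src \<G>' e:verts \<G>'" "tgt \<G>' e:verts \<G>'" if "e:edges \<G>'" for e
  using contraction_ends[OF c that] contractionD(8)[OF c] closed_edgesD[OF cl contractionD(9)[OF c that]] by metis+
 moreover have "connected_graph \<G>'" unfolding connected_graph_def
 proof (intro conjI ballI)
  show "verts \<G>' ~= {}" using contractionD(1)[OF c] wf by (auto simp: wf_graph_def connected_graph_def)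
  fix x y assume "x:verts \<G>'" "y:verts \<G>'"
  then obtain u v where "u:verts \<G>" "v:verts \<G>" "x = iV u" "y = iV v" using contractionD(1)[OF c] by blast
  hence "(x, y):(adj \<G>' {e:edges \<G>'. iE e:edges \<G>})^*" using wf contraction_push_path[OF c cl order_refl] by (auto simp: wf_graph_def connected_graph_def)
  thus "(x, y):(adj \<G>' (edges \<G>'))^*" by (rule rev_subsetD) (auto intro!: rtrancl_mono simp: adj_def)
 qed
 moreover have "finite (edges \<G>')" using contractionD(2,3)[OF c] wf by (meson finite_imageD finite_subset wf_graph_def)
 moreover have "finite (verts \<G>')" using contractionD(1)[OF c] wf by (metis finite_imageI wf_graph_def)
 ultimately show ?thesis using wf contractionD(6,7,8)[OF c] by (auto simp: wf_graph_def)
qed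

lemma contraction_comp:
 assumes c: "contraction \<G> \<G>' iV iE" and d: "contraction \<G>' \<G>'' kV kE" and wf: "wf_graph \<G>"
 shows "contraction \<G> \<G>'' (kV \<circ> iV) (iE \<circ> kE)"
proof -
 note cl = wf_graph_closed[OF wf]
 have cl': "closed_edges \<G>'" using contraction_wf[OF c wf] by (rule wf_graph_closed)
 have inj: "inj_on (iE \<circ> kE) (edges \<G>'')" using contractionD(2,3)[OF d] contractionD(2)[OF c] by (meson comp_inj_on inj_on_subset)
 have eq: "edges \<G> - iE`edges \<G>' \<union> iE`(edges \<G>' - kE`edges \<G>'') = edges \<G> - (iE \<circ> kE)`edges \<G>''"
  using contractionD(2,3)[OF c] contractionD(3)[OF d] by (auto simp: inj_on_def)
 have fib: "(kV \<circ> iV) u = (kV \<circ> iV) v \<longleftrightarrow> (u, v):(adj \<G> (edges \<G> - (iE \<circ> kE)`edges \<G>''))^*"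
  if uv: "u:verts \<G>" "v:verts \<G>" for u v
 proof
  assume "(kV \<circ> iV) u = (kV \<circ> iV) v"
  hence "(iV u, iV v):(adj \<G>' (edges \<G>' - kE`edges \<G>''))^*" using contractionD(5)[OF d] contractionD(8)[OF c] uv by auto
  from contraction_lift_path[OF c cl _ uv this] show "(u, v):(adj \<G> (edges \<G> - (iE \<circ> kE)`edges \<G>''))^*" unfolding eq by blast
 next
  assume "(u, v):(adj \<G> (edges \<G> - (iE \<circ> kE)`edges \<G>''))^*"
  from contraction_push_path[OF c cl _ this]
  have "(iV u, iV v):(adj \<G>' {e:edges \<G>'. iE e:edges \<G> - (iE \<circ> kE)`edges \<G>''})^*" by blast
  also have "... <= (adj \<G>' (edges \<G>' - kE`edges \<G>''))^*" by (rule rtrancl_mono) (auto simp: adj_def)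
  finally show "(kV \<circ> iV) u = (kV \<circ> iV) v" using contractionD(5)[OF d] contractionD(8)[OF c] uv by auto
 qed
 have ends: "{(kV \<circ> iV) (src \<G> ((iE \<circ> kE) e)), (kV \<circ> iV) (tgt \<G> ((iE \<circ> kE) e))} = {src \<G>'' e, tgt \<G>'' e}"
  if e: "e:edges \<G>''" for e
 proof -
  have "{(kV \<circ> iV) (src \<G> ((iE \<circ> kE) e)), (kV \<circ> iV) (tgt \<G> ((iE \<circ> kE) e))} =
    kV`{iV (src \<G> (iE (kE e))), iV (tgt \<G> (iE (kE e)))}" by simp
  also have "... = {kV (src \<G>' (kE e)), kV (tgt \<G>' (kE e))}" unfolding contractionD(4)[OF c contractionD(9)[OF d e]] by simp
  finally show ?thesis using contractionD(4)[OF d e] by simp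
 qed
 have "(iE \<circ> kE)`edges \<G>'' <= edges \<G>" using contractionD(9)[OF c] contractionD(9)[OF d] by auto
 moreover have "(kV \<circ> iV)`verts \<G> = verts \<G>''" using contractionD(1)[OF c] contractionD(1)[OF d] by (metis image_comp)
 moreover have "nlegs \<G>'' = nlegs \<G>" "!!i. i < nlegs \<G> ==> leg \<G>'' i = (kV \<circ> iV) (leg \<G> i)"
  using contractionD(6,7)[OF c] contractionD(6,7)[OF d] by auto
 ultimately show ?thesis unfolding contraction_def using inj fib ends by blast
qed

lemma specialization_wf: "specialization \<G> \<G>' iV iE ==> wf_graph \<G> ==> wf_graph \<G>'" using contraction_wf specialization_contraction by blast

lemma specialization_comp:
 assumes c: "specialization \<G> \<G>' iV iE" and d: "specialization \<G>' \<G>'' kV kE" and wf: "wf_graph \<G>"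
 shows "specialization \<G> \<G>'' (kV \<circ> iV) (iE \<circ> kE)"
proof (rule specializationI[OF wf])
 note c' = specialization_contraction[OF c] and d' = specialization_contraction[OF d]
 show "contraction \<G> \<G>'' (kV \<circ> iV) (iE \<circ> kE)" by (rule contraction_comp[OF c' d' wf])
 note wf' = specialization_wf[OF c wf]
 fix v assume v: "v:verts \<G>''"
 have "omega_graph \<G>'' v = push_forward (verts \<G>') kV (omega_graph \<G>') v" by (rule specialization_omega[OF d wf' v])
 also have "... = push_forward (verts \<G>') kV (push_forward (verts \<G>) iV (omega_graph \<G>)) v"
  by (rule push_forward_cong) (auto intro: specialization_omega[OF c wf])
 also have "... = push_forward (verts \<G>) (kV \<circ> iV) (omega_graph \<G>) v"
  by (rule push_forward_comp) (use wf wf' contractionD(1)[OF c'] in "auto simp: wf_graph_def")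
 finally show "omega_graph \<G>'' v = push_forward (verts \<G>) (kV \<circ> iV) (omega_graph \<G>) v" .
qed

lemma specialization_id: "wf_graph \<G> ==> specialization \<G> \<G> id id" by (rule specializationI)
   (auto simp: contraction_def adj_def push_forward_inj[of id, simplified])

text \<open>Graphs are records of total functions, so in the applications graphs and maps agree only
  on the relevant vertices, edges and legs.\<close>

lemma specialization_cong:
 assumes s: "specialization \<G> \<G>' iV iE" and wf: "wf_graph \<G>"
  and V: "!!v. v:verts \<G> ==> iV v = kV v" and E: "!!e. e:edges \<G>' ==> iE e = kE e"
  and G: "verts \<G>'' = verts \<G>'" "edges \<G>'' = edges \<G>'" "nlegs \<G>'' = nlegs \<G>'"
   "!!e. e:edges \<G>' ==> src \<G>'' e = src \<G>' e" "!!e. e:edges \<G>' ==> tgt \<G>'' e = tgt \<G>' e"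
   "!!v. v:verts \<G>' ==> wt \<G>'' v = wt \<G>' v" "!!i. i < nlegs \<G>' ==> leg \<G>'' i = leg \<G>' i"
 shows "specialization \<G> \<G>'' kV kE"
proof -
 have im: "iE`edges \<G>' = kE`edges \<G>''" "iV`verts \<G> = kV`verts \<G>" using E V G by (auto intro!: image_cong)
 have inj: "inj_on kE (edges \<G>'') = inj_on iE (edges \<G>')" unfolding G by (rule inj_on_cong) (simp add: E)
 have c: "contraction \<G> \<G>' iV iE" using s by (rule specialization_contraction)
 have cl: "!!e. e:edges \<G> ==> src \<G> e:verts \<G>" "!!e. e:edges \<G> ==> tgt \<G> e:verts \<G>" using closed_edgesD[OF wf_graph_closed[OF wf]] by auto
 have sets: "{v:verts \<G>. iV v = v'} = {v:verts \<G>. kV v = v'}"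
  "{e:edges \<G> - kE`edges \<G>''. iV (src \<G> e) = v'} = {e:edges \<G> - kE`edges \<G>''. kV (src \<G> e) = v'}" for v' using V cl by auto
 have ends: "{kV (src \<G> (kE e)), kV (tgt \<G> (kE e))} = {src \<G>'' e, tgt \<G>'' e}" if "e:edges \<G>''" for e
  using contractionD(4)[OF c, of e] contractionD(9)[OF c, of e] that G E V cl by auto
 have legs: "leg \<G> i:verts \<G>" if "i < nlegs \<G>" for i using wf that by (auto simp: wf_graph_def)
 show ?thesis using s unfolding specialization_def im inj sets by (intro conjI) (auto simp: ends V legs G im)
qed

text \<open>A vertex of \<open>\<G>'\<close> is sent to the image of any preimage in
  \<open>\<G>\<close>. This is well defined because the fibres of \<open>iV\<close> are connected by
  edges that the second specialization contracts as well.\<close>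

lemma specialization_factor:
 assumes s: "specialization \<G> \<G>' iV iE" and t: "specialization \<G> \<G>'' kV kE" and wf: "wf_graph \<G>"
  and sub: "kE`edges \<G>'' <= iE`edges \<G>'"
 shows "\<exists>tV tE. specialization \<G>' \<G>'' tV tE & (ALL v:verts \<G>. tV (iV v) = kV v) &
  (ALL e:edges \<G>''. iE (tE e) = kE e)"
proof -
 note c = specialization_contraction[OF s] and d = specialization_contraction[OF t]
 note cl = wf_graph_closed[OF wf]
 have wf': "wf_graph \<G>'" by (rule specialization_wf[OF s wf])
 have mono: "(adj \<G> (edges \<G> - iE`edges \<G>'))^* <= (adj \<G> (edges \<G> - kE`edges \<G>''))^*" using sub by (intro rtrancl_mono adj_mono) blast
 define tV where "tV x = kV (inv_into (verts \<G>) iV x)" for x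
 define tE where "tE e = inv_into (edges \<G>') iE (kE e)" for e
 have V: "tV (iV v) = kV v" if v: "v:verts \<G>" for v
 proof -
  let ?u = "inv_into (verts \<G>) iV (iV v)"
  have "?u:verts \<G>" "iV ?u = iV v" using v by (auto intro: inv_into_into f_inv_into_f)
  thus ?thesis unfolding tV_def using contractionD(5)[OF c, of ?u v] contractionD(5)[OF d, of ?u v] v mono by blast
 qed
 have E: "iE (tE e) = kE e" "tE e:edges \<G>'" if e: "e:edges \<G>''" for e using sub e by (auto simp: tE_def intro!: f_inv_into_f inv_into_into)
 have im: "tV`verts \<G>' = verts \<G>''" unfolding contractionD(1)[OF c, symmetric] contractionD(1)[OF d, symmetric] image_image using V by auto
 have inj: "inj_on tE (edges \<G>'')" using contractionD(2)[OF d] E by (auto simp: inj_on_def) metis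
 have ends: "{tV (src \<G>' (tE e)), tV (tgt \<G>' (tE e))} = {src \<G>'' e, tgt \<G>'' e}" if e: "e:edges \<G>''" for e
 proof -
  have "{tV (src \<G>' (tE e)), tV (tgt \<G>' (tE e))} = tV`{src \<G>' (tE e), tgt \<G>' (tE e)}" by simp
  also have "... = {tV (iV (src \<G> (kE e))), tV (iV (tgt \<G> (kE e)))}" using contractionD(4)[OF c E(2)[OF e]] E(1)[OF e] by (metis image_empty image_insert)
  also have "... = {kV (src \<G> (kE e)), kV (tgt \<G> (kE e))}" using V closed_edgesD[OF cl contractionD(9)[OF d e]] by auto
  finally show ?thesis using contractionD(4)[OF d e] by simp
 qed
 have fib: "tV x = tV y \<longleftrightarrow> (x, y):(adj \<G>' (edges \<G>' - tE`edges \<G>''))^*"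
  if xy: "x:verts \<G>'" "y:verts \<G>'" for x y
 proof -
  obtain u v where uv: "u:verts \<G>" "v:verts \<G>" "x = iV u" "y = iV v" using xy contractionD(1)[OF c] by blast
  have eq: "edges \<G> - iE`edges \<G>' \<union> iE`(edges \<G>' - tE`edges \<G>'') = edges \<G> - kE`edges \<G>''"
  proof -
   have "kE`edges \<G>'' = iE`tE`edges \<G>''" using E by (auto simp: image_image)
   moreover have "tE`edges \<G>'' <= edges \<G>'" using E by auto
   moreover have "iE`(edges \<G>' - tE`edges \<G>'') = iE`edges \<G>' - iE`tE`edges \<G>''"
    using contractionD(2)[OF c] calculation(2) by (intro inj_on_image_set_diff) auto
   ultimately show ?thesis using contractionD(3)[OF c] by auto
  qed
  have "tV x = tV y \<longleftrightarrow> kV u = kV v" using uv V by auto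
  also have "... \<longleftrightarrow> (u, v):(adj \<G> (edges \<G> - kE`edges \<G>''))^*" using contractionD(5)[OF d] uv by blast
  also have "... \<longleftrightarrow> (x, y):(adj \<G>' (edges \<G>' - tE`edges \<G>''))^*"
  proof
   assume "(u, v):(adj \<G> (edges \<G> - kE`edges \<G>''))^*"
   from contraction_push_path[OF c cl _ this] uv
   have "(x, y):(adj \<G>' {e:edges \<G>'. iE e:edges \<G> - kE`edges \<G>''})^*" by blast
   also have "... <= (adj \<G>' (edges \<G>' - tE`edges \<G>''))^*" using E by (intro rtrancl_mono) (auto simp: adj_def)
   finally show "(x, y):(adj \<G>' (edges \<G>' - tE`edges \<G>''))^*" .
  next
   assume "(x, y):(adj \<G>' (edges \<G>' - tE`edges \<G>''))^*"
   from contraction_lift_path[OF c cl _ uv(1,2), OF _ this[unfolded uv]]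
   show "(u, v):(adj \<G> (edges \<G> - kE`edges \<G>''))^*" unfolding eq by blast
  qed
  finally show ?thesis .
 qed
 have legs: "nlegs \<G>'' = nlegs \<G>' & (\<forall>i<nlegs \<G>'. leg \<G>'' i = tV (leg \<G>' i))"
  using contractionD(6,7)[OF c] contractionD(6,7)[OF d] V wf by (auto simp: wf_graph_def)
 have con: "contraction \<G>' \<G>'' tV tE" unfolding contraction_def using im inj ends fib legs E by auto
 have "specialization \<G>' \<G>'' tV tE"
 proof (rule specializationI[OF wf' con])
  fix v assume v: "v:verts \<G>''"
  have "omega_graph \<G>'' v = push_forward (verts \<G>) (tV \<circ> iV) (omega_graph \<G>) v"
   unfolding specialization_omega[OF t wf v] by (rule push_forward_cong) (auto simp: V)
  also have "... = push_forward (verts \<G>') tV (push_forward (verts \<G>) iV (omega_graph \<G>)) v"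
   by (rule push_forward_comp[symmetric]) (use wf wf' contractionD(1)[OF c] in "auto simp: wf_graph_def")
  also have "... = push_forward (verts \<G>') tV (omega_graph \<G>') v" by (rule push_forward_cong) (auto simp: specialization_omega[OF s wf])
  finally show "omega_graph \<G>'' v = push_forward (verts \<G>') tV (omega_graph \<G>') v" .
 qed
 thus ?thesis using V E(1) by blast
qed

subsection \<open>Contracting a set of edges\<close>

lemma adj_component_eq:
 assumes "(x, y):(adj \<G> S)^*" shows "(adj \<G> S)^*``{x} = (adj \<G> S)^*``{y}" using rtrancl_trans[OF assms] rtrancl_trans[OF adj_rtrancl_sym[OF assms]]
 unfolding Image_singleton by blast

text \<open>An additional edge merges at most two components. For the fibres of a contraction this
  says that the first Betti number is nonnegative, which makes their genus a legitimate
  weight.\<close>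

lemma card_components:
 assumes "finite S" "finite V"
 shows "card V <= card ((%v. (adj \<G> S)^*``{v})`V) + card S" using assms(1)
proof (induction S rule: finite_induct)
 case empty
 have "adj \<G> {} = {}" by (auto simp: adj_def)
 hence "inj_on (%v. (adj \<G> {})^*``{v}) V" by (auto simp: inj_on_def)
 thus ?case by (simp add: card_image)
next
 case (insert e S)
 let ?C = "%T v. (adj \<G> T)^*``{v}"
 \<comment> \<open>\<open>f\<close> is the component map of \<open>S\<close> after merging the
   component of \<open>src \<G> e\<close> into that of \<open>tgt \<G> e\<close>. It factors through
   the components of the larger edge set and misses at most one old component.\<close>
 define f where "f x = (if x:?C S (src \<G> e) then ?C S (tgt \<G> e) else ?C S x)" for x
 note eqC = adj_component_eq[of _ _ \<G> S]
 have finv: "f x = f y" if "(x, y):(adj \<G> (insert e S))^*" for x y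
 proof (rule adj_rtrancl_invariant[OF that])
  fix e' assume "e':insert e S"
  moreover have "f (src \<G> e) = f (tgt \<G> e)" unfolding f_def by auto
  moreover have "f (src \<G> e') = f (tgt \<G> e')" if "e':S"
  proof -
   have "(src \<G> e', tgt \<G> e'):(adj \<G> S)^*" "(tgt \<G> e', src \<G> e'):(adj \<G> S)^*" using adj_edge[OF that] by auto
   hence "src \<G> e':?C S (src \<G> e) \<longleftrightarrow> tgt \<G> e':?C S (src \<G> e)" by (auto intro: rtrancl_trans)
   thus ?thesis unfolding f_def using eqC \<open>(src \<G> e', tgt \<G> e'):(adj \<G> S)^*\<close> by auto
  qed
  ultimately show "f (src \<G> e') = f (tgt \<G> e')" by blast
 qed
 have "?C S`V <= insert (?C S (src \<G> e)) (f`V)"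
 proof
  fix c assume "c:?C S`V"
  then obtain v where v: "v:V" "c = ?C S v" by blast
  show "c:insert (?C S (src \<G> e)) (f`V)"
  proof (cases "v:?C S (src \<G> e)")
   case True thus ?thesis using v eqC by auto
  next
   case False thus ?thesis using v by (auto simp: f_def image_iff)
  qed
 qed
 hence "card (?C S`V) <= card (insert (?C S (src \<G> e)) (f`V))" using assms by (intro card_mono) auto
 also have "... <= Suc (card (f`V))" using assms by (simp add: card_insert_if)
 also have "card (f`V) <= card (?C (insert e S)`V)"
 proof -
  have "f`V <= (%c. f (SOME x. x:c))`(?C (insert e S)`V)"
  proof
   fix y assume "y:f`V"
   then obtain v where v: "v:V" "y = f v" by blast
   have "(SOME x. x:?C (insert e S) v):?C (insert e S) v" by (rule someI[of _ v]) auto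
   hence "f v = f (SOME x. x:?C (insert e S) v)" using finv by auto
   thus "y:(%c. f (SOME x. x:c))`(?C (insert e S)`V)" using v(1) unfolding v(2) by (intro image_eqI[where x = "?C (insert e S) v"]) auto
  qed
  hence "card (f`V) <= card ((%c. f (SOME x. x:c))`(?C (insert e S)`V))" using assms by (intro card_mono) auto
  also have "... <= card (?C (insert e S)`V)" using assms by (intro card_image_le) auto
  finally show ?thesis .
 qed
 finally show ?case using insert by simp
qed

text \<open>\<open>S\<close> is the set of edges that are kept; the vertices are the numbered
  components of the rest. The choice \<open>S = edges \<G>\<close> produces a standard copy of
  \<open>\<G>\<close>, and reference directions are preserved so that paths can be carried over to
  it.\<close>

lemma contract_exists:
 assumes wf: "wf_graph \<G>" and S: "S <= edges \<G>"
 obtains \<G>' iV iE where "standard_graph \<G>'" "specialization \<G> \<G>' iV iE" "iE`edges \<G>' = S"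
  "!!e. e:edges \<G>' ==> src \<G>' e = iV (src \<G> (iE e)) & tgt \<G>' e = iV (tgt \<G> (iE e))"
proof -
 let ?T = "edges \<G> - S"
 let ?C = "%v. (adj \<G> ?T)^*``{v}"
 have fin: "finite (verts \<G>)" "finite (edges \<G>)" "finite S" using wf S by (auto simp: wf_graph_def intro: finite_subset)
 note cl = wf_graph_closed[OF wf]
 obtain h where h: "bij_betw h (?C`verts \<G>) {..<card (?C`verts \<G>)}" using ex_bij_betw_finite_nat[of "?C`verts \<G>"] fin by (auto simp: atLeast0LessThan)
 obtain k where k: "bij_betw k {..<card S} S" using ex_bij_betw_nat_finite[OF fin(3)] by (auto simp: atLeast0LessThan)
 define iV where "iV v = h (?C v)" for v
 define N where "N = card (?C`verts \<G>)"
 define \<G>' :: "(nat, nat) lgraph" where "\<G>' = \<lparr>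
  verts = {..<N}, edges = {..<card S},
  src = (%e. if e < card S then iV (src \<G> (k e)) else 0),
  tgt = (%e. if e < card S then iV (tgt \<G> (k e)) else 0),
  wt = (%v. if v < N then nat (sub_genus \<G> {u:verts \<G>. iV u = v} {e:?T. iV (src \<G> e) = v}) else 0),
  nlegs = nlegs \<G>, leg = (%i. if i < nlegs \<G> then iV (leg \<G> i) else 0)\<rparr>"
 have kE: "k`edges \<G>' = S" using k by (auto simp: \<G>'_def bij_betw_def)
 have kI: "k e:S" if "e < card S" for e using k that by (auto simp: bij_betw_def)
 have eqC: "?C u = ?C v \<longleftrightarrow> (u, v):(adj \<G> ?T)^*" for u v using adj_component_eq[of u v \<G> ?T] by blast
 have fib: "iV u = iV v \<longleftrightarrow> (u, v):(adj \<G> ?T)^*" if "u:verts \<G>" "v:verts \<G>" for u v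
 proof -
  have "iV u = iV v \<longleftrightarrow> ?C u = ?C v" unfolding iV_def using h that by (intro inj_on_eq_iff[where A = "?C`verts \<G>"]) (auto simp: bij_betw_def)
  thus ?thesis using eqC by simp
 qed
 have img: "iV`verts \<G> = verts \<G>'" using h unfolding iV_def \<G>'_def N_def bij_betw_def by (simp add: image_image)
 have c: "contraction \<G> \<G>' iV k" unfolding contraction_def kE
 proof (intro conjI ballI)
  show "inj_on k (edges \<G>')" using k by (simp add: \<G>'_def bij_betw_def)
  show "{iV (src \<G> (k e)), iV (tgt \<G> (k e))} = {src \<G>' e, tgt \<G>' e}" if "e:edges \<G>'" for e using that by (simp add: \<G>'_def)
  show "\<forall>i<nlegs \<G>. leg \<G>' i = iV (leg \<G> i)" by (simp add: \<G>'_def)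
  show "nlegs \<G>' = nlegs \<G>" by (simp add: \<G>'_def)
  show "iV u = iV v \<longleftrightarrow> (u, v):(adj \<G> ?T)^*" if "u:verts \<G>" "v:verts \<G>" for u v using that by (rule fib)
  show "iV`verts \<G> = verts \<G>'" by (rule img)
  show "S <= edges \<G>" by (rule S)
 qed
 \<comment> \<open>\<open>nat\<close> must not truncate the genus of a fibre. Each fibre is
   connected by its own contracted edges, so it has one component and \<open>card_components\<close>
   bounds its number of vertices.\<close>
 have nonneg: "sub_genus \<G> {u:verts \<G>. iV u = v} {e:?T. iV (src \<G> e) = v} >= 0" if v: "v:verts \<G>'" for v
 proof -
  let ?F = "{u:verts \<G>. iV u = v}" and ?S = "{e:?T. iV (src \<G> e) = v}"
  from v obtain u where "u:verts \<G>" "iV u = v" unfolding img[symmetric] by (elim imageE) simp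
  hence u: "u:?F" by simp
  have conn: "(u, w):(adj \<G> ?S)^*" if w: "w:?F" for w
  proof -
   have "(u, w):(adj \<G> ?T)^*" using fib[of u w] u w by simp
   hence "(u, w):(adj \<G> ?S)^* & iV w = v"
   proof (induction rule: rtrancl_induct)
    case base show ?case using u by simp
   next
    case (step y z)
    from step(2) obtain e where e: "e:?T" "(src \<G> e = y & tgt \<G> e = z) \<or> (src \<G> e = z & tgt \<G> e = y)" unfolding adj_def by blast
    have "e ~: k`edges \<G>'" using e(1) unfolding kE by simp
    hence eq: "iV (src \<G> e) = iV (tgt \<G> e)" using contraction_contracted[OF c cl, of e] e(1) by simp
    hence z: "iV z = v" "iV (src \<G> e) = v" using e(2) step.IH by (elim disjE; simp)+
    hence "(y, z):adj \<G> ?S" using e unfolding adj_def by blast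
    thus ?case using step.IH z(1) by (meson rtrancl_into_rtrancl)
   qed
   thus ?thesis by blast
  qed
  have "(%w. (adj \<G> ?S)^*``{w})`?F <= {(adj \<G> ?S)^*``{u}}"
  proof
   fix c assume "c:(%w. (adj \<G> ?S)^*``{w})`?F"
   then obtain w where "w:?F" "c = (adj \<G> ?S)^*``{w}" by blast
   thus "c:{(adj \<G> ?S)^*``{u}}" using adj_component_eq[OF conn[of w]] by simp
  qed
  hence "card ((%w. (adj \<G> ?S)^*``{w})`?F) <= card {(adj \<G> ?S)^*``{u}}" by (intro card_mono) auto
  hence "card ?F <= 1 + card ?S" using card_components[of ?S ?F \<G>] fin by simp
  hence "int (card ?S) - int (card ?F) + 1 >= 0" by linarith
  moreover have "(SUM v:?F. int (wt \<G> v)) >= 0" by (intro sum_nonneg) auto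
  ultimately show ?thesis unfolding sub_genus_def by linarith
 qed
 have wts: "int (wt \<G>' v) = sub_genus \<G> {u:verts \<G>. iV u = v} {e:?T. iV (src \<G> e) = v}" if "v:verts \<G>'" for v
 proof -
  have "wt \<G>' v = nat (sub_genus \<G> {u:verts \<G>. iV u = v} {e:?T. iV (src \<G> e) = v})" using that by (simp add: \<G>'_def)
  thus ?thesis using nonneg[OF that] by simp
 qed
 have "specialization \<G> \<G>' iV k" unfolding specialization_def kE using c[unfolded contraction_def kE] wts by blast
 moreover have "standard_graph \<G>'" unfolding standard_graph_def using contraction_wf[OF c wf] by (auto simp: \<G>'_def)
 ultimately show ?thesis using that[of \<G>' iV k] kE by (auto simp: \<G>'_def)
qed

lemma genus_specialization:
 assumes s: "specialization \<G> \<G>' iV iE" and wf: "wf_graph \<G>"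
 shows "genus \<G>' = genus \<G>"
proof -
 have wf': "wf_graph \<G>'" by (rule specialization_wf[OF s wf])
 have "2 * genus \<G>' - 2 = (SUM v:verts \<G>'. push_forward (verts \<G>) iV (omega_graph \<G>) v)"
  unfolding genus_omega[OF wf'] by (rule sum.cong) (auto simp: specialization_omega[OF s wf])
 also have "... = 2 * genus \<G> - 2" unfolding genus_omega[OF wf]
  by (rule sum_push_forward) (use wf_graphD(1)[OF wf] wf_graphD(1)[OF wf'] specializationD(1)[OF s] in auto)
 finally show ?thesis by simp
qed

lemma legs_at_contraction:
 assumes c: "contraction \<G> \<G>' iV iE" and wf: "wf_graph \<G>"
 shows "int (legs_at \<G>' v) = push_forward (verts \<G>) iV (%v. int (legs_at \<G> v)) v"
proof -
 have L: "legs_at G w = (\<Sum>i<nlegs G. of_bool (leg G i = w))" for G :: "('x, 'y) lgraph" and w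
 proof -
  have "{i. i < nlegs G & leg G i = w} = {i:{..<nlegs G}. leg G i = w}" by auto
  thus ?thesis unfolding legs_at_def by (simp only: card_filter_sum[OF finite_lessThan])
 qed
 have "push_forward (verts \<G>) iV (%v. int (legs_at \<G> v)) v =
   (\<Sum>i<nlegs \<G>. SUM u:{u:verts \<G>. iV u = v}. of_bool (leg \<G> i = u))" unfolding push_forward_def L of_nat_sum of_nat_of_bool by (rule sum.swap)
 also have "... = (\<Sum>i<nlegs \<G>. of_bool (leg \<G>' i = v))" using contractionD(7)[OF c] wf_graphD(1,5)[OF wf]
  by (intro sum.cong) (auto simp: of_bool_def sum.delta)
 finally show ?thesis using contractionD(6)[OF c] by (simp add: L)
qed

lemma stable_iff_omega:
 "stable \<G> \<longleftrightarrow> (ALL v:verts \<G>. omega_graph \<G> v + int (legs_at \<G> v) >= 1)"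
proof -
 have "valence \<G> v + 2 * wt \<G> v + legs_at \<G> v >= 3 \<longleftrightarrow> omega_graph \<G> v + int (legs_at \<G> v) >= 1" for v
  unfolding omega_graph_def by linarith
 thus ?thesis unfolding stable_def by blast
qed

text \<open>\<open>omega_graph\<close> plus the number of legs is additive over the fibres, which
  are nonempty, and at least 1 at every vertex of a stable graph.\<close>

lemma stable_specialization:
 assumes s: "specialization \<G> \<G>' iV iE" and wf: "wf_graph \<G>" and st: "stable \<G>"
 shows "stable \<G>'" unfolding stable_iff_omega
proof
 note c = specialization_contraction[OF s]
 fix v assume v: "v:verts \<G>'"
 let ?F = "{u:verts \<G>. iV u = v}"
 obtain u where u: "u:?F" using v unfolding contractionD(1)[OF c, symmetric] by (elim imageE) simp
 have "omega_graph \<G>' v + int (legs_at \<G>' v) = (SUM u:?F. omega_graph \<G> u + int (legs_at \<G> u))"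
  unfolding specialization_omega[OF s wf v] legs_at_contraction[OF c wf] by (simp add: push_forward_def sum.distrib)
 moreover have "(SUM u:?F. omega_graph \<G> u + int (legs_at \<G> u)) >= (SUM u:?F. 1)" using st by (intro sum_mono) (auto simp: stable_iff_omega)
 moreover have "(SUM u:?F. 1::int) >= 1" using u wf_graphD(1)[OF wf] card_gt_0_iff[of ?F] by (simp add: Suc_le_eq) fastforce
 ultimately show "omega_graph \<G>' v + int (legs_at \<G>' v) >= 1" by linarith
qed

lemma stable_graphsD:
 assumes "\<G>:stable_graphs g n"
 shows "wf_graph \<G>" "standard_graph \<G>" "stable \<G>" "genus \<G> = int g" "nlegs \<G> = n" using assms by (auto simp: stable_graphs_def standard_graph_def)

lemma stable_graphs_specialization:
 assumes "specialization \<G> \<G>' iV iE" "\<G>:stable_graphs g n" "standard_graph \<G>'"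
 shows "\<G>':stable_graphs g n" using assms stable_graphsD[OF assms(2)] genus_specialization[OF assms(1)] stable_specialization[OF assms(1)]
  specializationD(6)[OF assms(1)] by (simp add: stable_graphs_def)

subsection \<open>Points of the moduli space of tropical curves\<close>

abbreviation positive_lengths :: "('v, 'e) lgraph => ('e => real) => bool" where
 "positive_lengths \<G> l \<equiv> ALL e:edges \<G>. l e > 0"

lemma extend_zero_comp:
 assumes c: "contraction \<G> \<G>' iV iE" and d: "contraction \<G>' \<G>'' kV kE"
  and fin: "finite (edges \<G>')"
 shows "extend_zero (edges \<G>') iE (extend_zero (edges \<G>'') kE x) = extend_zero (edges \<G>'') (iE \<circ> kE) x"
proof
 fix e
 have "finite (edges \<G>'')" using contractionD(2,3)[OF d] fin by (meson finite_imageD finite_subset)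
 thus "extend_zero (edges \<G>') iE (extend_zero (edges \<G>'') kE x) e = extend_zero (edges \<G>'') (iE \<circ> kE) x e"
  using contractionD(3)[OF d] fin by (intro push_forward_comp) auto
qed

lemma extend_zero_eqI:
 assumes "inj_on g I" "!!i. i:I ==> y (g i) = x i" "!!j. j ~: g`I ==> y j = 0"
 shows "y = extend_zero I g x"
proof
 fix j show "y j = extend_zero I g x j" using assms by (cases "j:g`I") (auto simp: push_forward_inj push_forward_outside)
qed

text \<open>A representative with positive lengths is minimal in its class: every other point is its
  extension by zero along a specialization. This property is carried along the gluing steps, in both
  directions, by composing or factoring specializations.\<close>

lemma M_trop_glue_positive:
 assumes gl: "((\<G>, x), (\<G>', x')):glue (M_trop g n)"
  and \<G>': "\<G>':stable_graphs g n" "x':orthant (edges \<G>')" "positive_lengths \<G>' x'"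
 obtains iV iE where "\<G>:stable_graphs g n" "specialization \<G> \<G>' iV iE" "x = extend_zero (edges \<G>') iE x'"
proof -
 let ?P = "%p. fst p:stable_graphs g n & snd p:orthant (edges (fst p)) &
  (\<exists>iV iE. specialization (fst p) \<G>' iV iE & snd p = extend_zero (edges \<G>') iE x')"
 have "x' = extend_zero (edges \<G>') id x'" by (rule extend_zero_eqI) (use \<G>' in "auto simp: orthant_def")
 hence base0: "\<exists>iV iE. specialization \<G>' \<G>' iV iE & x' = extend_zero (edges \<G>') iE x'"
  using specialization_id[OF stable_graphsD(1)[OF \<G>'(1)]] by blast
 have "((\<G>', x'), (\<G>, x)):glue (M_trop g n)" using equiv_glue gl by (meson equivE symD)
 hence "?P (\<G>, x)" unfolding glue_def
 proof (induction "(\<G>, x)" arbitrary: \<G> x rule: rtrancl_induct)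
  case base show ?case using base0 \<G>'(1,2) by simp
 next
  case (step p \<G>b xb)
  obtain \<G>a xa where p: "p = (\<G>a, xa)" by force
  have IH: "\<G>a:stable_graphs g n" "xa:orthant (edges \<G>a)"
   "\<exists>iV iE. specialization \<G>a \<G>' iV iE & xa = extend_zero (edges \<G>') iE x'" using step.hyps(3)[OF p] by auto
  then obtain iV iE where \<iota>: "specialization \<G>a \<G>' iV iE" "xa = extend_zero (edges \<G>') iE x'" by blast
  note wfa = stable_graphsD(1)[OF IH(1)]
  from step.hyps(2) consider "((\<G>a, xa), (\<G>b, xb)):glue_step (M_trop g n)" | "((\<G>b, xb), (\<G>a, xa)):glue_step (M_trop g n)" unfolding p by blast
  thus ?case
  proof cases
   case 1
   then obtain kV kE where k: "\<G>b:stable_graphs g n" "xb:orthant (edges \<G>b)"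
    "specialization \<G>b \<G>a kV kE" "xb = extend_zero (edges \<G>a) kE xa" by (auto simp: glue_step_def M_trop_def)
   have "specialization \<G>b \<G>' (iV \<circ> kV) (kE \<circ> iE)" by (rule specialization_comp[OF k(3) \<iota>(1) stable_graphsD(1)[OF k(1)]])
   moreover have "xb = extend_zero (edges \<G>') (kE \<circ> iE) x'" unfolding k(4) \<iota>(2)
    by (rule extend_zero_comp[OF specialization_contraction[OF k(3)] specialization_contraction[OF \<iota>(1)] wf_graphD(2)[OF wfa]])
   ultimately show ?thesis using k by auto
  next
   case 2
   then obtain kV kE where k: "\<G>b:stable_graphs g n" "xb:orthant (edges \<G>b)"
    "specialization \<G>a \<G>b kV kE" "xa = extend_zero (edges \<G>b) kE xb" by (auto simp: glue_step_def M_trop_def)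
   have inj: "inj_on kE (edges \<G>b)" "inj_on iE (edges \<G>')" using contractionD(2) specialization_contraction k(3) \<iota>(1) by blast+
   \<comment> \<open>The gluing step is run against its direction. Edges missed by \<open>kE\<close>
     have length zero and those hit by \<open>iE\<close> have positive length, so the specialization
     to \<open>\<G>'\<close> factors through \<open>\<G>b\<close>.\<close>
   have "iE`edges \<G>' <= kE`edges \<G>b"
   proof
    fix e assume "e:iE`edges \<G>'"
    hence "xa e > 0" unfolding \<iota>(2) using \<G>'(3) inj by (auto simp: push_forward_inj)
    hence "xa e ~= 0" by simp
    thus "e:kE`edges \<G>b" unfolding k(4) using push_forward_outside[of e kE "edges \<G>b"] by blast
   qed
   from specialization_factor[OF k(3) \<iota>(1) wfa this]
   obtain tV tE where t: "specialization \<G>b \<G>' tV tE" "ALL v:verts \<G>a. tV (kV v) = iV v"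
     "ALL e:edges \<G>'. kE (tE e) = iE e" by (elim exE conjE)
   note ct = specializationD[OF t(1)]
   have "xb = extend_zero (edges \<G>') tE x'"
   proof (rule extend_zero_eqI[OF ct(2)])
    fix e assume e: "e:edges \<G>'"
    have "xb (tE e) = xa (kE (tE e))" unfolding k(4) by (rule push_forward_inj[OF inj(1) ct(9)[OF e], symmetric])
    thus "xb (tE e) = x' e" unfolding bspec[OF t(3) e] \<iota>(2) by (simp only: push_forward_inj[OF inj(2) e])
   next
    fix e assume e: "e ~: tE`edges \<G>'"
    show "xb e = 0"
    proof (cases "e:edges \<G>b")
     case True
     have "kE e ~: iE`edges \<G>'"
     proof
      assume "kE e:iE`edges \<G>'"
      then obtain e' where e': "e':edges \<G>'" "kE e = iE e'" by blast
      hence "kE e = kE (tE e')" using t(3) by simp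
      hence "e = tE e'" using inj_onD[OF inj(1) _ True ct(9)[OF e'(1)]] by blast
      thus False using e e'(1) by blast
     qed
     hence "xa (kE e) = 0" unfolding \<iota>(2) by (rule push_forward_outside)
     thus ?thesis unfolding k(4) by (simp only: push_forward_inj[OF inj(1) True])
    next
     case False thus ?thesis using k(2) by (simp add: orthant_def)
    qed
   qed
   thus ?thesis using k t by auto
  qed
 qed
 thus ?thesis using that by auto
qed

lemma positive_representative:
 assumes \<G>: "\<G>:stable_graphs g n" and x: "x:orthant (edges \<G>)"
 obtains \<G>' iV iE x' where "\<G>':stable_graphs g n" "specialization \<G> \<G>' iV iE"
  "x':orthant (edges \<G>')" "positive_lengths \<G>' x'" "x = extend_zero (edges \<G>') iE x'"
  "((\<G>, x), (\<G>', x')):glue (M_trop g n)"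
proof -
 note wf = stable_graphsD(1)[OF \<G>]
 obtain \<G>' :: "(nat, nat) lgraph" and iV iE where s: "standard_graph \<G>'" "specialization \<G> \<G>' iV iE" "iE`edges \<G>' = {e:edges \<G>. x e > 0}"
  by (rule contract_exists[OF wf, of "{e:edges \<G>. x e > 0}"]) auto
 note c = specializationD[OF s(2)]
 define x' where "x' e = (if e:edges \<G>' then x (iE e) else 0)" for e
 have st: "\<G>':stable_graphs g n" by (rule stable_graphs_specialization[OF s(2) \<G> s(1)])
 have pos: "positive_lengths \<G>' x'" using s(3) by (auto simp: x'_def)
 hence o: "x':orthant (edges \<G>')" by (auto simp: orthant_def x'_def less_imp_le)
 have e: "x = extend_zero (edges \<G>') iE x'"
 proof (rule extend_zero_eqI[OF c(2)])
  show "x e = 0" if "e ~: iE`edges \<G>'" for e using x that unfolding s(3) by (force simp: orthant_def)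
 qed (simp add: x'_def)
 have "((\<G>', x'), (\<G>, extend_zero (edges \<G>') iE x')):glue (M_trop g n)" by (rule glue_morI) (use st \<G> s(2) o x e in "auto simp: M_trop_def")
 hence "((\<G>, x), (\<G>', x')):glue (M_trop g n)" using equiv_glue e by (metis equivE symD)
 thus ?thesis using that[OF st s(2) o pos e] by blast
qed

subsection \<open>Pruning\<close>

lemma valence_one_edge:
 assumes fin: "finite (edges \<G>)" and "valence \<G> v = 1" and e: "e:edges \<G>" "{src \<G> e, tgt \<G> e} = {v, u}"
 shows "u ~= v" "!!e'. e':edges \<G> ==> src \<G> e' = v \<or> tgt \<G> e' = v ==> e' = e"
proof -
 let ?h = "%e. of_bool (src \<G> e = v) + of_bool (tgt \<G> e = v) :: nat"
 have s: "(SUM e:edges \<G>. ?h e) = 1" using assms(2) valence_sum[OF fin] by simp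
 have he: "?h e >= 1" using e(2) by (auto simp: doubleton_eq_iff)
 have r: "(SUM e:edges \<G>. ?h e) = ?h e + (SUM e:edges \<G> - {e}. ?h e)" by (rule sum.remove[OF fin e(1)])
 hence "?h e = 1" using s he by linarith
 thus "u ~= v" using e(2) by (auto simp: doubleton_eq_iff)
 have "(SUM e:edges \<G> - {e}. ?h e) = 0" using s he r by linarith
 hence "ALL e':edges \<G> - {e}. ?h e' = 0" using fin by (simp add: sum_eq_0_iff)
 thus "e' = e" if "e':edges \<G>" "src \<G> e' = v \<or> tgt \<G> e' = v" for e' using that by (cases "e' = e") auto
qed

text \<open>The only nontrivial fibre consists of \<open>u\<close>, \<open>v\<close> and one edge
  between them. It is a tree in which only \<open>u\<close> can have weight, so the weight of
  \<open>u\<close> is right as it stands.\<close>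

lemma prune_step_specialization:
 assumes wf: "wf_graph \<C>" and v: "v:verts \<C>" "valence \<C> v = 1" "wt \<C> v = 0"
  and e: "e:edges \<C>" "{src \<C> e, tgt \<C> e} = {v, u}"
 shows "specialization \<C> (\<C>\<lparr>verts := verts \<C> - {v}, edges := edges \<C> - {e},
     leg := (%i. if leg \<C> i = v then u else leg \<C> i)\<rparr>) (%x. if x = v then u else x) id"
  (is "specialization _ ?D ?f id")
proof -
 note one = valence_one_edge[OF wf_graphD(2)[OF wf] v(2) e]
 note cl = edge_ends[OF wf]
 have u: "u:verts \<C>" using e cl[of e] by (auto simp: doubleton_eq_iff)
 have C: "edges \<C> - id`edges ?D = {e}" using e by auto
 have fib: "?f x = ?f y \<longleftrightarrow> (x, y):(adj \<C> {e})^*" for x y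
 proof
  have a: "(v, u):(adj \<C> {e})^*" using e(2) by (auto simp: adj_def doubleton_eq_iff intro!: r_into_rtrancl)
  have b: "(x, ?f x):(adj \<C> {e})^*" for x using a by auto
  show "(x, y):(adj \<C> {e})^*" if "?f x = ?f y" using rtrancl_trans[OF b[of x, unfolded that] adj_rtrancl_sym[OF b[of y]]] .
  show "(x, y):(adj \<C> {e})^* ==> ?f x = ?f y" by (erule adj_rtrancl_invariant) (use e(2) in "auto simp: doubleton_eq_iff")
 qed
 have "contraction \<C> ?D ?f id" unfolding contraction_def C
 proof (intro conjI ballI allI impI fib)
  show "?f`verts \<C> = verts ?D" using u v one(1) by auto
  fix e' assume e': "e':edges ?D"
  hence "src \<C> e' ~= v" "tgt \<C> e' ~= v" using one(2)[of e'] by auto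
  thus "{?f (src \<C> (id e')), ?f (tgt \<C> (id e'))} = {src ?D e', tgt ?D e'}" by simp
 qed auto
 moreover have "int (wt ?D x) = sub_genus \<C> {y:verts \<C>. ?f y = x} {e':edges \<C> - id`edges ?D. ?f (src \<C> e') = x}"
  if x: "x:verts ?D" for x
 proof (cases "x = u")
  case True
  have "{y:verts \<C>. ?f y = x} = {u, v}" using True u v by auto
  moreover have "{e':edges \<C> - id`edges ?D. ?f (src \<C> e') = x} = {e}" unfolding C using e(2) True by (auto simp: doubleton_eq_iff)
  ultimately show ?thesis using one(1) v(3) True by (simp add: sub_genus_def)
 next
  case False
  have "{y:verts \<C>. ?f y = x} = {x}" using False x by auto
  moreover have "{e':edges \<C> - id`edges ?D. ?f (src \<C> e') = x} = {}" unfolding C using e(2) False x by (auto simp: doubleton_eq_iff)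
  ultimately show ?thesis by (simp only: sub_genus_def) simp
 qed
 ultimately show ?thesis unfolding specialization_def contraction_def by blast
qed

lemma prunes_specialization:
 assumes "prunes \<G> \<C> r" and wf: "wf_graph \<G>"
 shows "specialization \<G> \<C> r id & verts \<C> <= verts \<G> & edges \<C> <= edges \<G> & src \<C> = src \<G> & tgt \<C> = tgt \<G> &
   wt \<C> = wt \<G> & nlegs \<C> = nlegs \<G> & (ALL v:verts \<C>. r v = v)" using assms(1)
proof (induction rule: prunes.induct)
 case prunes_refl
 show ?case by (intro conjI specialization_id[OF wf]) auto
next
 case (prunes_step \<C> r v e u)
 have wf': "wf_graph \<C>" using prunes_step.IH specialization_wf[OF _ wf] by blast
 have "specialization \<G> \<C> r id" using prunes_step.IH by blast
 from specialization_comp[OF this prune_step_specialization[OF wf' prunes_step.hyps(2,3,4,6,7)] wf]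
 show ?case using prunes_step.IH by (auto simp: comp_def)
qed

lemmas prunesD = prunes_specialization[THEN conjunct1]
 prunes_specialization[THEN conjunct2, THEN conjunct1]
 prunes_specialization[THEN conjunct2, THEN conjunct2, THEN conjunct1]
 prunes_specialization[THEN conjunct2, THEN conjunct2, THEN conjunct2, THEN conjunct1]
 prunes_specialization[THEN conjunct2, THEN conjunct2, THEN conjunct2, THEN conjunct2, THEN conjunct1]
 prunes_specialization[THEN conjunct2, THEN conjunct2, THEN conjunct2, THEN conjunct2, THEN conjunct2, THEN conjunct1]
 prunes_specialization[THEN conjunct2, THEN conjunct2, THEN conjunct2, THEN conjunct2, THEN conjunct2, THEN conjunct2, THEN conjunct1]
 prunes_specialization[THEN conjunct2, THEN conjunct2, THEN conjunct2, THEN conjunct2, THEN conjunct2, THEN conjunct2, THEN conjunct2, THEN bspec]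

text \<open>It excludes vertices of weight 0 and valence at most 1. For at most one leg and genus at
  least 1 this follows from \<open>fully_pruned\<close>; in this form the condition passes to
  specializations, because \<open>omega_graph\<close> adds up over fibres.\<close>

definition core_like :: "('v, 'e) lgraph => bool" where
 "core_like \<C> \<longleftrightarrow> (ALL v:verts \<C>. omega_graph \<C> v >= 0)"

text \<open>A pruned vertex has weight 0 and valence 1, and its valence in a subgraph is no larger,
  so it would have negative \<open>omega_graph\<close> there. Hence pruning never reaches a
  core-like subgraph, and the core is the largest one.\<close>

lemma core_like_sub:
 assumes "prunes \<G> \<C> r" and wf: "wf_graph \<G>"
  and D: "core_like \<C>'" "verts \<C>' <= verts \<G>" "edges \<C>' <= edges \<G>" "src \<C>' = src \<G>" "tgt \<C>' = tgt \<G>" "wt \<C>' = wt \<G>"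
   "closed_edges \<C>'"
 shows "verts \<C>' <= verts \<C> & edges \<C>' <= edges \<C>" using assms(1)
proof (induction rule: prunes.induct)
 case prunes_refl thus ?case using D by simp
next
 case (prunes_step \<C> r v e u)
 note pd = prunesD[OF prunes_step.hyps(1) wf]
 have wf': "wf_graph \<C>" using pd(1) specialization_wf[OF _ wf] by blast
 note one = valence_one_edge[OF wf_graphD(2)[OF wf'] prunes_step.hyps(3,6,7)]
 have fin: "finite (edges \<C>')" using D(3) wf_graphD(2)[OF wf] finite_subset by blast
 have v: "v ~: verts \<C>'"
 proof
  assume "v:verts \<C>'"
  hence "omega_graph \<C>' v >= 0" using D(1) by (simp add: core_like_def)
  moreover have "wt \<C>' v = 0" using D(6) pd(6) prunes_step.hyps(4) by simp
  moreover have "valence \<C>' v <= valence \<C> v" unfolding valence_sum[OF fin] valence_sum[OF wf_graphD(2)[OF wf']]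
   using D(4,5) pd(4,5) prunes_step.IH wf_graphD(2)[OF wf'] by (simp add: sum_mono2)
  ultimately show False using prunes_step.hyps(3) by (simp add: omega_graph_def)
 qed
 have "e ~: edges \<C>'"
 proof
  assume "e:edges \<C>'"
  hence "src \<C> e:verts \<C>'" "tgt \<C> e:verts \<C>'" using closed_edgesD[OF D(7)] D(4,5) pd(4,5) by auto
  thus False using prunes_step.hyps(7) v by (auto simp: doubleton_eq_iff)
 qed
 thus ?case using v prunes_step.IH by auto
qed

text \<open>Each core contains the other. The maps agree because \<open>r v\<close> is joined to
  \<open>v\<close> by edges outside the core, which the second map contracts, while it fixes
  \<open>r v\<close>.\<close>

lemma core_unique:
 assumes p: "prunes \<G> \<C> r" "prunes \<G> \<C>' r'" and wf: "wf_graph \<G>" and c: "core_like \<C>" "core_like \<C>'"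
 shows "verts \<C>' = verts \<C>" "edges \<C>' = edges \<C>" "!!v. v:verts \<G> ==> r' v = r v"
proof -
 note pd = prunesD[OF p(1) wf] and pd' = prunesD[OF p(2) wf]
 have cl: "closed_edges \<C>" "closed_edges \<C>'" using specialization_wf[OF pd(1) wf] specialization_wf[OF pd'(1) wf] by (auto intro: wf_graph_closed)
 show V: "verts \<C>' = verts \<C>" and E: "edges \<C>' = edges \<C>"
  using core_like_sub[OF p(1) wf c(2) pd'(2-6) cl(2)] core_like_sub[OF p(2) wf c(1) pd(2-6) cl(1)] by auto
 show "r' v = r v" if v: "v:verts \<G>" for v
 proof -
  note con = specializationD[OF pd(1)] and con' = specializationD[OF pd'(1)]
  have rv: "r v:verts \<C>" using con(8)[OF v] .
  hence "r (r v) = r v" using pd(8) by blast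
  hence "(v, r v):(adj \<G> (edges \<G> - id`edges \<C>))^*" using con(5)[of v "r v"] v rv pd(2) by auto
  hence "r' v = r' (r v)" using con'(5)[of v "r v"] v rv pd(2) E by auto
  thus ?thesis using pd'(8)[of "r v"] rv V by simp
 qed
qed

lemma core_like_specialization:
 assumes s: "specialization \<C> \<C>' iV iE" and wf: "wf_graph \<C>" and c: "core_like \<C>"
 shows "core_like \<C>'" unfolding core_like_def
proof
 fix v assume "v:verts \<C>'"
 from specialization_omega[OF s wf this] show "0 <= omega_graph \<C>' v" using c by (auto simp: push_forward_def core_like_def intro!: sum_nonneg)
qed

lemma isolated_vertex:
 assumes wf: "wf_graph \<C>" and v: "v:verts \<C>" and val: "valence \<C> v = 0"
 shows "verts \<C> = {v}" "edges \<C> = {}"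
proof -
 have no: "src \<C> e ~= v & tgt \<C> e ~= v" if "e:edges \<C>" for e
 proof -
  have "(SUM e:edges \<C>. of_bool (src \<C> e = v) + of_bool (tgt \<C> e = v)) = (0::nat)" using val valence_sum[OF wf_graphD(2)[OF wf]] by simp
  hence "ALL e:edges \<C>. of_bool (src \<C> e = v) + of_bool (tgt \<C> e = v) = (0::nat)" using wf_graphD(2)[OF wf] by (simp only: sum_eq_0_iff)
  thus ?thesis using that by auto
 qed
 have "w = v" if "w:verts \<C>" for w
 proof -
  have "(v, w):(adj \<C> (edges \<C>))^*" using wf_graphD(4)[OF wf] v that by (auto simp: connected_graph_def)
  thus ?thesis by (induction rule: rtrancl_induct) (use no in "auto simp: adj_def")
 qed
 thus V: "verts \<C> = {v}" using v by blast
 show "edges \<C> = {}"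
 proof (rule equals0I)
  fix e assume "e:edges \<C>"
  thus False using no[of e] edge_ends(1)[OF wf, of e] V by simp
 qed
qed

text \<open>By connectedness a vertex of valence 0 is the whole graph, so its weight is the genus;
  this is where genus 0 has to be excluded.\<close>

lemma fully_pruned_core_like:
 assumes wf: "wf_graph \<C>" and f: "fully_pruned \<C>" and "nlegs \<C> <= 1" "genus \<C> >= 1"
 shows "core_like \<C>" unfolding core_like_def
proof
 fix v assume v: "v:verts \<C>"
 have "legs_at \<C> v <= card {..<nlegs \<C>}" unfolding legs_at_def by (rule card_mono) auto
 hence 1: "\<not> (valence \<C> v = 1 & wt \<C> v = 0)" using f v assms(3) by (fastforce simp: fully_pruned_def)
 have 2: "wt \<C> v >= 1" if val: "valence \<C> v = 0" using isolated_vertex[OF wf v val] assms(4) by (simp add: genus_def sub_genus_def)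
 show "0 <= omega_graph \<C> v" unfolding omega_graph_def using 1 2 by (cases "valence \<C> v = 0"; cases "valence \<C> v = 1"; cases "wt \<C> v = 0") auto
qed

text \<open>A pruning step on the source is matched by no step on the target if the pruned edge is
  contracted. Otherwise that edge is the only one at \<open>v\<close>, so \<open>v\<close> is alone
  in its fibre, and its image is again a leaf of weight 0, which is pruned too.\<close>

lemma prunes_commute:
 assumes "prunes \<G> \<C> r" and s: "specialization \<G> \<G>' iV iE" and wf: "wf_graph \<G>" and n: "nlegs \<G> <= 1"
 shows "\<exists>\<C>' r'. prunes \<G>' \<C>' r' & specialization \<C> \<C>' iV iE & (ALL x:verts \<G>. r' (iV x) = iV (r x))" using assms(1)
proof (induction rule: prunes.induct)
 case prunes_refl
 thus ?case using s by (auto intro!: exI[of _ \<G>'] exI[of _ id] prunes.prunes_refl)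
next
 case (prunes_step \<C> r v e u)
 then obtain \<C>' r' where D': "prunes \<G>' \<C>' r'" "specialization \<C> \<C>' iV iE" "ALL x:verts \<G>. r' (iV x) = iV (r x)" by blast
 note pd = prunesD[OF prunes_step.hyps(1) wf]
 have wf': "wf_graph \<C>" using pd(1) specialization_wf[OF _ wf] by blast
 have wfD': "wf_graph \<C>'" using D'(2) specialization_wf[OF _ wf'] by blast
 note one = valence_one_edge[OF wf_graphD(2)[OF wf'] prunes_step.hyps(3,6,7)]
 let ?f = "%x. if x = v then u else x"
 let ?D = "\<C>\<lparr>verts := verts \<C> - {v}, edges := edges \<C> - {e}, leg := (%i. if leg \<C> i = v then u else leg \<C> i)\<rparr>"
 have sD: "specialization \<C> ?D ?f id" by (rule prune_step_specialization[OF wf' prunes_step.hyps(2,3,4,6,7)])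
 have wfD: "wf_graph ?D" by (rule specialization_wf[OF sD wf'])
 note c = specializationD[OF D'(2)]
 note cc = contraction_contracted[OF specialization_contraction[OF D'(2)] wf_graphD(3)[OF wf']]
 show ?case
 proof (cases "e:iE`edges \<C>'")
  case False
  hence "iE`edges \<C>' <= id`edges ?D" using c(3) by auto
  from specialization_factor[OF sD D'(2) wf' this] obtain tV tE where
   t: "specialization ?D \<C>' tV tE" "ALL v:verts \<C>. tV (?f v) = iV v" "ALL e:edges \<C>'. id (tE e) = iE e" by (elim exE conjE)
  have "specialization ?D \<C>' iV iE"
  proof (rule specialization_cong[OF t(1) wfD])
   show "tV w = iV w" if "w:verts ?D" for w using bspec[OF t(2), of w] that by auto
  qed (use t(3) in auto)
  moreover have "iV u = iV v" using cc[OF prunes_step.hyps(6) False] prunes_step.hyps(7) by (auto simp: doubleton_eq_iff)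
  ultimately show ?thesis using D' by (intro exI[of _ \<C>'] exI[of _ r']) auto
 next
  case True
  then obtain e' where e': "e':edges \<C>'" "e = iE e'" by blast
  have fib: "w = v" if w: "w:verts \<C>" "iV w = iV v" for w
  proof -
   have "(v, w):(adj \<C> (edges \<C> - iE`edges \<C>'))^*" using c(5)[OF prunes_step.hyps(2) w(1)] w(2) by simp
   thus ?thesis
   proof (cases rule: converse_rtranclE)
    case (step y)
    then obtain e'' where "e'':edges \<C> - iE`edges \<C>'" "src \<C> e'' = v \<or> tgt \<C> e'' = v" by (auto simp: adj_def)
    thus ?thesis using one(2)[of e''] True by auto
   qed simp
  qed
  let ?x = "iV v"
  have x: "?x:verts \<C>'" using c(8) prunes_step.hyps(2) .
  have "{w:verts \<C>. iV w = ?x} = {v}" using fib prunes_step.hyps(2) by auto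
  hence "omega_graph \<C>' ?x = omega_graph \<C> v" using specialization_omega[OF D'(2) wf' x] by (simp add: push_forward_def)
  hence "2 * wt \<C>' ?x + valence \<C>' ?x = 1" using prunes_step.hyps(3,4) by (simp add: omega_graph_def)
  hence vx: "wt \<C>' ?x = 0" "valence \<C>' ?x = 1" by presburger+
  have ends: "{src \<C>' e', tgt \<C>' e'} = {?x, iV u}"
  proof -
   have "{src \<C>' e', tgt \<C>' e'} = iV`{src \<C> e, tgt \<C> e}" using c(4)[OF e'(1)] e'(2) by simp
   thus ?thesis unfolding prunes_step.hyps(7) by simp
  qed
  have "legs_at \<C>' ?x <= card {..<nlegs \<C>'}" unfolding legs_at_def by (rule card_mono) auto
  hence lx: "legs_at \<C>' ?x <= 1" using n pd(7) c(6) by simp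
  let ?f' = "%x. if x = ?x then iV u else x"
  let ?D' = "\<C>'\<lparr>verts := verts \<C>' - {?x}, edges := edges \<C>' - {e'}, leg := (%i. if leg \<C>' i = ?x then iV u else leg \<C>' i)\<rparr>"
  have p': "prunes \<G>' ?D' (%x. if r' x = ?x then iV u else r' x)" by (rule prunes.prunes_step[OF D'(1) x vx(2,1) lx e'(1) ends])
  have sD': "specialization \<C>' ?D' ?f' id" by (rule prune_step_specialization[OF wfD' x vx(2,1) e'(1) ends])
  have comp: "specialization \<C> ?D' (?f' \<circ> iV) (iE \<circ> id)" by (rule specialization_comp[OF D'(2) sD' wf'])
  have "(iE \<circ> id)`edges ?D' <= id`edges ?D" using c(2,3) e' by (auto simp: inj_on_def)
  from specialization_factor[OF sD comp wf' this] obtain tV tE where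
   t: "specialization ?D ?D' tV tE" "ALL v:verts \<C>. tV (?f v) = (?f' \<circ> iV) v" "ALL e:edges ?D'. id (tE e) = (iE \<circ> id) e" by (elim exE conjE)
  have "specialization ?D ?D' iV iE"
  proof (rule specialization_cong[OF t(1) wfD])
   show "tV w = iV w" if "w:verts ?D" for w using bspec[OF t(2), of w] fib[of w] that by auto
   show "tE e = iE e" if "e:edges ?D'" for e using bspec[OF t(3) that] by simp
  qed simp_all
  moreover have "(if r' (iV y) = ?x then iV u else r' (iV y)) = iV (if r y = v then u else r y)" if y: "y:verts \<G>" for y
  proof -
   have "r y:verts \<C>" using specializationD(8)[OF pd(1) y] .
   thus ?thesis using D'(3) y fib[of "r y"] by auto
  qed
  ultimately show ?thesis using p' by blast
 qed
qed

text \<open>The pruning of \<open>\<G>'\<close> obtained from \<open>prunes_commute\<close> is a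
  specialization of a core, hence core-like, hence the core of \<open>\<G>'\<close> by
  uniqueness.\<close>

lemma core_specialization:
 assumes s: "specialization \<G> \<G>' iV iE" and wf: "wf_graph \<G>" and n: "nlegs \<G> <= 1"
  and p: "prunes \<G> \<C> r" "core_like \<C>" and p': "prunes \<G>' \<C>' r'" "core_like \<C>'"
 shows "specialization \<C> \<C>' iV iE" "!!x. x:verts \<G> ==> r' (iV x) = iV (r x)"
proof -
 have wf': "wf_graph \<G>'" by (rule specialization_wf[OF s wf])
 note pd = prunesD[OF p(1) wf]
 have wfD: "wf_graph \<C>" by (rule specialization_wf[OF pd(1) wf])
 obtain \<C>1 r1 where D1: "prunes \<G>' \<C>1 r1" "specialization \<C> \<C>1 iV iE" "ALL x:verts \<G>. r1 (iV x) = iV (r x)"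
  using prunes_commute[OF p(1) s wf n] by blast
 note u = core_unique[OF D1(1) p'(1) wf' core_like_specialization[OF D1(2) wfD p(2)] p'(2)]
 note c = specializationD[OF s]
 show "r' (iV x) = iV (r x)" if "x:verts \<G>" for x using u(3)[OF c(8)[OF that]] D1(3) that by simp
 note pd1 = prunesD[OF D1(1) wf'] and pd' = prunesD[OF p'(1) wf']
 show "specialization \<C> \<C>' iV iE"
 proof (rule specialization_cong[OF D1(2) wfD refl refl u(1,2)])
  fix i assume "i < nlegs \<C>1"
  hence i: "i < nlegs \<G>'" using pd1(7) by simp
  show "leg \<C>' i = leg \<C>1 i" using specializationD(7)[OF pd1(1) i] specializationD(7)[OF pd'(1) i]
    u(3)[OF wf_graphD(5)[OF wf' i]] by simp
 qed (use pd1 pd' in auto)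
qed

subsection \<open>Chains of a refinement\<close>

lemma walk_nth:
 assumes "walk G u p v"
 shows "!!i. i < length p ==> fst (p ! i):edges G"
  and "!!i. Suc i < length p ==> dart_tgt G (p ! i) = dart_src G (p ! Suc i)"
  and "p ~= [] ==> dart_src G (p ! 0) = u"
  and "p ~= [] ==> dart_tgt G (p ! (length p - 1)) = v"
proof -
 have "(\<forall>i<length p. fst (p ! i):edges G) & (\<forall>i. Suc i < length p --> dart_tgt G (p ! i) = dart_src G (p ! Suc i)) &
  (p ~= [] --> dart_src G (p ! 0) = u & dart_tgt G (p ! (length p - 1)) = v)" using assms
 proof (induction p arbitrary: u)
  case (Cons d p)
  hence w: "fst d:edges G" "dart_src G d = u" "walk G (dart_tgt G d) p v" by auto
  note IH = Cons.IH[OF w(3)]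
  show ?case
  proof (intro conjI allI impI)
   fix i assume "i < length (d # p)"
   thus "fst ((d # p) ! i):edges G" using w(1) IH by (cases i) auto
  next
   fix i assume "Suc i < length (d # p)"
   thus "dart_tgt G ((d # p) ! i) = dart_src G ((d # p) ! Suc i)" using IH by (cases i) auto
  next
   show "dart_src G ((d # p) ! 0) = u" using w(2) by simp
   show "dart_tgt G ((d # p) ! (length (d # p) - 1)) = v" using IH w(3) by (cases p) auto
  qed
 qed simp
 thus "!!i. i < length p ==> fst (p ! i):edges G"
  and "!!i. Suc i < length p ==> dart_tgt G (p ! i) = dart_src G (p ! Suc i)"
  and "p ~= [] ==> dart_src G (p ! 0) = u"
  and "p ~= [] ==> dart_tgt G (p ! (length p - 1)) = v" by blast+
qed

definition incident :: "('v, 'e) lgraph => 'e => 'v => bool" where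
 "incident G a v \<longleftrightarrow> src G a = v \<or> tgt G a = v"

text \<open>\<open>H\<close> is the coarse graph and \<open>P e\<close> the chain of
  \<open>G\<close> that subdivides \<open>e\<close>. This covers the stable model inside the core,
  subdivisions, and the subdivided core as a refinement of the straightened subdivision.\<close>

locale chains =
 fixes H :: "('w, 'f) lgraph" and G :: "('v, 'e) lgraph" and j :: "'w => 'v" and P :: "'f => ('e \<times> bool) list"
 assumes ref: "refinement H G j P" and wfG: "wf_graph G" and wfH: "wf_graph H"
begin

abbreviation "len e \<equiv> length (P e)"

text \<open>The vertices of the chain of \<open>e\<close> have indices from \<open>0\<close> to
  \<open>len e\<close>, and those strictly in between are interior. The last one is not the source
  of a dart of the chain and needs its own case.\<close>

definition pt :: "'f => nat => 'v" where
 "pt e i = (if i < len e then dart_src G (P e ! i) else j (tgt H e))"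

definition ed :: "'f => nat => 'e" where "ed e i = fst (P e ! i)"

abbreviation "good \<equiv> j`verts H"

lemma refD: "inj_on j (verts H)" "good <= verts G"
 "!!v. v:verts H ==> wt G (j v) = wt H v" "!!v. v:verts G ==> v ~: good ==> wt G v = 0"
 "nlegs G = nlegs H" "!!i. i < nlegs H ==> leg G i = j (leg H i)"
 "!!e. e:edges H ==> P e ~= []" "!!e. e:edges H ==> walk G (j (src H e)) (P e) (j (tgt H e))"
 "bij_betw (%(e, i). fst (P e ! i)) (SIGMA e:edges H. {..<len e}) (edges G)"
 "bij_betw (%(e, i). dart_tgt G (P e ! i)) (SIGMA e:edges H. {..<len e - 1}) (verts G - good)" using ref unfolding refinement_def by blast+

lemma len_pos: "e:edges H ==> 0 < len e" using refD(7) by blast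

lemma pt_0: "e:edges H ==> pt e 0 = j (src H e)" using walk_nth(3)[OF refD(8) refD(7)] len_pos by (simp add: pt_def)

lemma pt_len: "pt e (len e) = j (tgt H e)" by (simp add: pt_def)

lemma dart_tgt_pt:
 assumes "e:edges H" "i < len e" shows "dart_tgt G (P e ! i) = pt e (Suc i)"
proof (cases "Suc i < len e")
 case True thus ?thesis using walk_nth(2)[OF refD(8)[OF assms(1)]] by (simp add: pt_def)
next
 case False
 hence "len e - 1 = i" using assms(2) by simp
 thus ?thesis using walk_nth(4)[OF refD(8)[OF assms(1)] refD(7)[OF assms(1)]] False by (simp add: pt_def)
qed

lemma dart_src_pt: "i < len e ==> dart_src G (P e ! i) = pt e i" by (simp add: pt_def)

lemma ends_ed:
 assumes "e:edges H" "i < len e"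
 shows "(src G (ed e i) = pt e i & tgt G (ed e i) = pt e (Suc i)) \<or> (src G (ed e i) = pt e (Suc i) & tgt G (ed e i) = pt e i)"
 using dart_tgt_pt[OF assms] dart_src_pt[OF assms(2)] unfolding ed_def dart_src_def dart_tgt_def by presburger

lemma incident_ed: "e:edges H ==> i < len e ==> incident G (ed e i) v \<longleftrightarrow> v = pt e i \<or> v = pt e (Suc i)"
 using ends_ed[of e i] unfolding incident_def by (elim meta_impE disjE conjE) auto

lemma ed_edge: "e:edges H ==> i < len e ==> ed e i:edges G" unfolding ed_def using walk_nth(1)[OF refD(8)] by blast

lemma ed_inj:
 assumes "e:edges H" "i < len e" "e':edges H" "i' < len e'" "ed e i = ed e' i'"
 shows "e = e'" "i = i'"
proof -
 have "(e, i) = (e', i')" by (rule inj_onD[OF bij_betw_imp_inj_on[OF refD(9)]]) (use assms in "auto simp: ed_def")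
 thus "e = e'" "i = i'" by auto
qed

lemma ed_surj:
 assumes "a:edges G" obtains e i where "e:edges H" "i < len e" "a = ed e i"
proof -
 from assms have "a:(%(e, i). fst (P e ! i))`(SIGMA e:edges H. {..<len e})" using bij_betw_imp_surj_on[OF refD(9)] by simp
 thus ?thesis using that by (auto simp: ed_def)
qed

lemma pt_bad:
 assumes "e:edges H" "0 < i" "i < len e" shows "pt e i:verts G" "pt e i ~: good"
proof -
 have "dart_tgt G (P e ! (i - 1)):verts G - good" using bij_betwE[OF refD(10)] assms by force
 thus "pt e i:verts G" "pt e i ~: good" using dart_tgt_pt[OF assms(1), of "i - 1"] assms by auto
qed

lemma pt_verts: "e:edges H ==> i <= len e ==> pt e i:verts G" using pt_bad(1)[of e i] pt_0[of e] pt_len[of e] refD(2) edge_ends[OF wfH, of e]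
 by (cases "i = 0"; cases "i = len e") auto

lemma pt_inj:
 assumes "e:edges H" "0 < i" "i < len e" "e':edges H" "0 < i'" "i' < len e'" "pt e i = pt e' i'"
 shows "e = e'" "i = i'"
proof -
 have "(e, i - 1) = (e', i' - 1)"
 proof (rule inj_onD[OF bij_betw_imp_inj_on[OF refD(10)]])
  show "(case (e, i - 1) of (e, i) => dart_tgt G (P e ! i)) = (case (e', i' - 1) of (e, i) => dart_tgt G (P e ! i))"
   using assms dart_tgt_pt[of e "i - 1"] dart_tgt_pt[of e' "i' - 1"] by simp
 qed (use assms in auto)
 thus "e = e'" "i = i'" using assms by auto
qed

lemma pt_surj:
 assumes "v:verts G" "v ~: good" obtains e i where "e:edges H" "0 < i" "i < len e" "v = pt e i"
proof -
 from assms have "v:(%(e, i). dart_tgt G (P e ! i))`(SIGMA e:edges H. {..<len e - 1})" using bij_betw_imp_surj_on[OF refD(10)] by simp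
 then obtain e i where "e:edges H" "i < len e - 1" "v = dart_tgt G (P e ! i)" by auto
 thus ?thesis using that[of e "Suc i"] dart_tgt_pt[of e i] by simp
qed

text \<open>\<open>ch\<close> and \<open>ix\<close> invert the map
  \<open>(e, i) \<mapsto> ed e i\<close>: they give the chain of an edge and its position on that
  chain.\<close>

definition ch :: "'e => 'f" where "ch a = (THE e. e:edges H & (\<exists>i<len e. a = ed e i))"

definition ix :: "'e => nat" where "ix a = (THE i. i < len (ch a) & a = ed (ch a) i)"

lemma ch_ed: assumes "e:edges H" "i < len e" shows "ch (ed e i) = e" unfolding ch_def
proof (rule the_equality)
 show "e:edges H & (\<exists>i'<len e. ed e i = ed e i')" using assms by blast
 show "e' = e" if "e':edges H & (\<exists>i'<len e'. ed e i = ed e' i')" for e' using that ed_inj(1)[OF assms] by blast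
qed

lemma ix_ed: assumes "e:edges H" "i < len e" shows "ix (ed e i) = i" unfolding ix_def ch_ed[OF assms]
proof (rule the_equality)
 show "i' = i" if "i' < len e & ed e i = ed e i'" for i' using that ed_inj(2)[OF assms assms(1)] by blast
qed (use assms in simp)

lemma ch_ix: assumes "a:edges G" shows "ch a:edges H" "ix a < len (ch a)" "ed (ch a) (ix a) = a"
proof -
 obtain e i where "e:edges H" "i < len e" "a = ed e i" using ed_surj[OF assms] .
 thus "ch a:edges H" "ix a < len (ch a)" "ed (ch a) (ix a) = a" using ch_ed ix_ed by simp_all
qed

text \<open>Interior vertices of chains are pairwise distinct and never ends of chains, so an edge
  at \<open>pt e i\<close> can only be one of its two neighbours on the chain.\<close>

lemma incident_bad:
 assumes a: "a:edges G" "incident G a (pt e i)" and e: "e:edges H" "0 < i" "i < len e"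
 shows "ch a = e" "ix a = i \<or> Suc (ix a) = i"
proof -
 note c = ch_ix[OF a(1)]
 have "pt e i = pt (ch a) (ix a) \<or> pt e i = pt (ch a) (Suc (ix a))" using a(2) incident_ed[OF c(1,2)] c(3) by metis
 hence "ch a = e & (ix a = i \<or> Suc (ix a) = i)"
 proof
  assume eq: "pt e i = pt (ch a) (ix a)"
  have "0 < ix a"
  proof (rule ccontr)
   assume "\<not> 0 < ix a"
   hence "pt e i:good" using eq pt_0[OF c(1)] edge_ends[OF wfH c(1)] by simp
   thus False using pt_bad(2)[OF e] by blast
  qed
  thus ?thesis using pt_inj[OF e c(1) _ c(2) eq] by simp
 next
  assume eq: "pt e i = pt (ch a) (Suc (ix a))"
  have "Suc (ix a) < len (ch a)"
  proof (rule ccontr)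
   assume "\<not> Suc (ix a) < len (ch a)"
   hence "Suc (ix a) = len (ch a)" using c(2) by simp
   hence "pt e i:good" using eq pt_len edge_ends[OF wfH c(1)] by simp
   thus False using pt_bad(2)[OF e] by blast
  qed
  thus ?thesis using pt_inj[OF e c(1) _ _ eq] by simp
 qed
 thus "ch a = e" "ix a = i \<or> Suc (ix a) = i" by auto
qed

lemma ch_eq_bad:
 assumes "a:edges G" "b:edges G" "incident G a v" "incident G b v" "v ~: good"
 shows "ch a = ch b"
proof -
 have "v:verts G" using assms(1,3) edge_ends[OF wfG] by (auto simp: incident_def)
 from pt_surj[OF this assms(5)] obtain e i where "e:edges H" "0 < i" "i < len e" "v = pt e i" .
 thus ?thesis using incident_bad(1)[of a e i] incident_bad(1)[of b e i] assms by simp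
qed

lemma good_end:
 assumes a: "a:edges G" "incident G a x" and x: "x:good"
 shows "x = j (src H (ch a)) \<or> x = j (tgt H (ch a))"
proof -
 note c = ch_ix[OF a(1)]
 have "x = pt (ch a) (ix a) \<or> x = pt (ch a) (Suc (ix a))" using incident_ed[OF c(1,2), of x] c(3) a(2) by simp
 then obtain k where k: "k <= len (ch a)" "x = pt (ch a) k" using c(2) by (metis Suc_leI less_imp_le)
 hence "k = 0 \<or> k = len (ch a)" using pt_bad(2)[OF c(1), of k] x by fastforce
 thus ?thesis using k(2) pt_0[OF c(1)] pt_len by auto
qed

lemma sum_chains:
 fixes h :: "'e => 'b::comm_monoid_add"
 shows "(SUM a:edges G. h a) = (SUM e:edges H. \<Sum>i<len e. h (ed e i))"
proof -
 have "(SUM a:edges G. h a) = (SUM p:(SIGMA e:edges H. {..<len e}). h ((%(e, i). fst (P e ! i)) p))" using sum.reindex_bij_betw[OF refD(9), of h] by simp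
 also have "... = (SUM e:edges H. \<Sum>i<len e. h (ed e i))" using wf_graphD(2)[OF wfH] by (subst sum.Sigma) (auto simp: ed_def split_def)
 finally show ?thesis .
qed

lemma sum_two_ends:
 fixes f :: "nat => nat"
 shows "0 < n ==> (\<Sum>i<n. f i + f (Suc i)) = f 0 + f n + 2 * (SUM i:{0<..<n}. f i)"
proof (induction n)
 case (Suc n)
 show ?case
 proof (cases "n = 0")
  case False
  hence "{0<..<Suc n} = insert n {0<..<n}" by auto
  thus ?thesis using Suc False by simp
 qed (simp add: greaterThanLessThan_empty)
qed simp

lemma valence_chains:
 "valence G x = (SUM e:edges H. of_bool (j (src H e) = x) + of_bool (j (tgt H e) = x) +
   2 * (SUM i:{0<..<len e}. of_bool (pt e i = x)))"
proof -
 have "valence G x = (SUM e:edges H. \<Sum>i<len e. of_bool (src G (ed e i) = x) + of_bool (tgt G (ed e i) = x))"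
  unfolding valence_sum[OF wf_graphD(2)[OF wfG]] by (rule sum_chains)
 also have "... = (SUM e:edges H. \<Sum>i<len e. of_bool (pt e i = x) + of_bool (pt e (Suc i) = x))"
 proof (intro sum.cong refl)
  fix e i assume "e:edges H" "i:{..<len e}"
  thus "of_bool (src G (ed e i) = x) + of_bool (tgt G (ed e i) = x) = of_bool (pt e i = x) + (of_bool (pt e (Suc i) = x) :: nat)"
   using ends_ed[of e i] by (elim meta_impE disjE conjE) (simp_all only: add.commute lessThan_iff)
 qed
 also have "... = (SUM e:edges H. of_bool (j (src H e) = x) + of_bool (j (tgt H e) = x) +
   2 * (SUM i:{0<..<len e}. of_bool (pt e i = x)))"
 proof (rule sum.cong[OF refl])
  fix e assume e: "e:edges H"
  show "(\<Sum>i<len e. of_bool (pt e i = x) + (of_bool (pt e (Suc i) = x) :: nat)) = of_bool (j (src H e) = x) + of_bool (j (tgt H e) = x) +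
   2 * (SUM i:{0<..<len e}. of_bool (pt e i = x))" unfolding sum_two_ends[OF len_pos[OF e], of "%i. of_bool (pt e i = x)"] pt_0[OF e] pt_len ..
 qed
 finally show ?thesis .
qed

lemma valence_good: assumes v: "v:verts H" shows "valence G (j v) = valence H v" unfolding valence_chains valence_sum[OF wf_graphD(2)[OF wfH]]
proof (rule sum.cong[OF refl])
 fix e assume e: "e:edges H"
 have "pt e i ~= j v" if "0 < i" "i < len e" for i using pt_bad(2)[OF e that] v by auto
 hence "(SUM i:{0<..<len e}. of_bool (pt e i = j v)) = (0::nat)" by (intro sum.neutral) auto
 moreover have "j (src H e) = j v \<longleftrightarrow> src H e = v" "j (tgt H e) = j v \<longleftrightarrow> tgt H e = v"
  using edge_ends[OF wfH e] refD(1) v by (auto dest: inj_onD)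
 ultimately show "of_bool (j (src H e) = j v) + of_bool (j (tgt H e) = j v) + 2 * (SUM i:{0<..<len e}. of_bool (pt e i = j v)) =
   (of_bool (src H e = v) + of_bool (tgt H e = v) :: nat)" by (simp only:)
qed

lemma valence_bad: assumes v: "v:verts G" "v ~: good" shows "valence G v = 2"
proof -
 obtain e i where ei: "e:edges H" "0 < i" "i < len e" "v = pt e i" using pt_surj[OF v] .
 have "valence G v = (SUM e':edges H. if e' = e then 2 else 0)" unfolding valence_chains
 proof (rule sum.cong[OF refl])
  fix e' assume e': "e':edges H"
  have "j (src H e') ~= v" "j (tgt H e') ~= v" using edge_ends[OF wfH e'] v by auto
  moreover have "(SUM i':{0<..<len e'}. of_bool (pt e' i' = v)) = (SUM i':{0<..<len e'}. if i' = i then of_bool (e' = e) else (0::nat))"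
  proof (rule sum.cong[OF refl])
   fix i' assume i': "i':{0<..<len e'}"
   have "pt e' i' = v \<longleftrightarrow> e' = e & i' = i" using pt_inj[OF e' _ _ ei(1-3), of i'] i' ei(4) by auto
   thus "of_bool (pt e' i' = v) = (if i' = i then of_bool (e' = e) else (0::nat))" by simp
  qed
  moreover have "... = of_bool (e' = e)" using ei by (auto simp: sum.delta)
  ultimately show "of_bool (j (src H e') = v) + of_bool (j (tgt H e') = v) + 2 * (SUM i:{0<..<len e'}. of_bool (pt e' i = v)) =
    (if e' = e then 2 else 0 :: nat)" by simp
 qed
 also have "... = 2" using ei(1) wf_graphD(2)[OF wfH] by (simp add: sum.delta)
 finally show ?thesis .
qed

lemma omega_good: "v:verts H ==> omega_graph G (j v) = omega_graph H v" by (simp add: omega_graph_def valence_good refD(3))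

lemma omega_bad: "v:verts G ==> v ~: good ==> omega_graph G v = 0" by (simp add: omega_graph_def valence_bad refD(4))

definition chain_edges :: "'f => 'e set" where "chain_edges e = {a:edges G. ch a = e}"

lemma chain_edges_ed: assumes e: "e:edges H" shows "chain_edges e = ed e`{..<len e}"
proof
 show "chain_edges e <= ed e`{..<len e}"
 proof
  fix a assume "a:chain_edges e"
  hence "a:edges G" "ch a = e" by (auto simp: chain_edges_def)
  thus "a:ed e`{..<len e}" using ch_ix[of a] by (intro image_eqI[of _ _ "ix a"]) auto
 qed
 show "ed e`{..<len e} <= chain_edges e" using ch_ed[OF e] ed_edge[OF e] by (auto simp: chain_edges_def)
qed

lemma sum_list_chain:
 assumes "e:edges H" shows "(\<Sum>d\<leftarrow>P e. h (fst d)) = (SUM a:chain_edges e. h a)"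
proof -
 have "inj_on (ed e) {..<len e}" using ed_inj(2)[OF assms _ assms] by (auto simp: inj_on_def)
 hence "(SUM a:chain_edges e. h a) = (\<Sum>i<len e. h (ed e i))" unfolding chain_edges_ed[OF assms] by (simp add: sum.reindex)
 thus ?thesis by (simp add: sum_list_sum_nth ed_def atLeast0LessThan)
qed

end

text \<open>A specialization of the fine graphs induces one of the coarse graphs provided that, as
  \<open>good_iff\<close> demands, a vertex downstairs is good exactly if its fibre contains a good
  vertex. In the applications this comes from quantities of constant sign that add up over
  fibres.\<close>

locale chains_specialization = C: chains H G j P + C': chains H' G' j' P'
 for H :: "('w, 'f) lgraph" and G :: "('v, 'e) lgraph" and j P
  and H' :: "('w2, 'f2) lgraph" and G' :: "('v2, 'e2) lgraph" and j' P' +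
 fixes iV :: "'v => 'v2" and iE :: "'e2 => 'e"
 assumes spec: "specialization G G' iV iE"
  and good_iff: "!!x. x:verts G' ==> x:C'.good \<longleftrightarrow> (EX v:verts H. iV (j v) = x)"
begin

lemmas con = specialization_contraction[OF spec]
lemmas conD = contractionD[OF con]

abbreviation "S \<equiv> edges G - iE`edges G'"

lemma S_collapse: "a:S ==> incident G a u ==> incident G a v ==> iV u = iV v"
 using contraction_contracted[OF con wf_graphD(3)[OF C.wfG], of a] by (auto simp: incident_def)

lemma incident_push: "a:edges G' ==> incident G (iE a) v ==> incident G' a (iV v)"
 using contraction_ends[OF con, of a] unfolding incident_def by (elim meta_impE disjE conjE) auto

lemma incident_lift: "a:edges G' ==> incident G' a x ==> \<exists>v. incident G (iE a) v & iV v = x"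
 using contraction_ends[OF con, of a] unfolding incident_def by (elim meta_impE disjE conjE) auto

lemma incident_verts: "a:edges G ==> incident G a v ==> v:verts G" using edge_ends[OF C.wfG, of a] by (auto simp: incident_def)

text \<open>The fibre over a bad vertex has no good vertex and is connected by contracted edges.
  Walking through it never changes the chain, so all edges at it lie on one chain.\<close>

lemma ch_lift_bad:
 assumes a: "a:edges G'" "b:edges G'" "incident G' a x" "incident G' b x" and x: "x:verts G'" "x ~: C'.good"
 shows "C.ch (iE a) = C.ch (iE b)"
proof -
 obtain v w where v: "incident G (iE a) v" "iV v = x" and w: "incident G (iE b) w" "iV w = x" using incident_lift a by blast
 have aE: "iE a:edges G" "iE b:edges G" using conD(9) a by auto
 have vV: "v:verts G" "w:verts G" using incident_verts aE v w by auto
 have nogood: "u ~: C.good" if "iV u = x" for u using good_iff[OF x(1)] x(2) that by blast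
 have "(v, w):(adj G S)^*" using conD(5)[OF vV] v w by simp
 hence "iV w = x & (ALL c:edges G. incident G c w --> C.ch c = C.ch (iE a))"
 proof (induction rule: rtrancl_induct)
  case base
  show ?case using C.ch_eq_bad[OF _ aE(1) _ v(1)] nogood[OF v(2)] v(2) by blast
 next
  case (step y z)
  then obtain c where c: "c:S" "incident G c y" "incident G c z" by (auto simp: adj_def incident_def)
  have z: "iV z = x" using S_collapse[OF c] step.IH by simp
  have "C.ch c = C.ch (iE a)" using step.IH c by blast
  thus ?case using C.ch_eq_bad[OF _ _ _ c(3)] c(1) nogood[OF z] z by (metis DiffD1)
 qed
 thus ?thesis using w aE by simp
qed

text \<open>By induction on the distance it is enough to treat two surviving edges with only
  contracted ones between them. These meet in one vertex downstairs, whose fibre consists of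
  interior points of the chain; so that vertex is bad, and both edges lie on one chain.\<close>

lemma ch_push:
 assumes e: "e:edges H" and q: "q < C.len e" and pq: "p < q"
  and a: "a:edges G'" "C.ed e p = iE a" and b: "b:edges G'" "C.ed e q = iE b"
 shows "C'.ch a = C'.ch b" using q pq a b
proof (induction "q - p" arbitrary: p q a b rule: less_induct)
 case less
 show ?case
 proof (cases "\<exists>m. p < m & m < q & C.ed e m:iE`edges G'")
  case True
  then obtain m c where m: "p < m" "m < q" "c:edges G'" "C.ed e m = iE c" by blast
  have "C'.ch a = C'.ch c" by (rule less.hyps[of m p]) (use m less.prems in auto)
  moreover have "C'.ch c = C'.ch b" by (rule less.hyps[of q m]) (use m less.prems in auto)
  ultimately show ?thesis by simp
 next
  case False
  have inS: "C.ed e m:S" if "p < m" "m < q" for m using False that C.ed_edge[OF e, of m] less.prems by auto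
  have same: "iV (C.pt e k) = iV (C.pt e (Suc p))" if "Suc p <= k" "k <= q" for k using that
  proof (induction k rule: dec_induct)
   case (step k)
   have "iV (C.pt e k) = iV (C.pt e (Suc k))" using S_collapse[OF inS[of k], of "C.pt e k" "C.pt e (Suc k)"] C.incident_ed[OF e, of k] step less.prems by simp
   thus ?case using step by simp
  qed simp
  let ?B = "C.pt e`{p<..q}"
  have bad: "C.pt e k:verts G" "C.pt e k ~: C.good" if "k:{p<..q}" for k using C.pt_bad[OF e, of k] that less.prems by auto
  have closed: "u:?B" if "(C.pt e (Suc p), u):(adj G S)^*" for u using that
  proof (induction rule: rtrancl_induct)
   case base show ?case using less.prems by auto
  next
   case (step y z)
   then obtain c where c: "c:S" "incident G c y" "incident G c z" by (auto simp: adj_def incident_def)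
   obtain k where k: "k:{p<..q}" "y = C.pt e k" using step.IH by blast
   have kk: "0 < k" "k < C.len e" using k less.prems by auto
   have cE: "c:edges G" using c by blast
   note ib = C.incident_bad[OF cE c(2)[unfolded k(2)] e kk]
   have ce: "C.ed e (C.ix c) = c" "C.ix c < C.len e" using C.ch_ix[OF cE] ib(1) by auto
   have "C.ix c ~= p" "C.ix c ~= q" using ce(1) c(1) less.prems by auto
   hence "C.ix c:{p<..q}" "Suc (C.ix c):{p<..q}" using ib(2) k(1) by auto
   moreover have "z = C.pt e (C.ix c) \<or> z = C.pt e (Suc (C.ix c))" using C.incident_ed[OF e ce(2), of z] ce(1) c(3) by simp
   ultimately show ?case by blast
  qed
  let ?x = "iV (C.pt e (Suc p))"
  have pV: "C.pt e (Suc p):verts G" using bad(1) less.prems by simp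
  have x: "?x:verts G'" using conD(8)[OF pV] .
  have nx: "?x ~: C'.good"
  proof
   assume "?x:C'.good"
   then obtain v where v: "v:verts H" "iV (j v) = ?x" using good_iff[OF x] by blast
   have "j v:verts G" using v C.refD(2) by blast
   hence "(C.pt e (Suc p), j v):(adj G S)^*" using conD(5)[OF pV, of "j v"] v by simp
   from closed[OF this] obtain k where "k:{p<..q}" "j v = C.pt e k" by blast
   hence "C.pt e k:C.good" using v(1) by (metis imageI)
   thus False using bad(2) \<open>k:{p<..q}\<close> by blast
  qed
  have "incident G' a ?x" by (rule incident_push) (use less.prems C.incident_ed[OF e, of p] in auto)
  moreover have "incident G' b ?x" using incident_push[of b "C.pt e q"] same[of q] less.prems C.incident_ed[OF e, of q] by simp
  ultimately show ?thesis using C'.ch_eq_bad[OF less.prems(3,5)] nx by blast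
 qed
qed

text \<open>By \<open>ch_lift\<close> every edge of the chain of \<open>e\<close> gives the same
  value; the first one is at hand because chains are not empty.\<close>

definition sE :: "'f2 => 'f" where "sE e = C.ch (iE (C'.ed e 0))"

lemma ch_lift:
 assumes a: "a:edges G'" shows "C.ch (iE a) = sE (C'.ch a)"
proof -
 note c = C'.ch_ix[OF a]
 have "C.ch (iE (C'.ed (C'.ch a) i)) = sE (C'.ch a)" if "i < C'.len (C'.ch a)" for i using that
 proof (induction i)
  case (Suc i)
  have i: "i < C'.len (C'.ch a)" using Suc by simp
  have "C.ch (iE (C'.ed (C'.ch a) (Suc i))) = C.ch (iE (C'.ed (C'.ch a) i))"
  proof (rule ch_lift_bad)
   show "incident G' (C'.ed (C'.ch a) (Suc i)) (C'.pt (C'.ch a) (Suc i))" using C'.incident_ed[OF c(1) Suc.prems] by simp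
   show "incident G' (C'.ed (C'.ch a) i) (C'.pt (C'.ch a) (Suc i))" using C'.incident_ed[OF c(1) i] by simp
  qed (use C'.pt_bad[OF c(1) _ Suc.prems] C'.ed_edge[OF c(1)] Suc.prems in auto)
  thus ?case using Suc by simp
 qed (simp add: sE_def)
 from this[OF c(2)] show ?thesis unfolding c(3) .
qed

lemma sE_edge: "e:edges H' ==> sE e:edges H" unfolding sE_def using C.ch_ix(1) conD(9) C'.ed_edge C'.len_pos by blast

lemma ch_push':
 assumes a: "a:edges G'" "b:edges G'" "C.ch (iE a) = C.ch (iE b)" shows "C'.ch a = C'.ch b"
proof -
 have E: "iE a:edges G" "iE b:edges G" using a conD(9) by auto
 note ca = C.ch_ix[OF E(1)] and cb = C.ch_ix[OF E(2), folded a(3)]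
 show ?thesis
 proof (cases "C.ix (iE a)" "C.ix (iE b)" rule: linorder_cases)
  case less show ?thesis by (rule ch_push[OF ca(1) cb(2) less a(1) ca(3) a(2) cb(3)])
 next
  case equal
  have "iE a = iE b" using ca(3) unfolding equal cb(3) by (rule sym)
  hence "a = b" by (rule inj_onD[OF conD(2) _ a(1,2)])
  thus ?thesis by simp
 next
  case greater show ?thesis by (rule ch_push[OF ca(1) ca(2) greater a(2) cb(3) a(1) ca(3), symmetric])
 qed
qed

lemma sE_inj: "inj_on sE (edges H')"
proof (rule inj_onI)
 fix e f assume ef: "e:edges H'" "f:edges H'" "sE e = sE f"
 have "C'.ch (C'.ed e 0) = C'.ch (C'.ed f 0)" by (rule ch_push') (use ef C'.ed_edge C'.len_pos in "auto simp: sE_def")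
 thus "e = f" using C'.ch_ed C'.len_pos ef by simp
qed

lemma chain_edges_lift:
 assumes e: "e:edges H'"
 shows "iE`C'.chain_edges e = C.chain_edges (sE e) \<inter> iE`edges G'"
proof -
 have "C'.ch a = e" if "a:edges G'" "C.ch (iE a) = sE e" for a using ch_lift[OF that(1)] that inj_onD[OF sE_inj] e C'.ch_ix(1)[OF that(1)] by metis
 thus ?thesis unfolding C.chain_edges_def C'.chain_edges_def using conD(9) ch_lift by auto
qed

lemma contracted_chain:
 assumes e: "e:edges H" "e ~: sE`edges H'" and i: "i < C.len e" shows "C.ed e i:S"
proof (rule ccontr)
 assume "C.ed e i ~: S"
 then obtain a where a: "a:edges G'" "C.ed e i = iE a" using C.ed_edge[OF e(1) i] by blast
 hence "e = sE (C'.ch a)" using ch_lift[OF a(1)] C.ch_ed[OF e(1) i] by simp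
 thus False using e(2) C'.ch_ix(1)[OF a(1)] by blast
qed

lemma uncontracted_chain:
 assumes e: "e:edges H'" obtains i where "i < C.len (sE e)" "C.ed (sE e) i ~: S"
proof -
 have a: "C'.ed e 0:edges G'" using C'.ed_edge[OF e C'.len_pos[OF e]] .
 note c = C.ch_ix[OF conD(9)[OF a], folded sE_def]
 show ?thesis using that[OF c(2)] c(3) a by simp
qed

definition sV :: "'w => 'w2" where "sV v = inv_into (verts H') j' (iV (j v))"

lemma sV: assumes "v:verts H" shows "sV v:verts H'" "j' (sV v) = iV (j v)"
proof -
 have "iV (j v):verts G'" using conD(8) C.refD(2) assms by blast
 hence "iV (j v):C'.good" using good_iff assms by blast
 thus "sV v:verts H'" "j' (sV v) = iV (j v)" unfolding sV_def by (auto intro: inv_into_into f_inv_into_f)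
qed

lemma sV_eq_iff: "v:verts H ==> x:verts H' ==> sV v = x \<longleftrightarrow> iV (j v) = j' x" using sV inj_onD[OF C'.refD(1)] by metis

lemma prefix_collapse:
 assumes e: "e:edges H" and k: "k <= C.len e" "!!i. i < k ==> C.ed e i:S"
 shows "iV (C.pt e k) = iV (C.pt e 0)" using k
proof (induction k)
 case (Suc k)
 have "iV (C.pt e (Suc k)) = iV (C.pt e k)" using S_collapse[OF Suc.prems(2)[of k], of "C.pt e (Suc k)" "C.pt e k"] C.incident_ed[OF e, of k] Suc.prems by simp
 thus ?case using Suc by simp
qed simp

lemma suffix_collapse:
 assumes e: "e:edges H" and k: "k <= C.len e" "!!i. k <= i ==> i < C.len e ==> C.ed e i:S"
 shows "iV (C.pt e k) = iV (C.pt e (C.len e))" using k(1)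
proof (induction k rule: inc_induct)
 case (step i)
 have "iV (C.pt e (Suc i)) = iV (C.pt e i)" using S_collapse[OF k(2)[of i], of "C.pt e (Suc i)" "C.pt e i"] C.incident_ed[OF e, of i] step by simp
 thus ?case using step by simp
qed simp

text \<open>The parts of the chain before the first and after the last surviving edge collapse, so
  the ends of the coarse edge map to good ends of surviving edges, that is, to ends of
  \<open>e\<close>. Conversely, an end of \<open>e\<close> is reached from a lifted edge through a
  fibre, and the first good vertex on the way is an end of the same chain.\<close>

lemma sE_ends:
 assumes e: "e:edges H'" shows "{sV (src H (sE e)), sV (tgt H (sE e))} = {src H' e, tgt H' e}"
proof -
 let ?e = "sE e"
 note eH = sE_edge[OF e]
 note V = edge_ends[OF C.wfH eH] and V' = edge_ends[OF C'.wfH e]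
 obtain i0 where i0: "i0 < C.len ?e" "C.ed ?e i0 ~: S" using uncontracted_chain[OF e] .
 let ?N = "{i. i < C.len ?e & C.ed ?e i ~: S}"
 have N: "finite ?N" "i0:?N" using i0 by auto
 define p where "p = Min ?N" define q where "q = Max ?N"
 have "p:?N" "q:?N" unfolding p_def q_def using Min_in[OF N(1)] Max_in[OF N(1)] N(2) by blast+
 hence p: "p < C.len ?e" "C.ed ?e p ~: S" and q: "q < C.len ?e" "C.ed ?e q ~: S" by auto
 have preS: "C.ed ?e i:S" if "i < p" for i using Min_le[OF N(1), of i] that p(1) unfolding p_def[symmetric] by (force simp: not_le)
 have sufS: "C.ed ?e i:S" if "Suc q <= i" "i < C.len ?e" for i using Max_ge[OF N(1), of i] that unfolding q_def[symmetric] by force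
 have good: "iV (j v):C'.good" if "v:verts H" for v using sV[OF that] by (metis imageI)
 have end_good: "j' (sV v):{j' (src H' e), j' (tgt H' e)}"
  if v: "v:verts H" and i: "i < C.len ?e" "C.ed ?e i ~: S" and x: "x = C.pt ?e i \<or> x = C.pt ?e (Suc i)" "iV x = iV (j v)" for v i x
 proof -
  obtain a where a: "a:edges G'" "C.ed ?e i = iE a" using i C.ed_edge[OF eH i(1)] by blast
  have "incident G' a (iV x)" by (rule incident_push) (use a x(1) C.incident_ed[OF eH i(1)] in auto)
  hence inc: "incident G' a (j' (sV v))" using x(2) sV(2)[OF v] by simp
  have "sE (C'.ch a) = sE e" using ch_lift[OF a(1)] C.ch_ed[OF eH i(1)] a(2) by simp
  hence "C'.ch a = e" using inj_onD[OF sE_inj _ C'.ch_ix(1)[OF a(1)] e] by blast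
  thus ?thesis using C'.good_end[OF a(1) inc] sV(1)[OF v] by auto
 qed
 have "j' (sV (src H ?e)):{j' (src H' e), j' (tgt H' e)}" by (rule end_good[OF V(1) p, of "C.pt ?e p"]) (use prefix_collapse[OF eH, of p] p(1) preS C.pt_0[OF eH] in auto)
 moreover have "j' (sV (tgt H ?e)):{j' (src H' e), j' (tgt H' e)}"
  by (rule end_good[OF V(2) q, of "C.pt ?e (Suc q)"]) (use suffix_collapse[OF eH, of "Suc q"] q(1) sufS C.pt_len[of ?e] in auto)
 ultimately have 1: "{sV (src H ?e), sV (tgt H ?e)} <= {src H' e, tgt H' e}" using inj_onD[OF C'.refD(1)] sV(1) V V' by blast
 \<comment> \<open>Up to its first good vertex a path of contracted edges cannot leave the chain on
   which it starts.\<close>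
 have reach: "EX w:C.good. (v, w):(adj G S)^* & (EX c:edges G. C.ch c = ?e & incident G c w)"
  if "(v, u):(adj G S)^*" "u:C.good" "EX c:edges G. C.ch c = ?e & incident G c v" for u v using that
 proof (induction rule: converse_rtrancl_induct)
  case base thus ?case by blast
 next
  case (step y z)
  show ?case
  proof (cases "y:C.good")
   case True thus ?thesis using step.prems by blast
  next
   case False
   from step(1) obtain c where c: "c:S" "incident G c y" "incident G c z" by (auto simp: adj_def incident_def)
   obtain c0 where c0: "c0:edges G" "C.ch c0 = ?e" "incident G c0 y" using step.prems by blast
   have "C.ch c = ?e" using C.ch_eq_bad[OF _ c0(1) c(2) c0(3) False] c(1) c0(2) by simp
   then obtain w where "w:C.good" "(z, w):(adj G S)^*" "EX c:edges G. C.ch c = ?e & incident G c w" using step.IH step.prems c by blast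
   thus ?thesis using step(1) by (meson converse_rtrancl_into_rtrancl)
  qed
 qed
 have 2: "x:{sV (src H ?e), sV (tgt H ?e)}" if x: "x = src H' e \<or> x = tgt H' e" for x
 proof -
  have xV: "x:verts H'" using x V' by blast
  have "\<exists>a. a:edges G' & C'.ch a = e & incident G' a (j' x)"
  proof (cases "x = src H' e")
   case True
   have "incident G' (C'.ed e 0) (j' x)" unfolding C'.incident_ed[OF e C'.len_pos[OF e]] C'.pt_0[OF e] True by simp
   thus ?thesis using C'.ed_edge[OF e C'.len_pos[OF e]] C'.ch_ed[OF e C'.len_pos[OF e]] by blast
  next
   case False
   hence xt: "x = tgt H' e" using x by blast
   have l: "C'.len e - 1 < C'.len e" "Suc (C'.len e - 1) = C'.len e" using C'.len_pos[OF e] by auto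
   have "incident G' (C'.ed e (C'.len e - 1)) (j' x)" unfolding C'.incident_ed[OF e l(1)] l(2) C'.pt_len xt by simp
   thus ?thesis using C'.ed_edge[OF e l(1)] C'.ch_ed[OF e l(1)] by blast
  qed
  then obtain a where a: "a:edges G'" "C'.ch a = e" "incident G' a (j' x)" by blast
  obtain v where v: "incident G (iE a) v" "iV v = j' x" using incident_lift[OF a(1,3)] by blast
  have vV: "v:verts G" using incident_verts[OF conD(9)[OF a(1)] v(1)] .
  have "j' x:verts G'" using xV C'.refD(2) by blast
  then obtain u where u: "u:verts H" "iV (j u) = j' x" using good_iff xV by blast
  have "(v, j u):(adj G S)^*" using conD(5)[OF vV, of "j u"] u v C.refD(2) by auto
  from reach[OF this] obtain w c where w: "w:C.good" "(v, w):(adj G S)^*" "c:edges G" "C.ch c = ?e" "incident G c w"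
   using u(1) v(1) conD(9)[OF a(1)] ch_lift[OF a(1)] a(2) by blast
  have wV: "w:verts G" using w(1) C.refD(2) by blast
  have wx: "iV w = j' x" using conD(5)[OF vV wV] w(2) v(2) by simp
  have "w = j (src H ?e) \<or> w = j (tgt H ?e)" using C.good_end[OF w(3,5,1)] unfolding w(4) .
  thus ?thesis using wx sV_eq_iff[OF V(1) xV] sV_eq_iff[OF V(2) xV] by auto
 qed
 show ?thesis using 1 2 by blast
qed

abbreviation "T \<equiv> edges H - sE`edges H'"

lemma sV_fibre:
 assumes uv: "u:verts H" "v:verts H"
 shows "sV u = sV v \<longleftrightarrow> (u, v):(adj H T)^*"
proof
 assume "(u, v):(adj H T)^*"
 thus "sV u = sV v"
 proof (rule adj_rtrancl_invariant)
  fix e assume e: "e:T"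
  hence "iV (C.pt e (C.len e)) = iV (C.pt e 0)" using contracted_chain by (intro prefix_collapse) auto
  thus "sV (src H e) = sV (tgt H e)" using C.pt_0 C.pt_len e unfolding sV_def by simp
 qed
next
 assume eq: "sV u = sV v"
 have jV: "j u:verts G" "j v:verts G" using uv C.refD(2) by auto
 have "iV (j u) = iV (j v)" using eq sV uv by metis
 hence p: "(j u, j v):(adj G S)^*" using conD(5)[OF jV] by simp
 \<comment> \<open>\<open>R\<close> retracts \<open>G\<close> onto \<open>H\<close>: an interior
   vertex goes to the source of its coarse edge if everything before it on the chain is contracted,
   and to the target otherwise. A contracted edge does not change this choice, so along it
   \<open>R\<close> moves only through contracted coarse edges.\<close>
 define pre where "pre e i \<longleftrightarrow> (\<forall>k<i. C.ed e k:S)" for e i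
 define base where "base e i = (if pre e i then src H e else tgt H e)" for e i
 define R where "R x = (if x:C.good then inv_into (verts H) j x
  else (let (e, i) = (SOME (e, i). e:edges H & 0 < i & i < C.len e & x = C.pt e i) in base e i))" for x
 have Rj: "R (j w) = w" if "w:verts H" for w using that C.refD(1) by (simp add: R_def)
 have Rb: "R (C.pt e i) = base e i" if ei: "e:edges H" "0 < i" "i < C.len e" for e i
 proof -
  have "(SOME (e', i'). e':edges H & 0 < i' & i' < C.len e' & C.pt e i = C.pt e' i') = (e, i)"
  proof (rule some_equality)
   fix ei' assume "case ei' of (e', i') => e':edges H & 0 < i' & i' < C.len e' & C.pt e i = C.pt e' i'"
   thus "ei' = (e, i)" using C.pt_inj[OF ei, of "fst ei'" "snd ei'"] by (cases ei') simp
  qed (use ei in simp)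
  thus ?thesis using C.pt_bad(2)[OF ei] by (simp add: R_def)
 qed
 have Rpt: "(R (C.pt e i), base e i):(adj H T)^*" if e: "e:edges H" "i <= C.len e" for e i
 proof -
  note V = edge_ends[OF C.wfH e(1)]
  consider "i = 0" | "0 < i" "i < C.len e" | "i = C.len e" using e(2) by linarith
  thus ?thesis
  proof cases
   case 1
   thus ?thesis using C.pt_0[OF e(1)] Rj[OF V(1)] by (simp add: base_def pre_def)
  next
   case 2 thus ?thesis using Rb[OF e(1)] by simp
  next
   case 3
   have R: "R (C.pt e i) = tgt H e" using C.pt_len[of e] Rj[OF V(2)] 3 by simp
   show ?thesis
   proof (cases "pre e i")
    case True
    have "e ~: sE`edges H'"
    proof
     assume "e:sE`edges H'"
     thus False using uncontracted_chain True 3 unfolding pre_def by blast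
    qed
    hence "e:T" using e(1) by blast
    thus ?thesis using R True adj_edge(2)[of e T H] by (simp add: base_def)
   next
    case False thus ?thesis using R by (simp add: base_def)
   qed
  qed
 qed
 have "(R (j u), R (j v)):(adj H T)^*"
 proof (rule adj_rtrancl_map[OF p])
  fix a assume a: "a:S"
  hence aE: "a:edges G" by blast
  note c = C.ch_ix[OF aE]
  let ?e = "C.ch a" and ?i = "C.ix a"
  have "base ?e ?i = base ?e (Suc ?i)" using a c(3) unfolding base_def pre_def less_Suc_eq by (metis DiffD2)
  have "(R (C.pt ?e ?i), R (C.pt ?e (Suc ?i))):(adj H T)^*"
   using rtrancl_trans[OF Rpt[OF c(1) less_imp_le[OF c(2)]] adj_rtrancl_sym[OF Rpt[OF c(1) Suc_leI[OF c(2)], folded \<open>base ?e ?i = base ?e (Suc ?i)\<close>]]] .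
  thus "(R (src G a), R (tgt G a)):(adj H T)^*" using C.ends_ed[OF c(1,2), unfolded c(3)] adj_rtrancl_sym by metis
 qed
 thus "(u, v):(adj H T)^*" using Rj uv by simp
qed

lemma sV_surj: "sV`verts H = verts H'"
proof
 show "sV`verts H <= verts H'" using sV(1) by blast
 show "verts H' <= sV`verts H"
 proof
  fix x assume x: "x:verts H'"
  hence "j' x:verts G'" using C'.refD(2) by blast
  then obtain v where "v:verts H" "iV (j v) = j' x" using good_iff x by blast
  thus "x:sV`verts H" using sV_eq_iff x by blast
 qed
qed

lemma push_forward_good:
 fixes h :: "'v => 'b::comm_monoid_add"
 assumes x: "x:verts H'" and h: "!!v. v:verts G ==> v ~: C.good ==> h v = 0"
 shows "push_forward (verts G) iV h (j' x) = push_forward (verts H) sV (%v. h (j v)) x"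
proof -
 have "push_forward (verts G) iV h (j' x) = (SUM v:{v:C.good. iV v = j' x}. h v)" unfolding push_forward_def
  by (rule sum.mono_neutral_right) (use wf_graphD(1)[OF C.wfG] C.refD(2) h in auto)
 also have "{v:C.good. iV v = j' x} = j`{v:verts H. sV v = x}" using sV_eq_iff x by auto
 also have "(SUM v:j`{v:verts H. sV v = x}. h v) = (SUM v:{v:verts H. sV v = x}. h (j v))" using C.refD(1) by (subst sum.reindex) (auto intro: inj_on_subset)
 finally show ?thesis by (simp add: push_forward_def)
qed

text \<open>Interior vertices have \<open>omega_graph\<close> 0, so the additivity that replaces the
  weight condition can be checked on good vertices alone.\<close>

theorem chain_specialization: "specialization H H' sV sE"
proof (rule specializationI[OF C.wfH])
 have "nlegs H' = nlegs H" using C.refD(5) C'.refD(5) conD(6) by simp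
 moreover have "leg H' i = sV (leg H i)" if i: "i < nlegs H" for i
 proof -
  have i': "i < nlegs H'" "i < nlegs G" using i calculation C.refD(5) by auto
  have V: "leg H i:verts H" "leg H' i:verts H'" using wf_graphD(5)[OF C.wfH i] wf_graphD(5)[OF C'.wfH i'(1)] .
  have "iV (j (leg H i)) = j' (leg H' i)" using conD(7)[OF i'(2)] C.refD(6)[OF i] C'.refD(6)[OF i'(1)] by simp
  thus ?thesis using sV_eq_iff[OF V] by simp
 qed
 ultimately show "contraction H H' sV sE" unfolding contraction_def using sV_surj sE_inj sE_edge sE_ends sV_fibre by blast
 fix x assume x: "x:verts H'"
 have jx: "j' x:verts G'" using x C'.refD(2) by blast
 have "omega_graph H' x = push_forward (verts G) iV (omega_graph G) (j' x)" using C'.omega_good[OF x] specialization_omega[OF spec C.wfG jx] by simp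
 also have "... = push_forward (verts H) sV (%v. omega_graph G (j v)) x" by (rule push_forward_good[OF x]) (rule C.omega_bad)
 also have "... = push_forward (verts H) sV (omega_graph H) x" by (rule push_forward_cong) (auto simp: C.omega_good)
 finally show "omega_graph H' x = push_forward (verts H) sV (omega_graph H) x" .
qed

text \<open>Contracted edges contribute length zero, so a chain keeps the total length of its
  surviving edges, and a chain without any gets length zero.\<close>

lemma path_lengths_extend_zero:
 "path_lengths H P (extend_zero (edges G') iE z) = extend_zero (edges H') sE (path_lengths H' P' z)"
proof (rule extend_zero_eqI[OF sE_inj])
 let ?z = "extend_zero (edges G') iE z"
 have zero: "?z a = 0" if "a:S" for a using that by (intro push_forward_outside) auto
 fix e assume e: "e:edges H'"
 have fin: "finite (C.chain_edges (sE e))" unfolding C.chain_edges_def using wf_graphD(2)[OF C.wfG] by auto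
 have "path_lengths H P ?z (sE e) = (SUM a:C.chain_edges (sE e). ?z a)" using sE_edge[OF e] C.sum_list_chain[OF sE_edge[OF e], of ?z] by (simp add: path_lengths_def)
 also have "... = (SUM a:iE`C'.chain_edges e. ?z a)"
  unfolding chain_edges_lift[OF e] by (rule sum.mono_neutral_right[OF fin]) (use zero in "auto simp: C.chain_edges_def")
 also have "... = (SUM a:C'.chain_edges e. z a)"
  using conD(2) by (subst sum.reindex) (auto simp: C'.chain_edges_def push_forward_inj intro: inj_on_subset intro!: sum.cong)
 finally show "path_lengths H P ?z (sE e) = path_lengths H' P' z e" using C'.sum_list_chain[OF e, of z] e by (simp add: path_lengths_def)
next
 let ?z = "extend_zero (edges G') iE z"
 fix e assume e: "e ~: sE`edges H'"
 show "path_lengths H P ?z e = 0"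
 proof (cases "e:edges H")
  case True
  have "?z (C.ed e i) = 0" if "i < C.len e" for i using contracted_chain[OF True e that] by (intro push_forward_outside) auto
  thus ?thesis using True by (simp add: path_lengths_def sum_list_sum_nth C.ed_def)
 qed (simp add: path_lengths_def)
qed

end

subsection \<open>Composition of refinements\<close>

text \<open>As multiset equations, the conditions that each edge and each new vertex occur exactly
  once become additive, which turns composition of refinements into a computation. In the converse
  direction equal sizes turn surjectivity into bijectivity.\<close>

lemma bij_betw_iff_mset:
 assumes A: "finite A" and B: "finite B"
 shows "bij_betw (%(e, i). f (P e ! i)) (SIGMA e:A. {..<length (P e)}) B \<longleftrightarrow>
  (SUM e:A. mset (map f (P e))) = mset_set B"
proof -
 let ?F = "%(e, i). f (P e ! i)" and ?S = "SIGMA e:A. {..<length (P e)}"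
 have fS: "finite ?S" using A by auto
 have "(SUM e:A. mset (map f (P e))) = image_mset ?F (mset_set ?S)" using A
 proof (induction A rule: finite_induct)
  case (insert x A)
  have eq: "(SIGMA e:insert x A. {..<length (P e)}) = Pair x`{..<length (P x)} \<union> (SIGMA e:A. {..<length (P e)})" by auto
  have m: "image_mset ?F (mset_set (Pair x`{..<length (P x)})) = mset (map f (P x))"
  proof -
   have "mset_set (Pair x`{..<length (P x)}) = image_mset (Pair x) (mset_set {..<length (P x)})" by (rule image_mset_mset_set[symmetric]) (auto simp: inj_on_def)
   hence "image_mset ?F (mset_set (Pair x`{..<length (P x)})) = image_mset (%i. f (P x ! i)) (mset_set {..<length (P x)})" by (simp add: multiset.map_comp comp_def)
   also have "... = mset (map (%i. f (P x ! i)) [0..<length (P x)])" by (simp add: atLeast0LessThan)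
   also have "map (%i. f (P x ! i)) [0..<length (P x)] = map f (P x)" by (rule nth_equalityI) auto
   finally show ?thesis .
  qed
  have "mset_set (SIGMA e:insert x A. {..<length (P e)}) = mset_set (Pair x`{..<length (P x)}) + mset_set (SIGMA e:A. {..<length (P e)})"
   unfolding eq by (rule mset_set_Union) (use insert in auto)
  thus ?case using insert m by simp
 qed simp
 moreover have "image_mset ?F (mset_set ?S) = mset_set B \<longleftrightarrow> bij_betw ?F ?S B"
 proof
  assume "bij_betw ?F ?S B"
  thus "image_mset ?F (mset_set ?S) = mset_set B" using image_mset_mset_set[of ?F ?S] by (auto simp: bij_betw_def)
 next
  assume m: "image_mset ?F (mset_set ?S) = mset_set B"
  have im: "?F`?S = B" using arg_cong[OF m, of set_mset] fS B by simp
  have "card ?S = card B" using arg_cong[OF m, of size] by simp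
  hence "inj_on ?F ?S" using im fS by (intro eq_card_imp_inj_on) auto
  thus "bij_betw ?F ?S B" using im by (simp add: bij_betw_def)
 qed
 ultimately show ?thesis by simp
qed

abbreviation interior :: "('v, 'e) lgraph => ('e \<times> bool) list => 'v multiset" where
 "interior G p \<equiv> mset (map (dart_tgt G) (butlast p))"

lemma refinement_iff_mset:
 assumes fin: "finite (edges H)" "finite (edges G)" "finite (verts G)"
 shows "refinement H G j P \<longleftrightarrow>
   inj_on j (verts H) & j`verts H <= verts G &
   (ALL e:edges H. P e ~= [] & walk G (j (src H e)) (P e) (j (tgt H e))) &
   (SUM e:edges H. mset (map fst (P e))) = mset_set (edges G) &
   (SUM e:edges H. interior G (P e)) = mset_set (verts G - j`verts H) &
   (ALL v:verts H. wt G (j v) = wt H v) & (ALL v:verts G - j`verts H. wt G v = 0) &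
   nlegs G = nlegs H & (\<forall>i<nlegs H. leg G i = j (leg H i))"
proof -
 have "bij_betw (%(e, i). dart_tgt G (P e ! i)) (SIGMA e:edges H. {..<length (P e) - 1}) (verts G - j`verts H) \<longleftrightarrow>
  bij_betw (%(e, i). dart_tgt G (butlast (P e) ! i)) (SIGMA e:edges H. {..<length (butlast (P e))}) (verts G - j`verts H)"
  by (simp, rule bij_betw_cong) (auto simp: nth_butlast)
 also have "... \<longleftrightarrow> (SUM e:edges H. interior G (P e)) = mset_set (verts G - j`verts H)" by (rule bij_betw_iff_mset) (use fin in auto)
 finally have 2: "bij_betw (%(e, i). dart_tgt G (P e ! i)) (SIGMA e:edges H. {..<length (P e) - 1}) (verts G - j`verts H) \<longleftrightarrow>
  (SUM e:edges H. interior G (P e)) = mset_set (verts G - j`verts H)" .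
 show ?thesis unfolding refinement_def 2 bij_betw_iff_mset[OF fin(1,2)] by (rule refl)
qed

definition expand :: "('e => ('a \<times> bool) list) => ('e \<times> bool) list => ('a \<times> bool) list" where
 "expand R p = concat (map (%(a, b). if b then R a else rev_path (R a)) p)"

lemma expand_simps [simp]:
 "expand R [] = []" "expand R ((a, b) # p) = (if b then R a else rev_path (R a)) @ expand R p"
 "expand R (p @ q) = expand R p @ expand R q" by (simp_all add: expand_def)

lemma map_fst_rev_path: "map fst (rev_path p) = rev (map fst p)" by (simp add: rev_path_def rev_map[symmetric] comp_def split_def)

lemma mset_fst_rev_path [simp]: "image_mset fst (mset (rev_path p)) = image_mset fst (mset p)" using arg_cong[OF map_fst_rev_path[of p], of mset] by simp

lemma tl_walk: "walk G u p v ==> tl (map (dart_src G) p) = map (dart_tgt G) (butlast p)"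
proof (induction p arbitrary: u)
 case (Cons d p)
 thus ?case by (cases p) auto
qed simp

lemma interior_rev_path:
 assumes "walk G u p v" shows "interior G (rev_path p) = interior G p"
proof -
 have "map (dart_tgt G) (rev_path p) = rev (map (dart_src G) p)" by (simp add: rev_path_def rev_map[symmetric] comp_def split_def)
 hence "map (dart_tgt G) (butlast (rev_path p)) = rev (tl (map (dart_src G) p))" by (simp only: map_butlast butlast_rev)
 thus ?thesis unfolding tl_walk[OF assms] by simp
qed

lemma rev_path_Nil [simp]: "rev_path p = [] \<longleftrightarrow> p = []" by (simp add: rev_path_def)

context
 fixes G' :: "('w, 'f) lgraph" and G :: "('v, 'e) lgraph" and k R
 assumes ref: "refinement G' G k R" and wfG: "wf_graph G" and wfG': "wf_graph G'"
begin

lemma refinement_dart: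
 assumes "a:edges G'"
 shows "(if b then R a else rev_path (R a)) ~= []"
  "walk G (k (dart_src G' (a, b))) (if b then R a else rev_path (R a)) (k (dart_tgt G' (a, b)))"
  "interior G (if b then R a else rev_path (R a)) = interior G (R a)"
proof -
 have w: "R a ~= []" "walk G (k (src G' a)) (R a) (k (tgt G' a))" using ref assms by (auto simp: refinement_def)
 show "(if b then R a else rev_path (R a)) ~= []" using w by simp
 show "walk G (k (dart_src G' (a, b))) (if b then R a else rev_path (R a)) (k (dart_tgt G' (a, b)))"
  using w walk_rev_path[OF wf_graphD(3)[OF wfG] w(2)] by (simp add: dart_src_def dart_tgt_def)
 show "interior G (if b then R a else rev_path (R a)) = interior G (R a)" using interior_rev_path[OF w(2)] by simp
qed

lemma walk_expand:
 assumes "walk G' u p v" shows "walk G (k u) (expand R p) (k v)" using assms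
proof (induction p arbitrary: u)
 case Nil
 thus ?case using ref by (auto simp: refinement_def)
next
 case (Cons d p)
 obtain a b where d: "d = (a, b)" by force
 have a: "a:edges G'" "dart_src G' (a, b) = u" "walk G' (dart_tgt G' (a, b)) p v" using Cons.prems d by auto
 show ?case unfolding d expand_simps walk_append[OF wf_graphD(3)[OF wfG]] using refinement_dart(2)[OF a(1), of b] Cons.IH[OF a(3)] a(2) by blast
qed

text \<open>Besides the interiors of the pieces, exactly the joints between consecutive pieces
  become interior; these are the images of the old interior vertices.\<close>

lemma interior_expand:
 assumes "walk G' u p v"
 shows "interior G (expand R p) = (\<Sum>d\<leftarrow>p. interior G (R (fst d))) + image_mset k (interior G' p)" using assms
proof (induction p arbitrary: u)
 case (Cons d p)
 obtain a b where d: "d = (a, b)" by force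
 have a: "a:edges G'" "walk G' (dart_tgt G' (a, b)) p v" using Cons.prems d by auto
 let ?q = "if b then R a else rev_path (R a)"
 note q = refinement_dart[OF a(1), of b]
 show ?case
 proof (cases p)
  case Nil
  thus ?thesis using q(3) d by simp
 next
  case (Cons d' p')
  obtain a' b' where d': "d' = (a', b')" by force
  have "a':edges G'" using a(2) Cons d' by simp
  hence ne: "expand R p ~= []" using refinement_dart(1)[of a' b'] Cons d' by simp
  have l: "dart_tgt G (last ?q) = k (dart_tgt G' (a, b))" using walk_nth(4)[OF q(2,1)] q(1) by (simp add: last_conv_nth)
  have "map (dart_tgt G) ?q = map (dart_tgt G) (butlast ?q) @ [dart_tgt G (last ?q)]"
   by (subst append_butlast_last_id[OF q(1), symmetric]) (simp only: map_append list.map)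
  hence "mset (map (dart_tgt G) ?q) = interior G (R a) + {#k (dart_tgt G' (a, b))#}" by (simp only: mset_append q(3) l mset.simps)
  moreover have "butlast (expand R (d # p)) = ?q @ butlast (expand R p)" using ne d by (simp add: butlast_append)
  moreover have "butlast (d # p) = d # butlast p" using Cons by simp
  ultimately show ?thesis using Cons.IH[OF a(2)] d by (simp only: map_append mset_append list.map mset.simps fst_conv sum_list.Cons image_mset_add_mset) simp
 qed
qed simp

end

lemma sum_list_mset_eq: "(\<Sum>d\<leftarrow>p. f (fst d)) = (SUM a:#mset (map fst p). f a)" by (induction p) auto

lemma sum_image_mset_sum:
 fixes f :: "'a => 'b multiset"
 assumes "finite A" shows "(SUM e:A. SUM a:#M e. f a) = (SUM a:#(SUM e:A. M e). f a)" using assms by (induction A rule: finite_induct) auto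

lemma image_mset_sum:
 "finite A ==> (SUM e:A. image_mset k (M e)) = image_mset k (SUM e:A. M e)" by (induction A rule: finite_induct) auto

lemma refinement_comp:
 assumes r1: "refinement H G' j Q" and r2: "refinement G' G k R"
  and wf: "wf_graph H" "wf_graph G'" "wf_graph G"
 shows "refinement H G (k \<circ> j) (%e. expand R (Q e))"
proof -
 note m1 = r1[unfolded refinement_iff_mset[OF wf_graphD(2)[OF wf(1)] wf_graphD(2,1)[OF wf(2)]]]
 note m2 = r2[unfolded refinement_iff_mset[OF wf_graphD(2)[OF wf(2)] wf_graphD(2,1)[OF wf(3)]]]
 have w: "walk G' (j (src H e)) (Q e) (j (tgt H e))" "Q e ~= []" if "e:edges H" for e using m1 that by auto
 have fH: "finite (edges H)" and fG': "finite (edges G')" using wf_graphD(2) wf by auto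
 \<comment> \<open>Every edge of \<open>G'\<close> occurs once on the chains \<open>Q e\<close>, so
   a sum along all chains is a sum over the edges of \<open>G'\<close>.\<close>
 have tot: "(SUM e:edges H. \<Sum>d\<leftarrow>Q e. f (fst d)) = (SUM a:edges G'. f a)" for f :: "_ => 'z multiset"
 proof -
  have "(SUM e:edges H. \<Sum>d\<leftarrow>Q e. f (fst d)) = (SUM a:#(SUM e:edges H. mset (map fst (Q e))). f a)"
   unfolding sum_list_mset_eq by (rule sum_image_mset_sum[OF fH])
  thus ?thesis using m1 by (simp add: sum_unfold_sum_mset)
 qed
 have ex: "mset (map fst (expand R p)) = (\<Sum>d\<leftarrow>p. mset (map fst (R (fst d))))" for p by (induction p) auto
 have "(SUM e:edges H. mset (map fst (expand R (Q e)))) = mset_set (edges G)" unfolding ex tot[of "%a. mset (map fst (R a))"] using m2 by blast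
 moreover have "(SUM e:edges H. interior G (expand R (Q e))) = mset_set (verts G - (k \<circ> j)`verts H)"
 proof -
  have "(SUM e:edges H. interior G (expand R (Q e))) =
    (SUM e:edges H. \<Sum>d\<leftarrow>Q e. interior G (R (fst d))) + (SUM e:edges H. image_mset k (interior G' (Q e)))" unfolding sum.distrib[symmetric]
   by (rule sum.cong[OF refl]) (rule interior_expand[OF r2 wf(3,2) w(1)])
  also have "(SUM e:edges H. image_mset k (interior G' (Q e))) = image_mset k (SUM e:edges H. interior G' (Q e))" by (rule image_mset_sum[OF fH])
  also have "(SUM e:edges H. interior G' (Q e)) = mset_set (verts G' - j`verts H)" using m1 by simp
  also have "image_mset k (mset_set (verts G' - j`verts H)) = mset_set (k`(verts G' - j`verts H))" using m2 by (intro image_mset_mset_set) (auto intro: inj_on_subset)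
  also have "(SUM e:edges H. \<Sum>d\<leftarrow>Q e. interior G (R (fst d))) = mset_set (verts G - k`verts G')" unfolding tot[of "%a. interior G (R a)"] using m2 by blast
  also have "mset_set (verts G - k`verts G') + mset_set (k`(verts G' - j`verts H)) =
    mset_set ((verts G - k`verts G') \<union> k`(verts G' - j`verts H))" by (rule mset_set_Union[symmetric]) (use wf_graphD(1) wf in auto)
  also have "k`(verts G' - j`verts H) = k`verts G' - k`j`verts H" by (rule inj_on_image_set_diff[of k "verts G'"]) (use m1 m2 in auto)
  also have "(verts G - k`verts G') \<union> (k`verts G' - k`j`verts H) = verts G - (k \<circ> j)`verts H" using m1 m2 by (auto simp: image_comp)
  finally show ?thesis .
 qed
 moreover have "inj_on (k \<circ> j) (verts H)" using m1 m2 by (meson comp_inj_on inj_on_subset)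
 moreover have "(k \<circ> j)`verts H <= verts G" using m1 m2 by auto
 moreover have "expand R (Q e) ~= [] & walk G ((k \<circ> j) (src H e)) (expand R (Q e)) ((k \<circ> j) (tgt H e))"
  if e: "e:edges H" for e
 proof
  show "walk G ((k \<circ> j) (src H e)) (expand R (Q e)) ((k \<circ> j) (tgt H e))" using walk_expand[OF r2 wf(3,2) w(1)[OF e]] by simp
  obtain a b q where q: "Q e = (a, b) # q" using w(2)[OF e] by (cases "Q e") auto
  hence "a:edges G'" using w(1)[OF e] by simp
  thus "expand R (Q e) ~= []" using refinement_dart(1)[OF r2 wf(3,2), of a b] q by simp
 qed
 moreover have "wt G v = 0" if "v:verts G - (k \<circ> j)`verts H" for v
 proof (cases "v:k`verts G'")
  case True
  then obtain u where "u:verts G'" "v = k u" by blast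
  thus ?thesis using that m1 m2 by (cases "u:j`verts H") auto
 next
  case False thus ?thesis using that m2 by auto
 qed
 ultimately show ?thesis unfolding refinement_iff_mset[OF wf_graphD(2)[OF wf(1)] wf_graphD(2,1)[OF wf(3)]] using m1 m2 by auto
qed

subsection \<open>Subdivisions\<close>

lemma subdivide_simps [simp]:
 "verts (subdivide \<G> S) = Inl`verts \<G> \<union> Inr`S"
 "edges (subdivide \<G> S) = {(e, b). e:edges \<G> & (b --> e:S)}"
 "src (subdivide \<G> S) (e, b) = (if b then Inr e else Inl (src \<G> e))"
 "tgt (subdivide \<G> S) (e, b) = (if e:S & \<not> b then Inr e else Inl (tgt \<G> e))"
 "wt (subdivide \<G> S) (Inl v) = wt \<G> v" "wt (subdivide \<G> S) (Inr e) = 0"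
 "nlegs (subdivide \<G> S) = nlegs \<G>" "leg (subdivide \<G> S) i = Inl (leg \<G> i)" by (auto simp: subdivide_def)

lemma subdivide_edges: "S <= edges \<G> ==> edges (subdivide \<G> S) = (%e. (e, False))`edges \<G> \<union> (%e. (e, True))`S" by auto

lemma subdivide_path:
 assumes "e:T" "T <= edges \<G>" "!!b. (e, b):edges (subdivide \<G> S) ==> (e, b):U"
 shows "(Inl (src \<G> e), Inl (tgt \<G> e)):(adj (subdivide \<G> S) U)^*"
proof (cases "e:S")
 case True
 hence "(e, False):U" "(e, True):U" using assms by auto
 from adj_edge(1)[OF this(1), of "subdivide \<G> S"] adj_edge(1)[OF this(2), of "subdivide \<G> S"]
 show ?thesis using True by simp
next
 case False
 hence "(e, False):U" using assms by auto
 from adj_edge(1)[OF this, of "subdivide \<G> S"] show ?thesis using False by simp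
qed

lemma subdivide_wf:
 assumes wf: "wf_graph \<G>" and S: "S <= edges \<G>" shows "wf_graph (subdivide \<G> S)"
proof -
 let ?G = "subdivide \<G> S"
 have fin: "finite S" using S wf_graphD(2)[OF wf] finite_subset by blast
 have "finite (verts ?G)" using fin wf_graphD(1)[OF wf] by simp
 moreover have "finite (edges ?G)" unfolding subdivide_edges[OF S] using fin wf_graphD(2)[OF wf] by simp
 moreover have "src ?G`edges ?G <= verts ?G" "tgt ?G`edges ?G <= verts ?G" using edge_ends[OF wf] S by auto
 moreover have "connected_graph ?G" unfolding connected_graph_def
 proof (intro conjI ballI)
  show "verts ?G ~= {}" using wf_graphD(4)[OF wf] by (auto simp: connected_graph_def)
  have l: "EX w:verts \<G>. (Inl w, u):(adj ?G (edges ?G))^*" if u: "u:verts ?G" for u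
  proof (cases u)
   case (Inl w) thus ?thesis using u by auto
  next
   case (Inr e)
   hence "e:S" using u by auto
   hence "(e, False):edges ?G" using S by auto
   from adj_edge(1)[OF this, of ?G] have "(Inl (src \<G> e), u):(adj ?G (edges ?G))^*" using Inr \<open>e:S\<close> by simp
   thus ?thesis using edge_ends[OF wf] S \<open>e:S\<close> by blast
  qed
  fix u v assume "u:verts ?G" "v:verts ?G"
  then obtain x y where xy: "x:verts \<G>" "y:verts \<G>" "(Inl x, u):(adj ?G (edges ?G))^*" "(Inl y, v):(adj ?G (edges ?G))^*" using l by meson
  have "(x, y):(adj \<G> (edges \<G>))^*" using xy(1,2) wf_graphD(4)[OF wf] by (simp add: connected_graph_def)
  hence "(Inl x, Inl y):(adj ?G (edges ?G))^*" by (rule adj_rtrancl_map) (rule subdivide_path, auto)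
  thus "(u, v):(adj ?G (edges ?G))^*" using xy(4) adj_rtrancl_sym[OF xy(3)] by (meson rtrancl_trans)
 qed
 ultimately show ?thesis using wf_graphD(5)[OF wf] by (auto simp: wf_graph_def)
qed

definition halves :: "'e set => 'e => (('e \<times> bool) \<times> bool) list" where
 "halves S e = (if e:S then [((e, False), True), ((e, True), True)] else [((e, False), True)])"

lemma sum_singleton_mset: "finite A ==> inj_on f A ==> (SUM e:A. {#f e#}) = mset_set (f`A)" by (simp add: sum_unfold_sum_mset flip: image_mset_mset_set)

lemma subdivide_refinement:
 assumes wf: "wf_graph \<G>" and S: "S <= edges \<G>" shows "refinement \<G> (subdivide \<G> S) Inl (halves S)"
proof -
 let ?G = "subdivide \<G> S"
 have wfG: "wf_graph ?G" by (rule subdivide_wf[OF assms])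
 have fin: "finite (edges \<G>)" "finite S" using S wf_graphD(2)[OF wf] finite_subset by blast+
 have V: "verts ?G - Inl`verts \<G> = Inr`S" by auto
 have "(SUM e:edges \<G>. mset (map fst (halves S e))) = (SUM e:edges \<G>. {#(e, False)#} + (if e:S then {#(e, True)#} else {#}))"
  by (rule sum.cong) (auto simp: halves_def)
 also have "... = (SUM e:edges \<G>. {#(e, False)#}) + (SUM e:S. {#(e, True)#})"
  unfolding sum.distrib using S fin by (simp add: sum.inter_restrict[symmetric] Int_absorb1)
 also have "... = mset_set ((%e. (e, False))`edges \<G>) + mset_set ((%e. (e, True))`S)" using fin by (simp add: sum_singleton_mset inj_on_def)
 also have "... = mset_set (edges ?G)" unfolding subdivide_edges[OF S] by (rule mset_set_Union[symmetric]) (use fin in auto)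
 finally have 1: "(SUM e:edges \<G>. mset (map fst (halves S e))) = mset_set (edges ?G)" .
 have "(SUM e:edges \<G>. interior ?G (halves S e)) = (SUM e:edges \<G>. if e:S then {#Inr e#} else {#})" by (rule sum.cong) (auto simp: halves_def dart_tgt_def)
 also have "... = (SUM e:S. {#Inr e#})" using S fin by (simp add: sum.inter_restrict[symmetric] Int_absorb1)
 also have "... = mset_set (Inr`S)" using fin by (simp add: sum_singleton_mset)
 finally have 2: "(SUM e:edges \<G>. interior ?G (halves S e)) = mset_set (verts ?G - Inl`verts \<G>)" unfolding V .
 have "halves S e ~= [] & walk ?G (Inl (src \<G> e)) (halves S e) (Inl (tgt \<G> e))" if "e:edges \<G>" for e
  using that edge_ends[OF wf that] by (auto simp: halves_def dart_src_def dart_tgt_def)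
 thus ?thesis unfolding refinement_iff_mset[OF fin(1) wf_graphD(2,1)[OF wfG]] using 1 2 by auto
qed

lemma subdivide_chains: "wf_graph \<G> ==> S <= edges \<G> ==> chains \<G> (subdivide \<G> S) Inl (halves S)" by (simp add: chains_def subdivide_refinement subdivide_wf)

lemma omega_subdivide:
 assumes "wf_graph \<G>" "S <= edges \<G>"
 shows "v:verts \<G> ==> omega_graph (subdivide \<G> S) (Inl v) = omega_graph \<G> v"
  "e:S ==> omega_graph (subdivide \<G> S) (Inr e) = 0"
proof -
 interpret chains \<G> "subdivide \<G> S" Inl "halves S" using assms by (rule subdivide_chains)
 show "v:verts \<G> ==> omega_graph (subdivide \<G> S) (Inl v) = omega_graph \<G> v" by (rule omega_good)
 show "e:S ==> omega_graph (subdivide \<G> S) (Inr e) = 0" by (rule omega_bad) auto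
qed

subsection \<open>Existence of stable reductions\<close>

text \<open>Vertices outside \<open>W\<close> are removed one at a time by joining their two edges.
  The result keeps the vertex and edge types, as the induction requires; the standard numbering is
  introduced only afterwards.\<close>

lemma refinement_exists:
 fixes G :: "('v, 'e) lgraph"
 assumes "wf_graph G" "W <= verts G" "W ~= {}"
  and "!!v. v:verts G - W ==> valence G v = 2 & wt G v = 0" and "!!i. i < nlegs G ==> leg G i:W"
 shows "\<exists>(H :: ('v, 'e) lgraph) P. wf_graph H & refinement H G id P & verts H = W" using assms
proof (induction "card (verts G - W)" arbitrary: G)
 case 0
 note wf = 0(2)
 have "verts G = W" using 0 wf_graphD(1)[OF wf] by auto
 moreover have "refinement G G id (%e. [(e, True)])" unfolding refinement_iff_mset[OF wf_graphD(2)[OF wf] wf_graphD(2,1)[OF wf]]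
  using edge_ends[OF wf] wf_graphD(2)[OF wf] sum_singleton_mset[of "edges G" id] by (auto simp: dart_src_def dart_tgt_def)
 ultimately show ?case using wf by blast
next
 case (Suc n)
 note wf = Suc.prems(1)
 note cl = edge_ends[OF wf]
 have fE: "finite (edges G)" using wf_graphD(2)[OF wf] .
 obtain v where v: "v:verts G" "v ~: W" using Suc.hyps(2) by (metis Diff_iff card.empty equals0I nat.distinct(1))
 let ?h = "%e. of_bool (src G e = v) + of_bool (tgt G e = v) :: nat"
 let ?A = "{e:edges G. src G e = v \<or> tgt G e = v}"
 have val: "(SUM e:edges G. ?h e) = 2" using Suc.prems(4)[of v] v valence_sum[OF fE, of v] by simp
 have valA: "(SUM e:?A. ?h e) = 2" using val fE by (subst sum.mono_neutral_left[of "edges G"]) auto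
 \<comment> \<open>A loop would use up the valence 2 of \<open>v\<close>, and connectedness would
   leave no other vertex, but \<open>W\<close> contains one.\<close>
 have noloop: "\<not> (src G e = v & tgt G e = v)" if e: "e:edges G" for e
 proof
  assume l: "src G e = v & tgt G e = v"
  have "(SUM e:edges G. ?h e) = ?h e + (SUM e:edges G - {e}. ?h e)" by (rule sum.remove[OF fE e])
  hence "(SUM e:edges G - {e}. ?h e) = 0" using val l by simp
  hence z: "ALL e':edges G - {e}. ?h e' = 0" using fE by (simp only: sum_eq_0_iff finite_Diff)
  have "w = v" if "w:verts G" for w
  proof -
   have "(v, w):(adj G (edges G))^*" using wf_graphD(4)[OF wf] v(1) that by (simp add: connected_graph_def)
   thus ?thesis
   proof (induction rule: rtrancl_induct)
    case (step y w)
    then obtain e' where e': "e':edges G" "(src G e' = v & tgt G e' = w) \<or> (src G e' = w & tgt G e' = v)" by (auto simp: adj_def)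
    hence "e' = e" using z by (cases "e' = e") auto
    thus ?case using e' l by auto
   qed simp
  qed
  thus False using Suc.prems(2,3) v by blast
 qed
 have "(SUM e:?A. ?h e) = (SUM e:?A. 1)" by (rule sum.cong) (use noloop in auto)
 hence "card ?A = 2" using valA by simp
 then obtain a b where ab: "?A = {a, b}" "a ~= b" by (meson card_2_iff)
 hence aA: "a:edges G" "src G a = v \<or> tgt G a = v" and bA: "b:edges G" "src G b = v \<or> tgt G b = v" by blast+
 have others: "src G e ~= v" "tgt G e ~= v" if "e:edges G" "e ~= a" "e ~= b" for e using that ab by blast+
 \<comment> \<open>\<open>da\<close> runs into \<open>v\<close> and \<open>db\<close> out of it. The
   name \<open>a\<close> is reused for the joined edge from \<open>p\<close> to \<open>q\<close>,
   and \<open>b\<close> is dropped.\<close>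
 define da where "da = (a, tgt G a = v)"
 define db where "db = (b, src G b = v)"
 define p where "p = dart_src G da"
 define q where "q = dart_tgt G db"
 have d: "dart_tgt G da = v" "dart_src G db = v" "p ~= v" "q ~= v" "p:verts G" "q:verts G" using aA bA noloop[OF aA(1)] noloop[OF bA(1)] cl[OF aA(1)] cl[OF bA(1)]
  by (auto simp: da_def db_def p_def q_def dart_src_def dart_tgt_def)
 define G' where "G' = G\<lparr>verts := verts G - {v}, edges := edges G - {b}, src := (src G)(a := p), tgt := (tgt G)(a := q)\<rparr>"
 define R where "R e = (if e = a then [da, db] else [(e, True)])" for e
 have V': "verts G' = verts G - {v}" "edges G' = edges G - {b}" by (simp_all add: G'_def)
 have S': "src G' e = (if e = a then p else src G e)" "tgt G' e = (if e = a then q else tgt G e)" for e by (simp_all add: G'_def)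
 have wf': "wf_graph G'" unfolding wf_graph_def
 proof (intro conjI)
  show "finite (verts G')" "finite (edges G')" using wf_graphD(1,2)[OF wf] by (auto simp: V')
  show "src G'`edges G' <= verts G'" "tgt G'`edges G' <= verts G'" using d others cl by (auto simp: V' S')
  show "\<forall>i<nlegs G'. leg G' i:verts G'" using Suc.prems(2,5) v by (auto simp: G'_def)
  show "connected_graph G'" unfolding connected_graph_def
  proof (intro conjI ballI)
   show "verts G' ~= {}" using d by (auto simp: V')
   fix x y assume xy: "x:verts G'" "y:verts G'"
   let ?f = "%z. if z = v then p else z"
   have "(x, y):(adj G (edges G))^*" using wf_graphD(4)[OF wf] xy by (simp add: connected_graph_def V')
   hence "(?f x, ?f y):(adj G' (edges G'))^*"
   proof (rule adj_rtrancl_map)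
    fix e assume e: "e:edges G"
    have aE: "a:edges G'" using aA ab(2) by (simp add: V')
    consider "e = a" | "e = b" | "e ~= a" "e ~= b" by blast
    thus "(?f (src G e), ?f (tgt G e)):(adj G' (edges G'))^*"
    proof cases
     case 1
     hence "?f (src G e) = ?f (tgt G e)" using aA(2) by (auto simp: p_def da_def dart_src_def)
     thus ?thesis by simp
    next
     case 2
     have "{?f (src G b), ?f (tgt G b)} = {p, q}" using bA(2) d(4) noloop[OF bA(1)] by (auto simp: q_def db_def dart_tgt_def)
     hence "(?f (src G b) = p & ?f (tgt G b) = q) \<or> (?f (src G b) = q & ?f (tgt G b) = p)" by (auto simp: doubleton_eq_iff)
     thus ?thesis using adj_edge[OF aE, of G'] 2 by (auto simp: S')
    next
     case 3
     hence "e:edges G'" using e by (simp add: V')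
     from adj_edge(1)[OF this, of G'] show ?thesis using 3 others[OF e 3] by (simp add: S')
    qed
   qed
   thus "(x, y):(adj G' (edges G'))^*" using xy by (simp add: V')
  qed
 qed
 have ref: "refinement G' G id R" unfolding refinement_iff_mset[OF wf_graphD(2)[OF wf'] wf_graphD(2,1)[OF wf]]
 proof (intro conjI ballI)
  show "inj_on id (verts G')" "id`verts G' <= verts G" by (auto simp: V')
  fix e assume e: "e:edges G'"
  show "R e ~= []" by (simp add: R_def)
  show "walk G (id (src G' e)) (R e) (id (tgt G' e))"
  proof (cases "e = a")
   case True
   thus ?thesis using d aA bA by (auto simp: R_def S' p_def q_def da_def db_def)
  next
   case False
   thus ?thesis using e cl by (auto simp: R_def S' V' dart_src_def dart_tgt_def)
  qed
 next
  have E: "edges G' = insert a (edges G - {a, b})" "finite (edges G - {a, b})" using aA ab(2) fE by (auto simp: V')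
  have "(SUM e:edges G'. mset (map fst (R e))) = {#a, b#} + (SUM e:edges G - {a, b}. {#e#})" unfolding E(1) using E(2) by (simp add: R_def da_def db_def)
  also have "(SUM e:edges G - {a, b}. {#e#}) = mset_set (edges G - {a, b})" using sum_singleton_mset[of "edges G - {a, b}" id] E(2) by simp
  also have "{#a, b#} + mset_set (edges G - {a, b}) = mset_set (insert a (insert b (edges G - {a, b})))" using E(2) ab(2) by simp
  also have "insert a (insert b (edges G - {a, b})) = edges G" using aA bA by auto
  finally show "(SUM e:edges G'. mset (map fst (R e))) = mset_set (edges G)" .
  have "(SUM e:edges G'. interior G (R e)) = {#v#}" unfolding E(1) using E(2) d(1) by (simp add: R_def)
  moreover have "verts G - id`verts G' = {v}" using v by (auto simp: V')
  ultimately show "(SUM e:edges G'. interior G (R e)) = mset_set (verts G - id`verts G')" by simp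
  show "wt G u = 0" if "u:verts G - id`verts G'" for u using that Suc.prems(4)[of v] v by (auto simp: V')
 qed (auto simp: G'_def)
 interpret chains G' G id R using ref wf wf' by (simp add: chains_def)
 have "n = card (verts G' - W)"
 proof -
  have "verts G' - W = (verts G - W) - {v}" by (auto simp: V')
  thus ?thesis using Suc.hyps(2) v wf_graphD(1)[OF wf] by simp
 qed
 hence "\<exists>(H :: ('v, 'e) lgraph) P. wf_graph H & refinement H G' id P & verts H = W"
 proof (rule Suc.hyps(1)[OF _ wf' _ Suc.prems(3)])
  show "W <= verts G'" using Suc.prems(2) v by (auto simp: V')
  show "leg G' i:W" if "i < nlegs G'" for i using that Suc.prems(5) by (simp add: G'_def)
  show "valence G' u = 2 & wt G' u = 0" if u: "u:verts G' - W" for u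
  proof -
   have "valence G u = 2 & wt G u = 0" using Suc.prems(4) u by (simp add: V')
   moreover have "valence G u = valence G' u" using valence_good[of u] u by simp
   moreover have "wt G' u = wt G u" by (simp add: G'_def)
   ultimately show ?thesis by simp
  qed
 qed
 then obtain H :: "('v, 'e) lgraph" and P where H: "wf_graph H" "refinement H G' id P" "verts H = W" by blast
 have "refinement H G (id \<circ> id) (%e. expand R (P e))" by (rule refinement_comp[OF H(2) ref H(1) wf' wf])
 thus ?case using H by auto
qed

lemma specialization_wt:
 assumes "specialization \<G> \<G>' iV iE" "v':verts \<G>'"
 shows "int (wt \<G>' v') =
  sub_genus \<G> {v:verts \<G>. iV v = v'} {e:edges \<G> - iE`edges \<G>'. iV (src \<G> e) = v'}" using assms unfolding specialization_def by blast

text \<open>\<open>contract_exists\<close> without any contracted edge acts as an isomorphism onto a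
  standard graph. It preserves reference directions, so the chains need no reversal.\<close>

lemma standard_refinement_exists:
 fixes G :: "('a, 'b) lgraph"
 assumes G: "wf_graph G" "W <= verts G" "W ~= {}"
  "!!v. v:verts G - W ==> valence G v = 2 & wt G v = 0" "!!i. i < nlegs G ==> leg G i:W"
 shows "\<exists>\<G>' j P. standard_graph \<G>' & refinement \<G>' G j P & j`verts \<G>' = W"
proof -
 have "\<exists>(H :: ('a, 'b) lgraph) P. wf_graph H & refinement H G id P & verts H = W" by (rule refinement_exists[OF G(1-3)]) (fact G(4), fact G(5))
 then obtain H :: "('a, 'b) lgraph" and P where H: "wf_graph H" "refinement H G id P" "verts H = W" by blast
 obtain \<G>' :: "(nat, nat) lgraph" and iV iE where c: "standard_graph \<G>'" "specialization H \<G>' iV iE" "iE`edges \<G>' = edges H"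
  and st: "!!e. e:edges \<G>' ==> src \<G>' e = iV (src H (iE e)) & tgt \<G>' e = iV (tgt H (iE e))" by (rule contract_exists[OF H(1) order_refl]) blast
 note con = specializationD[OF c(2)]
 have wf': "wf_graph \<G>'" using c(1) by (simp add: standard_graph_def)
 have inj: "inj_on iV (verts H)" using con(5) unfolding c(3) by (auto simp: inj_on_def adj_def)
 define j where "j = inv_into (verts H) iV"
 have jV: "j (iV v) = v" if "v:verts H" for v unfolding j_def using inj that by simp
 have im: "j`verts \<G>' = W" unfolding con(1)[symmetric] image_image H(3)[symmetric] using jV by auto
 have bE: "bij_betw iE (edges \<G>') (edges H)" using con(2) c(3) by (simp add: bij_betw_def)
 have sumE: "(SUM e:edges \<G>'. X (iE e)) = (SUM e:edges H. X e)" for X :: "_ => 'z multiset" by (rule sum.reindex_bij_betw[OF bE])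
 note m = H(2)[unfolded refinement_iff_mset[OF wf_graphD(2)[OF H(1)] wf_graphD(2,1)[OF G(1)]]]
 have wtv: "wt \<G>' (iV v) = wt H v" if v: "v:verts H" for v
 proof -
  have "{u:verts H. iV u = iV v} = {v}" using inj v by (auto dest: inj_onD)
  hence "int (wt \<G>' (iV v)) = sub_genus H {v} {e:edges H - iE`edges \<G>'. iV (src H e) = iV v}" using specialization_wt[OF c(2) con(8)[OF v]] by (simp only:)
  thus ?thesis unfolding c(3) by (simp add: sub_genus_def)
 qed
 have "refinement \<G>' G j (P \<circ> iE)" unfolding refinement_iff_mset[OF wf_graphD(2)[OF wf'] wf_graphD(2,1)[OF G(1)]]
 proof (intro conjI ballI allI impI)
  show "inj_on j (verts \<G>')" unfolding con(1)[symmetric] using jV by (auto intro!: inj_onI)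
  show "j`verts \<G>' <= verts G" using im G(2) by simp
  fix e assume e: "e:edges \<G>'"
  have eH: "iE e:edges H" using con(9)[OF e] .
  show "(P \<circ> iE) e ~= []" using m eH by simp
  show "walk G (j (src \<G>' e)) ((P \<circ> iE) e) (j (tgt \<G>' e))" using m eH st[OF e] jV edge_ends[OF H(1) eH] by simp
 next
  show "(SUM e:edges \<G>'. mset (map fst ((P \<circ> iE) e))) = mset_set (edges G)" using m sumE[of "%e. mset (map fst (P e))"] by simp
  show "(SUM e:edges \<G>'. interior G ((P \<circ> iE) e)) = mset_set (verts G - j`verts \<G>')" using m sumE[of "%e. interior G (P e)"] im H(3) by simp
  show "wt G (j v) = wt \<G>' v" if "v:verts \<G>'" for v using that m jV wtv unfolding con(1)[symmetric] by auto
  show "wt G v = 0" if "v:verts G - j`verts \<G>'" for v using that im G(4) by simp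
  show "nlegs G = nlegs \<G>'" using con(6) m by simp
  show "leg G i = j (leg \<G>' i)" if "i < nlegs \<G>'" for i using that con(6,7) m jV wf_graphD(5)[OF H(1)] by simp
 qed
 thus ?thesis using c(1) im by blast
qed

text \<open>A pruning with the fewest vertices admits no further step.\<close>

lemma fully_pruned_exists:
 assumes wf: "wf_graph \<G>" shows "\<exists>\<C> r. prunes \<G> \<C> r & fully_pruned \<C>"
proof -
 let ?Q = "%(\<C>, r). prunes \<G> \<C> r"
 have "?Q (\<G>, id)" by (simp add: prunes_refl)
 then obtain p where p: "?Q p" "!!p'. ?Q p' ==> card (verts (fst p)) <= card (verts (fst p'))"
  using ex_has_least_nat[of ?Q "(\<G>, id)" "%p. card (verts (fst p))"] by blast
 obtain \<C> r where pr: "p = (\<C>, r)" by force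
 have D: "prunes \<G> \<C> r" using p(1) pr by simp
 have wfD: "wf_graph \<C>" using specialization_wf[OF prunesD(1)[OF D wf] wf] .
 have "fully_pruned \<C>" unfolding fully_pruned_def
 proof
  assume "EX v:verts \<C>. valence \<C> v = 1 & wt \<C> v = 0 & legs_at \<C> v <= 1"
  then obtain v where v: "v:verts \<C>" "valence \<C> v = 1" "wt \<C> v = 0" "legs_at \<C> v <= 1" by blast
  have "EX e:edges \<C>. src \<C> e = v \<or> tgt \<C> e = v"
  proof (rule ccontr)
   assume "\<not> ?thesis"
   hence "valence \<C> v = 0" unfolding valence_sum[OF wf_graphD(2)[OF wfD]] by (intro sum.neutral) auto
   thus False using v(2) by simp
  qed
  then obtain e where e: "e:edges \<C>" "src \<C> e = v \<or> tgt \<C> e = v" by blast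
  then obtain u where u: "{src \<C> e, tgt \<C> e} = {v, u}" by (metis insert_commute)
  from p(2)[of "(_, _)"] prunes_step[OF D v e(1) u]
  have "card (verts \<C>) <= card (verts \<C> - {v})" using pr by fastforce
  moreover have "card (verts \<C> - {v}) < card (verts \<C>)" using v(1) wf_graphD(1)[OF wfD] by (intro psubset_card_mono) auto
  ultimately show False by simp
 qed
 thus ?thesis using D by blast
qed

text \<open>The quantity that is additive under specialization and positive exactly at the vertices of
 the stable model.\<close>

definition stability :: "('v, 'e) lgraph => 'v => int" where
 "stability G v = omega_graph G v + int (legs_at G v)"

lemma stability_specialization:
 assumes "specialization \<G> \<G>' iV iE" "wf_graph \<G>" "v:verts \<G>'"
 shows "stability \<G>' v = (SUM u:{u:verts \<G>. iV u = v}. stability \<G> u)"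
 unfolding stability_def specialization_omega[OF assms] legs_at_contraction[OF specialization_contraction[OF assms(1)] assms(2)]
 by (simp add: push_forward_def sum.distrib)

definition one_legged :: "nat => ('v, 'e) lgraph => bool" where
 "one_legged g \<G> \<longleftrightarrow> wf_graph \<G> & nlegs \<G> = 1 & genus \<G> = int g & g >= 1"

lemma one_leggedD:
 assumes "one_legged g \<G>" shows "wf_graph \<G>" "nlegs \<G> = 1" "genus \<G> = int g" "genus \<G> >= 1" using assms by (auto simp: one_legged_def)

lemma one_legged_specialization: "specialization \<G> \<G>' iV iE ==> one_legged g \<G> ==> one_legged g \<G>'"
 using specialization_wf[of \<G> \<G>' iV iE] genus_specialization[of \<G> \<G>' iV iE]
  contractionD(6)[OF specialization_contraction, of \<G> \<G>' iV iE] unfolding one_legged_def by simp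

text \<open>Both summands are nonnegative, so both vanish together with their sum. This leaves
  valence 2 and weight 0, or valence 0 and weight 1; in the latter case the graph is a single
  vertex, which carries the leg.\<close>

lemma stability_core:
 assumes o: "one_legged g \<C>" and c: "core_like \<C>" and v: "v:verts \<C>"
 shows "stability \<C> v >= 0"
  "stability \<C> v = 0 \<longleftrightarrow> valence \<C> v = 2 & wt \<C> v = 0 & legs_at \<C> v = 0"
proof -
 note od = one_leggedD[OF o]
 have w: "omega_graph \<C> v >= 0" using c v by (simp add: core_like_def)
 thus "stability \<C> v >= 0" by (simp add: stability_def)
 have "legs_at \<C> v ~= 0" if "valence \<C> v = 0"
 proof -
  have "leg \<C> 0 = v" using isolated_vertex(1)[OF od(1) v that] wf_graphD(5)[OF od(1), of 0] od(2) by simp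
  hence "{i. i < nlegs \<C> & leg \<C> i = v} = {0}" using od(2) by auto
  thus ?thesis by (simp add: legs_at_def)
 qed
 thus "stability \<C> v = 0 \<longleftrightarrow> valence \<C> v = 2 & wt \<C> v = 0 & legs_at \<C> v = 0" using w unfolding stability_def omega_graph_def
  by (cases "wt \<C> v = 0"; cases "valence \<C> v = 0") auto
qed

lemma stable_reductionD:
 assumes s: "stable_reduction \<G> \<C> r \<G>' j P" and o: "one_legged g \<G>"
 shows "specialization \<G> \<C> r id" "one_legged g \<C>" "core_like \<C>" "chains \<G>' \<C> j P"
  "!!v. v:verts \<C> ==> v:j`verts \<G>' \<longleftrightarrow> stability \<C> v ~= 0"
  "\<G>':stable_graphs g 1" "prunes \<G> \<C> r"
proof -
 note od = one_leggedD[OF o]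
 have p: "prunes \<G> \<C> r" "fully_pruned \<C>" "standard_graph \<G>'" "refinement \<G>' \<C> j P"
   "verts \<C> - j`verts \<G>' = {v:verts \<C>. valence \<C> v = 2 & wt \<C> v = 0 & legs_at \<C> v = 0}" using s by (auto simp: stable_reduction_def)
 show "prunes \<G> \<C> r" by (rule p(1))
 show sp: "specialization \<G> \<C> r id" by (rule prunesD(1)[OF p(1) od(1)])
 show oD: "one_legged g \<C>" by (rule one_legged_specialization[OF sp o])
 note odD = one_leggedD[OF oD]
 show core: "core_like \<C>" by (rule fully_pruned_core_like[OF odD(1) p(2) _ odD(4)]) (use odD in simp)
 have wf': "wf_graph \<G>'" using p(3) by (simp add: standard_graph_def)
 show ch: "chains \<G>' \<C> j P" using p(4) wf' odD(1) by (simp add: chains_def)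
 interpret chains \<G>' \<C> j P by (rule ch)
 show good: "v:j`verts \<G>' \<longleftrightarrow> stability \<C> v ~= 0" if "v:verts \<C>" for v using stability_core(2)[OF oD core that] p(5) that by blast
 have legs: "legs_at \<G>' v = legs_at \<C> (j v)" if v: "v:verts \<G>'" for v
 proof -
  have "leg \<G>' i = v \<longleftrightarrow> leg \<C> i = j v" if "i < nlegs \<G>'" for i
   using refD(6)[OF that] inj_onD[OF refD(1) _ wf_graphD(5)[OF wf' that] v] by auto
  hence "{i. i < nlegs \<G>' & leg \<G>' i = v} = {i. i < nlegs \<C> & leg \<C> i = j v}" using refD(5) by auto
  thus ?thesis by (simp add: legs_at_def)
 qed
 have "stable \<G>'" unfolding stable_iff_omega
 proof
  fix v assume v: "v:verts \<G>'"
  hence jv: "j v:verts \<C>" using refD(2) by blast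
  have "stability \<C> (j v) >= 1" using stability_core(1)[OF oD core jv] good[OF jv] v by fastforce
  thus "1 <= omega_graph \<G>' v + int (legs_at \<G>' v)" unfolding stability_def omega_good[OF v] legs[OF v] .
 qed
 moreover have "genus \<G>' = int g"
 proof -
  have "2 * genus \<G>' - 2 = (SUM v:verts \<G>'. omega_graph \<C> (j v))" unfolding genus_omega[OF wf'] by (rule sum.cong) (auto simp: omega_good)
  also have "... = (SUM v:j`verts \<G>'. omega_graph \<C> v)" using refD(1) by (simp add: sum.reindex)
  also have "... = (SUM v:verts \<C>. omega_graph \<C> v)" by (rule sum.mono_neutral_left) (use wf_graphD(1)[OF odD(1)] refD(2) omega_bad in auto)
  also have "... = 2 * genus \<C> - 2" using genus_omega[OF odD(1)] by simp
  finally show ?thesis using odD(3) by simp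
 qed
 moreover have "nlegs \<G>' = 1" using refD(5) odD(2) by simp
 ultimately show "\<G>':stable_graphs g 1" using p(3) by (simp add: stable_graphs_def)
qed

lemma stable_reduction_exists:
 assumes o: "one_legged g \<G>" shows "\<exists>\<C> r \<G>' j P. stable_reduction \<G> \<C> r \<G>' j P"
proof -
 note od = one_leggedD[OF o]
 obtain \<C> r where p: "prunes \<G> \<C> r" "fully_pruned \<C>" using fully_pruned_exists[OF od(1)] by blast
 have oD: "one_legged g \<C>" by (rule one_legged_specialization[OF prunesD(1)[OF p(1) od(1)] o])
 note odD = one_leggedD[OF oD]
 let ?W = "{v:verts \<C>. \<not> (valence \<C> v = 2 & wt \<C> v = 0 & legs_at \<C> v = 0)}"
 have legW: "leg \<C> i:?W" if i: "i < nlegs \<C>" for i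
 proof -
  have "card {k. k < nlegs \<C> & leg \<C> k = leg \<C> i} > 0" using i by (intro card_gt_0_iff[THEN iffD2]) auto
  hence "legs_at \<C> (leg \<C> i) ~= 0" by (simp only: legs_at_def)
  thus ?thesis using wf_graphD(5)[OF odD(1) i] by simp
 qed
 have "\<exists>\<G>' j P. standard_graph \<G>' & refinement \<G>' \<C> j P & j`verts \<G>' = ?W"
 proof (rule standard_refinement_exists[OF odD(1)])
  show "?W ~= {}" using legW[of 0] odD(2) by (metis empty_iff zero_less_one)
 qed (use legW in auto)
 then obtain \<G>' j P where "standard_graph \<G>'" "refinement \<G>' \<C> j P" "j`verts \<G>' = ?W" by blast
 hence "stable_reduction \<G> \<C> r \<G>' j P" using p by (auto simp: stable_reduction_def)
 thus ?thesis by blast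
qed

text \<open>\<open>stability\<close> is nonnegative on a core and additive over fibres, so it is
  nonzero downstairs exactly if it is nonzero somewhere in the fibre; this is the hypothesis
  \<open>good_iff\<close>.\<close>

lemma stable_reduction_specialization:
 assumes s: "specialization \<G> \<G>1 iV iE" and o: "one_legged g \<G>"
  and r: "stable_reduction \<G> \<C> r \<G>' j P" and r1: "stable_reduction \<G>1 \<C>1 r1 \<G>1' j1 P1"
 shows "chains_specialization \<G>' \<C> j P \<G>1' \<C>1 j1 P1 iV iE" "!!x. x:verts \<G> ==> r1 (iV x) = iV (r x)"
proof -
 have o1: "one_legged g \<G>1" by (rule one_legged_specialization[OF s o])
 note d = stable_reductionD[OF r o] and d1 = stable_reductionD[OF r1 o1]
 note wf = one_leggedD(1)[OF o] and wfD = one_leggedD(1)[OF d(2)]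
 have n: "nlegs \<G> <= 1" using one_leggedD(2)[OF o] by simp
 note cs = core_specialization[OF s wf n d(7,3) d1(7,3)]
 show "!!x. x:verts \<G> ==> r1 (iV x) = iV (r x)" by (rule cs(2))
 interpret C: chains \<G>' \<C> j P by (rule d(4))
 show "chains_specialization \<G>' \<C> j P \<G>1' \<C>1 j1 P1 iV iE" unfolding chains_specialization_def chains_specialization_axioms_def
 proof (intro conjI d(4) d1(4) cs(1) allI impI)
  fix x assume x: "x:verts \<C>1"
  let ?F = "{u:verts \<C>. iV u = x}"
  have "x:j1`verts \<G>1' \<longleftrightarrow> (SUM u:?F. stability \<C> u) ~= 0" using d1(5)[OF x] stability_specialization[OF cs(1) wfD x] by simp
  also have "... \<longleftrightarrow> (EX u:?F. stability \<C> u ~= 0)"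
   using sum_nonneg_eq_0_iff[of ?F "stability \<C>"] stability_core(1)[OF d(2,3)] wf_graphD(1)[OF wfD] by auto
  also have "... \<longleftrightarrow> (EX v:verts \<G>'. iV (j v) = x)" using d(5) C.refD(2) by blast
  finally show "x:j1`verts \<G>1' \<longleftrightarrow> (EX v:verts \<G>'. iV (j v) = x)" .
 qed
qed

subsection \<open>Contractions of subdivisions\<close>

text \<open>An exceptional vertex survives if both halves of its edge do. Otherwise it falls onto
  the end whose half has length zero; if both halves have, the two ends coincide after the
  contraction and the choice is immaterial.\<close>

definition sub_vertex :: "('v => 'w) => ('f => 'e) => ('e => 'v) => ('e => 'v) => 'f set => ('e \<times> bool => real) => 'v + 'e => 'w + 'f" where
 "sub_vertex iV iE s t \<E>' z u = (case u of Inl v => Inl (iV v)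
   | Inr e => if e:iE`\<E>' then Inr (inv_into \<E>' iE e)
    else if z (e, False) = 0 then Inl (iV (s e)) else Inl (iV (t e)))"

text \<open>Lengths \<open>z\<close> of the half edges, some of them zero, decide what is
  contracted. By \<open>z_pos\<close> an edge survives in \<open>\<G>'\<close> as soon as one of its
  halves does; it stays subdivided only if both do.\<close>

locale subdivided_contraction =
 fixes \<G> :: "('v, 'e) lgraph" and \<G>' :: "('w, 'f) lgraph" and iV iE and \<E> :: "'e set" and z :: "'e \<times> bool => real"
 assumes spec: "specialization \<G> \<G>' iV iE" and wf: "wf_graph \<G>" and \<E>: "\<E> <= edges \<G>"
  and z_nonneg: "!!h. h:edges (subdivide \<G> \<E>) ==> z h >= 0"
  and z_pos: "!!e. e:edges \<G> ==> e:iE`edges \<G>' \<longleftrightarrow> (\<exists>b. (e, b):edges (subdivide \<G> \<E>) & z (e, b) > 0)"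
begin

lemmas con = specialization_contraction[OF spec]
lemmas conD = contractionD[OF con]

definition \<E>' :: "'f set" where
 "\<E>' = {e:edges \<G>'. iE e:\<E> & z (iE e, False) > 0 & z (iE e, True) > 0}"

abbreviation "G \<equiv> subdivide \<G> \<E>"
abbreviation "G' \<equiv> subdivide \<G>' \<E>'"

definition gV :: "'v + 'e => 'w + 'f" where "gV = sub_vertex iV iE (src \<G>) (tgt \<G>) \<E>' z"

text \<open>If both halves survive, they are exchanged when \<open>e\<close> and \<open>iE e\<close>
  have opposite reference directions. If only one survives, it is the second half exactly when the
  first has length zero.\<close>

definition gE :: "'f \<times> bool => 'e \<times> bool" where
 "gE = (%(e, b). if e:\<E>' then (iE e, if iV (src \<G> (iE e)) = src \<G>' e then b else \<not> b)
   else (iE e, iE e:\<E> & z (iE e, False) = 0))"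

lemma wf': "wf_graph \<G>'" by (rule specialization_wf[OF spec wf])

lemma \<E>'_edges: "\<E>' <= edges \<G>'" by (auto simp: \<E>'_def)

lemma inj_\<E>': "inj_on iE \<E>'" using conD(2) \<E>'_edges by (rule inj_on_subset)

lemma gV_Inl [simp]: "gV (Inl v) = Inl (iV v)" by (simp add: gV_def sub_vertex_def)

lemma gV_Inr_exceptional: "e:\<E>' ==> gV (Inr (iE e)) = Inr e" using inj_\<E>' by (simp add: gV_def sub_vertex_def)

lemma gV_Inr_eq: "gV (Inr e) = Inr e' ==> e = iE e' & e':\<E>'" using f_inv_into_f[of e iE \<E>'] inv_into_into[of e iE \<E>']
 by (auto simp: gV_def sub_vertex_def split: if_splits)

lemma gV_Inr_other: "e ~: iE`\<E>' ==> gV (Inr e) = Inl (iV (if z (e, False) = 0 then src \<G> e else tgt \<G> e))" by (simp add: gV_def sub_vertex_def)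

lemma z_eq0: "h:edges G ==> \<not> z h > 0 ==> z h = 0" using z_nonneg[of h] by simp

lemma contracted_zero: "e:edges \<G> ==> e ~: iE`edges \<G>' ==> (e, b):edges G ==> z (e, b) = 0" using z_pos[of e] z_eq0 by blast

lemma half_zero:
 assumes "e:\<E>" "e ~: iE`\<E>'" shows "z (e, False) = 0 \<or> z (e, True) = 0"
proof (cases "e:iE`edges \<G>'")
 case True
 thus ?thesis using assms z_eq0[of "(e, False)"] z_eq0[of "(e, True)"] \<E> by (auto simp: \<E>'_def)
next
 case False
 thus ?thesis using contracted_zero[of e False] assms \<E> by auto
qed

lemma gE_pos: assumes h: "h:edges G'" shows "gE h:edges G" "z (gE h) > 0"
proof -
 obtain e b where eb: "h = (e, b)" "e:edges \<G>'" "b --> e:\<E>'" using h by auto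
 have e: "iE e:edges \<G>" using conD(9) eb by blast
 obtain c where c: "(iE e, c):edges G" "z (iE e, c) > 0" using z_pos[OF e] eb(2) by blast
 show "gE h:edges G" using e eb by (auto simp: gE_def \<E>'_def)
 show "z (gE h) > 0"
 proof (cases "e:\<E>'")
  case True
  hence "z (iE e, c) > 0" for c by (cases c) (auto simp: \<E>'_def)
  thus ?thesis using True eb by (simp add: gE_def)
 next
  case False
  note zn = z_nonneg[of "(iE e, False)"]
  show ?thesis
  proof (cases "iE e:\<E> & z (iE e, False) = 0")
   case True
   hence "c" using c(2) by (cases c) auto
   thus ?thesis using c eb(1) False True by (simp add: gE_def)
  next
   case no: False
   have "z (iE e, False) > 0"
   proof (cases c)
    case True
    hence "iE e:\<E>" using c(1) by auto
    thus ?thesis using no zn e by simp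
   next
    case False thus ?thesis using c(2) by simp
   qed
   moreover have "gE h = (iE e, False)" using False no eb(1) by (auto simp: gE_def)
   ultimately show ?thesis by simp
  qed
 qed
qed

lemma gE_inj: "inj_on gE (edges G')"
proof (rule inj_onI)
 fix h k assume hk: "h:edges G'" "k:edges G'" "gE h = gE k"
 obtain e b e' b' where [simp]: "h = (e, b)" "k = (e', b')" by (cases h, cases k)
 have "fst (gE h) = iE e" "fst (gE k) = iE e'" by (auto simp: gE_def)
 hence "e = e'" using inj_onD[OF conD(2), of e e'] hk by auto
 thus "h = k" using hk by (auto simp: gE_def split: if_splits)
qed

lemma gE_image: "gE`edges G' = {h:edges G. z h > 0}"
proof
 show "gE`edges G' <= {h:edges G. z h > 0}" using gE_pos by blast
 show "{h:edges G. z h > 0} <= gE`edges G'"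
 proof
  fix h assume h: "h:{h:edges G. z h > 0}"
  obtain a c where ac: "h = (a, c)" by force
  have a: "a:edges \<G>" "c --> a:\<E>" "z (a, c) > 0" using h ac by auto
  then obtain e where e: "e:edges \<G>'" "a = iE e" using z_pos[OF a(1)] h ac by blast
  show "h:gE`edges G'"
  proof (cases "e:\<E>'")
   case True
   let ?b = "if iV (src \<G> (iE e)) = src \<G>' e then c else \<not> c"
   have "gE (e, ?b) = h" using True ac e by (auto simp: gE_def)
   moreover have "(e, ?b):edges G'" using True e by auto
   ultimately show ?thesis by blast
  next
   case False
   have "gE (e, False) = h"
   proof (cases c)
    case True
    hence "\<not> z (iE e, False) > 0" using False a e by (auto simp: \<E>'_def)
    thus ?thesis using False True ac e a z_eq0[of "(iE e, False)"] by (simp add: gE_def)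
   qed (use False ac e a in "auto simp: gE_def")
   moreover have "(e, False):edges G'" using e by auto
   ultimately show ?thesis by blast
  qed
 qed
qed

lemma gE_complement: "edges G - gE`edges G' = {h:edges G. z h = 0}" unfolding gE_image using z_nonneg by (auto simp: less_le)

lemma gE_ends:
 assumes h: "h:edges G'" shows "{gV (src G (gE h)), gV (tgt G (gE h))} = {src G' h, tgt G' h}"
proof -
 obtain e b where eb: "h = (e, b)" "e:edges \<G>'" "b --> e:\<E>'" using h by auto
 have ends: "{iV (src \<G> (iE e)), iV (tgt \<G> (iE e))} = {src \<G>' e, tgt \<G>' e}" using conD(4) eb(2) .
 show ?thesis
 proof (cases "e:\<E>'")
  case True
  hence E: "iE e:\<E>" by (auto simp: \<E>'_def)
  have g: "gV (Inr (iE e)) = Inr e" by (rule gV_Inr_exceptional[OF True])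
  show ?thesis using ends True E g unfolding eb(1) by (cases "iV (src \<G> (iE e)) = src \<G>' e"; cases b) (auto simp: gE_def doubleton_eq_iff)
 next
  case False
  have ni: "iE e ~: iE`\<E>'" using False inj_onD[OF conD(2)] \<E>'_edges eb(2) by blast
  have b: "\<not> b" using eb(3) False by blast
  have "{gV (src G (gE h)), gV (tgt G (gE h))} = {Inl (iV (src \<G> (iE e))), Inl (iV (tgt \<G> (iE e)))}" using gV_Inr_other[OF ni] False b unfolding eb(1)
   by (cases "iE e:\<E>"; cases "z (iE e, False) = 0") (auto simp: gE_def)
  also have "... = Inl`{iV (src \<G> (iE e)), iV (tgt \<G> (iE e))}" by simp
  also have "... = {src G' h, tgt G' h}" unfolding ends using eb(1) b False by simp
  finally show ?thesis .
 qed
qed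

lemma zero_half_collapse:
 assumes h: "h:edges G" "z h = 0" shows "gV (src G h) = gV (tgt G h)"
proof -
 obtain e b where eb: "h = (e, b)" "e:edges \<G>" "b --> e:\<E>" using h(1) by auto
 have col: "iV (src \<G> e) = iV (tgt \<G> e)" if "e ~: iE`edges \<G>'" by (rule contraction_contracted[OF con wf_graphD(3)[OF wf] eb(2) that])
 show ?thesis
 proof (cases "e:\<E>")
  case False
  hence "e ~: iE`edges \<G>'" using z_pos[OF eb(2)] eb h(2) by auto
  thus ?thesis using col eb False by auto
 next
  case True
  have ni: "e ~: iE`\<E>'" using h(2) eb(1) by (cases b) (auto simp: \<E>'_def)
  show ?thesis
  proof (cases b)
   case False
   thus ?thesis using gV_Inr_other[OF ni] h(2) eb(1) True by simp
  next
   case b: True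
   show ?thesis
   proof (cases "z (e, False) = 0")
    case z0: True
    have "z (e, c) = 0" for c using z0 h(2) eb(1) b by (cases c) auto
    hence "e ~: iE`edges \<G>'" using z_pos[OF eb(2)] by simp
    thus ?thesis using gV_Inr_other[OF ni] col eb(1) b z0 by simp
   next
    case False
    thus ?thesis using gV_Inr_other[OF ni] eb(1) b by simp
   qed
  qed
 qed
qed

text \<open>An exceptional vertex that does not survive is joined by a half of length zero to an old
  vertex with the same image.\<close>

lemma gV_retract:
 assumes u: "u:verts G" "gV u = Inl x"
 shows "EX v:verts \<G>. iV v = x & (u, Inl v):(adj G {h:edges G. z h = 0})^*"
proof (cases u)
 case (Inl v)
 thus ?thesis using u by auto
next
 case (Inr e)
 have e: "e:\<E>" "e:edges \<G>" using u(1) Inr \<E> by auto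
 have ni: "e ~: iE`\<E>'" using u(2) Inr gV_Inr_exceptional by auto
 note V = edge_ends[OF wf e(2)]
 show ?thesis
 proof (cases "z (e, False) = 0")
  case True
  hence "(e, False):{h:edges G. z h = 0}" using e by simp
  from adj_edge(2)[OF this, of G] show ?thesis using Inr u(2) gV_Inr_other[OF ni] True e V by auto
 next
  case False
  hence "(e, True):{h:edges G. z h = 0}" using e half_zero[OF e(1) ni] by simp
  from adj_edge(1)[OF this, of G] show ?thesis using Inr u(2) gV_Inr_other[OF ni] False e V by auto
 qed
qed

lemma gV_fibre:
 assumes uv: "u:verts G" "v:verts G"
 shows "gV u = gV v \<longleftrightarrow> (u, v):(adj G (edges G - gE`edges G'))^*" unfolding gE_complement
proof
 assume "(u, v):(adj G {h:edges G. z h = 0})^*"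
 thus "gV u = gV v" by (rule adj_rtrancl_invariant) (use zero_half_collapse in auto)
next
 let ?A = "(adj G {h:edges G. z h = 0})^*"
 assume eq: "gV u = gV v"
 show "(u, v):?A"
 proof (cases "gV u")
  case (Inr e)
  have "u = Inr (iE e)" using Inr gV_Inr_eq by (cases u) auto
  moreover have "v = Inr (iE e)" using Inr eq gV_Inr_eq by (cases v) auto
  ultimately show ?thesis by simp
 next
  case (Inl x)
  obtain p where p: "p:verts \<G>" "iV p = x" "(u, Inl p):?A" using gV_retract[OF uv(1) Inl] by blast
  obtain q where q: "q:verts \<G>" "iV q = x" "(v, Inl q):?A" using gV_retract[OF uv(2) Inl[unfolded eq]] by blast
  have "(p, q):(adj \<G> (edges \<G> - iE`edges \<G>'))^*" using conD(5)[OF p(1) q(1)] p(2) q(2) by simp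
  hence "(Inl p, Inl q):?A"
  proof (rule adj_rtrancl_map)
   fix e assume "e:edges \<G> - iE`edges \<G>'"
   thus "(Inl (src \<G> e), Inl (tgt \<G> e)):?A" by (intro subdivide_path[of e "edges \<G>"]) (use contracted_zero[of e] in auto)
  qed
  thus ?thesis using p(3) adj_rtrancl_sym[OF q(3)] by (meson rtrancl_trans)
 qed
qed

lemma gV_verts: "gV`verts G = verts G'"
proof
 show "gV`verts G <= verts G'"
 proof
  fix w assume "w:gV`verts G"
  then obtain u where u: "u:verts G" "w = gV u" by blast
  show "w:verts G'"
  proof (cases u)
   case (Inl v) thus ?thesis using u conD(8) by auto
  next
   case (Inr e)
   have e: "e:edges \<G>" using u Inr \<E> by auto
   show ?thesis
   proof (cases "e:iE`\<E>'")
    case True thus ?thesis using gV_Inr_exceptional u(2) Inr by auto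
   next
    case False
    thus ?thesis using gV_Inr_other[OF False] u(2) Inr conD(8) edge_ends[OF wf e] by auto
   qed
  qed
 qed
 show "verts G' <= gV`verts G"
 proof
  fix w assume w: "w:verts G'"
  show "w:gV`verts G"
  proof (cases w)
   case (Inl x)
   hence "x:iV`verts \<G>" using w conD(1) by auto
   then obtain v where "v:verts \<G>" "x = iV v" by blast
   thus ?thesis using Inl by (intro image_eqI[of _ _ "Inl v"]) auto
  next
   case (Inr e)
   hence "e:\<E>'" using w by auto
   thus ?thesis using gV_Inr_exceptional Inr by (intro image_eqI[of _ _ "Inr (iE e)"]) (auto simp: \<E>'_def)
  qed
 qed
qed

lemma contraction_sub: "contraction G G' gV gE" unfolding contraction_def
proof (intro conjI ballI)
 show "gE`edges G' <= edges G" using gE_pos by blast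
 show "\<forall>i<nlegs G. leg G' i = gV (leg G i)" using conD(6,7) by simp
 show "nlegs G' = nlegs G" using conD(6) by simp
qed (fact gV_verts gE_inj gE_ends gV_fibre)+

lemma push_forward_Inl:
 fixes h :: "'v + 'e => 'b::comm_monoid_add"
 assumes "!!e. e:\<E> ==> h (Inr e) = 0 \<or> (\<exists>e'. gV (Inr e) = Inr e')"
 shows "push_forward (verts G) gV h (Inl x) = push_forward (verts \<G>) iV (%v. h (Inl v)) x"
proof -
 have fin: "finite (verts G)" using subdivide_wf[OF wf \<E>] by (rule wf_graphD)
 have "push_forward (verts G) gV h (Inl x) = (SUM u:Inl`{v:verts \<G>. iV v = x}. h u)" unfolding push_forward_def
  by (rule sum.mono_neutral_right) (use fin assms in fastforce)+
 thus ?thesis by (simp add: push_forward_def sum.reindex)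
qed

lemma push_forward_Inr:
 fixes h :: "'v + 'e => 'b::comm_monoid_add"
 assumes "e:\<E>'" shows "push_forward (verts G) gV h (Inr e) = h (Inr (iE e))"
proof -
 have "{u:verts G. gV u = Inr e} = {Inr (iE e)}"
 proof -
  have "u = Inr (iE e)" if "gV u = Inr e" for u using that gV_Inr_eq[of _ e] by (cases u) auto
  hence "{u:verts G. gV u = Inr e} <= {Inr (iE e)}" by blast
  moreover have "{Inr (iE e)} <= {u:verts G. gV u = Inr e}" using gV_Inr_exceptional[OF assms] assms unfolding \<E>'_def by simp
  ultimately show ?thesis by (rule subset_antisym)
 qed
 thus ?thesis by (simp add: push_forward_def)
qed

lemma push_forward_case_sum:
 fixes h :: "'v => 'b::comm_monoid_add"
 assumes "w:verts G'"
 shows "push_forward (verts G) gV (case_sum h (%_. 0)) w = case_sum (push_forward (verts \<G>) iV h) (%_. 0) w"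
proof (cases w)
 case (Inl x)
 have "push_forward (verts G) gV (case_sum h (%_. 0)) (Inl x) = push_forward (verts \<G>) iV (%v. case_sum h (%_. 0) (Inl v :: 'v + 'e)) x"
  by (rule push_forward_Inl) simp
 thus ?thesis using Inl by simp
next
 case (Inr e)
 hence "e:\<E>'" using assms by auto
 thus ?thesis unfolding Inr push_forward_Inr[OF \<open>e:\<E>'\<close>] by simp
qed

lemma specialization_sub: "specialization G G' gV gE"
proof (rule specializationI[OF subdivide_wf[OF wf \<E>] contraction_sub])
 fix w assume w: "w:verts G'"
 show "omega_graph G' w = push_forward (verts G) gV (omega_graph G) w"
 proof (cases w)
  case (Inl x)
  hence x: "x:verts \<G>'" using w by auto
  have "push_forward (verts G) gV (omega_graph G) (Inl x) = push_forward (verts \<G>) iV (%v. omega_graph G (Inl v)) x"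
   by (rule push_forward_Inl) (use omega_subdivide(2)[OF wf \<E>] in blast)
  also have "... = push_forward (verts \<G>) iV (omega_graph \<G>) x" by (rule push_forward_cong) (auto simp: omega_subdivide(1)[OF wf \<E>])
  also have "... = omega_graph G' (Inl x)" using specialization_omega[OF spec wf x] omega_subdivide(1)[OF wf' \<E>'_edges x] by simp
  finally show ?thesis using Inl by simp
 next
  case (Inr e)
  hence e: "e:\<E>'" using w by auto
  hence "iE e:\<E>" by (simp add: \<E>'_def)
  thus ?thesis unfolding Inr push_forward_Inr[OF e] omega_subdivide(2)[OF wf' \<E>'_edges e] omega_subdivide(2)[OF wf \<E> \<open>iE e:\<E>\<close>] by simp
 qed
qed

lemma compatible: "compatible_specialization \<G> \<E> \<G>' \<E>' iV iE gV gE"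
proof -
 have "fst (gE h) = iE (fst h)" for h by (cases h) (simp add: gE_def)
 thus ?thesis unfolding compatible_specialization_def using spec specialization_sub by (auto simp: \<E>'_def)
qed

end

subsection \<open>Push-forward of divisors and flows\<close>

lemma cut_size_contraction:
 assumes c: "contraction G G' gV gE" and wf: "wf_graph G"
 shows "cut_size G' W = cut_size G {v:verts G. gV v:W}"
proof -
 have fin: "finite (edges G)" "finite (edges G')" using wf contraction_wf[OF c wf] wf_graphD(2) by auto
 let ?h = "%e. of_bool ((gV (src G e):W) ~= (gV (tgt G e):W)) :: nat"
 have "cut_size G {v:verts G. gV v:W} = (SUM e:edges G. ?h e)" unfolding cut_size_sum[OF fin(1)] by (rule sum.cong) (auto simp: edge_ends[OF wf])
 also have "... = (SUM e:edges G - gE`edges G'. ?h e) + (SUM e:edges G'. ?h (gE e))" by (rule sum_contraction_edges[OF c fin(1)])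
 also have "(SUM e:edges G - gE`edges G'. ?h e) = 0" by (rule sum.neutral) (auto simp: contraction_contracted[OF c wf_graphD(3)[OF wf]])
 also have "(SUM e:edges G'. ?h (gE e)) = cut_size G' W" unfolding cut_size_sum[OF fin(2)]
 proof (rule sum.cong[OF refl])
  fix e assume "e:edges G'"
  from contraction_ends[OF c this] show "?h (gE e) = of_bool ((src G' e:W) ~= (tgt G' e:W))" by auto
 qed
 finally show ?thesis by simp
qed

text \<open>The preimage of a vertex set has the same degree, the same polarization and, since
  contracted edges are never cut by it, the same cut size.\<close>

lemma quasistable_contraction:
 assumes c: "contraction G G' gV gE" and wf: "wf_graph G"
  and D: "!!w. w:verts G' ==> D' w = push_forward (verts G) gV D w"
  and \<mu>: "!!w. w:verts G' ==> \<mu>' w = push_forward (verts G) gV \<mu> w"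
  and q: "quasistable G v0 \<mu> D" and v0: "v0:verts G"
 shows "quasistable G' (gV v0) \<mu>' D'"
proof -
 note cD = contractionD[OF c]
 have fin: "finite (verts G)" "finite (verts G')" using wf contraction_wf[OF c wf] wf_graphD(1) by auto
 have sums: "(SUM w:W. D' w) = (SUM v:{v:verts G. gV v:W}. D v)" "(SUM w:W. \<mu>' w) = (SUM v:{v:verts G. gV v:W}. \<mu> v)"
  if "W <= verts G'" for W
 proof -
  have fW: "finite W" using that fin(2) finite_subset by blast
  show "(SUM w:W. D' w) = (SUM v:{v:verts G. gV v:W}. D v)" unfolding sum_push_forward_subset[OF fin(1) fW, symmetric] by (rule sum.cong) (use D that in auto)
  show "(SUM w:W. \<mu>' w) = (SUM v:{v:verts G. gV v:W}. \<mu> v)" unfolding sum_push_forward_subset[OF fin(1) fW, symmetric] by (rule sum.cong) (use \<mu> that in auto)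
 qed
 have all: "{v:verts G. gV v:verts G'} = verts G" using cD(8) by auto
 show ?thesis unfolding quasistable_def
 proof (intro conjI allI impI)
  show "real_of_int (sum D' (verts G')) = sum \<mu>' (verts G')" using q unfolding sums[OF order_refl] all quasistable_def by blast
  fix W assume W: "W \<subset> verts G'"
  let ?U = "{v:verts G. gV v:W}"
  have U: "?U \<subset> verts G"
  proof -
   obtain w where w: "w:verts G'" "w ~: W" using W by blast
   then obtain v where "v:verts G" "gV v = w" unfolding cD(1)[symmetric] by (elim imageE) simp
   thus ?thesis using w by blast
  qed
  have b: "beta G' \<mu>' D' W = beta G \<mu> D ?U" unfolding beta_def cut_size_contraction[OF c wf] using sums[of W] W by simp
  show "beta G' \<mu>' D' W >= 0" using q U unfolding b quasistable_def by blast
  show "beta G' \<mu>' D' W > 0" if "gV v0:W" using q U that v0 unfolding b quasistable_def by blast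
 qed
qed

text \<open>The sign records whether the reference direction is reversed. For an edge that becomes a
  loop either sign will do, since a loop does not contribute to the divergence.\<close>

definition push_flow :: "('v, 'e) lgraph => ('w, 'f) lgraph => ('v => 'w) => ('f => 'e) => ('e => int) => 'f => int" where
 "push_flow G G' gV gE \<phi> e = (if e:edges G'
   then if gV (src G (gE e)) = src G' e then \<phi> (gE e) else - \<phi> (gE e) else 0)"

text \<open>A contracted edge has both ends in one fibre, where its two contributions
  cancel.\<close>

lemma flow_div_push:
 assumes c: "contraction G G' gV gE" and wf: "wf_graph G"
 shows "flow_div G' (push_flow G G' gV gE \<phi>) w = push_forward (verts G) gV (flow_div G \<phi>) w"
proof -
 have fin: "finite (edges G)" "finite (edges G')" "finite (verts G)" using wf contraction_wf[OF c wf] wf_graphD(1,2) by auto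
 note cl = edge_ends[OF wf]
 let ?h = "%e. \<phi> e * (of_bool (gV (tgt G e) = w) - of_bool (gV (src G e) = w))"
 have "push_forward (verts G) gV (flow_div G \<phi>) w =
   (SUM e:edges G. SUM v:{v:verts G. gV v = w}. \<phi> e * (of_bool (tgt G e = v) - of_bool (src G e = v)))"
  unfolding push_forward_def flow_div_sum[OF fin(1)] by (rule sum.swap)
 also have "... = (SUM e:edges G. ?h e)"
 proof (rule sum.cong[OF refl])
  fix e assume e: "e:edges G"
  have "(SUM v:{v:verts G. gV v = w}. of_bool (u = v)) = (of_bool (gV u = w) :: int)" if "u:verts G" for u using that fin(3) by (simp add: of_bool_def sum.delta)
  thus "(SUM v:{v:verts G. gV v = w}. \<phi> e * (of_bool (tgt G e = v) - of_bool (src G e = v))) = ?h e"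
   using cl[OF e] by (simp add: sum_distrib_left[symmetric] sum_subtractf)
 qed
 also have "... = (SUM e:edges G - gE`edges G'. ?h e) + (SUM e:edges G'. ?h (gE e))" by (rule sum_contraction_edges[OF c fin(1)])
 also have "(SUM e:edges G - gE`edges G'. ?h e) = 0" by (rule sum.neutral) (auto simp: contraction_contracted[OF c wf_graphD(3)[OF wf]])
 also have "(SUM e:edges G'. ?h (gE e)) = flow_div G' (push_flow G G' gV gE \<phi>) w" unfolding flow_div_sum[OF fin(2)]
 proof (rule sum.cong[OF refl])
  fix e assume e: "e:edges G'"
  show "?h (gE e) = push_flow G G' gV gE \<phi> e * (of_bool (tgt G' e = w) - of_bool (src G' e = w))"
   using contraction_ends[OF c e] e unfolding push_flow_def by (elim disjE conjE) auto
 qed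
 finally show ?thesis by simp
qed

lemma potential_constant:
 assumes c: "contraction G G' gV gE" and wf: "wf_graph G" and p: "potential G \<phi> z f"
  and z: "!!e. e:edges G - gE`edges G' ==> z e = 0" and uv: "u:verts G" "v:verts G" "gV u = gV v"
 shows "f u = f v"
proof -
 have "(u, v):(adj G (edges G - gE`edges G'))^*" using contractionD(5)[OF c uv(1,2)] uv(3) by simp
 thus ?thesis
 proof (rule adj_rtrancl_invariant)
  fix e assume e: "e:edges G - gE`edges G'"
  hence "f (tgt G e) - f (src G e) = of_int (\<phi> e) * z e" using p by (simp add: potential_def)
  thus "f (src G e) = f (tgt G e)" using z[OF e] by simp
 qed
qed

text \<open>Across an edge of length zero a potential does not change, so it is constant on the
  fibres and descends.\<close>

lemma potential_push:
 assumes c: "contraction G G' gV gE" and wf: "wf_graph G" and p: "potential G \<phi> z f"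
  and z: "!!e. e:edges G - gE`edges G' ==> z e = 0"
 shows "potential G' (push_flow G G' gV gE \<phi>) (%e. z (gE e)) (%x. f (inv_into (verts G) gV x))" unfolding potential_def
proof
 fix e assume e: "e:edges G'"
 note cD = contractionD[OF c]
 have inv: "f (inv_into (verts G) gV (gV v)) = f v" if "v:verts G" for v by (rule potential_constant[OF c wf p z]) (use that in "auto intro: inv_into_into f_inv_into_f")
 have ge: "gE e:edges G" using cD(9)[OF e] .
 have pe: "f (tgt G (gE e)) - f (src G (gE e)) = of_int (\<phi> (gE e)) * z (gE e)" using p ge by (simp add: potential_def)
 note V = edge_ends[OF wf ge]
 have g: "!!v. v:verts G ==> gV v = x ==> f (inv_into (verts G) gV x) = f v" for x using inv by auto
 show "f (inv_into (verts G) gV (tgt G' e)) - f (inv_into (verts G) gV (src G' e)) =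
    of_int (push_flow G G' gV gE \<phi> e) * z (gE e)"
 proof (cases "gV (src G (gE e)) = src G' e")
  case True
  hence "gV (tgt G (gE e)) = tgt G' e" using contraction_ends[OF c e] by auto
  thus ?thesis using pe g[OF V(1) True] g[OF V(2)] True e by (simp add: push_flow_def)
 next
  case False
  hence "gV (src G (gE e)) = tgt G' e" "gV (tgt G (gE e)) = src G' e" using contraction_ends[OF c e] by auto
  thus ?thesis using pe g[OF V(1)] g[OF V(2)] False e by (simp add: push_flow_def)
 qed
qed

text \<open>With positive lengths the potential increases strictly along the flow. This is how
  acyclicity is recovered after a contraction, which in general does not preserve it.\<close>

lemma acyclic_of_potential:
 assumes fl: "is_flow G \<phi>" and p: "potential G \<phi> z f" and z: "!!e. e:edges G ==> z e > 0"
 shows "acyclic_flow G \<phi>"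
proof -
 let ?Z = "{e:edges G. \<phi> e = 0}"
 define comp where "comp v = (adj G ?Z)^*``{v}" for v
 define m where "m c = f (SOME x. x:c)" for c
 have mc: "m (comp v) = f v" for v
 proof -
  have "(SOME x. x:comp v):comp v" by (rule someI[of _ v]) (simp add: comp_def)
  hence "(v, SOME x. x:comp v):(adj G ?Z)^*" by (simp add: comp_def)
  hence "f v = f (SOME x. x:comp v)"
  proof (rule adj_rtrancl_invariant)
   fix e assume "e:?Z"
   hence "f (tgt G e) - f (src G e) = of_int (\<phi> e) * z e" "\<phi> e = 0" using p by (simp_all add: potential_def)
   thus "f (src G e) = f (tgt G e)" by simp
  qed
  thus ?thesis by (simp add: m_def)
 qed
 let ?r = "{(comp (flow_src G \<phi> e), comp (flow_tgt G \<phi> e)) | e. e:edges G & \<phi> e ~= 0}"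
 have step: "m c < m d" if "(c, d):?r" for c d
 proof -
  from that obtain e where e: "e:edges G" "\<phi> e ~= 0" "c = comp (flow_src G \<phi> e)" "d = comp (flow_tgt G \<phi> e)" by blast
  have d: "f (tgt G e) - f (src G e) = of_int (\<phi> e) * z e" using p e by (simp add: potential_def)
  have "f (flow_src G \<phi> e) < f (flow_tgt G \<phi> e)"
  proof (cases "\<phi> e > 0")
   case True
   hence "of_int (\<phi> e) * z e > 0" using z[OF e(1)] by simp
   thus ?thesis using d True by (simp add: flow_src_def flow_tgt_def dart_src_def dart_tgt_def)
  next
   case False
   hence "of_int (\<phi> e) * z e < 0" using z[OF e(1)] e(2) by (simp add: mult_less_0_iff)
   thus ?thesis using d False e(2) by (simp add: flow_src_def flow_tgt_def dart_src_def dart_tgt_def)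
  qed
  thus ?thesis using e mc by simp
 qed
 have "m c < m d" if "(c, d):?r^+" for c d using that by (induction rule: trancl_induct) (use step less_trans in blast)+
 hence "acyclic ?r" unfolding acyclic_def by blast
 thus ?thesis unfolding acyclic_flow_def Let_def comp_def using fl by blast
qed

lemma adj_edges_update [simp]: "adj (\<G>\<lparr>edges := S\<rparr>) T = adj \<G> T" by (simp add: adj_def)

lemma nondisconnecting_contraction:
 assumes c: "contraction \<G> \<G>' iV iE" and wf: "wf_graph \<G>" and n: "nondisconnecting \<G> S"
  and S': "S' <= edges \<G>'" "iE`S' <= S"
 shows "nondisconnecting \<G>' S'" unfolding nondisconnecting_def connected_graph_def
proof (intro conjI ballI S'(1))
 note cD = contractionD[OF c]
 show "verts (\<G>'\<lparr>edges := edges \<G>' - S'\<rparr>) ~= {}" using wf_graphD(4)[OF contraction_wf[OF c wf]] by (simp add: connected_graph_def)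
 fix x y assume "x:verts (\<G>'\<lparr>edges := edges \<G>' - S'\<rparr>)" "y:verts (\<G>'\<lparr>edges := edges \<G>' - S'\<rparr>)"
 hence "x:iV`verts \<G>" "y:iV`verts \<G>" using cD(1) by simp_all
 then obtain u v where uv: "u:verts \<G>" "v:verts \<G>" "x = iV u" "y = iV v" by blast
 have "(u, v):(adj \<G> (edges \<G> - S))^*" using n uv by (simp add: nondisconnecting_def connected_graph_def)
 from contraction_push_path[OF c wf_graphD(3)[OF wf] _ this]
 have "(x, y):(adj \<G>' {e:edges \<G>'. iE e:edges \<G> - S})^*" using uv by blast
 also have "... <= (adj \<G>' (edges \<G>' - S'))^*" using S'(2) by (intro rtrancl_mono adj_mono) auto
 finally show "(x, y):(adj (\<G>'\<lparr>edges := edges \<G>' - S'\<rparr>) (edges (\<G>'\<lparr>edges := edges \<G>' - S'\<rparr>)))^*" by simp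
qed

text \<open>A pruned edge is the only one at its leaf, so removing it disconnects the graph; no
  pruned edge can belong to \<open>S\<close>.\<close>

lemma nondisconnecting_core:
 assumes "prunes \<G> \<C> r" and wf: "wf_graph \<G>" and n: "nondisconnecting \<G> S"
 shows "nondisconnecting \<C> S" using assms(1)
proof (induction rule: prunes.induct)
 case prunes_refl show ?case by (rule n)
next
 case (prunes_step \<C> r v e u)
 let ?D = "\<C>\<lparr>verts := verts \<C> - {v}, edges := edges \<C> - {e}, leg := (%i. if leg \<C> i = v then u else leg \<C> i)\<rparr>"
 have wfD: "wf_graph \<C>" using prunesD(1)[OF prunes_step.hyps(1) wf] specialization_wf wf by blast
 note one = valence_one_edge[OF wf_graphD(2)[OF wfD] prunes_step.hyps(3,6,7)]
 have u: "u:verts \<C>" using prunes_step.hyps(7) edge_ends[OF wfD prunes_step.hyps(6)] by (auto simp: doubleton_eq_iff)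
 have S: "S <= edges \<C>" and conn: "!!x y. x:verts \<C> ==> y:verts \<C> ==> (x, y):(adj \<C> (edges \<C> - S))^*"
  using prunes_step.IH by (auto simp: nondisconnecting_def connected_graph_def)
 have eS: "e ~: S"
 proof
  assume e: "e:S"
  have "(v, u):(adj \<C> (edges \<C> - S))^*" using conn u prunes_step.hyps(2) by blast
  thus False
  proof (cases rule: converse_rtranclE)
   case base thus ?thesis using one(1) by simp
  next
   case (step y)
   then obtain e' where "e':edges \<C> - S" "src \<C> e' = v \<or> tgt \<C> e' = v" by (auto simp: adj_def)
   thus ?thesis using one(2)[of e'] e by auto
  qed
 qed
 have "(x, y):(adj \<C> (edges \<C> - {e} - S))^*" if xy: "x:verts \<C> - {v}" "y:verts \<C> - {v}" for x y
 proof -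
  let ?f = "%z. if z = v then u else z"
  have "(x, y):(adj \<C> (edges \<C> - S))^*" using conn xy by blast
  hence "(?f x, ?f y):(adj \<C> (edges \<C> - {e} - S))^*"
  proof (rule adj_rtrancl_map)
   fix e' assume e': "e':edges \<C> - S"
   show "(?f (src \<C> e'), ?f (tgt \<C> e')):(adj \<C> (edges \<C> - {e} - S))^*"
   proof (cases "e' = e")
    case True
    hence "?f (src \<C> e') = ?f (tgt \<C> e')" using prunes_step.hyps(7) by (auto simp: doubleton_eq_iff)
    thus ?thesis by simp
   next
    case False
    hence m: "e':edges \<C> - {e} - S" "src \<C> e' ~= v" "tgt \<C> e' ~= v" using e' one(2)[of e'] by auto
    from adj_edge(1)[OF m(1), of \<C>] show ?thesis using m by simp
   qed
  qed
  thus ?thesis using xy by simp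
 qed
 note path = this
 have adj: "adj (?D\<lparr>edges := X\<rparr>) T = adj \<C> T" for X T by (simp add: adj_def)
 show ?case unfolding nondisconnecting_def connected_graph_def adj
 proof (intro conjI ballI)
  show "S <= edges ?D" using S eS by auto
  show "verts (?D\<lparr>edges := edges ?D - S\<rparr>) ~= {}" using u one(1) by auto
  fix x y assume "x:verts (?D\<lparr>edges := edges ?D - S\<rparr>)" "y:verts (?D\<lparr>edges := edges ?D - S\<rparr>)"
  thus "(x, y):(adj \<C> (edges (?D\<lparr>edges := edges ?D - S\<rparr>)))^*" using path[of x y] by simp
 qed
qed

section \<open>Keeping a single leg, and the induced polarization\<close>

lemma only_leg0_simps [simp]:
 "verts (only_leg0 \<G>) = verts \<G>" "edges (only_leg0 \<G>) = edges \<G>" "src (only_leg0 \<G>) = src \<G>" "tgt (only_leg0 \<G>) = tgt \<G>"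
 "wt (only_leg0 \<G>) = wt \<G>" "nlegs (only_leg0 \<G>) = 1" "leg (only_leg0 \<G>) = leg \<G>"
 "adj (only_leg0 \<G>) S = adj \<G> S" "sub_genus (only_leg0 \<G>) V E = sub_genus \<G> V E"
 "valence (only_leg0 \<G>) v = valence \<G> v" "omega_graph (only_leg0 \<G>) v = omega_graph \<G> v"
 by (simp_all add: only_leg0_def adj_def sub_genus_def valence_def omega_graph_def)

lemma specialization_only_leg0:
 assumes "specialization \<G> \<G>' iV iE" "nlegs \<G> > 0" shows "specialization (only_leg0 \<G>) (only_leg0 \<G>') iV iE"
 using assms unfolding specialization_def only_leg0_simps by simp

lemma one_legged_only_leg0:
 assumes "\<G>:stable_graphs g (n + 1)" "g >= 1" shows "one_legged g (only_leg0 \<G>)"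
proof -
 note s = stable_graphsD[OF assms(1)]
 have "wf_graph (only_leg0 \<G>)" using s(1,5) by (simp add: wf_graph_def connected_graph_def)
 moreover have "genus (only_leg0 \<G>) = genus \<G>" by (simp add: genus_def)
 ultimately show ?thesis using s(4) assms(2) by (simp add: one_legged_def)
qed

lemma D_graph_specialization:
 assumes s: "specialization \<G> \<G>' iV iE" and wf: "wf_graph \<G>" and n: "nlegs \<G> = n + 1" and v: "v:verts \<G>'"
 shows "D_graph n a m \<G>' v = push_forward (verts \<G>) iV (D_graph n a m \<G>) v"
proof -
 note c = specializationD[OF s]
 let ?F = "{u:verts \<G>. iV u = v}"
 have A: "(SUM i:{i. i <= n & leg G i = w}. a i) = (\<Sum>i\<le>n. a i * of_bool (leg G i = w))" for G :: "('x, 'y) lgraph" and w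
 proof -
  have "{i. i <= n & leg G i = w} = {i:{..n}. leg G i = w}" by auto
  thus ?thesis by (simp only:) (auto simp: sum.inter_filter intro!: sum.cong)
 qed
 have "push_forward (verts \<G>) iV (D_graph n a m \<G>) v = (SUM u:?F. m * omega_graph \<G> u) + (SUM u:?F. \<Sum>i\<le>n. a i * of_bool (leg \<G> i = u))"
  unfolding push_forward_def sum.distrib[symmetric] by (rule sum.cong) (auto simp: D_graph_def A)
 also have "(SUM u:?F. m * omega_graph \<G> u) = m * omega_graph \<G>' v" unfolding specialization_omega[OF s wf v] push_forward_def by (simp add: sum_distrib_left)
 also have "(SUM u:?F. \<Sum>i\<le>n. a i * of_bool (leg \<G> i = u)) = (\<Sum>i\<le>n. SUM u:?F. a i * of_bool (leg \<G> i = u))" by (rule sum.swap)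
 also have "... = (\<Sum>i\<le>n. a i * of_bool (leg \<G>' i = v))"
 proof (rule sum.cong[OF refl])
  fix i assume "i:{..n}"
  hence "leg \<G> i:verts \<G>" "leg \<G>' i = iV (leg \<G> i)" using wf_graphD(5)[OF wf] c(7) n by auto
  thus "(SUM u:?F. a i * of_bool (leg \<G> i = u)) = a i * of_bool (leg \<G>' i = v)"
   using wf_graphD(1)[OF wf] by (simp add: of_bool_def if_distrib sum.delta cong: if_cong)
 qed
 finally have R: "push_forward (verts \<G>) iV (D_graph n a m \<G>) v = m * omega_graph \<G>' v + (\<Sum>i\<le>n. a i * of_bool (leg \<G>' i = v))" .
 show ?thesis unfolding R D_graph_def A using v by simp
qed

lemma universal_polarizationD:
 assumes u: "universal_polarization g d \<mu>" and "\<G>:stable_graphs g 1" "\<G>':stable_graphs g 1"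
  "specialization \<G> \<G>' iV iE" "v:verts \<G>'"
 shows "\<mu> \<G>' v = push_forward (verts \<G>) iV (\<mu> \<G>) v"
 using u[unfolded universal_polarization_def, THEN conjunct2, THEN bspec, OF assms(2), THEN bspec, OF assms(3),
  THEN spec, THEN spec, THEN mp, OF assms(4)] assms(5) by (rule bspec)

text \<open>Two stable reductions of the same graph are linked by the specialization that the
  identity induces on their stable models, and universality of \<open>\<mu>\<close> identifies the
  polarizations. Hence the definite description in \<open>induced_polarization\<close> is
  meaningful.\<close>

lemma induced_polarization_eq:
 assumes u: "universal_polarization g d \<mu>" and o: "one_legged g (only_leg0 \<G>)"
  and r: "stable_reduction (only_leg0 \<G>) \<C> r \<G>' j P"
 shows "induced_polarization \<mu> \<G> = push_forward (verts \<G>') j (\<mu> \<G>')" unfolding induced_polarization_def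
proof (rule the_equality)
 show "\<exists>\<C> r \<G>'' j' P. stable_reduction (only_leg0 \<G>) \<C> r \<G>'' j' P &
   push_forward (verts \<G>') j (\<mu> \<G>') = push_forward (verts \<G>'') j' (\<mu> \<G>'')" using r by blast
 fix \<nu> assume "\<exists>\<C> r \<G>'' j' P. stable_reduction (only_leg0 \<G>) \<C> r \<G>'' j' P & \<nu> = push_forward (verts \<G>'') j' (\<mu> \<G>'')"
 then obtain \<C>1 r1 \<G>1 j1 P1 where r1: "stable_reduction (only_leg0 \<G>) \<C>1 r1 \<G>1 j1 P1" and \<nu>: "\<nu> = push_forward (verts \<G>1) j1 (\<mu> \<G>1)" by blast
 interpret chains_specialization \<G>' \<C> j P \<G>1 \<C>1 j1 P1 id id by (rule stable_reduction_specialization(1)[OF specialization_id[OF one_leggedD(1)[OF o]] o r r1])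
 note st = stable_reductionD(6)[OF r o] and st1 = stable_reductionD(6)[OF r1 o]
 have mu: "\<mu> \<G>1 v = push_forward (verts \<G>') sV (\<mu> \<G>') v" if "v:verts \<G>1" for v
  by (rule universal_polarizationD[OF u st st1 chain_specialization that])
 show "\<nu> = push_forward (verts \<G>') j (\<mu> \<G>')"
 proof
  fix w
  have "\<nu> w = push_forward (verts \<G>1) j1 (push_forward (verts \<G>') sV (\<mu> \<G>')) w" unfolding \<nu> by (rule push_forward_cong) (use mu in auto)
  also have "... = push_forward (verts \<G>') (j1 \<circ> sV) (\<mu> \<G>') w" by (rule push_forward_comp) (use wf_graphD(1) C.wfH C'.wfH sV_surj in auto)
  also have "... = push_forward (verts \<G>') j (\<mu> \<G>') w" by (rule push_forward_cong) (use sV(2) in auto)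
  finally show "\<nu> w = push_forward (verts \<G>') j (\<mu> \<G>') w" .
 qed
qed

lemma induced_polarization_specialization:
 assumes u: "universal_polarization g d \<mu>" and g: "g >= 1" and \<G>: "\<G>:stable_graphs g (n + 1)"
  and s: "specialization \<G> \<G>1 iV iE" and \<G>1: "\<G>1:stable_graphs g (n + 1)" and v: "v:verts \<G>1"
 shows "induced_polarization \<mu> \<G>1 v = push_forward (verts \<G>) iV (induced_polarization \<mu> \<G>) v"
proof -
 note o = one_legged_only_leg0[OF \<G> g] and o1 = one_legged_only_leg0[OF \<G>1 g]
 obtain \<C> r \<G>' j P where r: "stable_reduction (only_leg0 \<G>) \<C> r \<G>' j P" using stable_reduction_exists[OF o] by blast
 obtain \<C>1 r1 \<G>1' j1 P1 where r1: "stable_reduction (only_leg0 \<G>1) \<C>1 r1 \<G>1' j1 P1" using stable_reduction_exists[OF o1] by blast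
 have "nlegs \<G> > 0" using stable_graphsD(5)[OF \<G>] by simp
 note s0 = specialization_only_leg0[OF s this]
 interpret chains_specialization \<G>' \<C> j P \<G>1' \<C>1 j1 P1 iV iE by (rule stable_reduction_specialization(1)[OF s0 o r r1])
 note st = stable_reductionD(6)[OF r o] and st1 = stable_reductionD(6)[OF r1 o1]
 have mu: "\<mu> \<G>1' v = push_forward (verts \<G>') sV (\<mu> \<G>') v" if "v:verts \<G>1'" for v
  by (rule universal_polarizationD[OF u st st1 chain_specialization that])
 have sub: "verts \<C> <= verts \<G>" using prunesD(2)[OF stable_reductionD(7)[OF r o] one_leggedD(1)[OF o]] by simp
 have "push_forward (verts \<G>) iV (induced_polarization \<mu> \<G>) v = push_forward (verts \<G>') (iV \<circ> j) (\<mu> \<G>') v"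
  unfolding induced_polarization_eq[OF u o r] by (rule push_forward_comp) (use wf_graphD(1)[OF C.wfH] wf_graphD(1)[OF stable_graphsD(1)[OF \<G>]] C.refD(2) sub in auto)
 also have "... = push_forward (verts \<G>') (j1 \<circ> sV) (\<mu> \<G>') v" by (rule push_forward_cong) (use sV(2) in auto)
 also have "... = push_forward (verts \<G>1') j1 (push_forward (verts \<G>') sV (\<mu> \<G>')) v"
  by (rule push_forward_comp[symmetric]) (use wf_graphD(1) C.wfH C'.wfH sV_surj in auto)
 also have "... = push_forward (verts \<G>1') j1 (\<mu> \<G>1') v" by (rule push_forward_cong) (use mu in auto)
 finally show ?thesis unfolding induced_polarization_eq[OF u o1 r1] by simp
qed

subsection \<open>Straightening quasistable pseudo-divisors\<close>

lemma quasistable_cong: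
 assumes "!!v. v:verts G ==> \<mu> v = \<mu>' v" "!!v. v:verts G ==> D v = D' v"
 shows "quasistable G v0 \<mu> D \<longleftrightarrow> quasistable G v0 \<mu>' D'"
proof -
 have s: "(SUM v:W. D v) = (SUM v:W. D' v)" "(SUM v:W. \<mu> v) = (SUM v:W. \<mu>' v)" if "W <= verts G" for W by (rule sum.cong; use assms that in auto)+
 hence "beta G \<mu> D W = beta G \<mu>' D' W" if "W \<subset> verts G" for W using that unfolding beta_def by auto
 thus ?thesis unfolding quasistable_def using s[OF order_refl] by auto
qed

lemma (in chains) quasistable_good:
 assumes q: "quasistable G (j v0) \<mu> D" and v0: "v0:verts H"
  and D: "!!v. v:verts G ==> v ~: good ==> D v = 0" and \<mu>: "!!v. v:verts G ==> v ~: good ==> \<mu> v = 0"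
 shows "quasistable H v0 (%v. \<mu> (j v)) (%v. D (j v))"
proof -
 have fin: "finite (verts G)" "finite (edges G)" "finite (edges H)" using wfG wfH wf_graphD by auto
 have sums: "(SUM v:U. D v) = (SUM w:W. D (j w))" "(SUM v:U. \<mu> v) = (SUM w:W. \<mu> (j w))"
  if U: "U <= verts G" "U \<inter> good = j`W" "W <= verts H" for U W
 proof -
  have inj: "inj_on j W" using refD(1) U(3) by (rule inj_on_subset)
  have fU: "finite U" using U(1) fin(1) finite_subset by blast
  have jU: "j`W <= U" using U(2) by blast
  have out: "v:verts G" "v ~: good" if "v:U - j`W" for v using that U(1) unfolding U(2)[symmetric] by blast+
  have "(SUM v:U. D v) = (SUM v:j`W. D v)" by (rule sum.mono_neutral_right[OF fU jU]) (simp add: D out)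
  thus "(SUM v:U. D v) = (SUM w:W. D (j w))" using inj by (simp add: sum.reindex)
  have "(SUM v:U. \<mu> v) = (SUM v:j`W. \<mu> v)" by (rule sum.mono_neutral_right[OF fU jU]) (simp add: \<mu> out)
  thus "(SUM v:U. \<mu> v) = (SUM w:W. \<mu> (j w))" using inj by (simp add: sum.reindex)
 qed
 show ?thesis unfolding quasistable_def
 proof (intro conjI allI impI)
  have "verts G \<inter> good = j`verts H" using refD(2) by blast
  from sums[OF order_refl this order_refl] show "real_of_int (SUM v:verts H. D (j v)) = (SUM v:verts H. \<mu> (j v))" using q by (simp add: quasistable_def)
  fix W assume W: "W \<subset> verts H"
  \<comment> \<open>A chain that starts in \<open>W\<close> is taken up to its last edge, so each
    chain is cut at most once, and only if its coarse edge is. The interior vertices added have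
    neither degree nor polarization.\<close>
  define U where "U = j`W \<union> {pt e i | e i. e:edges H & src H e:W & 0 < i & i < len e}"
  have U: "U <= verts G" unfolding U_def using refD(2) W pt_bad(1) by blast
  have Ug: "U \<inter> good = j`W" unfolding U_def using pt_bad(2) W by blast
  have mem_good: "j v:U \<longleftrightarrow> v:W" if v: "v:verts H" for v
  proof -
   have "j v:U \<longleftrightarrow> j v:U \<inter> good" using v by blast
   also have "... \<longleftrightarrow> v:W" unfolding Ug using refD(1) v W by (auto dest: inj_onD)
   finally show ?thesis .
  qed
  note cl = edge_ends[OF wfH]
  have mem: "pt e i:U \<longleftrightarrow> src H e:W" if e: "e:edges H" and i: "i < len e" for e i
  proof (cases "i = 0")
   case True thus ?thesis using mem_good[OF cl(1)[OF e]] pt_0[OF e] by simp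
  next
   case False
   hence "pt e i ~: j`W" using pt_bad(2)[OF e _ i] W by blast
   thus ?thesis unfolding U_def using pt_inj[OF e _ i] e i False by blast
  qed
  have "{a:edges G. (src G a:U) ~= (tgt G a:U)} <= (%e. ed e (len e - 1))`{e:edges H. (src H e:W) ~= (tgt H e:W)}"
  proof
   fix a assume a: "a:{a:edges G. (src G a:U) ~= (tgt G a:U)}"
   hence "a:edges G" by blast
   note c = ch_ix[OF this]
   have n: "(pt (ch a) (ix a):U) ~= (pt (ch a) (Suc (ix a)):U)" using ends_ed[OF c(1,2)] a unfolding c(3) by force
   hence l: "Suc (ix a) = len (ch a)" using mem[OF c(1), of "ix a"] mem[OF c(1), of "Suc (ix a)"] c(2) by (cases "Suc (ix a) < len (ch a)") auto
   hence "(src H (ch a):W) ~= (tgt H (ch a):W)" using n mem[OF c(1,2)] mem_good[OF cl(2)[OF c(1)]] pt_len[of "ch a"] by simp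
   moreover have "a = ed (ch a) (len (ch a) - 1)" using c(3) unfolding l[symmetric] by simp
   ultimately show "a:(%e. ed e (len e - 1))`{e:edges H. (src H e:W) ~= (tgt H e:W)}" using c(1) by blast
  qed
  hence "cut_size G U <= cut_size H W" unfolding cut_size_def by (rule surj_card_le[rotated]) (use fin in simp)
  hence b: "beta H (%v. \<mu> (j v)) (%v. D (j v)) W >= beta G \<mu> D U" unfolding beta_def using sums[OF U Ug] W by simp
  have "U \<subset> verts G"
  proof -
   obtain w where w: "w:verts H" "w ~: W" using W by blast
   hence "j w:verts G" "j w ~: U" using mem_good refD(2) by auto
   thus ?thesis using U by blast
  qed
  note qU = q[unfolded quasistable_def, THEN conjunct2, THEN spec, THEN mp, OF this]
  show "0 <= beta H (%v. \<mu> (j v)) (%v. D (j v)) W" using qU b by linarith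
  show "0 < beta H (%v. \<mu> (j v)) (%v. D (j v)) W" if "v0:W"
  proof -
   have "j v0:U" using mem_good[OF v0] that by blast
   thus ?thesis using qU b by linarith
  qed
 qed
qed

text \<open>The subdivided core \<open>G\<close> refines the stable model \<open>\<G>'\<close> along
  chains \<open>Q\<close>. It also refines a subdivision \<open>H\<close> of \<open>\<G>'\<close>,
  whose exceptional vertices are the support of the divisor inside chains. Straightening amounts to
  passing from the first refinement to the second.\<close>

locale straightening = P: chains \<G>' \<C> j P
 for \<G>' :: "('w, 'f) lgraph" and \<C> :: "('v, 'e) lgraph" and j P +
 fixes \<E> :: "'e set" and D :: "'v + 'e => int" and \<mu> :: "'v => real" and v0 :: 'w
 assumes \<E>: "\<E> <= edges \<C>" and v0: "v0:verts \<G>'" "v0 = leg \<G>' 0"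
  and quasi: "quasistable (subdivide \<C> \<E>) (Inl (j v0)) (case_sum \<mu> (%_. 0)) D"
  and \<mu>: "!!v. v:verts \<C> ==> v ~: j`verts \<G>' ==> \<mu> v = 0"
begin

abbreviation "G \<equiv> subdivide \<C> \<E>"

definition Q :: "'f => (('e \<times> bool) \<times> bool) list" where "Q e = expand (halves \<E>) (P e)"

lemma Q_chains: "chains \<G>' G (Inl \<circ> j) Q"
proof -
 have "refinement \<G>' G (Inl \<circ> j) (%e. expand (halves \<E>) (P e))"
  by (rule refinement_comp[OF P.ref subdivide_refinement[OF P.wfG \<E>] P.wfH P.wfG subdivide_wf[OF P.wfG \<E>]])
 thus ?thesis unfolding Q_def[abs_def] by (simp add: chains_def P.wfH subdivide_wf[OF P.wfG \<E>])
qed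

sublocale Q: chains \<G>' G "Inl \<circ> j" Q by (rule Q_chains)

lemma \<mu>_bad: "v:verts G ==> v ~: Q.good ==> case_sum \<mu> (%_. 0) v = 0" using \<mu> by (cases v) auto

text \<open>A block of consecutive interior vertices has polarization 0 and at most two edges
  leaving it, so quasistability gives a sum of at least -1. Its complement contains the base vertex,
  and there the strict inequality gives a sum below 1.\<close>

lemma chain_sum:
 assumes e: "e:edges \<G>'" and pq: "0 < p" "p <= q" "q < Q.len e"
 shows "(SUM i:{p..q}. D (Q.pt e i)):{-1, 0}"
proof -
 let ?W = "Q.pt e`{p..q}"
 let ?U = "verts G - ?W"
 note fin = wf_graphD(1,2)[OF Q.wfG]
 have bad: "Q.pt e i:verts G" "Q.pt e i ~: Q.good" if "i:{p..q}" for i using Q.pt_bad[OF e] that pq by auto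
 have W: "?W <= verts G" using bad by blast
 have inj: "inj_on (Q.pt e) {p..q}"
 proof (rule inj_onI)
  fix i i' assume "i:{p..q}" "i':{p..q}" "Q.pt e i = Q.pt e i'"
  thus "i = i'" using Q.pt_inj(2)[OF e _ _ e, of i i'] pq by simp
 qed
 have sD: "(SUM v:?W. D v) = (SUM i:{p..q}. D (Q.pt e i))" using inj by (simp add: sum.reindex)
 have s\<mu>: "(SUM v:?W. case_sum \<mu> (%_. 0) v) = 0" by (rule sum.neutral) (use bad \<mu>_bad in blast)
 have cutW: "cut_size G ?W <= 2"
 proof -
  have "{a:edges G. (src G a:?W) ~= (tgt G a:?W)} <= {Q.ed e (p - 1), Q.ed e q}"
  proof
   fix a assume a: "a:{a:edges G. (src G a:?W) ~= (tgt G a:?W)}"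
   hence "EX v:?W. incident G a v" unfolding incident_def by blast
   then obtain i where i: "i:{p..q}" "incident G a (Q.pt e i)" by blast
   have aE: "a:edges G" using a by blast
   have i': "0 < i" "i < Q.len e" using i pq by auto
   note ib = Q.incident_bad[OF aE i(2) e i']
   note c = Q.ch_ix[OF aE, unfolded ib(1)]
   have "Q.ix a = p - 1 \<or> Q.ix a = q"
   proof (rule ccontr)
    assume "\<not> ?thesis"
    hence "Q.ix a:{p..q}" "Suc (Q.ix a):{p..q}" using ib(2) i(1) by auto
    hence "Q.pt e (Q.ix a):?W" "Q.pt e (Suc (Q.ix a)):?W" by blast+
    hence "src G a:?W" "tgt G a:?W" using Q.ends_ed[OF c(1,2)] unfolding c(3) by metis+
    thus False using a by blast
   qed
   hence "Q.ed e (Q.ix a):{Q.ed e (p - 1), Q.ed e q}" by (elim disjE) simp_all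
   thus "a:{Q.ed e (p - 1), Q.ed e q}" unfolding c(3) .
  qed
  hence "cut_size G ?W <= card {Q.ed e (p - 1), Q.ed e q}" unfolding cut_size_def by (rule card_mono[rotated]) simp
  also have "... <= 2" by (simp add: card_insert_if)
  finally show ?thesis .
 qed
 have cutU: "cut_size G ?U = cut_size G ?W" unfolding cut_size_sum[OF fin(2)] by (rule sum.cong[OF refl]) (use edge_ends[OF Q.wfG] in auto)
 have v0G: "Inl (j v0):Q.good" using v0 by auto
 have vG: "Inl (j v0):verts G" by (rule subsetD[OF Q.refD(2) v0G])
 have vW: "Inl (j v0) ~: ?W"
 proof
  assume "Inl (j v0):?W"
  then obtain i where "i:{p..q}" "Inl (j v0) = Q.pt e i" by (rule imageE)
  thus False using bad(2)[of i] v0G by (simp only:)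
 qed
 have U0: "Inl (j v0):?U" using vG vW by (rule DiffI)
 have psub: "?W \<subset> verts G" using W vG vW by (metis psubsetI)
 note qW = quasi[unfolded quasistable_def, THEN conjunct2, THEN spec, THEN mp]
 have "beta G (case_sum \<mu> (%_. 0)) D ?W >= 0" by (rule qW[THEN conjunct1, OF psub])
 moreover have "beta G (case_sum \<mu> (%_. 0)) D ?W = real_of_int (SUM i:{p..q}. D (Q.pt e i)) - 0 + real (cut_size G ?W) / 2"
  unfolding beta_def sD s\<mu> by (rule refl)
 moreover have c2: "real (cut_size G ?W) / 2 <= 1" using cutW by simp
 ultimately have 1: "real_of_int (SUM i:{p..q}. D (Q.pt e i)) >= -1" by linarith
 have "Q.pt e p:?W" using pq by auto
 hence "?U \<subset> verts G" using subsetD[OF W] by (metis Diff_iff Diff_subset psubsetI)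
 hence b: "beta G (case_sum \<mu> (%_. 0)) D ?U > 0" by (rule qW[THEN conjunct2, THEN mp, OF _ U0])
 have dU: "(SUM v:?U. D v) = (SUM v:verts G. D v) - (SUM i:{p..q}. D (Q.pt e i))" unfolding sD[symmetric] by (rule sum_diff[OF fin(1) W])
 have mU: "(SUM v:?U. case_sum \<mu> (%_. 0) v) = (SUM v:verts G. case_sum \<mu> (%_. 0) v)" by (simp only: sum_diff[OF fin(1) W] s\<mu> diff_zero)
 have tot: "real_of_int (SUM v:verts G. D v) = (SUM v:verts G. case_sum \<mu> (%_. 0) v)" using quasi unfolding quasistable_def by (rule conjunct1)
 have "beta G (case_sum \<mu> (%_. 0)) D ?U = - real_of_int (SUM i:{p..q}. D (Q.pt e i)) + real (cut_size G ?W) / 2"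
  unfolding beta_def dU mU cutU of_int_diff tot by (simp del: subdivide_simps)
 hence "real_of_int (SUM i:{p..q}. D (Q.pt e i)) < 1" using b c2 by linarith
 hence "(SUM i:{p..q}. D (Q.pt e i)) = -1 \<or> (SUM i:{p..q}. D (Q.pt e i)) = 0" using 1 by linarith
 thus ?thesis by blast
qed

lemma D_bad: assumes "v:verts G" "v ~: Q.good" shows "D v:{-1, 0}"
proof -
 obtain e i where "e:edges \<G>'" "0 < i" "i < Q.len e" "v = Q.pt e i" using Q.pt_surj[OF assms] .
 thus ?thesis using chain_sum[of e i i] by simp
qed

text \<open>Interior values are -1 or 0, so two marks on a chain would bound a block with sum at
  most -2.\<close>

lemma mark_unique:
 assumes e: "e:edges \<G>'" and p: "0 < p" "p < Q.len e" "D (Q.pt e p) ~= 0" and q: "0 < q" "q < Q.len e" "D (Q.pt e q) ~= 0"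
 shows "p = q"
proof -
 have no: False if pq: "0 < p" "p < q" "q < Q.len e" "D (Q.pt e p) ~= 0" "D (Q.pt e q) ~= 0" for p q
 proof -
  have D: "D (Q.pt e i):{-1, 0}" if "i:{p..q}" for i using D_bad[of "Q.pt e i"] Q.pt_bad[OF e, of i] that pq by simp
  hence n: "D (Q.pt e p) = -1" "D (Q.pt e q) = -1" using D[of p] D[of q] pq by simp_all
  have "(SUM i:{p..q}. D (Q.pt e i)) <= (SUM i:{p, q}. D (Q.pt e i))"
  proof -
   have "(SUM i:{p..q}. - D (Q.pt e i)) >= (SUM i:{p, q}. - D (Q.pt e i))" by (rule sum_mono2) (use D pq in force)+
   thus ?thesis by (simp only: sum_negf)
  qed
  also have "... = -2" using n pq by simp
  finally show False using chain_sum[OF e pq(1) less_imp_le[OF pq(2)] pq(3)] by auto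
 qed
 show ?thesis using no[of p q] no[of q p] p q by (cases p q rule: linorder_cases) auto
qed

definition \<E>' :: "'f set" where "\<E>' = {e:edges \<G>'. \<exists>i. 0 < i & i < Q.len e & D (Q.pt e i) ~= 0}"

definition mark :: "'f => nat" where "mark e = (THE i. 0 < i & i < Q.len e & D (Q.pt e i) ~= 0)"

lemma \<E>'_edges: "\<E>' <= edges \<G>'" by (auto simp: \<E>'_def)

lemma mark: assumes "e:\<E>'" shows "0 < mark e" "mark e < Q.len e" "D (Q.pt e (mark e)) = -1"
proof -
 obtain i where e: "e:edges \<G>'" and i: "0 < i" "i < Q.len e" "D (Q.pt e i) ~= 0" using assms by (auto simp: \<E>'_def)
 have "mark e = i" unfolding mark_def
 proof (rule the_equality)
  show "k = i" if "0 < k & k < Q.len e & D (Q.pt e k) ~= 0" for k using mark_unique[OF e _ _ _ i] that by blast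
 qed (use i in blast)
 thus "0 < mark e" "mark e < Q.len e" "D (Q.pt e (mark e)) = -1" using i D_bad[OF Q.pt_bad[OF e i(1,2)]] by (simp_all del: subdivide_simps)
qed

lemma mark_eq: "e:edges \<G>' ==> 0 < i ==> i < Q.len e ==> D (Q.pt e i) ~= 0 ==> e:\<E>' & i = mark e"
 using mark_unique[of e i "mark e"] mark[of e] by (force simp: \<E>'_def)

definition D' :: "'w + 'f => int" where
 "D' w = (case w of Inl v => if v:verts \<G>' then D (Inl (j v)) else 0 | Inr e => if e:\<E>' then -1 else 0)"

definition jj :: "'w + 'f => 'v + 'e" where
 "jj w = (case w of Inl v => Inl (j v) | Inr e => Q.pt e (mark e))"

definition Q' :: "'f \<times> bool => (('e \<times> bool) \<times> bool) list" where
 "Q' h = (if fst h:\<E>' then if snd h then drop (mark (fst h)) (Q (fst h)) else take (mark (fst h)) (Q (fst h)) else Q (fst h))"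

lemma jj_simps [simp]: "jj (Inl v) = Inl (j v)" "jj (Inr e) = Q.pt e (mark e)" by (simp_all add: jj_def)

abbreviation "H \<equiv> subdivide \<G>' \<E>'"

lemma D'_jj: "w:verts H ==> D' w = D (jj w)" using mark(3) by (auto simp: D'_def)

lemma walk_take_drop:
 assumes cl: "closed_edges G" and w: "walk G u p v" and k: "k < length p"
 shows "walk G u (take k p) (dart_src G (p ! k))" "walk G (dart_src G (p ! k)) (drop k p) v"
proof -
 have "walk G u (take k p @ drop k p) v" using w by simp
 then obtain x where x: "walk G u (take k p) x" "walk G x (drop k p) v" unfolding walk_append[OF cl] by blast
 have "drop k p = p ! k # drop (Suc k) p" using k by (rule Cons_nth_drop_Suc[symmetric])
 hence "x = dart_src G (p ! k)" using x(2) by simp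
 thus "walk G u (take k p) (dart_src G (p ! k))" "walk G (dart_src G (p ! k)) (drop k p) v" using x by simp_all
qed

lemma interior_split:
 assumes k: "0 < k" "k < length p" shows "interior G p = interior G (take k p) + interior G (drop k p) + {#dart_tgt G (p ! (k - 1))#}"
proof -
 have "butlast p = take k p @ butlast (drop k p)" using k by (metis append_take_drop_id butlast_append drop_eq_Nil not_le)
 moreover have "take k p = butlast (take k p) @ [p ! (k - 1)]"
 proof -
  have "take k p ~= []" using k by auto
  moreover have "last (take k p) = p ! (k - 1)" using calculation k by (simp add: last_conv_nth)
  ultimately show ?thesis by (metis append_butlast_last_id)
 qed
 ultimately have "map (dart_tgt G) (butlast p) = map (dart_tgt G) (butlast (take k p)) @ [dart_tgt G (p ! (k - 1))] @ map (dart_tgt G) (butlast (drop k p))"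
  by (simp add: map_butlast[symmetric] del: butlast_take) (metis append.assoc list.map(1) list.map(2) map_append)
 thus ?thesis by simp
qed

lemma sum_H:
 fixes f :: "'f \<times> bool => 'z::comm_monoid_add"
 shows "(SUM h:edges H. f h) = (SUM e:edges \<G>'. f (e, False) + (if e:\<E>' then f (e, True) else 0))"
proof -
 have fin: "finite (edges \<G>')" "finite \<E>'" using wf_graphD(2)[OF P.wfH] \<E>'_edges finite_subset by blast+
 have "(SUM h:edges H. f h) = (SUM h:(%e. (e, False))`edges \<G>'. f h) + (SUM h:(%e. (e, True))`\<E>'. f h)"
  unfolding subdivide_edges[OF \<E>'_edges] by (rule sum.union_disjoint) (use fin in auto)
 also have "... = (SUM e:edges \<G>'. f (e, False)) + (SUM e:\<E>'. f (e, True))" by (simp add: sum.reindex inj_on_def)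
 also have "(SUM e:\<E>'. f (e, True)) = (SUM e:edges \<G>'. if e:\<E>' then f (e, True) else 0)"
  using \<E>'_edges fin by (simp add: sum.inter_restrict[symmetric] Int_absorb1)
 finally show ?thesis by (simp add: sum.distrib)
qed

text \<open>Chains are cut at their marks. The lengths of the halves of a marked edge are then
  lengths of chains, and the general results on refinements apply to them.\<close>

lemma R_refinement: "refinement H G jj Q'"
proof -
 have wfH: "wf_graph H" by (rule subdivide_wf[OF P.wfH \<E>'_edges])
 have finH: "finite (edges \<G>')" "finite \<E>'" using wf_graphD(2)[OF P.wfH] \<E>'_edges finite_subset by blast+
 note m = Q.ref[unfolded refinement_iff_mset[OF wf_graphD(2)[OF P.wfH] wf_graphD(2,1)[OF Q.wfG]]]
 have pm: "Q.pt e (mark e):verts G" "Q.pt e (mark e) ~: Q.good" if "e:\<E>'" for e using Q.pt_bad[OF _ mark(1,2)[OF that]] \<E>'_edges that by auto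
 have pinj: "e = e'" if "e:\<E>'" "e':\<E>'" "Q.pt e (mark e) = Q.pt e' (mark e')" for e e'
  using Q.pt_inj(1)[OF _ mark(1,2)[OF that(1)] _ mark(1,2)[OF that(2)] that(3)] \<E>'_edges that by auto
 have jjV: "jj`verts H = Q.good \<union> (%e. Q.pt e (mark e))`\<E>'" by (auto simp: image_Un image_image)
 have e1: "(SUM h:edges H. mset (map fst (Q' h))) = mset_set (edges G)"
 proof -
  have "mset (map fst (Q' (e, False))) + (if e:\<E>' then mset (map fst (Q' (e, True))) else {#}) = mset (map fst (Q e))" for e
  proof (cases "e:\<E>'")
   case True
   have "mset (map fst (take (mark e) (Q e))) + mset (map fst (drop (mark e) (Q e))) = mset (map fst (take (mark e) (Q e) @ drop (mark e) (Q e)))"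
    by (simp only: map_append mset_append)
   thus ?thesis using True by (simp add: Q'_def)
  qed (simp add: Q'_def)
  thus ?thesis unfolding sum_H using m by simp
 qed
 have e2: "(SUM h:edges H. interior G (Q' h)) = mset_set (verts G - jj`verts H)"
 proof -
  have "interior G (Q' (e, False)) + (if e:\<E>' then interior G (Q' (e, True)) else {#}) + (if e:\<E>' then {#Q.pt e (mark e)#} else {#}) = interior G (Q e)"
   if "e:edges \<G>'" for e
  proof (cases "e:\<E>'")
   case True
   have "dart_tgt G (Q e ! (mark e - 1)) = Q.pt e (mark e)" using Q.dart_tgt_pt[OF that, of "mark e - 1"] mark[OF True] by simp
   thus ?thesis using interior_split[OF mark(1,2)[OF True]] True by (simp add: Q'_def)
  qed (simp add: Q'_def)
  hence "(SUM h:edges H. interior G (Q' h)) + (SUM e:edges \<G>'. if e:\<E>' then {#Q.pt e (mark e)#} else {#}) = (SUM e:edges \<G>'. interior G (Q e))"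
   unfolding sum_H sum.distrib[symmetric] by (intro sum.cong) auto
  also have "... = mset_set (verts G - Q.good)" using m by simp
  also have "(SUM e:edges \<G>'. if e:\<E>' then {#Q.pt e (mark e)#} else {#}) = (SUM e:\<E>'. {#Q.pt e (mark e)#})"
   using \<E>'_edges finH by (simp add: sum.inter_restrict[symmetric] Int_absorb1)
  also have "... = mset_set ((%e. Q.pt e (mark e))`\<E>')" by (rule sum_singleton_mset[OF finH(2)]) (use pinj in "auto simp: inj_on_def")
  finally have "(SUM h:edges H. interior G (Q' h)) + mset_set ((%e. Q.pt e (mark e))`\<E>') = mset_set (verts G - Q.good)" .
  note eq = this
  have "(SUM h:edges H. interior G (Q' h)) = mset_set (verts G - Q.good) - mset_set ((%e. Q.pt e (mark e))`\<E>')"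
   unfolding eq[symmetric] by (rule add_diff_cancel_right'[symmetric])
  also have "... = mset_set (verts G - Q.good - (%e. Q.pt e (mark e))`\<E>')" by (rule mset_set_Diff[symmetric]) (use wf_graphD(1)[OF Q.wfG] pm in auto)
  also have "verts G - Q.good - (%e. Q.pt e (mark e))`\<E>' = verts G - jj`verts H" unfolding jjV by blast
  finally show ?thesis .
 qed
 show ?thesis unfolding refinement_iff_mset[OF wf_graphD(2)[OF wfH] wf_graphD(2,1)[OF Q.wfG]]
 proof (intro conjI e1 e2 ballI allI impI)
  show "inj_on jj (verts H)"
  proof (rule inj_onI)
   fix u w assume uw: "u:verts H" "w:verts H" "jj u = jj w"
   have "(Inl \<circ> j) v ~= Q.pt e (mark e)" if "v:verts \<G>'" "e:\<E>'" for v e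
   proof
    assume eq: "(Inl \<circ> j) v = Q.pt e (mark e)"
    have "Q.pt e (mark e):Q.good" by (rule subst[OF eq, of "%x. x:Q.good"]) (rule imageI[OF that(1)])
    thus False using pm(2)[OF that(2)] by contradiction
   qed
   thus "u = w" using uw pinj inj_onD[OF P.refD(1)] by (cases u; cases w) (auto, force+)
  qed
  show "jj`verts H <= verts G" unfolding jjV using pm(1) Q.refD(2) by blast
  fix h assume h: "h:edges H"
  obtain e b where eb: "h = (e, b)" "e:edges \<G>'" "b --> e:\<E>'" using h by auto
  note w = Q.refD(7,8)[OF eb(2)]
  have cl: "closed_edges G" using Q.wfG by (rule wf_graphD)
  have pt: "e:\<E>' ==> dart_src G (Q e ! mark e) = Q.pt e (mark e)" using Q.dart_src_pt mark(2) by blast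
  show "Q' h ~= []" using eb w(1) mark[of e] by (auto simp: Q'_def)
  show "walk G (jj (src H h)) (Q' h) (jj (tgt H h))" using w(2) walk_take_drop[OF cl w(2) mark(2)] pt eb by (auto simp: Q'_def)
 next
  show "wt G (jj w) = wt H w" if "w:verts H" for w
  proof (cases w)
   case (Inl v) thus ?thesis using that P.refD(3) by auto
  next
   case (Inr e)
   hence "e:\<E>'" using that by auto
   thus ?thesis using Inr Q.refD(4)[OF pm] by simp
  qed
  show "wt G v = 0" if "v:verts G - jj`verts H" for v using that Q.refD(4)[of v] unfolding jjV by blast
  show "nlegs G = nlegs H" using P.refD(5) by simp
  show "leg G i = jj (leg H i)" if "i < nlegs H" for i using that P.refD(6) by simp
 qed
qed

lemma R_chains: "chains H G jj Q'" by (simp add: chains_def R_refinement Q.wfG subdivide_wf[OF P.wfH \<E>'_edges])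

sublocale R: chains H G jj Q' by (rule R_chains)

text \<open>This describes the good vertices without reference to \<open>mark\<close>, in terms that
  can be compared along a specialization.\<close>

lemma R_good: assumes u: "u:verts G" shows "u:R.good \<longleftrightarrow> u:Q.good \<or> D u ~= 0"
proof
 assume "u:R.good"
 then obtain w where w: "w:verts H" "u = jj w" by blast
 thus "u:Q.good \<or> D u ~= 0" using mark(3) by (cases w) auto
next
 assume a: "u:Q.good \<or> D u ~= 0"
 show "u:R.good"
 proof (cases "u:Q.good")
  case True
  then obtain v where "v:verts \<G>'" "u = jj (Inl v)" by auto
  thus ?thesis by (intro image_eqI[of _ _ "Inl v"]) simp_all
 next
  case False
  obtain e i where ei: "e:edges \<G>'" "0 < i" "i < Q.len e" "u = Q.pt e i" using Q.pt_surj[OF u False] .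
  hence "e:\<E>'" "u = jj (Inr e)" using mark_eq[of e i] a False by auto
  thus ?thesis by (intro image_eqI[of _ _ "Inr e"]) simp_all
 qed
qed

lemma quasistable_pseudo: "quasistable_pseudo \<G>' (%v. \<mu> (j v)) \<E>' D'" unfolding quasistable_pseudo_def
proof
 show "pseudo_divisor \<G>' \<E>' D'" using \<E>'_edges by (auto simp: pseudo_divisor_def D'_def split: sum.splits)
 have "quasistable H (Inl v0) (%w. case_sum \<mu> (%_. 0) (jj w)) (%w. D (jj w))"
 proof (rule R.quasistable_good)
  show "quasistable G (jj (Inl v0)) (case_sum \<mu> (%_. 0)) D" using quasi by simp
  show "Inl v0:verts H" using v0 by simp
  fix u assume u: "u:verts G" "u ~: R.good"
  hence "u ~: Q.good" "D u = 0" using R_good by blast+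
  thus "D u = 0" "case_sum \<mu> (%_. 0) u = 0" using \<mu>_bad u by blast+
 qed
 moreover have "case_sum \<mu> (%_. 0) (jj w) = case_sum (%v. \<mu> (j v)) (%_. 0) w" if w: "w:verts H" for w
 proof (cases w)
  case (Inr e)
  hence e: "e:\<E>'" using w by auto
  hence "e:edges \<G>'" using \<E>'_edges by blast
  note Q.pt_bad[OF this mark(1,2)[OF e]]
  from \<mu>_bad[OF this] show ?thesis using Inr by (simp only: jj_simps sum.case)
 qed simp
 ultimately show "quasistable H (Inl (leg \<G>' 0)) (case_sum (%v. \<mu> (j v)) (%_. 0)) D'"
  using quasistable_cong[of H "case_sum (%v. \<mu> (j v)) (%_. 0)" "%w. case_sum \<mu> (%_. 0) (jj w)" D' "%w. D (jj w)" "Inl v0"]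
   D'_jj v0(2) by (simp del: subdivide_simps)
qed

lemma expand_fst: "d:set (expand (halves \<E>) p) ==> fst (fst d):fst`set p" by (auto simp: expand_def halves_def rev_path_def split: if_splits) force+

lemma chain_edges_fst:
 assumes h: "h:edges H" and a: "a:R.chain_edges h" shows "fst a:P.chain_edges (fst h)"
proof -
 have fh: "fst h:edges \<G>'" using h by auto
 obtain i where i: "i < R.len h" "a = R.ed h i" using a unfolding R.chain_edges_ed[OF h] by blast
 hence "a:fst`set (Q' h)" by (auto simp: R.ed_def)
 moreover have "set (Q' h) <= set (Q (fst h))" by (auto simp: Q'_def dest: in_set_takeD in_set_dropD)
 ultimately obtain d where "d:set (Q (fst h))" "a = fst d" by blast
 hence "fst a:fst`set (P (fst h))" unfolding Q_def using expand_fst by blast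
 then obtain d' where "d':set (P (fst h))" "fst a = fst d'" by blast
 then obtain k where "k < P.len (fst h)" "fst a = P.ed (fst h) k" unfolding P.ed_def in_set_conv_nth by blast
 thus ?thesis unfolding P.chain_edges_ed[OF fh] by blast
qed

end

locale straightening_specialization =
 S: straightening \<G>' \<C> j P \<E> D \<mu> v0 + S1: straightening \<G>1' \<C>1 j1 P1 \<E>1 D1 \<mu>1 v01 +
 X: chains_specialization \<G>' \<C> j P \<G>1' \<C>1 j1 P1 iV iE +
 C: subdivided_contraction \<C> \<C>1 iV iE \<E> z
 for \<G>' :: "('w, 'f) lgraph" and \<C> :: "('v, 'e) lgraph" and j P \<E> D \<mu> v0
  and \<G>1' :: "('w1, 'f1) lgraph" and \<C>1 :: "('v1, 'e1) lgraph" and j1 P1 \<E>1 D1 \<mu>1 v01 iV iE z +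
 assumes \<E>1: "\<E>1 = C.\<E>'" and Dneg: "!!e. e:\<E> ==> D (Inr e) = -1"
  and D1: "!!w. w:verts (subdivide \<C>1 \<E>1) ==> D1 w = push_forward (verts (subdivide \<C> \<E>)) C.gV D w"
begin

text \<open>Over a vertex that is bad for the chains \<open>S1.Q\<close> all values of
  \<open>D\<close> are -1 or 0, so their sum vanishes only if all of them do: marks cannot
  cancel.\<close>

lemma good_iff_sub:
 assumes x: "x:verts S1.G"
 shows "x:S1.R.good \<longleftrightarrow> (EX w:verts S.H. C.gV (S.jj w) = x)"
proof -
 have fin: "finite (verts S.G)" using S.Q.wfG by (rule wf_graphD)
 have "(EX w:verts S.H. C.gV (S.jj w) = x) \<longleftrightarrow> (EX u:S.R.good. C.gV u = x)" by blast
 also have "... \<longleftrightarrow> (EX u:verts S.G. C.gV u = x & (u:S.Q.good \<or> D u ~= 0))" using S.R_good S.R.refD(2) by blast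
 also have "... \<longleftrightarrow> x:S1.Q.good \<or> D1 x ~= 0"
 proof
  assume "EX u:verts S.G. C.gV u = x & (u:S.Q.good \<or> D u ~= 0)"
  then obtain u where u: "u:verts S.G" "C.gV u = x" "u:S.Q.good \<or> D u ~= 0" by blast
  show "x:S1.Q.good \<or> D1 x ~= 0"
  proof (rule disjCI)
   assume "\<not> D1 x ~= 0"
   hence z: "D1 x = 0" by simp
   show "x:S1.Q.good"
   proof (rule ccontr)
    assume n: "x ~: S1.Q.good"
    have nb: "u' ~: S.Q.good" if u': "u':verts S.G" "C.gV u' = x" for u'
    proof
     assume "u':S.Q.good"
     then obtain v where v: "v:verts \<G>'" "u' = Inl (j v)" by auto
     hence "x = Inl (iV (j v))" using u'(2) by simp
     moreover have "iV (j v):verts \<C>1" using X.conD(8) S.P.refD(2) v(1) by blast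
     ultimately have "x:S1.Q.good" using X.good_iff[of "iV (j v)"] v(1) by auto
     thus False using n by blast
    qed
    have "D u < 0" using S.D_bad[OF u(1) nb[OF u(1,2)]] u(3) nb[OF u(1,2)] by auto
    have "D1 x = (SUM u:{u:verts S.G. C.gV u = x}. D u)" using D1[OF x] by (simp add: push_forward_def)
    also have "... = D u + (SUM u:{u:verts S.G. C.gV u = x} - {u}. D u)" by (rule sum.remove) (use u fin in auto)
    also have "(SUM u:{u:verts S.G. C.gV u = x} - {u}. D u) <= 0" by (rule sum_nonpos) (use S.D_bad nb in force)
    finally show False using z \<open>D u < 0\<close> by simp
   qed
  qed
 next
  assume a: "x:S1.Q.good \<or> D1 x ~= 0"
  show "EX u:verts S.G. C.gV u = x & (u:S.Q.good \<or> D u ~= 0)"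
  proof (cases "x:S1.Q.good")
   case True
   then obtain w where w: "w:verts \<G>1'" "x = Inl (j1 w)" by auto
   hence "j1 w:verts \<C>1" using S1.P.refD(2) by blast
   then obtain v where v: "v:verts \<G>'" "iV (j v) = j1 w" using X.good_iff w(1) by blast
   hence "Inl (j v):verts S.G" using S.P.refD(2) by auto
   thus ?thesis using v w(2) by (intro bexI[of _ "Inl (j v)"]) auto
  next
   case False
   hence "(SUM u:{u:verts S.G. C.gV u = x}. D u) ~= 0" using a D1[OF x] by (simp add: push_forward_def)
   thus ?thesis using sum.neutral[of "{u:verts S.G. C.gV u = x}" D] by blast
  qed
 qed
 also have "... \<longleftrightarrow> x:S1.R.good" using S1.R_good[OF x] by blast
 finally show ?thesis by simp
qed

sublocale Y: chains_specialization S.H S.G S.jj S.Q' S1.H S1.G S1.jj S1.Q' C.gV C.gE by unfold_locales (use C.specialization_sub good_iff_sub in "simp_all only: \<E>1")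

lemma fst_sE: assumes h: "h:edges S1.H" shows "fst (Y.sE h) = X.sE (fst h)"
proof -
 note hH = Y.sE_edge[OF h]
 let ?a = "S1.R.ed h 0"
 have a: "?a:edges S1.G" "?a:S1.R.chain_edges h" using S1.R.ed_edge[OF h S1.R.len_pos[OF h]] S1.R.ch_ed[OF h S1.R.len_pos[OF h]] by (auto simp: S1.R.chain_edges_def)
 have "C.gE ?a:S.R.chain_edges (Y.sE h)" using Y.chain_edges_lift[OF h] a(2) by blast
 hence 1: "fst (C.gE ?a):S.P.chain_edges (fst (Y.sE h))" by (rule S.chain_edges_fst[OF hH])
 have f: "fst (C.gE ?a) = iE (fst ?a)" by (cases ?a) (simp add: C.gE_def)
 have fh: "fst h:edges \<G>1'" using h by auto
 have "fst ?a:S1.P.chain_edges (fst h)" by (rule S1.chain_edges_fst[OF h a(2)])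
 hence "iE (fst ?a):S.P.chain_edges (X.sE (fst h))" using X.chain_edges_lift[OF fh] by blast
 thus ?thesis using 1 f by (simp add: S.P.chain_edges_def)
qed

lemma sV_Inl: assumes v: "v:verts \<G>'" shows "Y.sV (Inl v) = Inl (X.sV v)"
proof -
 have "Inl v:verts S.H" "Inl (X.sV v):verts S1.H" using v X.sV(1) by auto
 thus ?thesis using Y.sV_eq_iff X.sV(2)[OF v] by simp
qed

lemma compatible: "compatible_specialization \<G>' S.\<E>' \<G>1' S1.\<E>' X.sV X.sE Y.sV Y.sE"
proof -
 \<comment> \<open>If the lifted edge carried no mark, both halves of \<open>e\<close> would have to
   lift to its only piece.\<close>
 have "X.sE e:S.\<E>'" if e: "e:S1.\<E>'" for e
 proof (rule ccontr)
  assume n: "X.sE e ~: S.\<E>'"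
  have h: "(e, False):edges S1.H" "(e, True):edges S1.H" using e S1.\<E>'_edges by auto
  have "Y.sE (e, b) = (X.sE e, False)" if "(e, b):edges S1.H" for b using fst_sE[OF that] Y.sE_edge[OF that] n by (cases "Y.sE (e, b)") auto
  hence "Y.sE (e, False) = Y.sE (e, True)" using h by simp
  thus False using inj_onD[OF Y.sE_inj _ h] by blast
 qed
 thus ?thesis unfolding compatible_specialization_def using X.chain_specialization Y.chain_specialization sV_Inl fst_sE by blast
qed

lemma D'_push: assumes w: "w:verts S1.H" shows "S1.D' w = push_forward (verts S.H) Y.sV S.D' w"
proof -
 have "S1.jj w:verts S1.G" using S1.R.refD(2) w by blast
 hence "S1.D' w = push_forward (verts S.G) C.gV D (S1.jj w)" using S1.D'_jj[OF w] D1 by simp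
 also have "... = push_forward (verts S.H) Y.sV (%w. D (S.jj w)) w" by (rule Y.push_forward_good[OF w]) (use S.R_good in blast)
 also have "... = push_forward (verts S.H) Y.sV S.D' w" by (rule push_forward_cong) (use S.D'_jj in auto)
 finally show ?thesis .
qed

end

subsection \<open>Specialization of admissible pairs\<close>

lemma flow_cone_iff:
 assumes "wf_graph \<G>" "\<E> <= edges \<G>"
 shows "x:flow_cone \<G> \<E> \<phi> \<longleftrightarrow> x:orthant (edges (subdivide \<G> \<E>)) & (\<exists>f. potential (subdivide \<G> \<E>) \<phi> x f)"
 using potential_iff_cycles[OF wf_graphD(3)[OF subdivide_wf[OF assms]] wf_graphD(4)[OF subdivide_wf[OF assms]], of \<phi> x]
 by (simp add: flow_cone_def dart_slope_def[abs_def])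

lemma merge_halves_extend_zero:
 assumes c: "compatible_specialization \<G> \<E> \<G>' \<E>' iV iE gV gE"
  and fin: "finite (edges (subdivide \<G> \<E>))" "finite (edges (subdivide \<G>' \<E>'))" "finite (edges \<G>')"
 shows "merge_halves \<G> \<E> (extend_zero (edges (subdivide \<G>' \<E>')) gE z) = extend_zero (edges \<G>') iE (merge_halves \<G>' \<E>' z)"
proof
 fix e
 have con: "contraction (subdivide \<G> \<E>) (subdivide \<G>' \<E>') gV gE" using c by (auto simp: compatible_specialization_def intro: specialization_contraction)
 have "merge_halves \<G> \<E> (extend_zero (edges (subdivide \<G>' \<E>')) gE z) e = push_forward (edges (subdivide \<G>' \<E>')) (fst \<circ> gE) z e"
  unfolding merge_halves_def by (rule push_forward_comp) (use fin contractionD(3)[OF con] in auto)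
 also have "... = push_forward (edges (subdivide \<G>' \<E>')) (iE \<circ> fst) z e" by (rule push_forward_cong) (use c in "auto simp: compatible_specialization_def")
 also have "... = extend_zero (edges \<G>') iE (merge_halves \<G>' \<E>' z) e" unfolding merge_halves_def by (rule push_forward_comp[symmetric]) (use fin in auto)
 finally show "merge_halves \<G> \<E> (extend_zero (edges (subdivide \<G>' \<E>')) gE z) e = extend_zero (edges \<G>') iE (merge_halves \<G>' \<E>' z) e" .
qed

lemma merge_halves_eq:
 "finite (edges \<G>) ==> e:edges \<G> ==> merge_halves \<G> \<E> z e = z (e, False) + (if e:\<E> then z (e, True) else 0)"
proof -
 assume "e:edges \<G>"
 hence "{h:edges (subdivide \<G> \<E>). fst h = e} = (if e:\<E> then {(e, False), (e, True)} else {(e, False)})" by auto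
 thus ?thesis by (simp add: merge_halves_def push_forward_def)
qed

lemma merge_halves_outside: "e ~: edges \<G> ==> merge_halves \<G> \<E> z e = 0" unfolding merge_halves_def by (rule push_forward_outside) auto

definition adm_divisor :: "('v, 'e) lgraph => ('v => int) => 'e set => ('e \<times> bool => int) => 'v + 'e => int" where
 "adm_divisor \<G> D0 \<E> \<phi> v = case_sum D0 (%_. 0) v + flow_div (subdivide \<G> \<E>) \<phi> v"

lemma AdmD:
 assumes "(\<E>, \<phi>):Adm \<G> \<mu> D0"
 shows "nondisconnecting \<G> \<E>" "acyclic_flow (subdivide \<G> \<E>) \<phi>" "is_flow (subdivide \<G> \<E>) \<phi>" "\<E> <= edges \<G>"
  "pseudo_divisor \<G> \<E> (adm_divisor \<G> D0 \<E> \<phi>)"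
  "quasistable (subdivide \<G> \<E>) (Inl (leg \<G> 0)) (case_sum \<mu> (%_. 0)) (adm_divisor \<G> D0 \<E> \<phi>)"
 using assms unfolding Adm_def quasistable_pseudo_def adm_divisor_def[abs_def] acyclic_flow_def nondisconnecting_def by auto

lemma flow_div_outside:
 assumes wf: "wf_graph G" and v: "v ~: verts G" shows "flow_div G \<phi> v = 0" unfolding flow_div_sum[OF wf_graphD(2)[OF wf]]
proof (rule sum.neutral, rule ballI)
 fix e assume "e:edges G"
 hence "src G e ~= v" "tgt G e ~= v" using edge_ends[OF wf, of e] v by blast+
 thus "\<phi> e * (of_bool (tgt G e = v) - of_bool (src G e = v)) = 0" by simp
qed

context subdivided_contraction
begin

definition \<phi>' :: "('e \<times> bool => int) => 'f \<times> bool => int" where "\<phi>' \<phi> = push_flow G G' gV gE \<phi>"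
definition z' :: "'f \<times> bool => real" where "z' h = (if h:edges G' then z (gE h) else 0)"

lemma z'_pos: "h:edges G' ==> z' h > 0" using gE_pos by (simp add: z'_def del: subdivide_simps)

lemma z'_orthant: "z':orthant (edges G')" using z'_pos by (auto simp: orthant_def z'_def less_imp_le simp del: subdivide_simps)

lemma z_extend:
 assumes "z:orthant (edges G)" shows "z = extend_zero (edges G') gE z'"
proof (rule extend_zero_eqI[OF gE_inj])
 show "z (gE h) = z' h" if "h:edges G'" for h using that by (simp add: z'_def del: subdivide_simps)
 show "z h = 0" if "h ~: gE`edges G'" for h
 proof (cases "h:edges G")
  case True
  hence "\<not> z h > 0" using that unfolding gE_image by blast
  thus ?thesis by (rule z_eq0[OF True])
 next
  case False thus ?thesis using assms unfolding orthant_def by blast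
 qed
qed

lemma adm_divisor_push:
 assumes D0: "!!v. v:verts \<G>' ==> D0' v = push_forward (verts \<G>) iV D0 v" and w: "w:verts G'"
 shows "adm_divisor \<G>' D0' \<E>' (\<phi>' \<phi>) w = push_forward (verts G) gV (adm_divisor \<G> D0 \<E> \<phi>) w"
proof -
 have "case_sum D0' (%_. 0) w = case_sum (push_forward (verts \<G>) iV D0) (%_. 0) w" using D0 w by auto
 hence "case_sum D0' (%_. 0) w = push_forward (verts G) gV (case_sum D0 (%_. 0)) w" using push_forward_case_sum[OF w, of D0] by simp
 moreover have "flow_div G' (\<phi>' \<phi>) w = push_forward (verts G) gV (flow_div G \<phi>) w"
  unfolding \<phi>'_def by (rule flow_div_push[OF contraction_sub subdivide_wf[OF wf \<E>]])
 ultimately show ?thesis unfolding adm_divisor_def[abs_def] by (simp only: push_forward_add)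
qed

lemma potential_sub:
 assumes "potential G \<phi> z f" shows "\<exists>f'. potential G' (\<phi>' \<phi>) z' f'"
proof -
 have zero: "z h = 0" if "h:edges G - gE`edges G'" for h using that unfolding gE_complement by blast
 have "potential G' (\<phi>' \<phi>) (%h. z (gE h)) (%x. f (inv_into (verts G) gV x))"
  unfolding \<phi>'_def by (rule potential_push[OF contraction_sub subdivide_wf[OF wf \<E>] assms zero])
 hence "potential G' (\<phi>' \<phi>) z' (%x. f (inv_into (verts G) gV x))" unfolding potential_def z'_def by simp
 thus ?thesis by blast
qed

text \<open>Quasistability and being nondisconnecting pass to contractions; acyclicity is read off
  from the pushed potential, since all remaining lengths are positive.\<close>

lemma Adm_sub:
 assumes adm: "(\<E>, \<phi>):Adm \<G> \<mu> D0" and pot: "potential G \<phi> z f"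
  and D0: "!!v. v:verts \<G>' ==> D0' v = push_forward (verts \<G>) iV D0 v"
  and D0_out: "!!v. v ~: verts \<G>' ==> D0' v = 0"
  and \<mu>: "!!v. v:verts \<G>' ==> \<mu>' v = push_forward (verts \<G>) iV \<mu> v" and legs: "nlegs \<G> > 0"
 shows "(\<E>', \<phi>' \<phi>):Adm \<G>' \<mu>' D0'"
proof -
 note A = AdmD[OF adm]
 have "nondisconnecting \<G>' \<E>'" by (rule nondisconnecting_contraction[OF con wf A(1) \<E>'_edges]) (auto simp: \<E>'_def)
 moreover have "acyclic_flow G' (\<phi>' \<phi>)"
 proof -
  obtain f' where f': "potential G' (\<phi>' \<phi>) z' f'" using potential_sub[OF pot] by blast
  have "is_flow G' (\<phi>' \<phi>)" by (simp add: is_flow_def \<phi>'_def push_flow_def del: subdivide_simps)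
  from acyclic_of_potential[OF this f' z'_pos] show ?thesis .
 qed
 moreover have "quasistable_pseudo \<G>' \<mu>' \<E>' (adm_divisor \<G>' D0' \<E>' (\<phi>' \<phi>))" unfolding quasistable_pseudo_def
 proof
  show "pseudo_divisor \<G>' \<E>' (adm_divisor \<G>' D0' \<E>' (\<phi>' \<phi>))" unfolding pseudo_divisor_def
  proof (intro conjI ballI allI impI \<E>'_edges)
   fix e assume e: "e:\<E>'"
   hence "Inr e:verts G'" by simp
   hence "adm_divisor \<G>' D0' \<E>' (\<phi>' \<phi>) (Inr e) = adm_divisor \<G> D0 \<E> \<phi> (Inr (iE e))"
    using adm_divisor_push[OF D0] push_forward_Inr[OF e] by (simp only:)
   thus "adm_divisor \<G>' D0' \<E>' (\<phi>' \<phi>) (Inr e) = -1" using A(5) e by (simp add: pseudo_divisor_def \<E>'_def)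
  next
   fix v assume v: "v ~: verts G'"
   hence "flow_div G' (\<phi>' \<phi>) v = 0" by (rule flow_div_outside[OF subdivide_wf[OF wf' \<E>'_edges]])
   moreover have "case_sum D0' (%_. 0) v = 0" using v D0_out by (cases v) auto
   ultimately show "adm_divisor \<G>' D0' \<E>' (\<phi>' \<phi>) v = 0" by (simp add: adm_divisor_def)
  qed
  have "quasistable G' (gV (Inl (leg \<G> 0))) (case_sum \<mu>' (%_. 0)) (adm_divisor \<G>' D0' \<E>' (\<phi>' \<phi>))"
  proof (rule quasistable_contraction[OF contraction_sub subdivide_wf[OF wf \<E>] _ _ A(6)])
   fix w assume w: "w:verts G'"
   show "adm_divisor \<G>' D0' \<E>' (\<phi>' \<phi>) w = push_forward (verts G) gV (adm_divisor \<G> D0 \<E> \<phi>) w" by (rule adm_divisor_push[OF D0 w])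
   have "case_sum \<mu>' (%_. 0) w = case_sum (push_forward (verts \<G>) iV \<mu>) (%_. 0) w" using \<mu> w by auto
   thus "case_sum \<mu>' (%_. 0) w = push_forward (verts G) gV (case_sum \<mu> (%_. 0)) w" using push_forward_case_sum[OF w, of \<mu>] by simp
  next
   show "Inl (leg \<G> 0):verts G" using wf_graphD(5)[OF wf legs] by simp
  qed
  thus "quasistable G' (Inl (leg \<G>' 0)) (case_sum \<mu>' (%_. 0)) (adm_divisor \<G>' D0' \<E>' (\<phi>' \<phi>))" using conD(7)[OF legs] by simp
 qed
 ultimately show ?thesis unfolding Adm_def adm_divisor_def[abs_def] by blast
qed

end

subsection \<open>Finiteness of the diagrams\<close>

lemma finite_stable_graphs: "finite (stable_graphs g n)"
proof -
 \<comment> \<open>\<open>stability\<close> is at least 1 at each vertex and sums to 2g - 2 + n.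
   This bounds the number of vertices by 2g - 2 + n and, through the genus, the number of edges by
   3g - 3 + n; weights are at most 2g + n. \<open>K\<close> exceeds all of these and the number of
   legs.\<close>
 define K where "K = 3 * g + 3 * n + 3"
 define F where "F = {f :: nat => nat. \<forall>x. (x:{..<K} --> f x:{..<K}) & (x ~: {..<K} --> f x = 0)}"
 have fF: "finite F" unfolding F_def by (rule finite_set_of_finite_funs) auto
 let ?mk = "%(N, M, s, t, w, l). \<lparr>verts = {..<N::nat}, edges = {..<M::nat}, src = s, tgt = t, wt = w, nlegs = n, leg = l\<rparr> :: (nat, nat) lgraph"
 have "stable_graphs g n <= ?mk`({..K} \<times> {..K} \<times> F \<times> F \<times> F \<times> F)"
 proof
  fix \<G> assume G: "\<G>:stable_graphs g n"
  note s = stable_graphsD[OF G]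
  note wf = s(1)
  have V: "verts \<G> = {..<card (verts \<G>)}" and E: "edges \<G> = {..<card (edges \<G>)}"
   and out: "!!e. e ~: edges \<G> ==> src \<G> e = 0 & tgt \<G> e = 0" "!!v. v ~: verts \<G> ==> wt \<G> v = 0" "!!i. i >= nlegs \<G> ==> leg \<G> i = 0"
   using s(2) unfolding standard_graph_def by blast+
  define N where "N = card (verts \<G>)" define M where "M = card (edges \<G>)"
  have lg: "(SUM v:verts \<G>. int (legs_at \<G> v)) = int n"
  proof -
   have "legs_at \<G> v = (\<Sum>i<n. of_bool (leg \<G> i = v))" for v
   proof -
    have "{i. i < n & leg \<G> i = v} = {i:{..<n}. leg \<G> i = v}" by auto
    thus ?thesis unfolding legs_at_def s(5) by (simp only: card_filter_sum[OF finite_lessThan])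
   qed
   hence "(SUM v:verts \<G>. legs_at \<G> v) = (\<Sum>i<n. SUM v:verts \<G>. of_bool (leg \<G> i = v))" by (simp only: sum.swap[of _ "verts \<G>"])
   also have "... = (\<Sum>i<n. 1)" using wf_graphD(1,5)[OF wf] s(5) by (intro sum.cong) (auto simp: of_bool_def sum.delta)
   finally show ?thesis by (simp flip: of_nat_sum)
  qed
  have om: "(SUM v:verts \<G>. omega_graph \<G> v) = 2 * int g - 2" using genus_omega[OF wf] s(4) by simp
  have st: "stability \<G> v >= 1" if "v:verts \<G>" for v using s(3) that by (simp add: stable_iff_omega stability_def)
  have tot: "(SUM v:verts \<G>. stability \<G> v) = 2 * int g - 2 + int n" unfolding stability_def by (simp add: sum.distrib om lg)
  have "(SUM v:verts \<G>. (1::int)) <= (SUM v:verts \<G>. stability \<G> v)" by (rule sum_mono) (use st in auto)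
  hence N: "int N <= 2 * int g - 2 + int n" using tot by (simp add: N_def)
  have wb: "int (wt \<G> v) <= 2 * int g + int n" if v: "v:verts \<G>" for v
  proof -
   have "stability \<G> v <= (SUM v:verts \<G>. stability \<G> v)" by (rule member_le_sum) (use v st wf_graphD(1)[OF wf] in force)+
   thus ?thesis unfolding tot by (simp add: stability_def omega_graph_def)
  qed
  have "int M <= int g - 1 + int N"
  proof -
   have "(SUM v:verts \<G>. int (wt \<G> v)) >= 0" by (rule sum_nonneg) simp
   thus ?thesis using s(4) by (simp add: genus_def sub_genus_def N_def M_def)
  qed
  hence NM: "N < K" "M < K" using N unfolding K_def by linarith+
  have "src \<G>:F" "tgt \<G>:F" unfolding F_def using NM out(1) E V edge_ends[OF wf]
   by (auto simp: M_def N_def) (metis gr_zeroI lessThan_iff less_nat_zero_code order.strict_trans)+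
  moreover have "wt \<G>:F"
  proof -
   have "wt \<G> v < K" for v using wb[of v] out(2)[of v] NM(1) by (cases "v:verts \<G>") (auto simp: K_def)
   moreover have "wt \<G> v = 0" if "v >= K" for v using out(2)[of v] V NM(1) that by (metis N_def lessThan_iff not_le order.strict_trans2 order_less_imp_le)
   ultimately show ?thesis by (auto simp: F_def)
  qed
  moreover have "leg \<G>:F"
  proof -
   have "leg \<G> i < K" for i
   proof (cases "i < nlegs \<G>")
    case True
    have "verts \<G> = {..<N}" using V unfolding N_def .
    hence "leg \<G> i < N" using wf_graphD(5)[OF wf True] by blast
    thus ?thesis using NM(1) by simp
   next
    case False thus ?thesis using out(3)[of i] NM(1) by simp
   qed
   moreover have "leg \<G> i = 0" if "i >= K" for i using out(3)[of i] s(5) that by (simp add: K_def)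
   ultimately show ?thesis by (auto simp: F_def)
  qed
  moreover have "\<G> = ?mk (N, M, src \<G>, tgt \<G>, wt \<G>, leg \<G>)" using V E s(5) by (cases \<G>) (simp add: N_def M_def)
  moreover have "N:{..K}" "M:{..K}" using NM by auto
  ultimately show "\<G>:?mk`({..K} \<times> {..K} \<times> F \<times> F \<times> F \<times> F)"
   by (intro image_eqI[of _ _ "(N, M, src \<G>, tgt \<G>, wt \<G>, leg \<G>)"]) blast+
 qed
 thus ?thesis by (rule finite_subset) (use fF in auto)
qed

text \<open>The inequality for one-element sets bounds each value from below; the fixed total degree
  then bounds it from above.\<close>

lemma finite_quasistable:
 assumes wf: "wf_graph G" shows "finite {D :: 'v => int. (\<forall>v. v ~: verts G --> D v = 0) & quasistable G v0 \<mu> D}"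
proof -
 have fin: "finite (verts G)" "finite (edges G)" using wf by (rule wf_graphD)+
 define b where "b = \<lceil>(SUM v:verts G. \<bar>\<mu> v\<bar>) + real (card (edges G))\<rceil>"
 have b0: "real_of_int b >= (SUM v:verts G. \<bar>\<mu> v\<bar>) + real (card (edges G))" unfolding b_def by linarith
 have s0: "(SUM v:verts G. \<bar>\<mu> v\<bar>) >= 0" by (simp add: sum_nonneg)
 define B where "B = b + int (card (verts G)) * b"
 have "{D :: 'v => int. (\<forall>v. v ~: verts G --> D v = 0) & quasistable G v0 \<mu> D} <=
   {D. \<forall>v. (v:verts G --> D v:{-b..B}) & (v ~: verts G --> D v = 0)}"
 proof (intro subsetI CollectI allI conjI impI)
  fix D v assume D: "D:{D :: 'v => int. (\<forall>v. v ~: verts G --> D v = 0) & quasistable G v0 \<mu> D}"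
  show "D v = 0" if "v ~: verts G" using D that by blast
  have q: "quasistable G v0 \<mu> D" using D by blast
  have tot: "real_of_int (SUM v:verts G. D v) = (SUM v:verts G. \<mu> v)" using q by (simp add: quasistable_def)
  have mub: "\<mu> v >= - (SUM v:verts G. \<bar>\<mu> v\<bar>)" if "v:verts G" for v using member_le_sum[of v "verts G" "%v. \<bar>\<mu> v\<bar>"] that fin(1) by auto
  have lower: "D v >= - b" if v: "v:verts G" for v
  proof (cases "{v} = verts G")
   case True
   hence "real_of_int (D v) = \<mu> v" using tot by (simp flip: True)
   hence "real_of_int (D v) >= - real_of_int b" using mub[OF v] b0 by linarith
   thus ?thesis by linarith
  next
   case False
   hence "{v} \<subset> verts G" using v by blast
   hence "beta G \<mu> D {v} >= 0" using q unfolding quasistable_def by blast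
   moreover have "cut_size G {v} <= card (edges G)" unfolding cut_size_def by (rule card_mono) (use fin in auto)
   ultimately have "real_of_int (D v) >= - real_of_int b" using mub[OF v] b0 unfolding beta_def by simp
   thus ?thesis by linarith
  qed
  assume v: "v:verts G"
  have "(SUM u:verts G - {v}. D u) >= (SUM u:verts G - {v}. - b)" by (rule sum_mono) (use lower in auto)
  moreover have "(SUM u:verts G. D u) = D v + (SUM u:verts G - {v}. D u)" by (rule sum.remove[OF fin(1) v])
  moreover have "(SUM u:verts G. D u) <= b"
  proof -
   have "(SUM v:verts G. \<mu> v) <= (SUM v:verts G. \<bar>\<mu> v\<bar>)" by (rule sum_mono) simp
   hence "real_of_int (SUM v:verts G. D v) <= real_of_int b" using tot b0 by linarith
   thus ?thesis by linarith
  qed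
  moreover have "(SUM u:verts G - {v}. - b) = - (int (card (verts G)) - 1) * b" using v fin(1) card_gt_0_iff[of "verts G"] by (auto simp: of_nat_diff algebra_simps)
  moreover have "b >= 0" using b0 s0 by linarith
  ultimately have "D v <= B" unfolding B_def by (simp add: algebra_simps)
  thus "D v:{-b..B}" using lower[OF v] by simp
 qed
 thus ?thesis by (rule finite_subset) (rule finite_set_of_finite_funs, use fin in auto)
qed

text \<open>Let \<open>W\<close> be what the flow can reach from the target of \<open>e\<close>.
  Flow only enters \<open>W\<close>, and by acyclicity \<open>e\<close> itself does; hence the flow
  on \<open>e\<close> is at most the total divergence of \<open>W\<close>.\<close>

lemma acyclic_flow_bound:
 assumes wf: "wf_graph G" and ac: "acyclic_flow G \<phi>" and e: "e:edges G"
 shows "\<bar>\<phi> e\<bar> <= (SUM v:verts G. \<bar>flow_div G \<phi> v\<bar>)"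
proof (cases "\<phi> e = 0")
 case True thus ?thesis by (simp add: sum_nonneg)
next
 case False
 have fin: "finite (verts G)" "finite (edges G)" using wf by (rule wf_graphD)+
 define comp where "comp v = (adj G {e:edges G. \<phi> e = 0})^*``{v}" for v
 define r where "r = {(comp (flow_src G \<phi> e), comp (flow_tgt G \<phi> e)) | e. e:edges G & \<phi> e ~= 0}"
 have acr: "acyclic r" using ac unfolding acyclic_flow_def Let_def r_def comp_def by blast
 define W where "W = {v:verts G. (comp (flow_tgt G \<phi> e), comp v):r^*}"
 have ends: "flow_tgt G \<phi> a:verts G" "flow_src G \<phi> a:verts G" if "a:edges G" for a
  using edge_ends[OF wf that] by (auto simp: flow_tgt_def flow_src_def dart_src_def dart_tgt_def)
 have zero: "src G a:W \<longleftrightarrow> tgt G a:W" if a: "a:edges G" "\<phi> a = 0" for a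
 proof -
  have "comp (src G a) = comp (tgt G a)" unfolding comp_def by (rule adj_component_eq, rule adj_edge) (use a in simp)
  thus ?thesis using edge_ends[OF wf a(1)] by (simp add: W_def)
 qed
 let ?t = "%a. \<phi> a * (of_bool (tgt G a:W) - of_bool (src G a:W))"
 have t: "?t a = \<bar>\<phi> a\<bar> * (of_bool (flow_tgt G \<phi> a:W) - of_bool (flow_src G \<phi> a:W))" for a
  by (auto simp: flow_tgt_def flow_src_def dart_src_def dart_tgt_def)
 have step: "flow_tgt G \<phi> a:W" if "a:edges G" "\<phi> a ~= 0" "flow_src G \<phi> a:W" for a
 proof -
  have "(comp (flow_src G \<phi> a), comp (flow_tgt G \<phi> a)):r" using that(1,2) unfolding r_def by blast
  thus ?thesis using that(3) ends(1)[OF that(1)] unfolding W_def by (auto intro: rtrancl_into_rtrancl)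
 qed
 have nonneg: "?t a >= 0" if "a:edges G" for a unfolding t using step[OF that] by (cases "\<phi> a = 0") auto
 have tW: "flow_tgt G \<phi> e:W" using ends(1)[OF e] by (simp add: W_def)
 have sW: "flow_src G \<phi> e ~: W"
 proof
  assume "flow_src G \<phi> e:W"
  hence "(comp (flow_tgt G \<phi> e), comp (flow_src G \<phi> e)):r^*" by (simp add: W_def)
  moreover have "(comp (flow_src G \<phi> e), comp (flow_tgt G \<phi> e)):r" using e False unfolding r_def by blast
  ultimately have "(comp (flow_src G \<phi> e), comp (flow_src G \<phi> e)):r^+" by (rule rtrancl_into_trancl2[rotated])
  thus False using acr unfolding acyclic_def by blast
 qed
 have "\<bar>\<phi> e\<bar> = ?t e" unfolding t using tW sW by simp
 also have "... <= (SUM a:edges G. ?t a)" by (rule member_le_sum) (use e nonneg fin in auto)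
 also have "... = (SUM v:W. flow_div G \<phi> v)"
 proof -
  have fW: "finite W" using fin(1) by (simp add: W_def)
  have "(SUM v:W. flow_div G \<phi> v) = (SUM a:edges G. SUM v:W. \<phi> a * (of_bool (tgt G a = v) - of_bool (src G a = v)))"
   unfolding flow_div_sum[OF fin(2)] by (rule sum.swap)
  also have "... = (SUM a:edges G. ?t a)"
  proof (rule sum.cong[OF refl])
   fix a
   have "(SUM v:W. of_bool (u = v)) = (of_bool (u:W) :: int)" for u using fW by (simp add: of_bool_def sum.delta)
   thus "(SUM v:W. \<phi> a * (of_bool (tgt G a = v) - of_bool (src G a = v))) = ?t a" by (simp only: sum_distrib_left[symmetric] sum_subtractf)
  qed
  finally show ?thesis by simp
 qed
 also have "... <= (SUM v:W. \<bar>flow_div G \<phi> v\<bar>)" by (rule sum_mono) simp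
 also have "... <= (SUM v:verts G. \<bar>flow_div G \<phi> v\<bar>)" by (rule sum_mono2) (use fin in "auto simp: W_def")
 finally show ?thesis .
qed

text \<open>There are finitely many quasistable divisors on each subdivision, so finitely many
  divergences occur, and these bound the acyclic flows.\<close>

lemma finite_Adm:
 assumes wf: "wf_graph \<G>" shows "finite (Adm \<G> \<mu> D0)"
proof -
 have fin: "finite (edges \<G>)" using wf by (rule wf_graphD)
 have "finite {\<phi>. (\<E>, \<phi>):Adm \<G> \<mu> D0}" if E: "\<E> <= edges \<G>" for \<E>
 proof -
  let ?G = "subdivide \<G> \<E>"
  have wfG: "wf_graph ?G" by (rule subdivide_wf[OF wf E])
  let ?Ds = "{D. (\<forall>v. v ~: verts ?G --> D v = 0) & quasistable ?G (Inl (leg \<G> 0)) (case_sum \<mu> (%_. 0)) D}"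
  have fD: "finite ?Ds" by (rule finite_quasistable[OF wfG])
  define B where "B = (SUM D:?Ds. SUM v:verts ?G. \<bar>D v - case_sum D0 (%_. 0) v\<bar>)"
  have "{\<phi>. (\<E>, \<phi>):Adm \<G> \<mu> D0} <= {\<phi>. \<forall>h. (h:edges ?G --> \<phi> h:{-B..B}) & (h ~: edges ?G --> \<phi> h = 0)}"
  proof (intro subsetI CollectI allI conjI impI)
   fix \<phi> h assume "\<phi>:{\<phi>. (\<E>, \<phi>):Adm \<G> \<mu> D0}"
   hence "(\<E>, \<phi>):Adm \<G> \<mu> D0" by blast
   note A = AdmD[OF this]
   show "\<phi> h = 0" if "h ~: edges ?G" using A(3) that unfolding is_flow_def by blast
   assume h: "h:edges ?G"
   let ?D = "adm_divisor \<G> D0 \<E> \<phi>"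
   have D: "?D:?Ds" using A(5,6) unfolding pseudo_divisor_def by blast
   have "\<bar>\<phi> h\<bar> <= (SUM v:verts ?G. \<bar>flow_div ?G \<phi> v\<bar>)" by (rule acyclic_flow_bound[OF wfG A(2) h])
   also have "... = (SUM v:verts ?G. \<bar>?D v - case_sum D0 (%_. 0) v\<bar>)" by (simp add: adm_divisor_def)
   also have "... <= B" unfolding B_def by (rule member_le_sum[OF D _ fD]) (simp add: sum_nonneg del: subdivide_simps)
   finally have "\<bar>\<phi> h\<bar> <= B" .
   thus "\<phi> h:{-B..B}" unfolding atLeastAtMost_iff by linarith
  qed
  thus ?thesis by (rule finite_subset) (rule finite_set_of_finite_funs, use wf_graphD(2)[OF wfG] in auto)
 qed
 hence "finite (SIGMA \<E>:Pow (edges \<G>). {\<phi>. (\<E>, \<phi>):Adm \<G> \<mu> D0})" using fin by auto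
 moreover have "Adm \<G> \<mu> D0 <= (SIGMA \<E>:Pow (edges \<G>). {\<phi>. (\<E>, \<phi>):Adm \<G> \<mu> D0})"
 proof
  fix p assume p: "p:Adm \<G> \<mu> D0"
  obtain \<E> \<phi> where "p = (\<E>, \<phi>)" by force
  thus "p:(SIGMA \<E>:Pow (edges \<G>). {\<phi>. (\<E>, \<phi>):Adm \<G> \<mu> D0})" using p AdmD(4) by blast
 qed
 ultimately show ?thesis by (rule finite_subset[rotated])
qed

lemma J_trop_finite_face_diagram: "finite_face_diagram (J_trop g \<mu>)" unfolding finite_face_diagram_def
proof (intro conjI ballI)
 let ?T = "%\<G> \<E>. {D. (\<forall>v. v ~: verts (subdivide \<G> \<E>) --> D v = 0) &
   quasistable (subdivide \<G> \<E>) (Inl (leg \<G> 0)) (case_sum (\<mu> \<G>) (%_. 0)) D}"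
 have "objs (J_trop g \<mu>) <= (SIGMA \<G>:stable_graphs g 1. SIGMA \<E>:Pow (edges \<G>). ?T \<G> \<E>)"
  by (auto simp: J_trop_def quasistable_pseudo_def pseudo_divisor_def simp del: subdivide_simps)
 moreover have "finite (SIGMA \<G>:stable_graphs g 1. SIGMA \<E>:Pow (edges \<G>). ?T \<G> \<E>)"
 proof (rule finite_SigmaI[OF finite_stable_graphs])
  fix \<G> assume G: "\<G>:stable_graphs g 1"
  note wf = stable_graphsD(1)[OF G]
  show "finite (SIGMA \<E>:Pow (edges \<G>). ?T \<G> \<E>)" by (rule finite_SigmaI) (use wf_graphD(2)[OF wf] finite_quasistable[OF subdivide_wf[OF wf]] in blast)+
 qed
 ultimately show "finite (objs (J_trop g \<mu>))" by (rule finite_subset)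
next
 fix s assume s: "s:objs (J_trop g \<mu>)"
 obtain \<G> \<E> D where sd: "s = (\<G>, \<E>, D)" by (cases s) auto
 have "\<G>:stable_graphs g 1" "\<E> <= edges \<G>" using s sd by (auto simp: J_trop_def quasistable_pseudo_def pseudo_divisor_def)
 hence fs: "finite (edges (subdivide \<G> \<E>))" using stable_graphsD(1) subdivide_wf wf_graphD(2) by blast
 thus "rational_polyhedral_cone (coords (J_trop g \<mu>) s) (cone (J_trop g \<mu>) s)"
  unfolding sd J_trop_def by (simp add: orthant_rational_polyhedral del: subdivide_simps)
 fix t f assume t: "t:objs (J_trop g \<mu>)" and f: "f:mors (J_trop g \<mu>) s t"
 obtain \<G>2 \<E>2 D2 where td: "t = (\<G>2, \<E>2, D2)" by (cases t) auto
 have "\<G>2:stable_graphs g 1" "\<E>2 <= edges \<G>2" using t td by (auto simp: J_trop_def quasistable_pseudo_def pseudo_divisor_def)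
 hence ft: "finite (edges (subdivide \<G>2 \<E>2))" using stable_graphsD(1) subdivide_wf wf_graphD(2) by blast
 obtain iV iE gV gE where g: "compatible_specialization \<G>2 \<E>2 \<G> \<E> iV iE gV gE" "f = extend_zero (edges (subdivide \<G> \<E>)) gE"
  using f unfolding sd td J_trop_def by (auto simp del: subdivide_simps)
 have c: "contraction (subdivide \<G>2 \<E>2) (subdivide \<G> \<E>) gV gE" using g(1) by (auto simp: compatible_specialization_def intro: specialization_contraction)
 show "face_morphism (coords (J_trop g \<mu>) s) (cone (J_trop g \<mu>) s) (coords (J_trop g \<mu>) t) (cone (J_trop g \<mu>) t) f"
  using face_morphism_orthant[OF fs ft contractionD(2,3)[OF c]] unfolding sd td g(2) J_trop_def by (simp del: subdivide_simps)
qed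

subsection \<open>The cones of admissible pairs\<close>

lemma flow_div_exceptional:
 assumes wf: "wf_graph \<G>" and E: "\<E> <= edges \<G>" "e:\<E>"
 shows "flow_div (subdivide \<G> \<E>) \<phi> (Inr e) = \<phi> (e, False) - \<phi> (e, True)"
proof -
 let ?G = "subdivide \<G> \<E>"
 let ?t = "%h. \<phi> h * (of_bool (tgt ?G h = Inr e) - of_bool (src ?G h = Inr e))"
 have fin: "finite (edges ?G)" using subdivide_wf[OF wf E(1)] by (rule wf_graphD)
 have "flow_div ?G \<phi> (Inr e) = (SUM h:edges ?G. ?t h)" by (rule flow_div_sum[OF fin])
 also have "... = (SUM h:{(e, False), (e, True)}. ?t h)"
 proof (rule sum.mono_neutral_right[OF fin])
  show "ALL h:edges ?G - {(e, False), (e, True)}. ?t h = 0"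
  proof
   fix h assume h: "h:edges ?G - {(e, False), (e, True)}"
   obtain a b where ab: "h = (a, b)" by (cases h) (simp del: subdivide_simps)
   hence "a ~= e" using h by (cases b) auto
   thus "?t h = 0" unfolding ab by (cases b; cases "a:\<E>") simp_all
  qed
 qed (use E in auto)
 also have "... = \<phi> (e, False) - \<phi> (e, True)" using E by simp
 finally show ?thesis .
qed

locale admissible =
 fixes \<G> :: "('v, 'e) lgraph" and \<E> :: "'e set" and \<phi> :: "'e \<times> bool => int"
 assumes wf: "wf_graph \<G>" and nd: "nondisconnecting \<G> \<E>"
  and exc: "!!e. e:\<E> ==> flow_div (subdivide \<G> \<E>) \<phi> (Inr e) = -1"
begin

abbreviation "G \<equiv> subdivide \<G> \<E>"

lemma \<E>: "\<E> <= edges \<G>" using nd by (simp add: nondisconnecting_def)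

lemma wfG: "wf_graph G" by (rule subdivide_wf[OF wf \<E>])

lemma finE: "finite (edges \<G>)" using wf by (rule wf_graphD)

lemma finG: "finite (edges G)" using wfG by (rule wf_graphD)

text \<open>The value -1 at the exceptional vertex makes the slopes on the two halves differ by 1.
  This unit coefficient is why the position of that vertex can be solved for without
  division.\<close>

lemma half_flow: "e:\<E> ==> \<phi> (e, True) = \<phi> (e, False) + 1" using flow_div_exceptional[OF wf \<E>, of e \<phi>] exc[of e] by simp

text \<open>The complement of \<open>\<E>\<close> is connected, so differences of a potential are computed along paths
 that avoid \<open>\<E>\<close>, on which they depend on the lengths of the edges of \<open>\<G>\<close> only.\<close>

lemma potential_functional:
 assumes "u:verts \<G>" "v:verts \<G>"
 shows "\<exists>L. int_functional (edges \<G>) L & (\<forall>z f. potential G \<phi> z f --> f (Inl v) - f (Inl u) = L (merge_halves \<G> \<E> z))"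
proof -
 have "(u, v):(adj \<G> (edges \<G> - \<E>))^*" using nd assms by (simp add: nondisconnecting_def connected_graph_def)
 thus ?thesis
 proof (induction rule: rtrancl_induct)
  case base
  show ?case by (rule exI[of _ "%x. 0"]) (simp add: int_functional_zero)
 next
  case (step v w)
  obtain L where L: "int_functional (edges \<G>) L" "!!z f. potential G \<phi> z f ==> f (Inl v) - f (Inl u) = L (merge_halves \<G> \<E> z)" using step.IH by blast
  from step(2) obtain e where e: "e:edges \<G>" "e ~: \<E>" "(src \<G> e = v & tgt \<G> e = w) \<or> (src \<G> e = w & tgt \<G> e = v)" by (auto simp: adj_def)
  define c where "c = (if src \<G> e = v & tgt \<G> e = w then \<phi> (e, False) else - \<phi> (e, False))"
  have fe: "f (Inl (tgt \<G> e)) - f (Inl (src \<G> e)) = of_int (\<phi> (e, False)) * merge_halves \<G> \<E> z e" if "potential G \<phi> z f" for z f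
  proof -
   have "(e, False):edges G" using e by simp
   hence "f (tgt G (e, False)) - f (src G (e, False)) = of_int (\<phi> (e, False)) * z (e, False)" using that unfolding potential_def by blast
   thus ?thesis using e merge_halves_eq[OF finE e(1), of \<E> z] by simp
  qed
  have "int_functional (edges \<G>) (%x. L x + of_int c * x e)" by (intro int_functional_add L int_functional_cmult int_functional_coord finE e)
  moreover have "f (Inl w) - f (Inl u) = L (merge_halves \<G> \<E> z) + of_int c * merge_halves \<G> \<E> z e" if "potential G \<phi> z f" for z f
  proof (cases "src \<G> e = v & tgt \<G> e = w")
   case True
   hence "f (Inl w) - f (Inl v) = of_int c * merge_halves \<G> \<E> z e" using fe[OF that] by (simp only: c_def simp_thms if_True)
   thus ?thesis using L(2)[OF that] by linarith
  next
   case False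
   hence "src \<G> e = w" "tgt \<G> e = v" using e(3) by blast+
   hence "f (Inl v) - f (Inl w) = of_int (\<phi> (e, False)) * merge_halves \<G> \<E> z e" using fe[OF that] by (simp only:)
   moreover have "c = - \<phi> (e, False)" using False by (simp only: c_def if_False)
   ultimately show ?thesis using L(2)[OF that] by simp
  qed
  ultimately show ?case by blast
 qed
qed

text \<open>For \<open>e \<in> \<E>\<close> the potential difference \<open>L\<close> over
  \<open>e\<close> equals \<open>\<phi> (e, False)\<close> times the merged length of
  \<open>e\<close>, plus \<open>z (e, True)\<close>; this is solved for \<open>z (e, True)\<close>.
  So \<open>merge_halves\<close> is injective on \<open>flow_cone\<close> and its inverse is
  integral.\<close>

lemma section_exists:
 "\<exists>N. (ALL h:edges G. int_functional (edges \<G>) (N h)) &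
  (ALL z:flow_cone \<G> \<E> \<phi>. ALL h:edges G. z h = N h (merge_halves \<G> \<E> z))"
proof -
 have "\<exists>L. int_functional (edges \<G>) L & (ALL z:flow_cone \<G> \<E> \<phi>. z h = L (merge_halves \<G> \<E> z))" if h: "h:edges G" for h
 proof -
  obtain e b where eb: "h = (e, b)" "e:edges \<G>" "b --> e:\<E>" using h by auto
  have ce: "int_functional (edges \<G>) (%x. x e)" by (rule int_functional_coord[OF finE eb(2)])
  show ?thesis
  proof (cases "e:\<E>")
   case False
   thus ?thesis using ce merge_halves_eq[OF finE eb(2), of \<E>] eb by (intro exI[of _ "%x. x e"]) auto
  next
   case True
   note V = edge_ends[OF wf eb(2)]
   obtain L where L: "int_functional (edges \<G>) L"
    "!!z f. potential G \<phi> z f ==> f (Inl (tgt \<G> e)) - f (Inl (src \<G> e)) = L (merge_halves \<G> \<E> z)" using potential_functional[OF V] by blast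
   have zT: "z (e, True) = L (merge_halves \<G> \<E> z) - of_int (\<phi> (e, False)) * merge_halves \<G> \<E> z e"
    and zF: "z (e, False) = merge_halves \<G> \<E> z e - z (e, True)" if z: "z:flow_cone \<G> \<E> \<phi>" for z
   proof -
    obtain f where f: "potential G \<phi> z f" using z flow_cone_iff[OF wf \<E>] by blast
    have m: "merge_halves \<G> \<E> z e = z (e, False) + z (e, True)" using merge_halves_eq[OF finE eb(2), of \<E> z] True by simp
    have "(e, False):edges G" "(e, True):edges G" using eb True by auto
    hence "f (tgt G (e, False)) - f (src G (e, False)) = of_int (\<phi> (e, False)) * z (e, False)"
     "f (tgt G (e, True)) - f (src G (e, True)) = of_int (\<phi> (e, True)) * z (e, True)" using f unfolding potential_def by blast+
    hence "L (merge_halves \<G> \<E> z) = of_int (\<phi> (e, False)) * z (e, False) + of_int (\<phi> (e, False) + 1) * z (e, True)"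
     using L(2)[OF f] True half_flow[OF True] by simp
    thus "z (e, True) = L (merge_halves \<G> \<E> z) - of_int (\<phi> (e, False)) * merge_halves \<G> \<E> z e" unfolding m by (simp add: algebra_simps)
    show "z (e, False) = merge_halves \<G> \<E> z e - z (e, True)" using m by simp
   qed
   have iT: "int_functional (edges \<G>) (%x. L x - of_int (\<phi> (e, False)) * x e)" by (intro int_functional_diff L int_functional_cmult ce)
   have iF: "int_functional (edges \<G>) (%x. x e - (L x - of_int (\<phi> (e, False)) * x e))" by (intro int_functional_diff iT ce)
   show ?thesis
   proof (cases b)
    case True
    show ?thesis unfolding eb(1) using True by (intro exI[of _ "%x. L x - of_int (\<phi> (e, False)) * x e"] conjI iT ballI) (simp only: zT)
   next
    case False
    have "z (e, False) = merge_halves \<G> \<E> z e - (L (merge_halves \<G> \<E> z) - of_int (\<phi> (e, False)) * merge_halves \<G> \<E> z e)"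
     if "z:flow_cone \<G> \<E> \<phi>" for z using zF[OF that] zT[OF that] by (simp only:)
    thus ?thesis unfolding eb(1) using False by (intro exI[of _ "%x. x e - (L x - of_int (\<phi> (e, False)) * x e)"] conjI iF ballI) (simp only:)
   qed
  qed
 qed
 thus ?thesis by metis
qed

definition N :: "'e \<times> bool => ('e => real) => real" where
 "N = (SOME N. (ALL h:edges G. int_functional (edges \<G>) (N h)) &
  (ALL z:flow_cone \<G> \<E> \<phi>. ALL h:edges G. z h = N h (merge_halves \<G> \<E> z)))"

definition lift :: "('e => real) => 'e \<times> bool => real" where "lift x h = (if h:edges G then N h x else 0)"

lemma N: "h:edges G ==> int_functional (edges \<G>) (N h)"
 "z:flow_cone \<G> \<E> \<phi> ==> h:edges G ==> z h = N h (merge_halves \<G> \<E> z)" using someI_ex[OF section_exists, folded N_def] by blast+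

lemma lift_merge: assumes "z:flow_cone \<G> \<E> \<phi>" shows "lift (merge_halves \<G> \<E> z) = z"
proof
 fix h show "lift (merge_halves \<G> \<E> z) h = z h" using N(2)[OF assms, of h] assms unfolding lift_def flow_cone_def orthant_def by (cases "h:edges G") auto
qed

lemma K_coneD:
 assumes "x:K_cone \<G> \<E> \<phi>"
 shows "lift x:flow_cone \<G> \<E> \<phi>" "merge_halves \<G> \<E> (lift x) = x" using assms lift_merge unfolding K_cone_def by auto

lemma K_cone_orthant: "K_cone \<G> \<E> \<phi> <= orthant (edges \<G>)"
proof
 fix x assume "x:K_cone \<G> \<E> \<phi>"
 then obtain z where z: "x = merge_halves \<G> \<E> z" "z:flow_cone \<G> \<E> \<phi>" by (auto simp: K_cone_def)
 have zn: "z h >= 0" if "h:edges G" for h using z(2) that unfolding flow_cone_def orthant_def by blast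
 have "x e >= 0" for e unfolding z(1) merge_halves_def push_forward_def by (rule sum_nonneg) (use zn in blast)
 thus "x:orthant (edges \<G>)" using z(1) merge_halves_outside by (auto simp: orthant_def)
qed

text \<open>An image is described by inequalities after pulling the conditions of
  \<open>flow_cone\<close> back along \<open>lift\<close>: half edges have nonnegative length, the
  cycle equations hold, and \<open>merge_halves\<close> returns \<open>x\<close>. Equations enter as
  pairs of opposite inequalities.\<close>

lemma K_cone_polyhedral: "rational_polyhedral_cone (edges \<G>) (K_cone \<G> \<E> \<phi>)"
proof -
 let ?C = "{p. graph_cycle G p}"
 have "?C <= {p. set p <= edges G \<times> UNIV & distinct p}"
 proof
  fix p assume "p:?C"
  then obtain u where w: "walk G u p u" and d: "distinct (map fst p)" unfolding graph_cycle_def mem_Collect_eq by (elim conjE exE)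
  have "set p <= edges G \<times> UNIV"
  proof
   fix x assume "x:set p"
   then obtain i where "i < length p" "x = p ! i" by (metis in_set_conv_nth)
   hence "fst x:edges G" using walk_nth(1)[OF w] by blast
   thus "x:edges G \<times> UNIV" by (cases x) (simp del: subdivide_simps)
  qed
  thus "p:{p. set p <= edges G \<times> UNIV & distinct p}" using d by (auto simp: distinct_map simp del: subdivide_simps)
 qed
 hence fC: "finite ?C" by (rule finite_subset) (rule finite_subset_distinct[OF finite_cartesian_product[OF finG finite]])
 define cyc where "cyc p x = (\<Sum>d\<leftarrow>p. dart_slope \<phi> (lift x) d)" for p x
 define mer where "mer e x = merge_halves \<G> \<E> (lift x) e - x e" for e x
 have edc: "fst d:edges G" if "p:?C" "d:set p" for p d
 proof -
  from that(1) obtain u where w: "walk G u p u" unfolding graph_cycle_def mem_Collect_eq by (elim conjE exE)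
  show ?thesis using walk_nth(1)[OF w] that(2) by (metis in_set_conv_nth)
 qed
 have icyc: "int_functional (edges \<G>) (cyc p)" if "p:?C" for p
 proof -
  have "int_functional (edges \<G>) (%x. \<Sum>d\<leftarrow>p. of_int ((if snd d then 1 else -1) * \<phi> (fst d)) * N (fst d) x)"
   by (intro int_functional_sum_list int_functional_cmult N edc[OF that])
  moreover have "cyc p x = (\<Sum>d\<leftarrow>p. of_int ((if snd d then 1 else -1) * \<phi> (fst d)) * N (fst d) x)" for x unfolding cyc_def
   by (rule arg_cong[of _ _ sum_list], rule map_cong[OF refl])
     (use edc[OF that] in "auto simp: dart_slope_def lift_def split: prod.splits simp del: subdivide_simps")
  ultimately show ?thesis by presburger
 qed
 have imer: "int_functional (edges \<G>) (mer e)" if "e:edges \<G>" for e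
 proof -
  have "int_functional (edges \<G>) (%x. (SUM h:{h:edges G. fst h = e}. N h x) - x e)"
   by (intro int_functional_diff int_functional_sum int_functional_coord finE that N) blast
  moreover have "mer e x = (SUM h:{h:edges G. fst h = e}. N h x) - x e" for x unfolding mer_def merge_halves_def push_forward_def
   by (rule arg_cong2[of _ _ _ _ minus, OF sum.cong refl]) (auto simp: lift_def simp del: subdivide_simps)
  ultimately show ?thesis by presburger
 qed
 let ?\<L> = "N`edges G \<union> cyc`?C \<union> (%p x. - cyc p x)`?C \<union> mer`edges \<G> \<union> (%e x. - mer e x)`edges \<G>"
 show ?thesis
 proof (rule rational_polyhedral_coneI[where \<L> = ?\<L>])
  show "finite ?\<L>" using finG finE fC by blast
  show "int_functional (edges \<G>) L" if "L:?\<L>" for L using that N(1) icyc imer int_functional_minus by blast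
  show "K_cone \<G> \<E> \<phi> = {x. (\<forall>i. i ~: edges \<G> --> x i = 0) & (ALL L:?\<L>. L x >= 0)}" (is "_ = ?R")
  proof
   show "K_cone \<G> \<E> \<phi> <= ?R"
   proof
    fix x assume x: "x:K_cone \<G> \<E> \<phi>"
    note K = K_coneD[OF x]
    have "N h x >= 0" if "h:edges G" for h
    proof -
     have "lift x h >= 0" using K(1) that unfolding flow_cone_def orthant_def by blast
     thus ?thesis using that by (simp add: lift_def del: subdivide_simps)
    qed
    moreover have "cyc p x = 0" if "p:?C" for p using K(1) that unfolding flow_cone_def cyc_def dart_slope_def by blast
    moreover have "mer e x = 0" for e using K(2) by (simp add: mer_def)
    moreover have "x i = 0" if "i ~: edges \<G>" for i using K_cone_orthant x that by (auto simp: orthant_def)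
    ultimately show "x:?R" by (auto simp del: subdivide_simps)
   qed
   show "?R <= K_cone \<G> \<E> \<phi>"
   proof
    fix x assume x: "x:?R"
    have xL: "L x >= 0" if "L:?\<L>" for L by (rule bspec[OF _ that]) (use x in "unfold mem_Collect_eq, elim conjE")
    have n: "N h x >= 0" if "h:edges G" for h using x that by blast
    have c: "cyc p x = 0" if p: "p:?C" for p
    proof -
     have "cyc p x >= 0" using x p by blast
     moreover have "(%p x. - cyc p x) p:?\<L>" using p by blast
     hence "- cyc p x >= 0" by (rule xL)
     ultimately show ?thesis by simp
    qed
    have m: "mer e x = 0" if e: "e:edges \<G>" for e
    proof -
     have "mer e x >= 0" using x e by blast
     moreover have "(%e x. - mer e x) e:?\<L>" using e by blast
     hence "- mer e x >= 0" by (rule xL)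
     ultimately show ?thesis by simp
    qed
    have "lift x:flow_cone \<G> \<E> \<phi>" using n c unfolding flow_cone_def cyc_def dart_slope_def by (auto simp: orthant_def lift_def simp del: subdivide_simps)
    moreover have "merge_halves \<G> \<E> (lift x) = x"
    proof
     fix e show "merge_halves \<G> \<E> (lift x) e = x e" using m[of e] x merge_halves_outside[of e \<G> \<E>] by (cases "e:edges \<G>") (auto simp: mer_def)
    qed
    ultimately show "x:K_cone \<G> \<E> \<phi>" unfolding K_cone_def by (metis imageI)
   qed
  qed
 qed (rule finE)
qed

end

lemma flow_potential_iff:
 "f (tgt G e) - f (src G e) = of_int (\<phi> e) * x \<longleftrightarrow> f (flow_tgt G \<phi> e) - f (flow_src G \<phi> e) = of_int \<bar>\<phi> e\<bar> * (x::real)"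
 by (auto simp: flow_tgt_def flow_src_def dart_src_def dart_tgt_def)

lemma flow_restricts_potential:
 assumes c: "contraction G G' gV gE" and r: "flow_restricts G G' gV gE \<phi> \<phi>'" and e: "e:edges G'"
 shows "f (tgt G' e) - f (src G' e) = of_int (\<phi>' e) * x \<longleftrightarrow>
  f (gV (tgt G (gE e))) - f (gV (src G (gE e))) = of_int (\<phi> (gE e)) * (x::real)"
proof -
 have a: "\<bar>\<phi>' e\<bar> = \<bar>\<phi> (gE e)\<bar>" and b: "\<phi>' e ~= 0 ==> flow_src G' \<phi>' e = gV (flow_src G \<phi> (gE e)) & flow_tgt G' \<phi>' e = gV (flow_tgt G \<phi> (gE e))"
  using r e unfolding flow_restricts_def by blast+
 show ?thesis
 proof (cases "\<phi>' e = 0")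
  case True
  thus ?thesis using a contraction_ends[OF c e] by auto
 next
  case False
  thus ?thesis using b a flow_potential_iff[of f G' e \<phi>' x] flow_potential_iff[of "f \<circ> gV" G "gE e" \<phi> x] by simp
 qed
qed

text \<open>The face functional is the total length of the contracted half edges, which is linear
  through \<open>N\<close>. Where it vanishes, the potential is constant on fibres and descends;
  conversely, a potential downstairs is pulled back along \<open>gV\<close>.\<close>

lemma admissible_face_morphism:
 assumes A: "admissible \<G> \<E> \<phi>" and A': "admissible \<G>' \<E>' \<phi>'"
  and c: "compatible_specialization \<G> \<E> \<G>' \<E>' iV iE gV gE"
  and fr: "flow_restricts (subdivide \<G> \<E>) (subdivide \<G>' \<E>') gV gE \<phi> \<phi>'"
 shows "face_morphism (edges \<G>') (K_cone \<G>' \<E>' \<phi>') (edges \<G>) (K_cone \<G> \<E> \<phi>) (extend_zero (edges \<G>') iE)"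
proof -
 interpret A: admissible \<G> \<E> \<phi> by (rule A)
 interpret A': admissible \<G>' \<E>' \<phi>' by (rule A')
 have con: "contraction \<G> \<G>' iV iE" and conG: "contraction A.G A'.G gV gE" using c by (auto simp: compatible_specialization_def intro: specialization_contraction)
 note cD = contractionD[OF con] and cG = contractionD[OF conG]
 note mez = merge_halves_extend_zero[OF c A.finG A'.finG A'.finE]
 let ?Z = "edges A.G - gE`edges A'.G"
 show ?thesis
 proof (rule face_morphism_extend_zero[where L = "%x. SUM h:?Z. A.N h x"])
  show "finite (edges \<G>')" "finite (edges \<G>)" by (rule A'.finE, rule A.finE)
  show "inj_on iE (edges \<G>')" "iE`edges \<G>' <= edges \<G>" by (rule cD(2), rule cD(3))
  show "x i = 0" if "x:K_cone \<G>' \<E>' \<phi>'" "i ~: edges \<G>'" for x i using A'.K_cone_orthant that by (auto simp: orthant_def)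
  show "int_functional (edges \<G>) (%x. SUM h:?Z. A.N h x)" by (intro int_functional_sum A.N) blast
  have pos: "A.N h y >= 0" if "y:K_cone \<G> \<E> \<phi>" "h:edges A.G" for y h
  proof -
   have "A.lift y h >= 0" using A.K_coneD(1)[OF that(1)] that(2) unfolding flow_cone_def orthant_def by blast
   thus ?thesis using that(2) by (simp add: A.lift_def del: subdivide_simps)
  qed
  thus "0 <= (SUM h:?Z. A.N h y)" if "y:K_cone \<G> \<E> \<phi>" for y using that by (intro sum_nonneg) blast
  show "extend_zero (edges \<G>') iE x:K_cone \<G> \<E> \<phi> & (SUM h:?Z. A.N h (extend_zero (edges \<G>') iE x)) = 0"
   if x: "x:K_cone \<G>' \<E>' \<phi>'" for x
  proof -
   let ?z' = "A'.lift x" and ?z = "extend_zero (edges A'.G) gE (A'.lift x)"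
   note K = A'.K_coneD[OF x]
   obtain f where f: "potential A'.G \<phi>' ?z' f" using K(1) flow_cone_iff[OF A'.wf A'.\<E>] by blast
   have zo: "?z':orthant (edges A'.G)" using K(1) unfolding flow_cone_def by blast
   have z0: "?z h = 0" if "h:?Z" for h by (rule push_forward_outside) (use that in blast)
   have zg: "?z (gE h) = ?z' h" if "h:edges A'.G" for h by (rule push_forward_inj[OF cG(2) that])
   have "potential A.G \<phi> ?z (f \<circ> gV)" unfolding potential_def
   proof
    fix h assume h: "h:edges A.G"
    show "(f \<circ> gV) (tgt A.G h) - (f \<circ> gV) (src A.G h) = of_int (\<phi> h) * ?z h"
    proof (cases "h:gE`edges A'.G")
     case False
     thus ?thesis using z0[of h] h contraction_contracted[OF conG wf_graphD(3)[OF A.wfG] h False] by simp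
    next
     case True
     then obtain h' where h': "h':edges A'.G" "h = gE h'" by blast
     have "f (tgt A'.G h') - f (src A'.G h') = of_int (\<phi>' h') * ?z' h'" using f h'(1) unfolding potential_def by blast
     thus ?thesis unfolding flow_restricts_potential[OF conG fr h'(1)] h'(2) zg[OF h'(1)] by simp
    qed
   qed
   moreover have "?z:orthant (edges A.G)"
   proof -
    have "?z h >= 0" if "h:edges A.G" for h unfolding push_forward_def by (rule sum_nonneg) (use zo in "auto simp: orthant_def simp del: subdivide_simps")
    moreover have "?z h = 0" if "h ~: edges A.G" for h by (rule push_forward_outside) (use cG(3) that in blast)
    ultimately show ?thesis unfolding orthant_def by blast
   qed
   ultimately have zc: "?z:flow_cone \<G> \<E> \<phi>" using flow_cone_iff[OF A.wf A.\<E>] by blast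
   have mz: "merge_halves \<G> \<E> ?z = extend_zero (edges \<G>') iE x" unfolding mez K(2) ..
   have "A.N h (extend_zero (edges \<G>') iE x) = 0" if "h:?Z" for h
   proof -
    have "?z h = A.N h (merge_halves \<G> \<E> ?z)" by (rule A.N(2)[OF zc]) (use that in blast)
    thus ?thesis using z0[OF that] unfolding mz by simp
   qed
   thus ?thesis using zc unfolding mz[symmetric] K_cone_def by (intro conjI imageI sum.neutral) auto
  qed
  show "EX x:K_cone \<G>' \<E>' \<phi>'. y = extend_zero (edges \<G>') iE x" if y: "y:K_cone \<G> \<E> \<phi>" and L0: "(SUM h:?Z. A.N h y) = 0" for y
  proof -
   let ?z = "A.lift y"
   note K = A.K_coneD[OF y]
   have z0: "?z h = 0" if h: "h:?Z" for h
   proof -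
    have fZ: "finite ?Z" using A.finG by blast
    have "ALL h:?Z. A.N h y = 0" using L0 sum_nonneg_eq_0_iff[OF fZ, of "%h. A.N h y"] pos[OF y] by blast
    thus ?thesis using h by (simp add: A.lift_def del: subdivide_simps)
   qed
   obtain f where f: "potential A.G \<phi> ?z f" using K(1) flow_cone_iff[OF A.wf A.\<E>] by blast
   have zo: "?z:orthant (edges A.G)" using K(1) unfolding flow_cone_def by blast
   define z' where "z' h = (if h:edges A'.G then ?z (gE h) else 0)" for h
   have ze: "?z = extend_zero (edges A'.G) gE z'"
   proof (rule extend_zero_eqI[OF cG(2)])
    show "?z (gE h) = z' h" if "h:edges A'.G" for h using that by (simp add: z'_def del: subdivide_simps)
    show "?z h = 0" if "h ~: gE`edges A'.G" for h
    proof (cases "h:edges A.G")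
     case True thus ?thesis using z0[of h] that by blast
    next
     case False thus ?thesis using zo unfolding orthant_def by blast
    qed
   qed
   define f' where "f' x = f (inv_into (verts A.G) gV x)" for x
   have f': "f' (gV v) = f v" if "v:verts A.G" for v
    unfolding f'_def by (rule potential_constant[OF conG A.wfG f z0]) (use that in "auto intro: inv_into_into f_inv_into_f simp del: subdivide_simps")
   have "potential A'.G \<phi>' z' f'" unfolding potential_def
   proof
    fix h assume h: "h:edges A'.G"
    have g: "gE h:edges A.G" by (rule cG(9)[OF h])
    note V = edge_ends[OF A.wfG g]
    have p: "f (tgt A.G (gE h)) - f (src A.G (gE h)) = of_int (\<phi> (gE h)) * ?z (gE h)" using f g unfolding potential_def by blast
    have z': "z' h = ?z (gE h)" using h by (simp add: z'_def del: subdivide_simps)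
    show "f' (tgt A'.G h) - f' (src A'.G h) = of_int (\<phi>' h) * z' h" unfolding flow_restricts_potential[OF conG fr h] z' f'[OF V(1)] f'[OF V(2)] by (rule p)
   qed
   moreover have "z':orthant (edges A'.G)" using zo cG(9) by (auto simp: orthant_def z'_def simp del: subdivide_simps)
   ultimately have "z':flow_cone \<G>' \<E>' \<phi>'" using flow_cone_iff[OF A'.wf A'.\<E>] by blast
   moreover have "y = extend_zero (edges \<G>') iE (merge_halves \<G>' \<E>' z')" using K(2) mez[of z'] unfolding ze[symmetric] by simp
   ultimately show ?thesis unfolding K_cone_def by blast
  qed
 qed
qed

lemma Adm_admissible:
 assumes wf: "wf_graph \<G>" and adm: "(\<E>, \<phi>):Adm \<G> \<mu> D0" shows "admissible \<G> \<E> \<phi>"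
proof
 note A = AdmD[OF adm]
 show "wf_graph \<G>" "nondisconnecting \<G> \<E>" by (rule wf, rule A(1))
 fix e assume "e:\<E>"
 hence "adm_divisor \<G> D0 \<E> \<phi> (Inr e) = -1" using A(5) by (simp add: pseudo_divisor_def)
 thus "flow_div (subdivide \<G> \<E>) \<phi> (Inr e) = -1" by (simp add: adm_divisor_def)
qed

lemma MA_objs:
 "(\<G>, \<E>, \<phi>):objs (MA_trop g n a m \<mu>) \<longleftrightarrow>
  \<G>:stable_graphs g (n + 1) & (\<E>, \<phi>):Adm \<G> (induced_polarization \<mu> \<G>) (D_graph n a m \<G>)" by (simp add: MA_trop_def)

lemma MA_trop_finite_face_diagram: "finite_face_diagram (MA_trop g n a m \<mu>)" unfolding finite_face_diagram_def
proof (intro conjI ballI)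
 have "objs (MA_trop g n a m \<mu>) <= (SIGMA \<G>:stable_graphs g (n + 1). Adm \<G> (induced_polarization \<mu> \<G>) (D_graph n a m \<G>))" by (auto simp: MA_trop_def)
 moreover have "finite (SIGMA \<G>:stable_graphs g (n + 1). Adm \<G> (induced_polarization \<mu> \<G>) (D_graph n a m \<G>))"
  by (rule finite_SigmaI[OF finite_stable_graphs finite_Adm[OF stable_graphsD(1)]])
 ultimately show "finite (objs (MA_trop g n a m \<mu>))" by (rule finite_subset)
next
 have adm: "admissible \<G> \<E> \<phi>" if "(\<G>, \<E>, \<phi>):objs (MA_trop g n a m \<mu>)" for \<G> \<E> \<phi>
  using that unfolding MA_objs by (blast intro: Adm_admissible stable_graphsD(1))
 fix s assume s: "s:objs (MA_trop g n a m \<mu>)"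
 obtain \<G> \<E> \<phi> where sd: "s = (\<G>, \<E>, \<phi>)" by (cases s) auto
 note a1 = adm[OF s[unfolded sd]]
 show "rational_polyhedral_cone (coords (MA_trop g n a m \<mu>) s) (cone (MA_trop g n a m \<mu>) s)"
  using admissible.K_cone_polyhedral[OF a1] unfolding sd by (simp add: MA_trop_def)
 fix t f assume t: "t:objs (MA_trop g n a m \<mu>)" and f: "f:mors (MA_trop g n a m \<mu>) s t"
 obtain \<G>2 \<E>2 \<phi>2 where td: "t = (\<G>2, \<E>2, \<phi>2)" by (cases t) auto
 note a2 = adm[OF t[unfolded td]]
 obtain iV iE gV gE where g: "compatible_specialization \<G>2 \<E>2 \<G> \<E> iV iE gV gE"
  "flow_restricts (subdivide \<G>2 \<E>2) (subdivide \<G> \<E>) gV gE \<phi>2 \<phi>" "f = extend_zero (edges \<G>) iE"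
  using f unfolding sd td MA_trop_def by (auto simp del: subdivide_simps)
 show "face_morphism (coords (MA_trop g n a m \<mu>) s) (cone (MA_trop g n a m \<mu>) s) (coords (MA_trop g n a m \<mu>) t) (cone (MA_trop g n a m \<mu>) t) f"
  using admissible_face_morphism[OF a2 a1 g(1,2)] unfolding sd td g(3) by (simp add: MA_trop_def)
qed

subsection \<open>Piecewise linear functions\<close>

text \<open>The set \<open>B\<close> may contain more than the actual breakpoints, so that several
  functions can share one set. Both ends belong to it, so that neighbouring breakpoints always
  exist.\<close>

definition pl :: "real => real set => (real => real) => bool" where
 "pl L B h \<longleftrightarrow> finite B & {0, L} <= B & B <= {0..L} &
   (\<forall>s t. 0 <= s & s < t & t <= L & {s<..<t} \<inter> B = {} --> (\<exists>k::int. ALL u:{s..t}. h u = h s + of_int k * (u - s)))"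

lemma plD:
 assumes "pl L B h" "0 <= s" "s < t" "t <= L" "{s<..<t} \<inter> B = {}"
 shows "\<exists>k::int. ALL u:{s..t}. h u = h s + of_int k * (u - s)"
proof -
 from assms(1) have "0 <= s & s < t & t <= L & {s<..<t} \<inter> B = {} --> (\<exists>k::int. ALL u:{s..t}. h u = h s + of_int k * (u - s))"
  unfolding pl_def by (elim conjE allE)
 with assms(2-) show ?thesis by blast
qed

lemma pl_mono:
 assumes h: "pl L B h" and B': "B <= B'" "finite B'" "B' <= {0..L}" shows "pl L B' h" unfolding pl_def
proof (intro conjI allI impI)
 show "{0, L} <= B'" using h B'(1) unfolding pl_def by blast
 fix s t assume st: "0 <= s & s < t & t <= L & {s<..<t} \<inter> B' = {}"
 hence "{s<..<t} \<inter> B = {}" using B'(1) by blast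
 thus "\<exists>k::int. ALL u:{s..t}. h u = h s + of_int k * (u - s)" using plD[OF h] st by blast
qed (rule B')+

lemma pl_reflect: assumes h: "pl L B h" shows "pl L ((%t. L - t)`B) (%u. h (L - u))" unfolding pl_def
proof (intro conjI allI impI)
 show "finite ((%t. L - t)`B)" "{0, L} <= (%t. L - t)`B" "(%t. L - t)`B <= {0..L}" using h by (auto simp: pl_def image_iff intro: bexI[of _ L] bexI[of _ 0])
 fix s t assume st: "0 <= s & s < t & t <= L & {s<..<t} \<inter> (%t. L - t)`B = {}"
 have "{L - t<..<L - s} \<inter> B = {}"
 proof (rule ccontr)
  assume "{L - t<..<L - s} \<inter> B ~= {}"
  then obtain b where "b:B" "L - t < b" "b < L - s" by auto
  hence "L - b:{s<..<t} \<inter> (%t. L - t)`B" by auto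
  thus False using st by blast
 qed
 hence "\<exists>k::int. ALL u:{L - t..L - s}. h u = h (L - t) + of_int k * (u - (L - t))" by (intro plD[OF h]) (use st in linarith)+
 then obtain k :: int where k: "!!u. u:{L - t..L - s} ==> h u = h (L - t) + of_int k * (u - (L - t))" by blast
 show "\<exists>k::int. ALL u:{s..t}. h (L - u) = h (L - s) + of_int k * (u - s)"
 proof (intro exI[of _ "-k"] ballI)
  fix u assume "u:{s..t}"
  hence "L - u:{L - t..L - s}" "L - s:{L - t..L - s}" unfolding atLeastAtMost_iff using st by linarith+
  from k[OF this(1)] k[OF this(2)]
  have "h (L - u) = h (L - t) + of_int k * (L - u - (L - t))" "h (L - s) = h (L - t) + of_int k * (L - s - (L - t))" .
  thus "h (L - u) = h (L - s) + of_int (- k) * (u - s)" by (simp add: algebra_simps)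
 qed
qed

lemma pl_next:
 assumes h: "pl L B h" and s: "0 <= s" "s < L"
 obtains t and k :: int where "s < t" "t:B" "t <= L" "{s<..<t} \<inter> B = {}" "!!u. u:{s..t} ==> h u = h s + of_int k * (u - s)"
proof -
 define t where "t = Min {b:B. s < b}"
 have "finite {b:B. s < b}" "{b:B. s < b} ~= {}" using h s by (auto simp: pl_def)
 hence t: "t:{b:B. s < b}" "!!b. b:B ==> s < b ==> t <= b" unfolding t_def by (auto intro!: Min_in Min_le simp del: mem_Collect_eq)
 hence "t <= L" "{s<..<t} \<inter> B = {}" using h by (force simp: pl_def)+
 moreover from this t obtain k :: int where "ALL u:{s..t}. h u = h s + of_int k * (u - s)" using plD[OF h s(1), of t] by blast
 ultimately show ?thesis using that t(1) by blast
qed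

lemma pl_prev:
 assumes h: "pl L B h" and u: "0 <= u"
 obtains s where "s:B" "s <= u" "!!b. b:B ==> b <= u ==> b <= s"
proof -
 have "finite {b:B. b <= u}" "{b:B. b <= u} ~= {}" using h u by (auto simp: pl_def)
 thus ?thesis using that[of "Max {b:B. b <= u}"] Max_in[of "{b:B. b <= u}"] Max_ge[of "{b:B. b <= u}"] by blast
qed

text \<open>An affine piece attains its maximum at one of its ends, which are breakpoints.\<close>

lemma pl_le:
 assumes h: "pl L B h" and M: "!!b. b:B ==> h b <= M" and u: "u:{0..L}"
 shows "h u <= M"
proof -
 obtain s where s: "s:B" "s <= u" "!!b. b:B ==> b <= u ==> b <= s" using pl_prev[OF h] u by auto
 show ?thesis
 proof (cases "s = u")
  case False
  hence "0 <= s" "s < L" using h s u by (auto simp: pl_def)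
  from pl_next[OF h this] obtain t and k :: int where t: "s < t" "t:B" "t <= L" "{s<..<t} \<inter> B = {}"
   and k: "!!u. u:{s..t} ==> h u = h s + of_int k * (u - s)" by blast
  have ut: "u < t" using s(3)[OF t(2)] t(1) by linarith
  show ?thesis
  proof (cases "k >= 0")
   case True
   hence "of_int k * (u - s) <= of_int k * (t - s)" using ut by (intro mult_left_mono) auto
   thus ?thesis using k[of u] k[of t] M[OF t(2)] ut t(1) s(2) by auto
  next
   case False
   hence "of_int k * (u - s) <= 0" using s(2) by (intro mult_nonpos_nonneg) auto
   thus ?thesis using k[of u] M[OF s(1)] ut s(2) by auto
  qed
 qed (use M s in auto)
qed

lemma linear_sublevel:
 fixes b t c h0 k :: real
 shows "\<exists>x y. {u:{b..t}. h0 + k * (u - b) <= c} = {x..y}"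
proof -
 consider "k = 0" "h0 <= c" | "k = 0" "h0 > c" | "k > 0" | "k < 0" by linarith
 thus ?thesis
 proof cases
  case 1 thus ?thesis by (intro exI[of _ b] exI[of _ t]) auto
 next
  case 2 thus ?thesis by (intro exI[of _ 1] exI[of _ 0]) auto
 next
  case 3
  hence eq: "h0 + k * (u - b) <= c \<longleftrightarrow> u <= b + (c - h0) / k" for u
   using pos_le_divide_eq[of k "u - b" "c - h0"] unfolding mult.commute[of k] by linarith
  show ?thesis unfolding eq by (intro exI[of _ b] exI[of _ "min t (b + (c - h0) / k)"]) auto
 next
  case 4
  hence eq: "h0 + k * (u - b) <= c \<longleftrightarrow> b + (c - h0) / k <= u" for u
   using neg_divide_le_eq[of k "c - h0" "u - b"] unfolding mult.commute[of k] by linarith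
  show ?thesis unfolding eq by (intro exI[of _ "max b (b + (c - h0) / k)"] exI[of _ t]) auto
 qed
qed

text \<open>Each breakpoint \<open>b\<close> accounts for the segment up to the next one, which is
  described without naming it so that \<open>b = L\<close> is covered too. On such a segment the
  sublevel set is one interval, possibly empty.\<close>

lemma pl_sublevel:
 assumes h: "pl L B h"
 shows "\<exists>A :: (real \<times> real) set. finite A & {t:{0..L}. h t <= c} = (UN (a, b):A. {a..b})"
proof -
 have "\<exists>p. {t:{0..L}. h t <= c & b <= t & (ALL b':B. b < b' --> t <= b')} = {fst p..snd p}" if b: "b:B" for b
 proof (cases "b < L")
  case True
  have b0: "0 <= b" using b h by (auto simp: pl_def)
  from pl_next[OF h this True] obtain t and k :: int where t: "b < t" "t:B" "t <= L" "{b<..<t} \<inter> B = {}"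
   and k: "!!u. u:{b..t} ==> h u = h b + of_int k * (u - b)" by blast
  have nx: "b < b' ==> t <= b'" if "b':B" for b' using t(4) that by force
  obtain x y where xy: "{u:{b..t}. h b + of_int k * (u - b) <= c} = {x..y}" using linear_sublevel by blast
  have "{u:{0..L}. h u <= c & b <= u & (ALL b':B. b < b' --> u <= b')} = {u:{b..t}. h b + of_int k * (u - b) <= c}"
   (is "?l = ?r")
  proof (rule set_eqI)
   fix u show "u:?l \<longleftrightarrow> u:?r"
   proof (cases "u:{b..t}")
    case True
    have "u <= b'" if "b':B" "b < b'" for b' using nx[OF that] True by auto
    thus ?thesis using k[OF True] True b0 t(3) by auto
   next
    case False thus ?thesis using t(1,2) by auto
   qed
  qed
  thus ?thesis unfolding xy by (intro exI[of _ "(x, y)"]) simp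
 next
  case False
  hence "b = L" "0 <= L" using b h by (auto simp: pl_def)
  moreover have "t = L" if "t:{0..L}" "L <= t" for t using that by simp
  moreover have "\<not> L < b'" if "b':B" for b' using h that unfolding pl_def by force
  ultimately have "{t:{0..L}. h t <= c & b <= t & (ALL b':B. b < b' --> t <= b')} = (if h L <= c then {L} else {})" by auto
  thus ?thesis by (simp only:) (intro exI[of _ "if h L <= c then (L, L) else (1, 0)"], simp)
 qed
 hence "ALL b:B. \<exists>p. {t:{0..L}. h t <= c & b <= t & (ALL b':B. b < b' --> t <= b')} = {fst p..snd p}" by blast
 from bchoice[OF this] obtain p where p: "!!b. b:B ==> {t:{0..L}. h t <= c & b <= t & (ALL b':B. b < b' --> t <= b')} = {fst (p b)..snd (p b)}"
  by (elim exE) (simp only: that)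
 have "{t:{0..L}. h t <= c} = (UN b:B. {fst (p b)..snd (p b)})"
 proof
  show "{t:{0..L}. h t <= c} <= (UN b:B. {fst (p b)..snd (p b)})"
  proof
   fix t assume t: "t:{t:{0..L}. h t <= c}"
   then obtain s where s: "s:B" "s <= t" "!!b. b:B ==> b <= t ==> b <= s" using pl_prev[OF h, of t] by auto
   have "t <= b'" if "b':B" "s < b'" for b' using s(3)[OF that(1)] that(2) by linarith
   hence "t:{fst (p s)..snd (p s)}" unfolding p[OF s(1), symmetric] using t s(2) by blast
   thus "t:(UN b:B. {fst (p b)..snd (p b)})" using s(1) by blast
  qed
  show "(UN b:B. {fst (p b)..snd (p b)}) <= {t:{0..L}. h t <= c}" using p by blast
 qed
 thus ?thesis using h by (intro exI[of _ "p`B"]) (auto simp: pl_def split_def)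
qed

lemma pl_diff:
 assumes h: "pl L B h1" "pl L B h2" shows "pl L B (%t. h1 t - h2 t)" unfolding pl_def
proof (intro conjI allI impI)
 show "finite B" "{0, L} <= B" "B <= {0..L}" using h(1) unfolding pl_def by blast+
 fix s t assume "0 <= s & s < t & t <= L & {s<..<t} \<inter> B = {}"
 hence c: "0 <= s" "s < t" "t <= L" "{s<..<t} \<inter> B = {}" by blast+
 obtain k1 k2 :: int where k1: "ALL u:{s..t}. h1 u = h1 s + of_int k1 * (u - s)" and k2: "ALL u:{s..t}. h2 u = h2 s + of_int k2 * (u - s)"
  using plD[OF h(1) c] plD[OF h(2) c] by blast
 show "\<exists>k::int. ALL u:{s..t}. h1 u - h2 u = h1 s - h2 s + of_int k * (u - s)"
 proof (intro exI[of _ "k1 - k2"] ballI)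
  fix u assume "u:{s..t}"
  from bspec[OF k1 this] bspec[OF k2 this]
  show "h1 u - h2 u = h1 s - h2 s + of_int (k1 - k2) * (u - s)" by (simp add: algebra_simps)
 qed
qed

subsection \<open>Uniqueness of quasistable divisors\<close>

locale tropical_curve =
 fixes \<G> :: "('v, 'e) lgraph" and l :: "'e => real"
 assumes wf: "wf_graph \<G>" and pos: "!!e. e:edges \<G> ==> l e > 0"
begin

abbreviation "al \<equiv> along \<G> l"
abbreviation "X \<equiv> curve_points \<G> l"

lemma along_flip: "e:edges \<G> ==> al (e, \<not> b) s = al (e, b) (l e - s)" using pos[of e] by (auto simp: along_def dart_src_def dart_tgt_def)

lemma along_in: assumes "fst d:edges \<G>" shows "al d s:X"
proof -
 have "dart_src \<G> d:verts \<G>" "dart_tgt \<G> d:verts \<G>" using edge_ends[OF wf assms] by (simp_all add: dart_src_def dart_tgt_def)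
 thus ?thesis using assms by (auto simp: along_def curve_points_def)
qed

lemma directions_at_Vertex: "directions_at \<G> l (Vertex v) = (%d. (d, 0))`{d. fst d:edges \<G> & dart_src \<G> d = v}"
 using pos by (force simp: directions_at_def directions_def along_def split: if_splits)

lemma directions_at_Inner:
 assumes "e:edges \<G>" "0 < t" "t < l e"
 shows "directions_at \<G> l (Inner e t) = {((e, True), t), ((e, False), l e - t)}"
 using assms by (auto simp: directions_at_def directions_def along_def split: if_splits)

lemma card_darts: "card {d. fst d:edges \<G> & dart_src \<G> d = v} = valence \<G> v" "finite {d. fst d:edges \<G> & dart_src \<G> d = v}"
proof -
 have fin: "finite (edges \<G>)" using wf by (rule wf_graphD)
 have eq: "{d. fst d:edges \<G> & dart_src \<G> d = v} =
  (%e. (e, True))`{e:edges \<G>. src \<G> e = v} \<union> (%e. (e, False))`{e:edges \<G>. tgt \<G> e = v}" by (auto simp: dart_src_def image_iff split: if_splits)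
 show "finite {d. fst d:edges \<G> & dart_src \<G> d = v}" unfolding eq using fin by simp
 show "card {d. fst d:edges \<G> & dart_src \<G> d = v} = valence \<G> v"
  unfolding eq valence_def using fin by (subst card_Un_disjoint) (auto simp: card_image inj_on_def)
qed

lemma finite_directions_at: "p:X ==> finite (directions_at \<G> l p)" using card_darts(2) directions_at_Inner by (auto simp: curve_points_def directions_at_Vertex)

lemma D_curve_eq: "D_curve n a m \<G> l p = (case p of Vertex v => D_graph n a m \<G> v | Inner e t => 0)"
proof (cases p)
 case (Vertex v)
 have "card (directions_at \<G> l (Vertex v)) = valence \<G> v" unfolding directions_at_Vertex by (simp add: card_image inj_on_def card_darts(1))
 thus ?thesis using Vertex by (auto simp: D_curve_def D_graph_def omega_curve_def omega_graph_def curve_points_def)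
next
 case (Inner e t)
 show ?thesis
 proof (cases "p:X")
  case True
  hence "e:edges \<G>" "0 < t" "t < l e" using Inner by (auto simp: curve_points_def)
  hence "card (directions_at \<G> l (Inner e t)) = 2" by (subst directions_at_Inner) simp_all
  thus ?thesis using Inner by (simp add: D_curve_def omega_curve_def)
 qed (simp add: D_curve_def Inner)
qed

lemma outgoing_slope_eq:
 assumes "s < t" and f: "!!u. u:{s..t} ==> f (al d u) = f (al d s) + k * (u - s)"
 shows "outgoing_slope \<G> l f (d, s) = k"
proof -
 have D: "((%u. f (al d u)) has_real_derivative k) (at_right s)" unfolding has_field_derivative_iff
 proof (rule tendsto_eventually)
  have "\<forall>\<^sub>F u in at_right s. u:{s<..<t}" using assms(1) by (rule eventually_at_right_real)
  thus "\<forall>\<^sub>F u in at_right s. (f (al d u) - f (al d s)) / (u - s) = k"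
  proof (rule eventually_mono)
   fix u assume "u:{s<..<t}"
   thus "(f (al d u) - f (al d s)) / (u - s) = k" using f[of u] by simp
  qed
 qed
 thus ?thesis unfolding outgoing_slope_def split
 proof (rule the_equality)
  fix k' assume "((%u. f (al d u)) has_real_derivative k') (at_right s)"
  thus "k' = k" using D unfolding has_field_derivative_iff by (rule tendsto_unique[OF trivial_limit_at_right_real])
 qed
qed

lemma rational_pl:
 assumes f: "rational_function \<G> l f" and e: "e:edges \<G>"
 shows "\<exists>B. pl (l e) B (%t. f (al (e, True) t))"
proof -
 obtain B where B: "finite B" "\<forall>s t. 0 <= s & s < t & t <= l e & {s<..<t} \<inter> B = {} -->
  (\<exists>k::int. ALL u:{s..t}. f (al (e, True) u) = f (al (e, True) s) + of_int k * (u - s))"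
  using f[unfolded rational_function_def Let_def, THEN bspec, OF e, THEN conjunct2] by (elim exE conjE) (simp only: that)
 have "pl (l e) (B \<inter> {0..l e} \<union> {0, l e}) (%t. f (al (e, True) t))" unfolding pl_def
 proof (intro conjI allI impI)
  fix s t assume st: "0 <= s & s < t & t <= l e & {s<..<t} \<inter> (B \<inter> {0..l e} \<union> {0, l e}) = {}"
  have "{s<..<t} \<inter> B = {}"
  proof (rule ccontr)
   assume "{s<..<t} \<inter> B ~= {}"
   then obtain u where "u:B" "s < u" "u < t" by auto
   hence "u:{s<..<t} \<inter> (B \<inter> {0..l e} \<union> {0, l e})" using st by auto
   thus False using st by blast
  qed
  thus "\<exists>k::int. ALL u:{s..t}. f (al (e, True) u) = f (al (e, True) s) + of_int k * (u - s)" using B(2) st by blast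
 qed (use B(1) pos[OF e] in auto)
 thus ?thesis by blast
qed

lemma pl_dart:
 assumes h: "pl (l e) B (%t. f (al (e, True) t))" and e: "e:edges \<G>"
 shows "pl (l e) (if b then B else (%t. l e - t)`B) (%t. f (al (e, b) t))" using h pl_reflect[OF h] along_flip[OF e, of True] by (cases b) simp_all

text \<open>Both subcurves in the proof are sublevel sets: where \<open>g = f1 - f2\<close> attains its maximum \<open>M\<close>, and
 where \<open>g \<le> M - \<epsilon>\<close>.  Each of the directions leaving the second one runs into the first one along a
 segment without breakpoints, so there are at most as many of them.\<close>

theorem quasistable_unique:
 assumes v0: "v0:verts \<G>"
  and q1: "curve_quasistable \<G> l (Vertex v0) \<mu> D1" and q2: "curve_quasistable \<G> l (Vertex v0) \<mu> D2"
  and e1: "equivalent_divisors \<G> l C D1" and e2: "equivalent_divisors \<G> l C D2"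
 shows "D1 = D2"
proof -
 obtain f1 where f1: "rational_function \<G> l f1" "!!p. p:X ==> of_int (D1 p - C p) = rational_div \<G> l f1 p" using e1 unfolding equivalent_divisors_def by blast
 obtain f2 where f2: "rational_function \<G> l f2" "!!p. p:X ==> of_int (D2 p - C p) = rational_div \<G> l f2 p" using e2 unfolding equivalent_divisors_def by blast
 define g where "g p = f1 p - f2 p" for p
 have fin: "finite (edges \<G>)" "finite (verts \<G>)" using wf by (rule wf_graphD)+
 have cd: "finite {p. D1 p ~= 0}" "{p. D1 p ~= 0} <= X" "finite {p. D2 p ~= 0}" "{p. D2 p ~= 0} <= X"
  using q1 q2 unfolding curve_quasistable_def curve_divisor_def by blast+
 \<comment> \<open>The support of \<open>D1\<close> is added to the breakpoints: then all of it lies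
   in \<open>Mk\<close> below, hence in one of the two subcurves.\<close>
 define supp where "supp e = {t:{0..l e}. D1 (Inner e t) ~= 0}" for e
 have fs: "finite (supp e)" for e by (rule finite_subset[OF _ finite_imageI[OF cd(1), of "%p. case p of Vertex v => 0 | Inner e t => t"]])
    (force simp: supp_def image_iff)
 have "\<exists>B. supp e <= B & pl (l e) B (%t. f1 (al (e, True) t)) & pl (l e) B (%t. f2 (al (e, True) t))" if e: "e:edges \<G>" for e
 proof -
  obtain B1 B2 where B: "pl (l e) B1 (%t. f1 (al (e, True) t))" "pl (l e) B2 (%t. f2 (al (e, True) t))" using rational_pl[OF f1(1) e] rational_pl[OF f2(1) e] by blast
  have "finite (supp e \<union> B1 \<union> B2)" "supp e \<union> B1 \<union> B2 <= {0..l e}" using B fs by (auto simp: pl_def supp_def)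
  thus ?thesis by (intro exI[of _ "supp e \<union> B1 \<union> B2"] conjI pl_mono[OF B(1)] pl_mono[OF B(2)]) (blast | assumption)+
 qed
 hence "ALL e:edges \<G>. \<exists>B. supp e <= B & pl (l e) B (%t. f1 (al (e, True) t)) & pl (l e) B (%t. f2 (al (e, True) t))" by blast
 from bchoice[OF this] obtain B where Ball: "ALL e:edges \<G>. supp e <= B e & pl (l e) (B e) (%t. f1 (al (e, True) t)) & pl (l e) (B e) (%t. f2 (al (e, True) t))" ..
 have B: "supp e <= B e" "pl (l e) (B e) (%t. f1 (al (e, True) t))" "pl (l e) (B e) (%t. f2 (al (e, True) t))" if "e:edges \<G>" for e using bspec[OF Ball that] by blast+
 define mk where "mk d = (if snd d then B (fst d) else (%t. l (fst d) - t)`B (fst d))" for d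
 have pl1: "pl (l (fst d)) (mk d) (%t. f1 (al d t))" "pl (l (fst d)) (mk d) (%t. f2 (al d t))" if "fst d:edges \<G>" for d
  using pl_dart[OF B(2)[OF that] that, of "snd d"] pl_dart[OF B(3)[OF that] that, of "snd d"] by (simp_all add: mk_def)
 have plg: "pl (l (fst d)) (mk d) (%t. g (al d t))" if "fst d:edges \<G>" for d unfolding g_def by (rule pl_diff[OF pl1[OF that]])
 define \<sigma> where "\<sigma> \<tau> = outgoing_slope \<G> l f1 \<tau> - outgoing_slope \<G> l f2 \<tau>" for \<tau>
 have piece: thesis
  if ds: "(d, s):directions \<G> l" and th: "!!t k. s < t ==> t:mk d ==> t <= l (fst d) ==> {s<..<t} \<inter> mk d = {} ==>
   \<sigma> (d, s) = of_int k ==> (!!u. u:{s..t} ==> g (al d u) = g (al d s) + of_int k * (u - s)) ==> thesis"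
  for d s thesis
 proof -
  have e: "fst d:edges \<G>" and s: "0 <= s" "s < l (fst d)" using ds by (auto simp: directions_def)
  from pl_next[OF plg[OF e] s] obtain t and k :: int where t: "s < t" "t:mk d" "t <= l (fst d)" "{s<..<t} \<inter> mk d = {}"
   and k: "!!u. u:{s..t} ==> g (al d u) = g (al d s) + of_int k * (u - s)" by blast
  obtain k1 :: int where k1: "ALL u:{s..t}. f1 (al d u) = f1 (al d s) + of_int k1 * (u - s)" using plD[OF pl1(1)[OF e] s(1) t(1,3,4)] by blast
  obtain k2 :: int where k2: "ALL u:{s..t}. f2 (al d u) = f2 (al d s) + of_int k2 * (u - s)" using plD[OF pl1(2)[OF e] s(1) t(1,3,4)] by blast
  have "\<sigma> (d, s) = of_int (k1 - k2)" unfolding \<sigma>_def of_int_diff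
   by (intro arg_cong2[of _ _ _ _ minus] outgoing_slope_eq[OF t(1)]) (erule bspec[OF k1] bspec[OF k2])+
  moreover have "g (al d u) = g (al d s) + of_int (k1 - k2) * (u - s)" if "u:{s..t}" for u using bspec[OF k1 that] bspec[OF k2 that] by (simp add: g_def algebra_simps)
  ultimately show ?thesis by (rule th[OF t])
 qed
 have div: "of_int (D1 p - D2 p) = (SUM \<tau>:directions_at \<G> l p. - \<sigma> \<tau>)" if "p:X" for p
  using f1(2)[OF that] f2(2)[OF that] unfolding rational_div_def \<sigma>_def by (simp add: sum_negf sum_subtractf)
 define Mk where "Mk = Vertex`verts \<G> \<union> (UN e:edges \<G>. al (e, True)`B e)"
 have fB: "finite (B e)" if "e:edges \<G>" for e using B(2)[OF that] by (simp add: pl_def)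
 have fMk: "finite Mk" unfolding Mk_def using fin fB by blast
 have mkM: "al d t:Mk" if d: "fst d:edges \<G>" "t:mk d" for d t
 proof -
  obtain e c where dd: "d = (e, c)" by (cases d)
  have e: "e:edges \<G>" using d(1) by (simp add: dd)
  have "EX b:B e. al d t = al (e, True) b"
  proof (cases c)
   case True thus ?thesis using d(2) by (intro bexI[of _ t]) (simp_all add: dd mk_def)
  next
   case False
   with d(2) obtain b where b: "b:B e" "t = l e - b" unfolding dd mk_def by auto
   have "al (e, \<not> True) t = al (e, True) (l e - t)" by (rule along_flip[OF e])
   thus ?thesis using False b by (intro bexI[of _ b]) (simp_all add: dd)
  qed
  thus ?thesis unfolding Mk_def using e by blast
 qed
 define M where "M = Max (g`Mk)"
 have Mk0: "Mk ~= {}" using v0 by (auto simp: Mk_def)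
 have gle: "g p <= M" if "p:Mk" for p unfolding M_def by (rule Max_ge) (use fMk that in auto)
 have gleX: "g p <= M" if p: "p:X" for p
 proof (cases p)
  case (Vertex v) thus ?thesis using p gle[of p] by (auto simp: curve_points_def Mk_def)
 next
  case (Inner e t)
  hence e: "e:edges \<G>" "0 < t" "t < l e" using p by (auto simp: curve_points_def)
  have "g (al (e, True) t) <= M" by (rule pl_le[OF plg[of "(e, True)", unfolded fst_conv]]) (use e mkM[of "(e, True)"] gle in auto)
  thus ?thesis using e Inner by (simp add: along_def)
 qed
 have "M:g`Mk" unfolding M_def by (rule Max_in) (use fMk Mk0 in auto)
 \<comment> \<open>Half of the smallest gap between \<open>M\<close> and another value on the finite
   set \<open>Mk\<close>; the inserted 1 covers the case that there is no other value.\<close>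
 have "\<exists>\<epsilon>>0. ALL p:Mk. g p = M \<or> g p < M - \<epsilon>"
 proof -
  define S where "S = (%p. M - g p)`{p:Mk. g p ~= M}"
  have fS: "finite S" using fMk by (simp add: S_def)
  have S0: "x > 0" if "x:S" for x using that gle by (force simp: S_def)
  have "Min (insert 1 S) > 0" using fS S0 by (subst Min_gr_iff) auto
  moreover have "M - g p >= Min (insert 1 S)" if "p:Mk" "g p ~= M" for p by (rule Min_le) (use fS that in "auto simp: S_def")
  ultimately show ?thesis by (intro exI[of _ "Min (insert 1 S) / 2"]) force
 qed
 then obtain \<epsilon> where \<epsilon>: "\<epsilon> > 0" "!!p. p:Mk ==> g p = M \<or> g p < M - \<epsilon>" by blast
 define Y1 where "Y1 = {p:X. g p = M}"
 define Y2 where "Y2 = {p:X. g p <= M - \<epsilon>}"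
 have sub: "subcurve \<G> l {p:X. h p <= c}" if "!!e. e:edges \<G> ==> pl (l e) (B e) (%t. h (al (e, True) t))" for h c
 proof -
  have "{t:{0..l e}. al (e, True) t:{p:X. h p <= c}} = {t:{0..l e}. h (al (e, True) t) <= c}" if "e:edges \<G>" for e using along_in[of "(e, True)"] that by auto
  thus ?thesis using pl_sublevel[OF that] unfolding subcurve_def by auto
 qed
 have plgB: "pl (l e) (B e) (%t. g (al (e, True) t))" if "e:edges \<G>" for e using plg[of "(e, True)"] that by (simp add: mk_def)
 have sY2: "subcurve \<G> l Y2" unfolding Y2_def by (rule sub[OF plgB])
 have sY1: "subcurve \<G> l Y1"
 proof -
  have "Y1 = {p:X. - g p <= - M}" using gleX by (force simp: Y1_def)
  moreover have "pl (l e) (B e) (%t. - g (al (e, True) t))" if "e:edges \<G>" for e using pl_diff[OF B(3)[OF that] B(2)[OF that]] by (simp add: g_def)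
  ultimately show ?thesis using sub[of "%p. - g p" "- M"] by simp
 qed
 \<comment> \<open>At a maximum no slope is positive. A direction leaving the set of maxima has
   nonzero slope, and by integrality it is then at most -1.\<close>
 have slope_le: "\<sigma> (d, s) <= 0" and slope_neg: "(d, s):leaving_directions \<G> l Y1 ==> \<sigma> (d, s) <= -1"
  if ds: "(d, s):directions \<G> l" and Y: "al d s:Y1" for d s
 proof -
  have e: "fst d:edges \<G>" using ds by (auto simp: directions_def)
  obtain t k where t: "s < t" "\<sigma> (d, s) = of_int k" and k: "!!u. u:{s..t} ==> g (al d u) = g (al d s) + of_int k * (u - s)"
   using ds by (rule piece) (rule that; assumption)
  have "of_int k * (t - s) <= 0" using k[of t] t(1) Y gleX[OF along_in[OF e, of t]] by (auto simp: Y1_def)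
  hence k0: "k <= 0" using t(1) by (simp add: mult_le_0_iff)
  thus "\<sigma> (d, s) <= 0" using t(2) by simp
  assume lv: "(d, s):leaving_directions \<G> l Y1"
  have "k ~= 0"
  proof
   assume "k = 0"
   hence "al d u:Y1" if "u:{s<..<t}" for u using k[of u] that Y along_in[OF e, of u] by (auto simp: Y1_def)
   moreover have "\<forall>\<^sub>F u in at_right s. al d u ~: Y1" using lv by (auto simp: leaving_directions_def)
   moreover have "\<forall>\<^sub>F u in at_right s. u:{s<..<t}" using t(1) by (rule eventually_at_right_real)
   ultimately have "\<forall>\<^sub>F u in at_right s. False" by (elim eventually_rev_mp) (auto elim: eventually_mono)
   thus False by simp
  qed
  thus "\<sigma> (d, s) <= -1" using k0 t(2) by simp
 qed
 define \<L>1 where "\<L>1 = leaving_directions \<G> l Y1"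
 define \<L>2 where "\<L>2 = leaving_directions \<G> l Y2"
 define F where "F = {p:Y1. D1 p ~= 0 \<or> D2 p ~= 0}"
 have fF: "finite F" by (rule finite_subset[OF _ finite_UnI[OF cd(1,3)]]) (auto simp: F_def)
 have FX: "F <= X" by (auto simp: F_def Y1_def)
 have dirs: "\<tau>:directions \<G> l" "al (fst \<tau>) (snd \<tau>) = p" if "\<tau>:directions_at \<G> l p" for \<tau> p using that by (auto simp: directions_at_def)
 \<comment> \<open>At a maximum \<open>D1 - D2\<close> is the sum of the negated slopes, to which
   every leaving direction contributes at least 1 and every other one at least 0.\<close>
 have local: "real (card (directions_at \<G> l p \<inter> \<L>1)) <= of_int (D1 p - D2 p)" if p: "p:Y1" for p
 proof -
  have pX: "p:X" using p by (simp add: Y1_def)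
  have "real (card (directions_at \<G> l p \<inter> \<L>1)) = (SUM \<tau>:directions_at \<G> l p. of_bool (\<tau>:\<L>1))"
   using finite_directions_at[OF pX] by (simp add: of_bool_def sum.If_cases)
  also have "... <= (SUM \<tau>:directions_at \<G> l p. - \<sigma> \<tau>)"
  proof (rule sum_mono)
   fix \<tau> assume \<tau>: "\<tau>:directions_at \<G> l p"
   have d: "(fst \<tau>, snd \<tau>):directions \<G> l" "al (fst \<tau>) (snd \<tau>):Y1" using dirs[OF \<tau>] p by simp_all
   show "of_bool (\<tau>:\<L>1) <= - \<sigma> \<tau>" using slope_le[OF d] slope_neg[OF d] by (auto simp: \<L>1_def of_bool_def)
  qed
  finally show ?thesis unfolding div[OF pX] .
 qed
 have L1_at: "\<tau>:directions_at \<G> l (al (fst \<tau>) (snd \<tau>))" "al (fst \<tau>) (snd \<tau>):F" if \<tau>: "\<tau>:\<L>1" for \<tau>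
 proof -
  have d: "(fst \<tau>, snd \<tau>):directions \<G> l" "al (fst \<tau>) (snd \<tau>):Y1" using \<tau> by (auto simp: \<L>1_def leaving_directions_def)
  thus da: "\<tau>:directions_at \<G> l (al (fst \<tau>) (snd \<tau>))" by (cases \<tau>) (simp add: directions_at_def)
  have "finite (directions_at \<G> l (al (fst \<tau>) (snd \<tau>)) \<inter> \<L>1)" using finite_directions_at d(2) by (auto simp: Y1_def)
  hence "card (directions_at \<G> l (al (fst \<tau>) (snd \<tau>)) \<inter> \<L>1) > 0" using da \<tau> by (auto simp: card_gt_0_iff)
  thus "al (fst \<tau>) (snd \<tau>):F" using local[OF d(2)] d(2) by (auto simp: F_def)
 qed
 have L1: "\<L>1 = (UN p:F. directions_at \<G> l p \<inter> \<L>1)" using L1_at by blast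
 have fin_at: "finite (directions_at \<G> l p \<inter> \<L>1)" if "p:F" for p using finite_directions_at FX that by blast
 have fL1: "finite \<L>1" by (subst L1) (use fF fin_at in blast)
 have "card \<L>1 = (SUM p:F. card (directions_at \<G> l p \<inter> \<L>1))" by (subst L1, rule card_UN_disjoint) (use fF fin_at in "auto simp: directions_at_def")
 hence "real (card \<L>1) = (SUM p:F. real (card (directions_at \<G> l p \<inter> \<L>1)))" by simp
 also have "... <= (SUM p:F. of_int (D1 p - D2 p))" by (rule sum_mono) (use local in "auto simp: F_def")
 finally have main: "real (card \<L>1) <= of_int (SUM p:F. D1 p) - of_int (SUM p:F. D2 p)" by (simp add: sum_subtractf)
 have "card \<L>2 <= card \<L>1"
 proof -
  \<comment> \<open>A direction leaving \<open>Y2\<close> starts at height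
    \<open>M - \<epsilon>\<close> and rises; the next breakpoint is higher, hence a maximum, and the
    reversed direction leaves \<open>Y1\<close> there. The clause on \<open>u\<close> recovers
    \<open>s\<close> from the segment and makes the assignment injective.\<close>
  let ?R = "%d s t. s < t & ((fst d, \<not> snd d), l (fst d) - t):\<L>1 & (ALL u:{s..t}. g (al d u) = M - \<epsilon> --> u = s) & g (al d s) = M - \<epsilon>"
  have "\<exists>t. ?R d s t" if ds: "(d, s):\<L>2" for d s
  proof -
   have dd: "(d, s):directions \<G> l" and sY: "al d s:Y2" and ev: "\<forall>\<^sub>F u in at_right s. al d u ~: Y2"
    using ds by (auto simp: \<L>2_def leaving_directions_def)
   have e: "fst d:edges \<G>" and s0: "0 <= s" using dd by (auto simp: directions_def)
   obtain t k where t: "s < t" "t:mk d" "t <= l (fst d)" "{s<..<t} \<inter> mk d = {}"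
    and k: "!!u. u:{s..t} ==> g (al d u) = g (al d s) + of_int k * (u - s)" using dd by (rule piece) (rule that; assumption)
   have "\<forall>\<^sub>F u in at_right s. u:{s<..<t}" using t(1) by (rule eventually_at_right_real)
   hence "\<forall>\<^sub>F u in at_right s. u:{s<..<t} & al d u ~: Y2" using ev by (rule eventually_conj)
   hence big: "\<forall>\<^sub>F u in at_right s. u:{s<..<t} & g (al d s) + of_int k * (u - s) > M - \<epsilon>"
   proof (rule eventually_mono)
    fix u assume u: "u:{s<..<t} & al d u ~: Y2"
    hence "g (al d u) = g (al d s) + of_int k * (u - s)" by (intro k) auto
    thus "u:{s<..<t} & g (al d s) + of_int k * (u - s) > M - \<epsilon>" using u along_in[OF e, of u] by (simp add: Y2_def not_le)
   qed
   have gs: "g (al d s) <= M - \<epsilon>" using sY by (simp add: Y2_def)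
   have "((%u. g (al d s) + of_int k * (u - s)) \<longlongrightarrow> g (al d s) + of_int k * (s - s)) (at_right s)" by (intro tendsto_intros)
   hence "M - \<epsilon> <= g (al d s) + of_int k * (s - s)" by (rule tendsto_lowerbound[OF _ eventually_mono[OF big]]) auto
   hence gs': "g (al d s) = M - \<epsilon>" using gs by simp
   obtain u where "u:{s<..<t}" "of_int k * (u - s) > 0" using eventually_happens[OF big] gs' by auto
   hence k0: "of_int k > (0::real)" by (auto simp: zero_less_mult_iff)
   have "g (al d t) > M - \<epsilon>" using k[of t] gs' k0 t(1) by simp
   hence gt: "g (al d t) = M" using \<epsilon>(2)[OF mkM[OF e t(2)]] by linarith
   have fl: "al (fst d, \<not> snd d) x = al d (l (fst d) - x)" for x using along_flip[OF e, of "snd d" x] by simp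
   have "((fst d, \<not> snd d), l (fst d) - t):\<L>1" unfolding \<L>1_def leaving_directions_def
   proof (intro CollectI case_prodI conjI)
    show "((fst d, \<not> snd d), l (fst d) - t):directions \<G> l" using t s0 e by (simp add: directions_def)
    show "al (fst d, \<not> snd d) (l (fst d) - t):Y1" unfolding fl using gt along_in[OF e] by (simp add: Y1_def)
    have "\<forall>\<^sub>F u in at_right (l (fst d) - t). u:{l (fst d) - t<..<l (fst d) - s}" by (rule eventually_at_right_real) (use t in auto)
    thus "\<forall>\<^sub>F u in at_right (l (fst d) - t). al (fst d, \<not> snd d) u ~: Y1"
    proof (rule eventually_mono)
     fix u assume u: "u:{l (fst d) - t<..<l (fst d) - s}"
     have "of_int k * (l (fst d) - u - s) < of_int k * (t - s)" using k0 u by (intro mult_strict_left_mono) auto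
     hence "g (al d (l (fst d) - u)) < M" using k[of "l (fst d) - u"] k[of t] gt u t(1) by auto
     thus "al (fst d, \<not> snd d) u ~: Y1" unfolding fl by (simp add: Y1_def)
    qed
   qed
   moreover have "u = s" if "u:{s..t}" "g (al d u) = M - \<epsilon>" for u using k[OF that(1)] that(2) gs' k0 by auto
   ultimately show ?thesis using t gs' by blast
  qed
  then obtain \<theta> where \<theta>: "!!d s. (d, s):\<L>2 ==> ?R d s (\<theta> d s)" by metis
  let ?\<theta> = "%(d, s). ((fst d, \<not> snd d), l (fst d) - \<theta> d s)"
  have "inj_on ?\<theta> \<L>2"
  proof (rule inj_onI)
   fix x y assume x: "x:\<L>2" and y: "y:\<L>2" and eq: "?\<theta> x = ?\<theta> y"
   obtain d s d' s' where xy: "x = (d, s)" "y = (d', s')" by (cases x; cases y) simp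
   have d: "d' = d" using eq xy by (auto simp: prod_eq_iff)
   hence t: "\<theta> d s = \<theta> d s'" using eq xy by simp
   note a = \<theta>[OF x[unfolded xy]] and b = \<theta>[OF y[unfolded xy d]]
   have "s = s'"
   proof (cases "s <= s'")
    case True
    hence "s':{s..\<theta> d s}" using b t by auto
    thus ?thesis using a b by blast
   next
    case False
    hence "s:{s'..\<theta> d s'}" using a t by auto
    thus ?thesis using a b by blast
   qed
   thus "x = y" using xy d by simp
  qed
  moreover have "?\<theta>`\<L>2 <= \<L>1" using \<theta> by force
  ultimately show ?thesis by (rule card_inj_on_le[OF _ _ fL1])
 qed
 note L21 = this
 have cover: "p:Y1 \<or> p:Y2" if "p:Mk" "p:X" for p using \<epsilon>(2)[OF that(1)] that(2) by (auto simp: Y1_def Y2_def)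
 have disj: "Y1 \<inter> Y2 = {}" using \<epsilon>(1) by (auto simp: Y1_def Y2_def)
 have VX: "Vertex v:X" "Vertex v:Mk" if "v:verts \<G>" for v using that by (auto simp: curve_points_def Mk_def)
 have supp_Mk: "p:Mk" if "D1 p ~= 0" for p
 proof (cases p)
  case (Vertex v) thus ?thesis using cd(2) that by (auto simp: curve_points_def Mk_def)
 next
  case (Inner e t)
  hence et: "e:edges \<G>" "0 < t" "t < l e" using cd(2) that by (auto simp: curve_points_def)
  hence "t:B e" using B(1)[OF et(1)] that Inner by (auto simp: supp_def)
  moreover have "p = al (e, True) t" using et Inner by (simp add: along_def)
  ultimately show ?thesis using et(1) unfolding Mk_def by blast
 qed
 note q1' = q1[unfolded curve_quasistable_def Let_def] and q2' = q2[unfolded curve_quasistable_def Let_def]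
 let ?m = "%Y. (SUM v:{v:verts \<G>. Vertex v:Y}. \<mu> v)"
 let ?s = "%D Y. (SUM p:{p:Y. D p ~= 0}. D p :: int)"
 have b1: "0 <= of_int (?s D2 Y1) - ?m Y1 + real (card \<L>1) / 2" "Y1 ~= X ==> Vertex v0:Y1 ==> 0 < of_int (?s D2 Y1) - ?m Y1 + real (card \<L>1) / 2"
  using q2' sY1 unfolding \<L>1_def by blast+
 have b2: "0 <= of_int (?s D1 Y2) - ?m Y2 + real (card \<L>2) / 2" "Y2 ~= X ==> Vertex v0:Y2 ==> 0 < of_int (?s D1 Y2) - ?m Y2 + real (card \<L>2) / 2"
  using q1' sY2 unfolding \<L>2_def by blast+
 have tot: "of_int (SUM p:{p. D1 p ~= 0}. D1 p) = (SUM v:verts \<G>. \<mu> v)" using q1' by blast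
 have s1: "(SUM p:{p. D1 p ~= 0}. D1 p) = ?s D1 Y1 + ?s D1 Y2"
 proof -
  have "{p. D1 p ~= 0} = {p:Y1. D1 p ~= 0} \<union> {p:Y2. D1 p ~= 0}" using cover supp_Mk cd(2) by blast
  hence "(SUM p:{p. D1 p ~= 0}. D1 p) = (SUM p:{p:Y1. D1 p ~= 0} \<union> {p:Y2. D1 p ~= 0}. D1 p)" by (rule arg_cong)
  also have "... = ?s D1 Y1 + ?s D1 Y2"
  proof (rule sum.union_disjoint)
   show "finite {p:Y1. D1 p ~= 0}" "finite {p:Y2. D1 p ~= 0}" by (rule finite_subset[OF _ cd(1)], blast)+
  qed (use disj in blast)
  finally show ?thesis .
 qed
 have m1: "(SUM v:verts \<G>. \<mu> v) = ?m Y1 + ?m Y2"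
 proof -
  have "verts \<G> = {v:verts \<G>. Vertex v:Y1} \<union> {v:verts \<G>. Vertex v:Y2}" (is "_ = ?V")
  proof
   show "verts \<G> <= ?V" using cover[OF VX(2,1)] by blast
  qed blast
  hence "(SUM v:verts \<G>. \<mu> v) = (SUM v:{v:verts \<G>. Vertex v:Y1} \<union> {v:verts \<G>. Vertex v:Y2}. \<mu> v)" by (rule arg_cong)
  also have "... = ?m Y1 + ?m Y2" by (rule sum.union_disjoint) (use disj fin in auto)
  finally show ?thesis .
 qed
 have F1: "(SUM p:F. D1 p) = ?s D1 Y1" "(SUM p:F. D2 p) = ?s D2 Y1" by (rule sum.mono_neutral_right; use fF in "auto simp: F_def")+
 have "Y1 = X"
 proof (rule ccontr)
  assume ne: "Y1 ~= X"
  have "EX p:Mk. g p = M" using \<open>M:g`Mk\<close> by blast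
  moreover have "Mk <= X" using VX along_in by (fastforce simp: Mk_def)
  ultimately have "Y1 ~= {}" by (auto simp: Y1_def)
  hence Y2X: "Y2 ~= X" using disj by (auto simp: Y1_def)
  have "Vertex v0:Y1 \<or> Vertex v0:Y2" using cover VX[OF v0] by blast
  \<comment> \<open>One of the two inequalities is strict because \<open>v0\<close> lies in
    \<open>Y1\<close> or \<open>Y2\<close>. Since \<open>D1\<close> has the degree of
    \<open>\<mu>\<close> on the union and exceeds \<open>D2\<close> on \<open>Y1\<close> by at least
    the size of \<open>\<L>1\<close>, the sum would make \<open>\<L>2\<close> larger than
    \<open>\<L>1\<close>.\<close>
  hence "0 < (of_int (?s D2 Y1) - ?m Y1 + real (card \<L>1) / 2) + (of_int (?s D1 Y2) - ?m Y2 + real (card \<L>2) / 2)"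
   using b1 b2 ne Y2X by (elim disjE) (auto intro: add_pos_nonneg add_nonneg_pos)
  moreover have "real (card \<L>2) <= real (card \<L>1)" using L21 by simp
  moreover have "of_int (?s D1 Y1) + of_int (?s D1 Y2) = ?m Y1 + ?m Y2" using tot unfolding s1 m1 of_int_add .
  ultimately show False using main[unfolded F1] by linarith
 qed
 hence gM: "g p = M" if "p:X" for p using that by (auto simp: Y1_def)
 have "D1 p = D2 p" if p: "p:X" for p
 proof -
  have "\<sigma> \<tau> = 0" if \<tau>: "\<tau>:directions_at \<G> l p" for \<tau>
  proof -
   have d: "(fst \<tau>, snd \<tau>):directions \<G> l" using dirs[OF \<tau>] by simp
   hence e: "fst (fst \<tau>):edges \<G>" by (auto simp: directions_def)
   obtain t k where t: "snd \<tau> < t" "\<sigma> (fst \<tau>, snd \<tau>) = of_int k" and k: "!!u. u:{snd \<tau>..t} ==> g (al (fst \<tau>) u) = g (al (fst \<tau>) (snd \<tau>)) + of_int k * (u - snd \<tau>)"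
    using d by (rule piece) (rule that; assumption)
   show ?thesis using k[of t] t gM[OF along_in[OF e]] by simp
  qed
  thus ?thesis using div[OF p] by simp
 qed
 moreover have "D1 p = D2 p" if "p ~: X" for p using cd(2,4) that by force
 ultimately show ?thesis by blast
qed

end

subsection \<open>Subcurves\<close>

context tropical_curve
begin

lemma subcurve_dart:
 assumes Y: "subcurve \<G> l Y" and e: "e:edges \<G>"
 shows "\<exists>A. finite A & {t:{0..l e}. al (e, b) t:Y} = (UN (x, y):A. {x..y})"
proof -
 obtain A where A: "finite A" "{t:{0..l e}. al (e, True) t:Y} = (UN (x, y):A. {x..y})" using Y e unfolding subcurve_def by blast
 show ?thesis
 proof (cases b)
  case False
  have flip: "al (e, False) t = al (e, True) (l e - t)" for t using along_flip[OF e, of True t] by simp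
  have mem: "u:(UN (x, y):A. {x..y}) \<longleftrightarrow> u:{0..l e} & al (e, True) u:Y" for u unfolding A(2)[symmetric] by blast
  have "{t:{0..l e}. al (e, False) t:Y} = (UN (x, y):(%(x, y). (l e - y, l e - x))`A. {x..y})"
  proof (rule set_eqI)
   fix t
   have "t:(UN (x, y):(%(x, y). (l e - y, l e - x))`A. {x..y}) \<longleftrightarrow> l e - t:(UN (x, y):A. {x..y})" by (force simp: split_def)
   thus "t:{t:{0..l e}. al (e, False) t:Y} \<longleftrightarrow> t:(UN (x, y):(%(x, y). (l e - y, l e - x))`A. {x..y})" unfolding mem flip by auto
  qed
  thus ?thesis using A(1) False by (intro exI[of _ "(%(x, y). (l e - y, l e - x))`A"]) simp
 qed (use A in auto)
qed

text \<open>The part of \<open>Y\<close> on a closed segment is compact, and \<open>Y\<close> is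
  left at its last point.\<close>

lemma last_exit:
 assumes Y: "subcurve \<G> l Y" and e: "e:edges \<G>" and ab: "0 <= a" "a < b" "b <= l e" and aY: "al (e, c) a:Y" and bY: "al (e, c) b ~: Y"
 shows "\<exists>s. a <= s & s < b & ((e, c), s):leaving_directions \<G> l Y"
proof -
 obtain A where A: "finite A" "{t:{0..l e}. al (e, c) t:Y} = (UN (x, y):A. {x..y})" using subcurve_dart[OF Y e] by blast
 have "compact ({t:{0..l e}. al (e, c) t:Y} \<inter> {a..b})" unfolding A(2) by (rule compact_Int) (use A(1) in "auto intro!: compact_UN")
 moreover have "a:{t:{0..l e}. al (e, c) t:Y} \<inter> {a..b}" using ab aY by simp
 ultimately obtain s where s: "s:{t:{0..l e}. al (e, c) t:Y} \<inter> {a..b}" "!!t. t:{t:{0..l e}. al (e, c) t:Y} \<inter> {a..b} ==> t <= s"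
  using compact_attains_sup[of "{t:{0..l e}. al (e, c) t:Y} \<inter> {a..b}"] by blast
 have "s ~= b" using s(1) bY by auto
 hence sb: "s < b" "a <= s" using s(1) by auto
 have "\<forall>\<^sub>F u in at_right s. u:{s<..<b}" using sb(1) by (rule eventually_at_right_real)
 hence "\<forall>\<^sub>F u in at_right s. al (e, c) u ~: Y"
 proof (rule eventually_mono)
  fix u assume u: "u:{s<..<b}"
  show "al (e, c) u ~: Y"
  proof
   assume "al (e, c) u:Y"
   hence "u:{t:{0..l e}. al (e, c) t:Y} \<inter> {a..b}" using u sb ab by auto
   thus False using s(2)[of u] u by auto
  qed
 qed
 hence "((e, c), s):leaving_directions \<G> l Y" using s(1) sb ab e by (auto simp: leaving_directions_def directions_def)
 thus ?thesis using sb by blast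
qed

text \<open>On each dart a subcurve is a finite union of closed intervals and can be left only at
  their upper ends.\<close>

lemma finite_leaving: assumes Y: "subcurve \<G> l Y" shows "finite (leaving_directions \<G> l Y)"
proof -
 have fin: "finite (edges \<G>)" using wf by (rule wf_graphD)
 have "finite {s. (d, s):leaving_directions \<G> l Y}" if d: "fst d:edges \<G>" for d
 proof -
  obtain e c where dd: "d = (e, c)" by (cases d)
  have e: "e:edges \<G>" using d dd by simp
  obtain A where A: "finite A" "{t:{0..l e}. al (e, c) t:Y} = (UN (x, y):A. {x..y})" using subcurve_dart[OF Y e] by blast
  have "{s. (d, s):leaving_directions \<G> l Y} <= snd`A"
  proof
   fix s assume "s:{s. (d, s):leaving_directions \<G> l Y}"
   hence s: "0 <= s" "s < l e" "al (e, c) s:Y" and ev: "\<forall>\<^sub>F u in at_right s. al (e, c) u ~: Y" by (auto simp: leaving_directions_def directions_def dd)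
   hence "s:(UN (x, y):A. {x..y})" unfolding A(2)[symmetric] by simp
   then obtain x y where xy: "(x, y):A" "x <= s" "s <= y" by auto
   have "s = y"
   proof (rule ccontr)
    assume "s ~= y"
    hence "\<forall>\<^sub>F u in at_right s. u:{s<..<y}" using xy by (intro eventually_at_right_real) simp
    hence "\<forall>\<^sub>F u in at_right s. u:{s<..<y} & al (e, c) u ~: Y" using ev by (rule eventually_conj)
    then obtain u where u: "u:{s<..<y}" "al (e, c) u ~: Y" using eventually_happens[of _ "at_right s"] by force
    hence "u:{x..y}" using xy(2) by auto
    hence "u:(UN (x, y):A. {x..y})" using xy(1) by blast
    thus False using u(2) unfolding A(2)[symmetric] by blast
   qed
   thus "s:snd`A" using xy(1) by force
  qed
  thus ?thesis using A(1) finite_subset by blast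
 qed
 moreover have "leaving_directions \<G> l Y <= (SIGMA d:edges \<G> \<times> UNIV. {s. (d, s):leaving_directions \<G> l Y})"
  by (auto simp: leaving_directions_def directions_def)
 moreover have "finite (edges \<G> \<times> (UNIV :: bool set))" using fin by simp
 ultimately show ?thesis by (elim finite_subset) (rule finite_SigmaI, auto)
qed

end

subsection \<open>Refinements of a tropical curve\<close>

text \<open>Positive lengths on the edges of the refinement make \<open>H\<close>, with the summed
  lengths \<open>l\<close>, a tropical curve and turn the vertices of \<open>G\<close> into points
  of it.\<close>

locale metric_chains = chains +
 fixes z assumes z_pos: "!!a. a:edges G ==> z a > (0::real)"
begin

abbreviation "l \<equiv> path_lengths H P z"

definition T where "T e i = (\<Sum>k<i. z (ed e k))"

lemma l_eq: "e:edges H ==> l e = T e (len e)" by (simp add: path_lengths_def T_def ed_def sum_list_sum_nth atLeast0LessThan)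

lemma T_0 [simp]: "T e 0 = 0" by (simp add: T_def)

lemma T_less: assumes "e:edges H" "i < k" "k <= len e" shows "T e i < T e k"
proof -
 have "T e k = T e i + (SUM x:{i..<k}. z (ed e x))" using assms(2) by (simp add: T_def lessThan_atLeast0 sum.atLeastLessThan_concat)
 moreover have "(SUM x:{i..<k}. z (ed e x)) > 0" by (rule sum_pos) (use assms z_pos ed_edge in auto)
 ultimately show ?thesis by simp
qed

lemma T_le: "e:edges H ==> i <= k ==> k <= len e ==> T e i <= T e k" using T_less[of e i k] by (cases "i = k") auto

lemma T_range: assumes "e:edges H" "i <= len e" shows "0 <= T e i" "T e i <= l e"
 using T_le[OF assms(1), of 0 i] T_le[OF assms(1), of i "len e"] assms by (simp_all add: l_eq)

sublocale X: tropical_curve H l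
proof
 show "0 < l e" if "e:edges H" for e using T_less[OF that, of 0 "len e"] len_pos[OF that] that by (simp add: l_eq)
qed (rule wfH)

lemma T_cover:
 assumes e: "e:edges H" and t: "0 <= t" "t < l e"
 obtains i where "i < len e" "T e i <= t" "t < T e (Suc i)"
proof -
 define i where "i = (LEAST k. t < T e (Suc k))"
 have ex: "t < T e (Suc (len e - 1))" using t(2) len_pos[OF e] by (simp add: l_eq[OF e])
 have 1: "t < T e (Suc i)" unfolding i_def by (rule LeastI[of "%k. t < T e (Suc k)", OF ex])
 have "i <= len e - 1" unfolding i_def by (rule Least_le[of "%k. t < T e (Suc k)", OF ex])
 moreover have "len e - 1 < len e" using len_pos[OF e] by linarith
 ultimately have 2: "i < len e" by (rule order.strict_trans1)
 have "T e i <= t"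
 proof (cases i)
  case (Suc k)
  hence "\<not> t < T e (Suc k)" unfolding i_def by (intro not_less_Least[of k "%k. t < T e (Suc k)"]) simp
  thus ?thesis using Suc by simp
 qed (use t in simp)
 thus ?thesis using that 1 2 by blast
qed

lemma T_unique:
 assumes e: "e:edges H" and i: "i < len e" "T e i <= t" "t < T e (Suc i)" and k: "k < len e" "T e k <= t" "t < T e (Suc k)"
 shows "i = k" using T_le[OF e, of "Suc i" k] T_le[OF e, of "Suc k" i] i k by (cases i k rule: linorder_cases) auto

text \<open>The point of the curve at which a vertex of the refinement sits. The choice is unique
  because interior vertices of chains are distinct.\<close>

definition ps where
 "ps v = (if v:good then Vertex (inv_into (verts H) j v)
   else case SOME (e, i). e:edges H & 0 < i & i < len e & v = pt e i of (e, i) => Inner e (T e i))"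

lemma ps_good: "v:verts H ==> ps (j v) = Vertex v" using refD(1) by (simp add: ps_def inv_into_f_f)

lemma ps_bad: assumes e: "e:edges H" and i: "0 < i" "i < len e" shows "ps (pt e i) = Inner e (T e i)"
proof -
 have "(SOME (e', i'). e':edges H & 0 < i' & i' < len e' & pt e i = pt e' i') = (e, i)"
 proof (rule some_equality)
  fix p assume p: "case p of (e', i') => e':edges H & 0 < i' & i' < len e' & pt e i = pt e' i'"
  obtain e' i' where pp: "p = (e', i')" by (cases p)
  have "e = e'" "i = i'" by (rule pt_inj[OF e i]; use p pp in simp)+
  thus "p = (e, i)" using pp by simp
 qed (use e i in simp)
 thus ?thesis using pt_bad(2)[OF e i] by (simp add: ps_def)
qed

lemma ps_pt: assumes e: "e:edges H" and i: "i <= len e" shows "ps (pt e i) = X.al (e, True) (T e i)"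
proof -
 note V = edge_ends[OF wfH e]
 consider "i = 0" | "i = len e" "0 < i" | "0 < i" "i < len e" using i by linarith
 thus ?thesis
 proof cases
  case 1 thus ?thesis using pt_0[OF e] ps_good[OF V(1)] by (simp add: along_def dart_src_def)
 next
  case 2 thus ?thesis using pt_len[of e] ps_good[OF V(2)] X.pos[OF e] by (simp add: along_def dart_tgt_def flip: l_eq[OF e])
 next
  case 3
  hence "0 < T e i" "T e i < l e" using T_less[OF e, of 0 i] T_less[OF e, of i "len e"] by (simp_all add: l_eq[OF e])
  thus ?thesis using ps_bad[OF e 3] by (simp add: along_def)
 qed
qed

lemma vertex_cases:
 assumes "v:verts G"
 obtains (good) w where "w:verts H" "v = j w" | (bad) e i where "e:edges H" "0 < i" "i < len e" "v = pt e i" using pt_surj[OF assms] by blast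

lemma ps_inj: "inj_on ps (verts G)"
proof (rule inj_onI)
 fix u v assume uv: "u:verts G" "v:verts G" "ps u = ps v"
 show "u = v"
 proof (cases rule: vertex_cases[OF uv(1)])
  case (1 w)
  show ?thesis by (cases rule: vertex_cases[OF uv(2)]) (use 1 uv(3) ps_good ps_bad in auto)
 next
  case u: (2 e i)
  show ?thesis
  proof (cases rule: vertex_cases[OF uv(2)])
   case v: (2 e' i')
   have "e = e' & T e i = T e' i'" using uv(3) unfolding u(4) v(4) ps_bad[OF u(1-3)] ps_bad[OF v(1-3)] point.inject .
   hence e: "e' = e" and T': "T e i = T e' i'" by (elim conjE, simp only:)+
   have T: "T e i = T e i'" using T' unfolding e .
   have "i = i'" using T T_less[OF u(1), of i i'] T_less[OF u(1), of i' i] u(3) v(3) e by (cases i i' rule: linorder_cases) auto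
   thus ?thesis using u(4) v(4) e by simp
  qed (use u uv(3) ps_good ps_bad in auto)
 qed
qed

lemma ps_in: assumes "v:verts G" shows "ps v:X.X" by (cases rule: vertex_cases[OF assms])
   (use ps_good ps_pt[OF _ less_imp_le] X.along_in in "force simp: curve_points_def")+

lemma ps_eq_along:
 assumes e: "e:edges H" and i: "i < len e" "T e i <= t" "t < T e (Suc i)" and v: "v:verts G" "ps v = X.al (e, True) t"
 shows "t = T e i" "v = pt e i"
proof -
 have tl: "t < l e" "0 <= t" using i T_range[OF e, of "Suc i"] T_range[OF e, of i] by simp_all
 show t: "t = T e i"
 proof (cases "t = 0")
  case True thus ?thesis using i T_range(1)[OF e, of i] by simp
 next
  case False
  hence pI: "ps v = Inner e t" using v(2) tl by (simp add: along_def)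
  show ?thesis
  proof (cases rule: vertex_cases[OF v(1)])
   case (1 w) thus ?thesis using pI ps_good by simp
  next
   case (2 e' i')
   have "e' = e & T e' i' = t" using pI unfolding 2(4) ps_bad[OF 2(1-3)] point.inject .
   hence e': "e' = e" and t': "t = T e' i'" by (elim conjE, simp only:)+
   have "t = T e i'" using t' unfolding e' .
   thus ?thesis using T_unique[OF e i, of i'] T_less[OF e, of i' "Suc i'"] 2 e' by simp
  qed
 qed
 show "v = pt e i" by (rule inj_onD[OF ps_inj _ v(1) pt_verts]) (use e i v(2) ps_pt t in auto)
qed

definition cd :: "_ => _ => int" where "cd D = push_forward (verts G) ps D"

lemma cd_ps: "v:verts G ==> cd D (ps v) = D v" by (simp add: cd_def push_forward_inj[OF ps_inj])

lemma cd_support: "{p. cd D p ~= 0} <= ps`verts G" using push_forward_outside[of _ ps "verts G" D] by (auto simp: cd_def)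

lemma cd_sum: "(SUM p:{p:Y. cd D p ~= 0}. cd D p) = (SUM v:{v:verts G. ps v:Y}. D v)"
proof -
 have fin: "finite (verts G)" using wfG by (rule wf_graphD)
 have "(SUM p:{p:Y. cd D p ~= 0}. cd D p) = (SUM p:ps`{v:verts G. ps v:Y}. cd D p)" by (rule sum.mono_neutral_left) (use fin cd_support in auto)
 also have "... = (SUM v:{v:verts G. ps v:Y}. D v)" by (subst sum.reindex) (auto intro: inj_on_subset[OF ps_inj] simp: cd_ps)
 finally show ?thesis .
qed

text \<open>Each cut edge of \<open>G\<close> has one end in \<open>Y\<close> and one outside, so
  \<open>Y\<close> is left somewhere on it. Half-open ranges, closed where the travel starts, keep
  directions on different edges apart.\<close>

lemma cut_leaving:
 assumes Y: "subcurve H l Y"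
 shows "cut_size G {v:verts G. ps v:Y} <= card (leaving_directions H l Y)"
proof -
 let ?W = "{v:verts G. ps v:Y}" and ?L = "leaving_directions H l Y"
 let ?C = "{a:edges G. (src G a:?W) ~= (tgt G a:?W)}"
 let ?ok = "%a \<tau>. \<tau>:?L & fst (fst \<tau>) = ch a & (if snd (fst \<tau>) then T (ch a) (ix a) <= snd \<tau> & snd \<tau> < T (ch a) (Suc (ix a))
   else T (ch a) (ix a) < l (ch a) - snd \<tau> & l (ch a) - snd \<tau> <= T (ch a) (Suc (ix a)))"
 have "\<exists>\<tau>. ?ok a \<tau>" if a: "a:?C" for a
 proof -
  have aE: "a:edges G" using a by blast
  define e i where "e = ch a" and "i = ix a"
  note c = ch_ix[OF aE, folded e_def i_def]
  have "pt e i:?W \<longleftrightarrow> pt e (Suc i) ~: ?W" using ends_ed[OF c(1,2)] a unfolding c(3) by force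
  moreover have "pt e i:verts G" "pt e (Suc i):verts G" using pt_verts[OF c(1)] c(2) by simp_all
  moreover have "ps (pt e i) = X.al (e, True) (T e i)" "ps (pt e (Suc i)) = X.al (e, True) (T e (Suc i))" using ps_pt[OF c(1)] c(2) by simp_all
  ultimately have W: "X.al (e, True) (T e i):Y \<longleftrightarrow> X.al (e, True) (T e (Suc i)) ~: Y" by simp
  have T: "0 <= T e i" "T e i < T e (Suc i)" "T e (Suc i) <= l e" using T_range[OF c(1)] T_less[OF c(1)] c(2) by simp_all
  show ?thesis
  proof (cases "X.al (e, True) (T e i):Y")
   case True
   then obtain s where "T e i <= s" "s < T e (Suc i)" "((e, True), s):?L" using X.last_exit[OF Y c(1) T True] W by blast
   thus ?thesis unfolding e_def[symmetric] i_def[symmetric] by (intro exI[of _ "((e, True), s)"]) simp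
  next
   case False
   have fl: "X.al (e, False) (l e - t) = X.al (e, True) t" for t using X.along_flip[OF c(1), of True "l e - t"] by simp
   have "\<exists>s. l e - T e (Suc i) <= s & s < l e - T e i & ((e, False), s):?L" by (rule X.last_exit[OF Y c(1)]) (use T False W fl in auto)
   then obtain s where "l e - T e (Suc i) <= s" "s < l e - T e i" "((e, False), s):?L" by blast
   thus ?thesis unfolding e_def[symmetric] i_def[symmetric] by (intro exI[of _ "((e, False), s)"]) simp
  qed
 qed
 hence "ALL a:?C. \<exists>\<tau>. ?ok a \<tau>" by blast
 from bchoice[OF this] obtain \<theta> where \<theta>: "ALL a:?C. ?ok a (\<theta> a)" ..
 have "inj_on \<theta> ?C"
 proof (rule inj_onI)
  fix a b assume ab: "a:?C" "b:?C" "\<theta> a = \<theta> b"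
  note a = bspec[OF \<theta> ab(1)] and b = bspec[OF \<theta> ab(2), folded ab(3)]
  have ch: "ch b = ch a" using a b by simp
  have aE: "a:edges G" and bE: "b:edges G" using ab by blast+
  note ca = ch_ix[OF aE] and cb = ch_ix[OF bE, unfolded ch]
  have "ix a = ix b"
  proof (cases "snd (fst (\<theta> a))")
   case True
   thus ?thesis using T_unique[OF ca(1,2) _ _ cb(2), of "snd (\<theta> a)"] a b ch by simp
  next
   case False
   thus ?thesis using a b ch T_le[OF ca(1), of "Suc (ix a)" "ix b"] T_le[OF ca(1), of "Suc (ix b)" "ix a"] ca(2) cb(2) by (cases "ix a" "ix b" rule: linorder_cases) auto
  qed
  thus "a = b" using ca(3) cb(3) by metis
 qed
 moreover have "\<theta>`?C <= ?L" using \<theta> by blast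
 ultimately show ?thesis unfolding cut_size_def by (rule card_inj_on_le[OF _ _ X.finite_leaving[OF Y]])
qed

text \<open>A subcurve is compared with the set of vertices it contains: degrees and polarizations
  agree, and at least as many directions leave it as edges are cut. If it contains all vertices but
  not the whole curve, strictness comes from a direction that leaves it on an edge of
  \<open>H\<close>.\<close>

lemma curve_quasistable:
 assumes v0: "v0:verts H" and q: "quasistable G (j v0) \<nu> D" and \<nu>: "!!v. v:verts G ==> v ~: good ==> \<nu> v = 0"
  and \<mu>: "!!v. v:verts H ==> \<mu> v = \<nu> (j v)"
 shows "curve_quasistable H l (Vertex v0) \<mu> (cd D)"
proof -
 have fin: "finite (verts G)" "finite (verts H)" using wfG wfH by (auto intro: wf_graphD)
 have msum: "(SUM v:{v:verts H. Vertex v:Y}. \<mu> v) = (SUM w:{v:verts G. ps v:Y}. \<nu> w)" for Y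
 proof -
  have "(SUM w:{v:verts G. ps v:Y}. \<nu> w) = (SUM w:j`{v:verts H. Vertex v:Y}. \<nu> w)"
  proof (rule sum.mono_neutral_right)
   show "ALL w:{v:verts G. ps v:Y} - j`{v:verts H. Vertex v:Y}. \<nu> w = 0"
   proof
    fix w assume w: "w:{v:verts G. ps v:Y} - j`{v:verts H. Vertex v:Y}"
    have "w ~: good"
    proof
     assume "w:good"
     then obtain v where v: "v:verts H" "w = j v" by blast
     hence "Vertex v:Y" using w ps_good[OF v(1)] by auto
     thus False using w v by blast
    qed
    thus "\<nu> w = 0" using w \<nu> by blast
   qed
  qed (use fin refD(2) ps_good in auto)
  also have "... = (SUM v:{v:verts H. Vertex v:Y}. \<mu> v)" using refD(1) by (subst sum.reindex) (auto intro: inj_on_subset simp: \<mu>)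
  finally show ?thesis ..
 qed
 have tot: "of_int (SUM v:verts G. D v) = (SUM v:verts G. \<nu> v)"
  and be: "!!W. W \<subset> verts G ==> beta G \<nu> D W >= 0 & (j v0:W --> beta G \<nu> D W > 0)" using q unfolding quasistable_def by blast+
 show ?thesis unfolding curve_quasistable_def Let_def
 proof (intro conjI allI impI)
  show "curve_divisor H l (cd D)" using finite_subset[OF cd_support finite_imageI[OF fin(1)]] cd_support ps_in unfolding curve_divisor_def by blast
  show "of_int (SUM p:{p. cd D p ~= 0}. cd D p) = (SUM v:verts H. \<mu> v)" using cd_sum[of D UNIV] msum[of UNIV] tot by simp
  fix Y assume Y: "subcurve H l Y"
  let ?W = "{v:verts G. ps v:Y}" and ?L = "leaving_directions H l Y"
  let ?b = "of_int (SUM p:{p:Y. cd D p ~= 0}. cd D p) - (SUM v:{v:verts H. Vertex v:Y}. \<mu> v) + real (card ?L) / 2"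
  have b: "?b = of_int (SUM v:?W. D v) - (SUM v:?W. \<nu> v) + real (card ?L) / 2" unfolding cd_sum msum ..
  have ge: "?b >= beta G \<nu> D ?W" unfolding b beta_def using cut_leaving[OF Y] by simp
  have W: "?W \<subset> verts G \<or> ?W = verts G" by blast
  show "0 <= ?b" using W
  proof
   assume "?W \<subset> verts G" thus ?thesis using be[of ?W] ge by linarith
  next
   assume "?W = verts G" thus ?thesis unfolding b using tot by simp
  qed
  assume ne: "Y ~= X.X & Vertex v0:Y"
  show "0 < ?b" using W
  proof
   assume "?W \<subset> verts G"
   moreover have "j v0:?W" using refD(2) v0 ps_good[OF v0] ne by auto
   ultimately show ?thesis using be[of ?W] ge by force
  next
   assume Weq: "?W = verts G"
   obtain p where p: "p:X.X" "p ~: Y" using ne Y unfolding subcurve_def by blast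
   have VY: "Vertex v:Y" if "v:verts H" for v
   proof -
    have "j v:?W" using Weq refD(2) that by blast
    thus ?thesis using ps_good[OF that] by simp
   qed
   then obtain e t where et: "p = Inner e t" "e:edges H" "0 < t" "t < l e" using p by (auto simp: curve_points_def)
   have "\<exists>s. 0 <= s & s < t & ((e, True), s):?L" by (rule X.last_exit[OF Y et(2)])
      (use et p VY edge_ends[OF wfH et(2)] in "auto simp: along_def dart_src_def")
   hence "card ?L > 0" using X.finite_leaving[OF Y] by (auto simp: card_gt_0_iff)
   thus ?thesis unfolding b Weq using tot by simp
  qed
 qed
qed

end

section \<open>The rational function that interpolates a potential\<close>

locale potential_chains = metric_chains +
 fixes \<phi> f
 assumes pot: "potential G \<phi> z f"
begin

definition sl where "sl e i = (if snd (P e ! i) then \<phi> (ed e i) else - \<phi> (ed e i))"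

lemma sl: assumes "e:edges H" "i < len e"
 shows "f (pt e (Suc i)) - f (pt e i) = of_int (sl e i) * (T e (Suc i) - T e i)"
proof -
 have "f (tgt G (ed e i)) - f (src G (ed e i)) = of_int (\<phi> (ed e i)) * z (ed e i)" using pot ed_edge[OF assms] unfolding potential_def by blast
 thus ?thesis using dart_tgt_pt[OF assms] dart_src_pt[OF assms(2)] by (cases "snd (P e ! i)") (simp_all add: sl_def T_def ed_def dart_src_def dart_tgt_def)
qed

definition F where
 "F p = (if p:ps`verts G then f (inv_into (verts G) ps p) else
   case p of Vertex v => 0 | Inner e t => let i = (THE i. i < len e & T e i <= t & t < T e (Suc i)) in f (pt e i) + of_int (sl e i) * (t - T e i))"

lemma F_ps: "v:verts G ==> F (ps v) = f v" by (simp add: F_def inv_into_f_f[OF ps_inj])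

lemma F_segment:
 assumes e: "e:edges H" and i: "i < len e" and t: "t:{T e i..T e (Suc i)}"
 shows "F (X.al (e, True) t) = f (pt e i) + of_int (sl e i) * (t - T e i)"
proof -
 have V: "pt e i:verts G" "pt e (Suc i):verts G" using pt_verts[OF e] i by simp_all
 have P: "ps (pt e i) = X.al (e, True) (T e i)" "ps (pt e (Suc i)) = X.al (e, True) (T e (Suc i))" using ps_pt[OF e] i by simp_all
 consider "t = T e i" | "t = T e (Suc i)" | "T e i < t" "t < T e (Suc i)" using t by fastforce
 thus ?thesis
 proof cases
  case 1 thus ?thesis using F_ps[OF V(1)] P(1) by simp
 next
  case 2 thus ?thesis using F_ps[OF V(2)] P(2) sl[OF e i] by simp
 next
  case 3
  have tl: "0 < t" "t < l e" using 3 T_range[OF e, of i] T_range[OF e, of "Suc i"] i by simp_all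
  hence al: "X.al (e, True) t = Inner e t" by (simp add: along_def)
  have "Inner e t ~: ps`verts G"
  proof
   assume "Inner e t:ps`verts G"
   then obtain v where "v:verts G" "ps v = X.al (e, True) t" unfolding al by (metis imageE)
   from ps_eq_along(1)[OF e i less_imp_le[OF 3(1)] 3(2) this] show False using 3(1) by simp
  qed
  moreover have "(THE i. i < len e & T e i <= t & t < T e (Suc i)) = i"
  proof (rule the_equality)
   show "k = i" if "k < len e & T e k <= t & t < T e (Suc k)" for k using T_unique[OF e, of k t i] that i 3 by simp
  qed (use i 3 in simp)
  ultimately show ?thesis unfolding al by (simp add: F_def)
 qed
qed

lemma F_linear:
 assumes e: "e:edges H" and i: "i < len e" and t: "T e i <= s" "u:{s..T e (Suc i)}"
 shows "F (X.al (e, True) u) = F (X.al (e, True) s) + of_int (sl e i) * (u - s)" using F_segment[OF e i, of u] F_segment[OF e i, of s] t by (simp add: algebra_simps)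

lemma F_rational: "rational_function H l F" unfolding rational_function_def Let_def
proof (intro ballI conjI)
 fix e assume e: "e:edges H"
 have "continuous_on {T e i..T e (Suc i)} (%t. F (X.al (e, True) t))" if "i < len e" for i
  by (rule continuous_on_eq[OF _ F_segment[OF e that, symmetric]]) (auto intro!: continuous_intros)
 hence "continuous_on (UN i:{..<len e}. {T e i..T e (Suc i)}) (%t. F (X.al (e, True) t))" by (intro continuous_on_closed_Union) auto
 moreover have "{0..l e} <= (UN i:{..<len e}. {T e i..T e (Suc i)})"
 proof
  fix t assume t: "t:{0..l e}"
  show "t:(UN i:{..<len e}. {T e i..T e (Suc i)})"
  proof (cases "t = l e")
   case True
   have n: "Suc (len e - 1) = len e" "len e - 1 < len e" using len_pos[OF e] by linarith+
   have "t:{T e (len e - 1)..T e (Suc (len e - 1))}" using T_le[OF e, of "len e - 1" "len e"] True unfolding n(1) True l_eq[OF e] by simp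
   thus ?thesis using n(2) by blast
  next
   case False
   then obtain i where "i < len e" "T e i <= t" "t < T e (Suc i)" using T_cover[OF e, of t] t by auto
   thus ?thesis by (intro UN_I[of i]) auto
  qed
 qed
 ultimately show "continuous_on {0..l e} (%t. F (X.al (e, True) t))" by (rule continuous_on_subset)
 show "\<exists>B. finite B & (\<forall>s t. 0 <= s & s < t & t <= l e & {s<..<t} \<inter> B = {} -->
  (\<exists>k::int. ALL u:{s..t}. F (X.al (e, True) u) = F (X.al (e, True) s) + of_int k * (u - s)))"
 proof (intro exI[of _ "T e`{..len e}"] conjI allI impI)
  fix s t assume st: "0 <= s & s < t & t <= l e & {s<..<t} \<inter> T e`{..len e} = {}"
  then obtain i where i: "i < len e" "T e i <= s" "s < T e (Suc i)" using T_cover[OF e, of s] by auto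
  have "T e (Suc i):T e`{..len e}" using i by auto
  hence "T e (Suc i) ~: {s<..<t}" using st by blast
  hence tT: "t <= T e (Suc i)" using i(3) by simp
  show "\<exists>k::int. ALL u:{s..t}. F (X.al (e, True) u) = F (X.al (e, True) s) + of_int k * (u - s)"
   by (intro exI[of _ "sl e i"] ballI F_linear[OF e i(1,2)]) (use tT in auto)
 qed simp
qed

lemma F_slopes:
 assumes e: "e:edges H" and i: "i < len e"
 shows "T e i <= s ==> s < T e (Suc i) ==> outgoing_slope H l F ((e, True), s) = of_int (sl e i)"
  and "T e i < t ==> t <= T e (Suc i) ==> outgoing_slope H l F ((e, False), l e - t) = - of_int (sl e i)"
proof -
 show "outgoing_slope H l F ((e, True), s) = of_int (sl e i)" if "T e i <= s" "s < T e (Suc i)" by (rule X.outgoing_slope_eq[OF that(2)]) (rule F_linear[OF e i that(1)])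
 assume t: "T e i < t" "t <= T e (Suc i)"
 show "outgoing_slope H l F ((e, False), l e - t) = - of_int (sl e i)"
 proof (rule X.outgoing_slope_eq[of _ "l e - T e i"])
  fix u assume u: "u:{l e - t..l e - T e i}"
  have fl: "X.al (e, False) v = X.al (e, True) (l e - v)" for v using X.along_flip[OF e, of True v] by simp
  have "F (X.al (e, True) t) = F (X.al (e, True) (l e - u)) + of_int (sl e i) * (t - (l e - u))" by (rule F_linear[OF e i]) (use u t in auto)
  thus "F (X.al (e, False) u) = F (X.al (e, False) (l e - t)) + - of_int (sl e i) * (u - (l e - t))" unfolding fl by (simp add: algebra_simps)
 qed (use t in simp)
qed

text \<open>Directions of the curve at a vertex of the refinement correspond to the darts of
  \<open>G\<close> that start there, and the outgoing slope is \<open>\<phi>\<close> up to the sign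
  of the dart.\<close>

lemma F_div_vertex: assumes v: "v:verts G" shows "rational_div H l F (ps v) = of_int (flow_div G \<phi> v)"
proof -
 have fin: "finite (edges G)" using wfG by (rule wf_graphD)
 let ?A = "{a:edges G. src G a = v}" and ?B = "{a:edges G. tgt G a = v}"
 let ?S = "(%a. (a, True))`?A \<union> (%a. (a, False))`?B"
 \<comment> \<open>A dart that follows its chain starts at the beginning of its segment; one that
   runs against it starts at the end, and its position is measured from the target of the coarse
   edge.\<close>
 define \<kappa> where "\<kappa> d = (let e = ch (fst d); i = ix (fst d) in
  if snd d = snd (P e ! i) then ((e, True), T e i) else ((e, False), l e - T e (Suc i)))" for d
 define s where "s d = (if snd d then - \<phi> (fst d) else \<phi> (fst d))" for d
 have S: "fst d:edges G" "dart_src G d = v" if "d:?S" for d using that by (auto simp: dart_src_def)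
 have Si: "d:?S" if "fst d:edges G" "dart_src G d = v" for d using that by (cases d; cases "snd d") (auto simp: dart_src_def)
 have fl: "X.al (e, False) (l e - u) = X.al (e, True) u" if "e:edges H" for e u using X.along_flip[OF that, of True "l e - u"] by simp
 have flip: "dart_src G (a, \<not> b) = dart_tgt G (a, b)" for a b by (simp add: dart_src_def dart_tgt_def)
 have P_ed: "P e ! i = (ed e i, snd (P e ! i))" for e i by (simp add: ed_def)
 have "bij_betw \<kappa> ?S (directions_at H l (ps v))" unfolding bij_betw_def
 proof
  show "inj_on \<kappa> ?S"
  proof (rule inj_onI)
   fix d d' assume d: "d:?S" and d': "d':?S" and eq: "\<kappa> d = \<kappa> d'"
   note c = ch_ix[OF S(1)[OF d]] and c' = ch_ix[OF S(1)[OF d']]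
   have e: "ch (fst d) = ch (fst d')" using eq by (auto simp: \<kappa>_def Let_def split: if_splits)
   have Tinj: "i = i'" if "T (ch (fst d)) i = T (ch (fst d)) i'" "i <= len (ch (fst d))" "i' <= len (ch (fst d))" for i i'
    using T_less[OF c(1), of i i'] T_less[OF c(1), of i' i] that by (cases i i' rule: linorder_cases) auto
   have i: "ix (fst d) = ix (fst d')" using eq Tinj[of "ix (fst d)" "ix (fst d')"] Tinj[of "Suc (ix (fst d))" "Suc (ix (fst d'))"] c(2) c'(2)
    by (simp add: \<kappa>_def Let_def e split: if_splits)
   have a: "fst d = fst d'" using c(3) c'(3) e i by metis
   have "snd d = snd (P (ch (fst d)) ! ix (fst d)) \<longleftrightarrow> snd d' = snd (P (ch (fst d)) ! ix (fst d))"
    using eq by (simp add: \<kappa>_def Let_def a split: if_splits)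
   hence "snd d = snd d'" by auto
   thus "d = d'" using a by (rule prod_eqI[rotated])
  qed
  show "\<kappa>`?S = directions_at H l (ps v)"
  proof
   show "\<kappa>`?S <= directions_at H l (ps v)"
   proof
    fix \<tau> assume "\<tau>:\<kappa>`?S"
    then obtain d where d: "d:?S" "\<tau> = \<kappa> d" by (rule imageE)
    define e i where "e = ch (fst d)" and "i = ix (fst d)"
    note c = ch_ix[OF S(1)[OF d(1)], folded e_def i_def]
    have T: "0 <= T e i" "T e i < T e (Suc i)" "T e (Suc i) <= l e" using T_range[OF c(1)] T_less[OF c(1)] c(2) by simp_all
    show "\<tau>:directions_at H l (ps v)"
    proof (cases "snd d = snd (P e ! i)")
     case True
     hence "d = (ed e i, snd (P e ! i))" using c(3) by (cases d) simp
     hence "d = P e ! i" using P_ed[of e i] by (simp only:)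
     hence "v = pt e i" using S(2)[OF d(1)] dart_src_pt[OF c(2)] by simp
     hence "ps v = X.al (e, True) (T e i)" using ps_pt[OF c(1)] c(2) by simp
     thus ?thesis using True T c(1) unfolding d(2) \<kappa>_def e_def[symmetric] i_def[symmetric] Let_def by (simp add: directions_at_def directions_def)
    next
     case False
     hence "d = (ed e i, \<not> snd (P e ! i))" using c(3) by (cases d) auto
     hence "v = pt e (Suc i)" using S(2)[OF d(1)] dart_tgt_pt[OF c(1,2)] flip[of "ed e i" "snd (P e ! i)"] P_ed[of e i] by simp
     hence "ps v = X.al (e, True) (T e (Suc i))" using ps_pt[OF c(1)] c(2) by simp
     thus ?thesis using False T c(1) fl[OF c(1)] unfolding d(2) \<kappa>_def e_def[symmetric] i_def[symmetric] Let_def by (simp add: directions_at_def directions_def)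
    qed
   qed
   show "directions_at H l (ps v) <= \<kappa>`?S"
   proof
    fix \<tau> assume \<tau>: "\<tau>:directions_at H l (ps v)"
    obtain e b s where \<tau>d: "\<tau> = ((e, b), s)" by (cases \<tau>) auto
    have e: "e:edges H" and s: "0 <= s" "s < l e" and al: "X.al (e, b) s = ps v" using \<tau> by (auto simp: \<tau>d directions_at_def directions_def)
    show "\<tau>:\<kappa>`?S"
    proof (cases b)
     case True
     obtain i where i: "i < len e" "T e i <= s" "s < T e (Suc i)" using T_cover[OF e s] .
     have al': "ps v = X.al (e, True) s" using al True by simp
     note sv = ps_eq_along[OF e i v al']
     have dS: "P e ! i:?S" by (rule Si) (use ed_edge[OF e i(1)] dart_src_pt[OF i(1)] sv(2) in "simp_all add: ed_def")
     have "\<kappa> (P e ! i) = \<tau>" using ch_ed[OF e i(1)] ix_ed[OF e i(1)] True sv(1) unfolding \<tau>d \<kappa>_def Let_def ed_def by simp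
     thus ?thesis using dS by (rule image_eqI[OF sym])
    next
     case False
     have l: "l e = T e (len e)" by (rule l_eq[OF e])
     have al': "ps v = X.al (e, True) (l e - s)" using al False fl[OF e, of "l e - s"] by simp
     have "\<exists>i<len e. l e - s = T e (Suc i)"
     proof (cases "s = 0")
      case True
      have "Suc (len e - 1) = len e" "len e - 1 < len e" using len_pos[OF e] by linarith+
      thus ?thesis using l True by (intro exI[of _ "len e - 1"] conjI) (simp_all only: diff_zero)
     next
      case False
      then obtain i where i: "i < len e" "T e i <= l e - s" "l e - s < T e (Suc i)" using T_cover[OF e, of "l e - s"] s by auto
      have li: "l e - s = T e i" by (rule ps_eq_along(1)[OF e i v al'])
      then obtain k where "i = Suc k" using s by (cases i) auto
      thus ?thesis using i(1) li by (intro exI[of _ k]) simp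
     qed
     then obtain i where i: "i < len e" "l e - s = T e (Suc i)" by blast
     have "v = pt e (Suc i)"
     proof (rule inj_onD[OF ps_inj _ v pt_verts[OF e]])
      show "ps v = ps (pt e (Suc i))" using al' ps_pt[OF e, of "Suc i"] i by (simp only: Suc_le_eq)
     qed (use i in simp)
     hence dS: "(ed e i, \<not> snd (P e ! i)):?S"
      using Si[of "(ed e i, \<not> snd (P e ! i))"] ed_edge[OF e i(1)] dart_tgt_pt[OF e i(1)] flip[of "ed e i" "snd (P e ! i)"] P_ed[of e i] by simp
     have "s = l e - T e (Suc i)" using i(2) by linarith
     hence "\<kappa> (ed e i, \<not> snd (P e ! i)) = \<tau>" using ch_ed[OF e i(1)] ix_ed[OF e i(1)] False unfolding \<tau>d \<kappa>_def Let_def by simp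
     thus ?thesis using dS by (rule image_eqI[OF sym])
    qed
   qed
  qed
 qed
 hence "rational_div H l F (ps v) = (SUM d:?S. - outgoing_slope H l F (\<kappa> d))" unfolding rational_div_def by (rule sum.reindex_bij_betw[symmetric])
 also have "... = (SUM d:?S. of_int (s d))"
 proof (rule sum.cong[OF refl])
  fix d assume d: "d:?S"
  define e i where "e = ch (fst d)" and "i = ix (fst d)"
  note c = ch_ix[OF S(1)[OF d], folded e_def i_def]
  have "T e i < T e (Suc i)" using T_less[OF c(1)] c(2) by simp
  hence o: "outgoing_slope H l F ((e, True), T e i) = of_int (sl e i)"
   "outgoing_slope H l F ((e, False), l e - T e (Suc i)) = - of_int (sl e i)" using F_slopes[OF c(1,2)] by simp_all
  have k: "\<kappa> d = (if snd d = snd (P e ! i) then ((e, True), T e i) else ((e, False), l e - T e (Suc i)))" by (simp only: \<kappa>_def e_def i_def Let_def)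
  show "- outgoing_slope H l F (\<kappa> d) = of_int (s d)" unfolding k s_def using o by (cases "snd d"; cases "snd (P e ! i)") (simp_all add: sl_def c(3))
 qed
 also have "... = of_int (flow_div G \<phi> v)"
 proof -
  have "(SUM d:?S. s d) = (SUM d:(%a. (a, True))`?A. s d) + (SUM d:(%a. (a, False))`?B. s d)" by (rule sum.union_disjoint) (use fin in auto)
  also have "... = (SUM a:?A. - \<phi> a) + (SUM a:?B. \<phi> a)" by (simp add: sum.reindex inj_on_def s_def)
  also have "... = (SUM a:edges G. if src G a = v then - \<phi> a else 0) + (SUM a:edges G. if tgt G a = v then \<phi> a else 0)"
   using fin by (simp only: sum.inter_filter)
  also have "... = flow_div G \<phi> v" unfolding flow_div_sum[OF fin] sum.distrib[symmetric] by (rule sum.cong[OF refl]) auto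
  finally have eq: "(SUM d:?S. s d) = flow_div G \<phi> v" .
  show ?thesis unfolding of_int_sum[symmetric] eq ..
 qed
 finally show ?thesis .
qed

text \<open>Inside a segment \<open>F\<close> is affine, and the slopes in the two directions
  cancel.\<close>

lemma F_div_inner: assumes p: "p:X.X" "p ~: ps`verts G" shows "rational_div H l F p = 0"
proof -
 have "p ~= Vertex v" if "v:verts H" for v
 proof
  assume "p = Vertex v"
  hence "p = ps (j v)" using ps_good[OF that] by simp
  thus False using p(2) refD(2) that by blast
 qed
 then obtain e t where et: "p = Inner e t" "e:edges H" "0 < t" "t < l e" using p(1) by (auto simp: curve_points_def)
 obtain i where i: "i < len e" "T e i <= t" "t < T e (Suc i)" using T_cover[OF et(2), of t] et by auto
 have "p = X.al (e, True) t" using et by (simp add: along_def)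
 hence "T e i ~= t" using p(2) ps_pt[OF et(2), of i] pt_verts[OF et(2), of i] i(1) by (metis imageI less_imp_le)
 hence "T e i < t" using i(2) by simp
 thus ?thesis unfolding rational_div_def et(1) X.directions_at_Inner[OF et(2-4)] using F_slopes(1)[OF et(2) i] F_slopes(2)[OF et(2) i(1) _ less_imp_le[OF i(3)]] by simp
qed

lemma equivalent:
 assumes C: "!!v. v:verts G ==> D v - C (ps v) = flow_div G \<phi> v" "!!p. p:X.X ==> p ~: ps`verts G ==> C p = 0"
 shows "equivalent_divisors H l C (cd D)" unfolding equivalent_divisors_def
proof (intro exI[of _ F] conjI ballI F_rational)
 fix p assume p: "p:X.X"
 show "of_int (cd D p - C p) = rational_div H l F p"
 proof (cases "p:ps`verts G")
  case True
  then obtain v where v: "v:verts G" "p = ps v" by blast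
  show ?thesis using C(1)[OF v(1)] F_div_vertex[OF v(1)] cd_ps[OF v(1), of D] unfolding v(2) by (simp only:)
 next
  case False
  hence "cd D p = 0" using cd_support[of D] by blast
  thus ?thesis using C(2)[OF p False] F_div_inner[OF p False] by simp
 qed
qed

end

subsection \<open>Straightened divisors on the curve\<close>

lemma (in metric_chains) T_take: "i <= len e ==> T e i = (\<Sum>d\<leftarrow>take i (P e). z (fst d))"
 by (simp add: T_def ed_def sum_list_sum_nth atLeast0LessThan min_absorb2)

lemma sum_expand:
 assumes "finite (edges \<C>)" "fst`set p <= edges \<C>"
 shows "(\<Sum>h\<leftarrow>expand (halves \<E>) p. z (fst h)) = (\<Sum>d\<leftarrow>p. merge_halves \<C> \<E> z (fst d))" using assms(2)
proof (induction p)
 case (Cons d p)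
 obtain a b where d: "d = (a, b)" by (cases d)
 have a: "a:edges \<C>" using Cons.prems d by auto
 have "(\<Sum>h\<leftarrow>(if b then halves \<E> a else rev_path (halves \<E> a)). z (fst h)) = merge_halves \<C> \<E> z a"
  unfolding merge_halves_eq[OF assms(1) a] by (simp add: halves_def rev_path_def)
 thus ?case using Cons by (simp add: d)
qed simp

text \<open>The same curve is measured in two ways: along the chains of the subdivided core with
  lengths \<open>z\<close>, and along those of the core with merged lengths. The first carries the
  divisor, the second the reduction map; \<open>lengths\<close> and \<open>ps_core\<close> identify
  them.\<close>

locale metric_straightening = straightening +
 fixes z assumes z_pos: "!!h. h:edges G ==> z h > (0::real)"
begin

abbreviation "ml \<equiv> merge_halves \<C> \<E> z"

lemma fin\<C>: "finite (edges \<C>)" using P.wfG by (rule wf_graphD)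

lemma ml_pos: assumes "e:edges \<C>" shows "ml e > 0"
 using z_pos[of "(e, False)"] z_pos[of "(e, True)"] assms by (auto simp: merge_halves_eq[OF fin\<C> assms] intro: add_pos_pos)

sublocale MQ: metric_chains \<G>' G "Inl \<circ> j" Q z by unfold_locales (rule z_pos)
sublocale MP: metric_chains \<G>' \<C> j P ml by unfold_locales (rule ml_pos)

lemma P_edges: assumes "e:edges \<G>'" shows "fst`set (P e) <= edges \<C>"
proof
 fix a assume "a:fst`set (P e)"
 then obtain i where "i < length (P e)" "a = fst (P e ! i)" by (auto simp: in_set_conv_nth)
 thus "a:edges \<C>" using P.ed_edge[OF assms] by (simp add: P.ed_def)
qed

lemma lengths: "path_lengths \<G>' Q z = path_lengths \<G>' P ml" using sum_expand[OF fin\<C> P_edges, of _ z \<E>] by (auto simp: path_lengths_def Q_def)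

lemma ps_core: assumes x: "x:verts \<C>" shows "MQ.ps (Inl x) = MP.ps x"
proof (cases "x:P.good")
 case True
 then obtain v where v: "v:verts \<G>'" "x = j v" by blast
 thus ?thesis using MQ.ps_good[OF v(1)] MP.ps_good[OF v(1)] by simp
next
 case False
 obtain e i where e: "e:edges \<G>'" and i: "0 < i" "i < length (P e)" and xi: "x = P.pt e i" using P.pt_surj[OF x False] .
 obtain a b where ab: "P e ! i = (a, b)" by (cases "P e ! i")
 let ?A = "expand (halves \<E>) (take i (P e))" and ?k = "length (expand (halves \<E>) (take i (P e)))"
 have "P e = take i (P e) @ (a, b) # drop (Suc i) (P e)" using id_take_nth_drop[OF i(2)] ab by simp
 hence "Q e = expand (halves \<E>) (take i (P e) @ (a, b) # drop (Suc i) (P e))" by (simp only: Q_def)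
 hence Qe: "Q e = ?A @ (if b then halves \<E> a else rev_path (halves \<E> a)) @ expand (halves \<E>) (drop (Suc i) (P e))" by simp
 \<comment> \<open>The dart at index \<open>i\<close> of \<open>P e\<close> begins after the
   \<open>?k\<close> darts into which its predecessors were expanded.\<close>
 have k: "?k < length (Q e)" "dart_src G (Q e ! ?k) = Inl (dart_src \<C> (a, b))"
  by (cases b; cases "a:\<E>"; simp add: Qe halves_def rev_path_def nth_append dart_src_def)+
 have "Q.pt e ?k = Inl x" using k Q.dart_src_pt[OF k(1)] P.dart_src_pt[OF i(2)] ab xi by simp
 hence "MQ.ps (Inl x) = along \<G>' (path_lengths \<G>' Q z) (e, True) (MQ.T e ?k)" using MQ.ps_pt[OF e less_imp_le[OF k(1)]] by simp
 also have "MQ.T e ?k = MP.T e i"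
 proof -
  have "take ?k (Q e) = ?A" unfolding Qe by simp
  hence "MQ.T e ?k = (\<Sum>h\<leftarrow>?A. z (fst h))" using MQ.T_take[OF less_imp_le[OF k(1)]] by simp
  also have "... = (\<Sum>d\<leftarrow>take i (P e). ml (fst d))" by (rule sum_expand[OF fin\<C> order_trans[OF image_mono[OF set_take_subset] P_edges[OF e]]])
  finally show ?thesis unfolding MP.T_take[OF less_imp_le[OF i(2)]] .
 qed
 finally show ?thesis unfolding xi lengths MP.ps_pt[OF e less_imp_le[OF i(2)]] .
qed

abbreviation "y \<equiv> path_lengths H Q' z"

lemma y_pos: assumes "h:edges H" shows "y h > 0"
proof -
 interpret MR: metric_chains H G jj Q' z by unfold_locales (rule z_pos)
 show ?thesis by (rule MR.X.pos[OF assms])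
qed

lemma y_mark: assumes "e:\<E>'" shows "y (e, False) = MQ.T e (mark e)"
 using MQ.T_take[OF less_imp_le[OF mark(2)[OF assms]]] assms \<E>'_edges by (auto simp: path_lengths_def Q'_def)

lemma y_merge: "merge_halves \<G>' \<E>' y = path_lengths \<G>' P ml"
proof
 fix e
 show "merge_halves \<G>' \<E>' y e = path_lengths \<G>' P ml e"
 proof (cases "e:edges \<G>'")
  case True
  have "(\<Sum>h\<leftarrow>take (mark e) (Q e). z (fst h)) + (\<Sum>h\<leftarrow>drop (mark e) (Q e). z (fst h)) = (\<Sum>h\<leftarrow>Q e. z (fst h))"
   unfolding sum_list_append[symmetric] map_append[symmetric] append_take_drop_id ..
  thus ?thesis unfolding lengths[symmetric] merge_halves_eq[OF wf_graphD(2)[OF P.wfH] True] using True by (simp add: path_lengths_def Q'_def)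
 qed (simp add: merge_halves_outside path_lengths_def)
qed

text \<open>Away from the vertices of \<open>\<G>'\<close> the divisor is supported at marks, and
  the first half of a marked edge ends exactly at its mark.\<close>

lemma divisor_eq: "pseudo_divisor_on_curve \<G>' \<E>' D' y = MQ.cd D"
proof
 fix p
 have out: "MQ.cd D p = 0" if "p ~: MQ.ps`verts G" using MQ.cd_support[of D] that by blast
 show "pseudo_divisor_on_curve \<G>' \<E>' D' y p = MQ.cd D p"
 proof (cases p)
  case (Vertex v)
  show ?thesis
  proof (cases "v:verts \<G>'")
   case True
   hence "Inl (j v):verts G" using P.refD(2) by auto
   thus ?thesis using MQ.cd_ps[of "Inl (j v)" D] MQ.ps_good[OF True] True Vertex by (simp add: pseudo_divisor_on_curve_def D'_def)
  next
   case False
   hence "p ~: MQ.ps`verts G" using MQ.ps_in Vertex by (fastforce simp: curve_points_def)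
   thus ?thesis using out False Vertex by (simp add: pseudo_divisor_on_curve_def D'_def)
  qed
 next
  case (Inner e t)
  show ?thesis
  proof (cases "e:\<E>' & t = y (e, False)")
   case True
   hence e: "e:edges \<G>'" "e:\<E>'" using \<E>'_edges by auto
   have "p = MQ.ps (Q.pt e (mark e))" using MQ.ps_bad[OF e(1) mark(1,2)[OF e(2)]] y_mark[OF e(2)] True Inner by simp
   hence "MQ.cd D p = -1" using MQ.cd_ps[OF Q.pt_bad(1)[OF e(1) mark(1,2)[OF e(2)]], of D] mark(3)[OF e(2)] by simp
   thus ?thesis using True Inner by (simp add: pseudo_divisor_on_curve_def D'_def)
  next
   case False
   have "MQ.cd D p = 0"
   proof (rule ccontr)
    assume n: "MQ.cd D p ~= 0"
    then obtain v where v: "v:verts G" "p = MQ.ps v" using out by blast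
    have "D v ~= 0" using n MQ.cd_ps[OF v(1), of D] v(2) by simp
    show False
    proof (cases "v:Q.good")
     case True
     then obtain w where w: "w:verts \<G>'" "v = (Inl \<circ> j) w" by (rule imageE)
     show False using MQ.ps_good[OF w(1)] v(2) Inner unfolding w(2) by simp
    next
     case False
     obtain e' i where ei: "e':edges \<G>'" "0 < i" "i < Q.len e'" "v = Q.pt e' i" using Q.pt_surj[OF v(1) False] .
     have m: "e':\<E>' & i = mark e'" using mark_eq[OF ei(1-3)] \<open>D v ~= 0\<close> ei(4) by simp
     have "Inner e t = Inner e' (MQ.T e' i)" using MQ.ps_bad[OF ei(1-3)] v(2) ei(4) Inner by simp
     thus False using m y_mark[of e'] \<open>\<not> (e:\<E>' & t = y (e, False))\<close> by simp
    qed
   qed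
   thus ?thesis using False Inner by (auto simp: pseudo_divisor_on_curve_def)
  qed
 qed
qed

end

text \<open>Inner points with value -1 reveal \<open>\<E>\<close> and the first halves; the merged
  lengths then give the second halves. So an Abel image is determined by its divisor on the
  curve.\<close>

lemma pseudo_divisor_on_curve_inj:
 assumes D: "pseudo_divisor \<G> \<E> D" "pseudo_divisor \<G> \<F> B" and fin: "finite (edges \<G>)"
  and y: "y:orthant (edges (subdivide \<G> \<E>))" "x:orthant (edges (subdivide \<G> \<F>))"
  and m: "merge_halves \<G> \<E> y = merge_halves \<G> \<F> x"
  and eq: "pseudo_divisor_on_curve \<G> \<E> D y = pseudo_divisor_on_curve \<G> \<F> B x"
 shows "\<E> = \<F>" "D = B" "y = x"
proof -
 have E: "\<E> <= edges \<G>" "\<F> <= edges \<G>" "!!e. e:\<E> ==> D (Inr e) = -1" "!!e. e:\<F> ==> B (Inr e) = -1"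
  "!!e. e ~: \<E> ==> D (Inr e) = 0" "!!e. e ~: \<F> ==> B (Inr e) = 0" using D by (auto simp: pseudo_divisor_def)
 have 1: "e:\<F> & y (e, False) = x (e, False)" if "e:\<E>" for e
  using fun_cong[OF eq, of "Inner e (y (e, False))"] that E(3) by (auto simp: pseudo_divisor_on_curve_def split: if_splits)
 have 2: "e:\<E>" if "e:\<F>" for e using fun_cong[OF eq, of "Inner e (x (e, False))"] that E(4) by (auto simp: pseudo_divisor_on_curve_def split: if_splits)
 show EF: "\<E> = \<F>" using 1 2 by blast
 show "D = B"
 proof
  fix v show "D v = B v"
  proof (cases v)
   case (Inl u) thus ?thesis using fun_cong[OF eq, of "Vertex u"] by (simp add: pseudo_divisor_on_curve_def)
  next
   case (Inr e) thus ?thesis using E(3-6)[of e] EF by (cases "e:\<E>") simp_all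
  qed
 qed
 show "y = x"
 proof
  fix h show "y h = x h"
  proof (cases "h:edges (subdivide \<G> \<E>)")
   case True
   then obtain e b where h: "h = (e, b)" "e:edges \<G>" "b --> e:\<E>" by auto
   show ?thesis using fun_cong[OF m, of e] 1[of e] h EF by (cases "e:\<E>"; cases b) (auto simp: merge_halves_eq[OF fin h(2)])
  next
   case False
   hence "y h = 0" "x h = 0" using y EF unfolding orthant_def by blast+
   thus ?thesis by simp
  qed
 qed
qed

subsection \<open>Reduction of admissible pairs\<close>

text \<open>The combinatorial part: one stable reduction, one straightened divisor and one formula
  for the lengths, set up for all points of the cone, including those with vanishing
  lengths.\<close>

locale admissible_reduction =
 fixes g n :: nat and a :: "nat => int" and m d :: int and \<mu> :: "(nat, nat) lgraph => nat => real"
  and \<G> :: "(nat, nat) lgraph" and \<E> :: "nat set" and \<phi> \<C> r \<G>' j P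
 assumes g: "g >= 1" and u: "universal_polarization g d \<mu>" and \<G>: "\<G>:stable_graphs g (n + 1)"
  and adm: "(\<E>, \<phi>):Adm \<G> (induced_polarization \<mu> \<G>) (D_graph n a m \<G>)"
  and red: "stable_reduction (only_leg0 \<G>) \<C> r \<G>' j P"
begin

abbreviation "\<G>0 \<equiv> only_leg0 \<G>"
lemmas o = one_legged_only_leg0[OF \<G> g]
lemmas sr = stable_reductionD[OF red o]
lemmas A = AdmD[OF adm]
lemmas wf = stable_graphsD(1)[OF \<G>]
lemmas p = prunesD[OF sr(7) one_leggedD(1)[OF o], unfolded only_leg0_simps]

lemma r_core: "v:verts \<C> ==> r v = v" and r_in: "v:verts \<G> ==> r v:verts \<C>" using p specializationD(8)[OF sr(1)] by simp_all

lemma core_ends: "e:edges \<C> ==> src \<G> e:verts \<C>" "e:edges \<C> ==> tgt \<G> e:verts \<C>" using edge_ends[OF one_leggedD(1)[OF sr(2)], of e] p by simp_all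

lemma r_contracted: "e:edges \<G> ==> e ~: edges \<C> ==> r (src \<G> e) = r (tgt \<G> e)"
 using contraction_contracted[OF specialization_contraction[OF sr(1)] wf_graphD(3)[OF one_leggedD(1)[OF o]], of e] by simp

lemma \<E>_core: "\<E> <= edges \<C>"
proof -
 have "nondisconnecting \<G>0 \<E>" using A(1) by (simp add: nondisconnecting_def connected_graph_def only_leg0_def adj_def)
 thus ?thesis using nondisconnecting_core[OF sr(7) one_leggedD(1)[OF o]] by (simp add: nondisconnecting_def)
qed

abbreviation "G0 \<equiv> subdivide \<G> \<E>"
abbreviation "G \<equiv> subdivide \<C> \<E>"

lemma sub_only_leg0: "verts (subdivide \<G>0 \<E>) = verts G0" "edges (subdivide \<G>0 \<E>) = edges G0" "src (subdivide \<G>0 \<E>) = src G0" "tgt (subdivide \<G>0 \<E>) = tgt G0"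
 unfolding subdivide_def only_leg0_simps by simp_all

text \<open>The core as a contraction of \<open>\<G>\<close>: edges outside it get length zero.\<close>

sublocale C0: subdivided_contraction \<G>0 \<C> r id \<E> "%h. of_bool (fst h:edges \<C>)" by unfold_locales (use sr(1) one_leggedD(1)[OF o] A(4) \<E>_core in auto)

lemma C0_\<E>: "C0.\<E>' = \<E>" using \<E>_core by (auto simp: C0.\<E>'_def)

lemma edges_G: "h:edges G ==> h:edges G0" using p by auto

lemma gE: assumes "h:edges G" shows "C0.gE h = h"
proof -
 obtain e b where "h = (e, b)" "e:edges \<C>" "b --> e:\<E>" using assms by auto
 thus ?thesis using r_core[OF core_ends(1)] p by (auto simp: C0.gE_def C0_\<E>)
qed

lemma gV: assumes "v:verts G0" shows "C0.gV v = map_sum r id v" using assms C0.gV_Inr_exceptional by (auto simp: C0_\<E>)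

definition "\<phi>\<C> = C0.\<phi>' \<phi>"

text \<open>The contraction onto the core fixes the vertices of the core, so no reference direction
  is reversed and no sign changes.\<close>

lemma \<phi>\<C>: assumes h: "h:edges G" shows "\<phi>\<C> h = \<phi> h"
proof -
 obtain e b where "h = (e, b)" "e:edges \<C>" "b --> e:\<E>" using h by auto
 hence "C0.gV (src G0 h) = src G h" using gV[of "src G0 h"] r_core[OF core_ends(1)] core_ends p by (cases b) auto
 thus ?thesis using h gE[OF h] by (simp add: \<phi>\<C>_def C0.\<phi>'_def push_flow_def C0_\<E> sub_only_leg0 del: subdivide_simps)
qed

definition "D\<C> = adm_divisor \<C> (push_forward (verts \<G>) r (D_graph n a m \<G>)) \<E> \<phi>\<C>"

lemma flow_div_only_leg0: "flow_div (subdivide \<G>0 \<E>) \<phi> = flow_div G0 \<phi>"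
 unfolding flow_div_def flow_src_def flow_tgt_def dart_src_def dart_tgt_def sub_only_leg0 ..

lemma D\<C>_push:
 assumes w: "w:verts G" shows "D\<C> w = push_forward (verts G0) (map_sum r id) (adm_divisor \<G> (D_graph n a m \<G>) \<E> \<phi>) w"
proof -
 have "D\<C> w = push_forward (verts G0) C0.gV (adm_divisor \<G>0 (D_graph n a m \<G>) \<E> \<phi>) w"
  using C0.adm_divisor_push[of "push_forward (verts \<G>) r (D_graph n a m \<G>)" "D_graph n a m \<G>" w \<phi>] w
  unfolding D\<C>_def \<phi>\<C>_def C0_\<E> sub_only_leg0 only_leg0_simps by simp
 also have "... = push_forward (verts G0) (map_sum r id) (adm_divisor \<G> (D_graph n a m \<G>) \<E> \<phi>) w"
  by (rule push_forward_cong) (use gV in "simp_all add: adm_divisor_def flow_div_only_leg0")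
 finally show ?thesis .
qed

definition "\<nu> = push_forward (verts \<G>') j (\<mu> \<G>')"

lemma \<nu>: "induced_polarization \<mu> \<G> = \<nu>" unfolding \<nu>_def by (rule induced_polarization_eq[OF u o red])

lemma leg_core: "leg \<C> 0 = j (leg \<G>' 0)" "r (leg \<G> 0) = leg \<C> 0" "leg \<G>' 0:verts \<G>'"
proof -
 interpret chains \<G>' \<C> j P by (rule sr(4))
 show "leg \<C> 0 = j (leg \<G>' 0)" "leg \<G>' 0:verts \<G>'" using refD(6)[of 0] wf_graphD(5)[OF wfH, of 0] stable_graphsD(5)[OF sr(6)] by simp_all
 show "r (leg \<G> 0) = leg \<C> 0" using specializationD(7)[OF sr(1), of 0] by simp
qed

text \<open>\<open>\<nu>\<close> is supported on the vertices of the stable model, which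
  \<open>r\<close> fixes.\<close>

lemma \<nu>_push: assumes x: "x:verts \<C>" shows "push_forward (verts \<G>) r \<nu> x = \<nu> x"
proof -
 interpret chains \<G>' \<C> j P by (rule sr(4))
 have "push_forward (verts \<G>) r \<nu> x = (SUM v:{x}. \<nu> v)" unfolding push_forward_def
 proof (rule sum.mono_neutral_right)
  show "ALL v:{v:verts \<G>. r v = x} - {x}. \<nu> v = 0"
  proof
   fix v assume v: "v:{v:verts \<G>. r v = x} - {x}"
   have "v ~: good"
   proof
    assume "v:good"
    hence "r v = v" using refD(2) by (intro r_core) (rule subsetD)
    thus False using v by simp
   qed
   thus "\<nu> v = 0" unfolding \<nu>_def by (rule push_forward_outside)
  qed
 qed (use x r_core p wf_graphD(1)[OF wf] in auto)
 thus ?thesis by simp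
qed

lemma quasistable_core: "quasistable G (Inl (j (leg \<G>' 0))) (case_sum \<nu> (%_. 0)) D\<C>"
proof -
 have "quasistable (subdivide \<G>0 \<E>) (Inl (leg \<G> 0)) (case_sum \<nu> (%_. 0)) (adm_divisor \<G> (D_graph n a m \<G>) \<E> \<phi>)"
  using A(6) unfolding quasistable_def beta_def cut_size_def sub_only_leg0 \<nu> .
 hence "quasistable C0.G' (C0.gV (Inl (leg \<G> 0))) (case_sum \<nu> (%_. 0)) D\<C>"
 proof (rule quasistable_contraction[OF C0.contraction_sub subdivide_wf[OF C0.wf C0.\<E>], rotated 2])
  fix w assume w: "w:verts C0.G'"
  have "push_forward (verts (subdivide \<G>0 \<E>)) C0.gV (case_sum \<nu> (%_. 0)) w = case_sum (push_forward (verts \<G>) r \<nu>) (%_. 0) w"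
   using C0.push_forward_case_sum[OF w, of \<nu>] unfolding only_leg0_simps .
  thus "case_sum \<nu> (%_. 0) w = push_forward (verts (subdivide \<G>0 \<E>)) C0.gV (case_sum \<nu> (%_. 0)) w" using w \<nu>_push by (cases w) auto
  have "D\<C> w = push_forward (verts G0) (map_sum r id) (adm_divisor \<G> (D_graph n a m \<G>) \<E> \<phi>) w" by (rule D\<C>_push) (use w in "simp only: C0_\<E>")
  also have "... = push_forward (verts (subdivide \<G>0 \<E>)) C0.gV (adm_divisor \<G> (D_graph n a m \<G>) \<E> \<phi>) w"
   unfolding sub_only_leg0 by (rule push_forward_cong) (use gV in simp_all)
  finally show "D\<C> w = push_forward (verts (subdivide \<G>0 \<E>)) C0.gV (adm_divisor \<G> (D_graph n a m \<G>) \<E> \<phi>) w" .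
 next
  show "Inl (leg \<G> 0):verts (subdivide \<G>0 \<E>)" using wf_graphD(5)[OF wf, of 0] stable_graphsD(5)[OF \<G>] by simp
 qed
 thus ?thesis unfolding C0_\<E> C0.gV_Inl leg_core .
qed

sublocale St: straightening \<G>' \<C> j P \<E> D\<C> \<nu> "leg \<G>' 0" unfolding straightening_def straightening_axioms_def
proof (intro conjI sr(4) \<E>_core leg_core quasistable_core refl allI impI)
 show "\<nu> v = 0" if "v ~: j`verts \<G>'" for v unfolding \<nu>_def using that by (rule push_forward_outside)
qed

lemma \<nu>_j: "v:verts \<G>' ==> \<nu> (j v) = \<mu> \<G>' v" unfolding \<nu>_def by (rule push_forward_inj[OF St.P.refD(1)])

lemma t_objs: "(\<G>', St.\<E>', St.D'):objs (J_trop g \<mu>)"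
proof -
 have "quasistable St.H (Inl (leg \<G>' 0)) (case_sum (%v. \<nu> (j v)) (%_. 0)) St.D' \<longleftrightarrow>
   quasistable St.H (Inl (leg \<G>' 0)) (case_sum (\<mu> \<G>') (%_. 0)) St.D'" by (rule quasistable_cong) (use \<nu>_j in auto)
 thus ?thesis using St.quasistable_pseudo sr(6) by (simp add: J_trop_def quasistable_pseudo_def)
qed

definition "zc z h = (if h:edges G then z h else (0::real))"

lemma core_potential: assumes f: "potential G0 \<phi> z f" shows "potential G \<phi>\<C> (zc z) f" unfolding potential_def
proof
 fix h assume h: "h:edges G"
 obtain e b where eb: "h = (e, b)" by (cases h)
 have "f (tgt G0 h) - f (src G0 h) = of_int (\<phi> h) * z h" using f edges_G[OF h] unfolding potential_def by blast
 moreover have "src G h = src G0 h" "tgt G h = tgt G0 h" unfolding eb subdivide_simps using p by simp_all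
 ultimately show "f (tgt G h) - f (src G h) = of_int (\<phi>\<C> h) * zc z h" using \<phi>\<C>[OF h] h by (simp only: zc_def if_True)
qed

abbreviation "y z \<equiv> path_lengths St.H St.Q' (zc z)"

lemma y_orthant: assumes "!!h. h:edges G0 ==> z h >= 0" shows "y z:orthant (edges St.H)"
proof -
 have "zc z h >= 0" for h using assms edges_G[of h] by (simp add: zc_def del: subdivide_simps)
 thus ?thesis by (auto simp: orthant_def path_lengths_def intro!: sum_list_nonneg simp del: subdivide_simps)
qed

end

text \<open>Here all half edges have positive length, so \<open>\<G>\<close> with lengths
  \<open>l\<close> is a tropical curve, and the straightened data can be compared with the Abel map
  as it is defined on curves.\<close>

locale positive_reduction = admissible_reduction +
 fixes z and l
 assumes z: "z:flow_cone \<G> \<E> \<phi>" and z_pos: "!!h. h:edges (subdivide \<G> \<E>) ==> z h > 0" and l: "l = merge_halves \<G> \<E> z"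
begin

lemma finE: "finite (edges \<G>)" using wf by (rule wf_graphD)

sublocale St: metric_straightening \<G>' \<C> j P \<E> D\<C> \<nu> "leg \<G>' 0" "zc z" by unfold_locales (use z_pos edges_G in "simp add: zc_def del: subdivide_simps")

lemma l_core: assumes e: "e:edges \<C>" shows "St.ml e = l e" using e p unfolding l by (auto simp: merge_halves_eq[OF St.fin\<C> e] merge_halves_eq[OF finE] zc_def)

lemma l_pos: assumes e: "e:edges \<G>" shows "l e > 0"
 using z_pos[of "(e, False)"] z_pos[of "(e, True)"] e unfolding l by (auto simp: merge_halves_eq[OF finE e] intro: add_pos_pos)

sublocale X: tropical_curve \<G> l by unfold_locales (rule wf, rule l_pos)

lemma l_P: "e:edges \<G>' ==> i < St.P.len e ==> l (fst (P e ! i)) = St.ml (fst (P e ! i))" using l_core[OF St.P.ed_edge, of e i] by (simp add: St.P.ed_def)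

lemma lengths_eq: "path_lengths \<G>' P l = St.MP.l" unfolding path_lengths_def
proof
 fix e show "(if e:edges \<G>' then \<Sum>d\<leftarrow>P e. l (fst d) else 0) = (if e:edges \<G>' then \<Sum>d\<leftarrow>P e. St.ml (fst d) else 0)"
  using l_P[of e] by (auto simp: sum_list_sum_nth)
qed

lemma T_eq: "e:edges \<G>' ==> i <= St.P.len e ==> (\<Sum>k<i. l (fst (P e ! k))) = St.MP.T e i" unfolding St.MP.T_def by (rule sum.cong) (auto simp: l_P St.P.ed_def)

lemma dart_core: "dart_src \<C> = dart_src \<G>" "dart_tgt \<C> = dart_tgt \<G>" using p by (auto simp: dart_src_def dart_tgt_def fun_eq_iff)

text \<open>A reduction map has to be exhibited, since \<open>abel_relation\<close> asks for one: it
  is constant on pruned edges and places core edges by arc length along their chains.\<close>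

definition \<rho> where
 "\<rho> q = (case q of Vertex v => St.MP.ps (r v)
  | Inner e t => if e:edges \<C> then let c = St.P.ch e; i = St.P.ix e in
     along \<G>' St.MP.l (c, True) (St.MP.T c i + (if snd (P c ! i) then t else l e - t))
    else St.MP.ps (r (src \<G> e)))"

lemma \<rho>: "curve_reduction_map \<G> l \<C> r \<G>' j P \<rho>" unfolding curve_reduction_map_def
proof (intro conjI ballI allI impI)
 fix v assume v: "v:verts \<G>'"
 hence "j v:verts \<C>" using St.P.refD(2) by blast
 thus "\<rho> (Vertex (j v)) = Vertex v" using St.MP.ps_good[OF v] by (simp add: \<rho>_def r_core)
next
 fix v assume "v:verts \<G>"
 thus "\<rho> (Vertex v) = \<rho> (Vertex (r v))" by (simp add: \<rho>_def r_core[OF r_in])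
next
 fix e s assume "e:edges \<G> - edges \<C>" "s:{0..l e}"
 thus "\<rho> (along \<G> l (e, True) s) = \<rho> (Vertex (src \<G> e))" using r_contracted[of e] by (auto simp: \<rho>_def along_def dart_src_def dart_tgt_def)
next
 fix e i s assume e: "e:edges \<G>'" and i: "i < St.P.len e" and s: "s:{0..l (fst (P e ! i))}"
 let ?d = "P e ! i"
 have dE: "fst ?d:edges \<C>" using St.P.ed_edge[OF e i] by (simp add: St.P.ed_def)
 have lp: "l (fst ?d) > 0" using St.ml_pos[OF dE] l_core[OF dE] by simp
 have TS: "St.MP.T e (Suc i) = St.MP.T e i + l (fst ?d)" using l_P[OF e i] by (simp add: St.MP.T_def St.P.ed_def)
 have V: "St.P.pt e i:verts \<C>" "St.P.pt e (Suc i):verts \<C>" using St.P.pt_verts[OF e] i by simp_all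
 consider "s = 0" | "s = l (fst ?d)" | "0 < s" "s < l (fst ?d)" using s by fastforce
 hence "\<rho> (along \<G> l ?d s) = along \<G>' St.MP.l (e, True) (St.MP.T e i + s)"
 proof cases
  case 1
  hence "along \<G> l ?d s = Vertex (St.P.pt e i)" using St.P.dart_src_pt[OF i] by (simp add: along_def dart_core)
  thus ?thesis using St.MP.ps_pt[OF e less_imp_le[OF i]] 1 by (simp add: \<rho>_def r_core[OF V(1)])
 next
  case 2
  hence "along \<G> l ?d s = Vertex (St.P.pt e (Suc i))" using St.P.dart_tgt_pt[OF e i] lp by (simp add: along_def dart_core)
  thus ?thesis using St.MP.ps_pt[OF e Suc_leI[OF i]] 2 TS by (simp add: \<rho>_def r_core[OF V(2)])
 next
  case 3
  hence "along \<G> l ?d s = Inner (fst ?d) (if snd ?d then s else l (fst ?d) - s)" by (simp add: along_def)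
  moreover have "St.P.ch (fst ?d) = e" "St.P.ix (fst ?d) = i" using St.P.ch_ed[OF e i] St.P.ix_ed[OF e i] by (simp_all add: St.P.ed_def)
  ultimately show ?thesis using dE by (simp add: \<rho>_def)
 qed
 thus "\<rho> (along \<G> l ?d s) = along \<G>' (path_lengths \<G>' P l) (e, True) ((\<Sum>k<i. l (fst (P e ! k))) + s)"
  unfolding lengths_eq T_eq[OF e less_imp_le[OF i]] .
qed

text \<open>The conditions on a reduction map pin it down at the vertices, where the Abel divisor is
  supported. So the push-forward does not depend on the map.\<close>

lemma curve_map_core:
 assumes c: "curve_reduction_map \<G> l \<C> r \<G>' j P \<sigma>" and v: "v:verts \<G>"
 shows "\<sigma> (Vertex v) = St.MQ.ps (Inl (r v))"
proof -
 have x: "r v:verts \<C>" by (rule r_in[OF v])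
 have c1: "!!v. v:verts \<G>' ==> \<sigma> (Vertex (j v)) = Vertex v" and c2: "\<sigma> (Vertex v) = \<sigma> (Vertex (r v))"
  and c4: "!!e i s. e:edges \<G>' ==> i < St.P.len e ==> s:{0..l (fst (P e ! i))} ==>
   \<sigma> (along \<G> l (P e ! i) s) = along \<G>' (path_lengths \<G>' P l) (e, True) ((\<Sum>k<i. l (fst (P e ! k))) + s)"
  using c v unfolding curve_reduction_map_def by blast+
 have "\<sigma> (Vertex (r v)) = St.MP.ps (r v)"
 proof (cases "r v:St.P.good")
  case True
  then obtain w where w: "w:verts \<G>'" "r v = j w" by blast
  thus ?thesis using c1[OF w(1)] St.MP.ps_good[OF w(1)] by simp
 next
  case False
  obtain e i where ei: "e:edges \<G>'" "0 < i" "i < St.P.len e" "r v = St.P.pt e i" using St.P.pt_surj[OF x False] .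
  have "l (fst (P e ! i)) > 0" using St.ml_pos[OF St.P.ed_edge[OF ei(1,3)]] l_P[OF ei(1,3)] by (simp add: St.P.ed_def)
  hence "\<sigma> (along \<G> l (P e ! i) 0) = along \<G>' St.MP.l (e, True) (St.MP.T e i)"
   using c4[OF ei(1,3), of 0] T_eq[OF ei(1) less_imp_le[OF ei(3)]] lengths_eq by simp
  moreover have "along \<G> l (P e ! i) 0 = Vertex (r v)" using St.P.dart_src_pt[OF ei(3)] ei(4) by (simp add: along_def dart_core)
  ultimately show ?thesis using St.MP.ps_pt[OF ei(1) less_imp_le[OF ei(3)]] ei(4) by simp
 qed
 thus ?thesis using c2 St.ps_core[OF x] by simp
qed

lemma curve_push:
 assumes c: "curve_reduction_map \<G> l \<C> r \<G>' j P \<sigma>"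
 shows "curve_push_forward \<sigma> (D_curve n a m \<G> l) q = (SUM v:{v:verts \<G>. St.MQ.ps (Inl (r v)) = q}. D_graph n a m \<G> v)"
proof -
 let ?C = "D_curve n a m \<G> l"
 have C: "?C (Vertex v) = D_graph n a m \<G> v" "?C (Inner e t) = 0" for v e t by (simp_all add: X.D_curve_eq)
 have fin: "finite (verts \<G>)" using wf by (rule wf_graphD)
 have "{p. ?C p ~= 0} <= Vertex`verts \<G>"
 proof
  fix p assume p: "p:{p. ?C p ~= 0}"
  thus "p:Vertex`verts \<G>" by (cases p) (auto simp: C D_graph_def split: if_splits)
 qed
 hence "curve_push_forward \<sigma> ?C q = (SUM p:Vertex`{v:verts \<G>. \<sigma> (Vertex v) = q}. ?C p)"
  unfolding curve_push_forward_def push_forward_def by (intro sum.mono_neutral_left) (use fin in auto)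
 also have "... = (SUM v:{v:verts \<G>. \<sigma> (Vertex v) = q}. D_graph n a m \<G> v)" by (simp add: sum.reindex inj_on_def C)
 also have "... = (SUM v:{v:verts \<G>. St.MQ.ps (Inl (r v)) = q}. D_graph n a m \<G> v)" by (rule sum.cong) (use curve_map_core[OF c] in auto)
 finally show ?thesis .
qed

abbreviation "\<D> \<equiv> pseudo_divisor_on_curve \<G>' St.\<E>' St.D' St.y"
abbreviation "l' \<equiv> path_lengths \<G>' P l"

lemma curve_quasistable: "curve_quasistable \<G>' l' (Vertex (leg \<G>' 0)) (\<mu> \<G>') \<D>" unfolding St.divisor_eq lengths_eq St.lengths[symmetric]
 by (rule St.MQ.curve_quasistable[OF leg_core(3), of "case_sum \<nu> (%_. 0)"])
   (use quasistable_core St.\<mu>_bad \<nu>_j in simp_all)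

lemma equivalent:
 assumes c: "curve_reduction_map \<G> l \<C> r \<G>' j P \<sigma>"
 shows "equivalent_divisors \<G>' l' (curve_push_forward \<sigma> (D_curve n a m \<G> l)) \<D>"
proof -
 obtain f where "potential G0 \<phi> z f" using z flow_cone_iff[OF wf A(4)] by blast
 note f = core_potential[OF this]
 interpret F: potential_chains \<G>' G "Inl \<circ> j" St.Q "zc z" \<phi>\<C> f by unfold_locales (rule f)
 let ?C = "curve_push_forward \<sigma> (D_curve n a m \<G> l)"
 show ?thesis unfolding St.divisor_eq lengths_eq St.lengths[symmetric]
 proof (rule F.equivalent)
  fix v assume v: "v:verts G"
  have "?C (St.MQ.ps v) = case_sum (push_forward (verts \<G>) r (D_graph n a m \<G>)) (%_. 0) v"
  proof -
   have V: "Inl (r w):verts G" if "w:verts \<G>" for w using r_in[OF that] by simp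
   have "{w:verts \<G>. St.MQ.ps (Inl (r w)) = St.MQ.ps v} = {w:verts \<G>. Inl (r w) = v}" using inj_onD[OF St.MQ.ps_inj _ V v] by blast
   hence "?C (St.MQ.ps v) = (SUM w:{w:verts \<G>. Inl (r w) = v}. D_graph n a m \<G> w)" unfolding curve_push[OF c] by (rule arg_cong)
   thus ?thesis by (cases v) (simp_all add: push_forward_def)
  qed
  thus "D\<C> v - ?C (St.MQ.ps v) = flow_div G \<phi>\<C> v" by (simp add: D\<C>_def adm_divisor_def)
 next
  fix q assume "q ~: St.MQ.ps`verts G"
  hence "{v:verts \<G>. St.MQ.ps (Inl (r v)) = q} = {}" using r_in by auto
  thus "?C q = 0" unfolding curve_push[OF c] by (simp only: sum.empty)
 qed
qed

abbreviation "solves \<sigma> B \<equiv> curve_quasistable \<G>' l' (Vertex (leg \<G>' 0)) (\<mu> \<G>') B &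
  equivalent_divisors \<G>' l' (curve_push_forward \<sigma> (D_curve n a m \<G> l)) B"

lemma the_divisor:
 assumes c: "curve_reduction_map \<G> l \<C> r \<G>' j P \<sigma>" shows "(THE B. solves \<sigma> B) = \<D>"
proof (rule the_equality)
 show "B = \<D>" if "solves \<sigma> B" for B using St.MP.X.quasistable_unique[OF leg_core(3), of "\<mu> \<G>'" B \<D>] that curve_quasistable equivalent[OF c]
  unfolding lengths_eq by blast
qed (use curve_quasistable equivalent[OF c] in blast)

lemma y_J: "St.y:cone (J_trop g \<mu>) (\<G>', St.\<E>', St.D')" using y_orthant[OF less_imp_le[OF z_pos]] by (simp add: J_trop_def)

lemma abel: "abel_relation g n a m \<mu> \<G> l (\<G>', St.\<E>', St.D') St.y" unfolding abel_relation_def split Let_def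
 by (intro exI[of _ \<C>] exI[of _ r] exI[of _ j] exI[of _ P] exI[of _ \<rho>] conjI red \<rho> t_objs y_J ballI St.y_pos)
   (simp_all only: St.y_merge lengths_eq[symmetric] the_divisor[OF \<rho>])

lemma abel_unique:
 assumes c: "curve_reduction_map \<G> l \<C> r \<G>' j P \<sigma>" and t: "(\<G>', \<F>, B):objs (J_trop g \<mu>)"
  and x: "x:cone (J_trop g \<mu>) (\<G>', \<F>, B)" "merge_halves \<G>' \<F> x = l'"
  and eq: "pseudo_divisor_on_curve \<G>' \<F> B x = (THE B. solves \<sigma> B)"
 shows "(\<G>', \<F>, B) = (\<G>', St.\<E>', St.D')" "x = St.y"
proof -
 have "pseudo_divisor \<G>' \<F> B" "pseudo_divisor \<G>' St.\<E>' St.D'" using t t_objs by (simp_all add: J_trop_def quasistable_pseudo_def)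
 note pd = this
 have o: "x:orthant (edges (subdivide \<G>' \<F>))" "St.y:orthant (edges St.H)" using x(1) y_J by (simp_all add: J_trop_def)
 have m: "merge_halves \<G>' \<F> x = merge_halves \<G>' St.\<E>' St.y" unfolding x(2) St.y_merge lengths_eq ..
 have "pseudo_divisor_on_curve \<G>' \<F> B x = \<D>" unfolding eq the_divisor[OF c] ..
 note pseudo_divisor_on_curve_inj[OF pd wf_graphD(2)[OF St.P.wfH] o m this]
 thus "(\<G>', \<F>, B) = (\<G>', St.\<E>', St.D')" "x = St.y" by simp_all
qed

end

subsection \<open>Specialization of reduced pairs\<close>

text \<open>A pruned edge joins a leaf to a different vertex. This is needed to see that an edge
  which a specialization turns into a loop stays in the core.\<close>

lemma prunes_loop:
 assumes "prunes \<G> \<C> r" and wf: "wf_graph \<G>" and e: "e:edges \<G>" "src \<G> e = tgt \<G> e" shows "e:edges \<C>" using assms(1)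
proof (induction rule: prunes.induct)
 case (prunes_step \<C> r v e' u)
 note p = prunesD[OF prunes_step.hyps(1) wf]
 have fin: "finite (edges \<C>)" using p wf_graphD(2)[OF wf] finite_subset by blast
 have "u ~= v" by (rule valence_one_edge(1)[OF fin prunes_step.hyps(3,6,7)])
 hence "src \<C> e' ~= tgt \<C> e'" using prunes_step.hyps(7) by (auto simp: doubleton_eq_iff)
 thus ?case using prunes_step.IH p e(2) by auto
qed (rule e(1))

text \<open>A point of the cone, possibly with vanishing lengths, together with a positive
  representative on \<open>\<G>1\<close>. The linear formula refers to \<open>\<G>\<close> and the
  Abel map to \<open>\<G>1\<close>; here the two reductions are compared.\<close>

locale reduction_specialization = R: admissible_reduction g n a m d \<mu> \<G> \<E> \<phi> \<C> r \<G>' j P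
 for g n a m d \<mu> \<G> \<E> \<phi> \<C> r \<G>' j P +
 fixes z and \<G>1 :: "(nat, nat) lgraph" and iV iE x1 \<C>1 r1 \<G>1' j1 P1
 assumes spec: "specialization \<G> \<G>1 iV iE" and \<G>1: "\<G>1:stable_graphs g (n + 1)"
  and z: "z:flow_cone \<G> \<E> \<phi>" and x1: "x1:orthant (edges \<G>1)" "positive_lengths \<G>1 x1"
  and zx: "merge_halves \<G> \<E> z = extend_zero (edges \<G>1) iE x1"
  and red1: "stable_reduction (only_leg0 \<G>1) \<C>1 r1 \<G>1' j1 P1"
begin

lemma finE: "finite (edges \<G>)" using R.wf by (rule wf_graphD)

lemma z_orthant: "z:orthant (edges R.G0)" using z unfolding flow_cone_def by blast

lemma z_nonneg: "h:edges R.G0 ==> z h >= 0" using z_orthant unfolding orthant_def by blast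

lemma z_pos:
 assumes e: "e:edges \<G>" shows "e:iE`edges \<G>1 \<longleftrightarrow> (\<exists>b. (e, b):edges R.G0 & z (e, b) > 0)"
proof -
 note c = specializationD[OF spec]
 have "e:iE`edges \<G>1 \<longleftrightarrow> merge_halves \<G> \<E> z e > 0" unfolding zx using x1(2) push_forward_outside[of e iE "edges \<G>1" x1]
  by (cases "e:iE`edges \<G>1") (auto simp: push_forward_inj[OF c(2)])
 also have "... \<longleftrightarrow> (\<exists>b. (e, b):edges R.G0 & z (e, b) > 0)"
  using z_nonneg[of "(e, False)"] z_nonneg[of "(e, True)"] e unfolding merge_halves_eq[OF finE e] ex_bool_eq by auto
 finally show ?thesis .
qed

sublocale C: subdivided_contraction \<G> \<G>1 iV iE \<E> z by unfold_locales (fact spec R.wf R.A(4) z_nonneg z_pos)+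

lemma D_graph_push: "v:verts \<G>1 ==> D_graph n a m \<G>1 v = push_forward (verts \<G>) iV (D_graph n a m \<G>) v"
 by (rule D_graph_specialization[OF spec R.wf stable_graphsD(5)[OF R.\<G>]])

lemma potential_exists: "\<exists>f. potential R.G0 \<phi> z f" using z flow_cone_iff[OF R.wf R.A(4)] by blast

lemma adm1: "(C.\<E>', C.\<phi>' \<phi>):Adm \<G>1 (induced_polarization \<mu> \<G>1) (D_graph n a m \<G>1)"
proof -
 obtain f where f: "potential R.G0 \<phi> z f" using potential_exists by blast
 show ?thesis by (rule C.Adm_sub[OF R.adm f D_graph_push _ induced_polarization_specialization[OF R.u R.g R.\<G> spec \<G>1]])
    (use stable_graphsD(5)[OF R.\<G>] in "simp_all add: D_graph_def")
qed

lemma z1: "C.z':flow_cone \<G>1 C.\<E>' (C.\<phi>' \<phi>)" using potential_exists C.potential_sub C.z'_orthant flow_cone_iff[OF C.wf' C.\<E>'_edges] by blast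

lemma x1_merge: "x1 = merge_halves \<G>1 C.\<E>' C.z'"
proof
 fix e
 have f: "finite (edges R.G0)" "finite (edges C.G')" "finite (edges \<G>1)"
  using subdivide_wf[OF R.wf R.A(4)] subdivide_wf[OF C.wf' C.\<E>'_edges] C.wf' by (auto intro: wf_graphD(2) simp del: subdivide_simps)
 have "extend_zero (edges \<G>1) iE x1 = extend_zero (edges \<G>1) iE (merge_halves \<G>1 C.\<E>' C.z')"
  using merge_halves_extend_zero[OF C.compatible f, of C.z'] unfolding zx[symmetric] C.z_extend[OF z_orthant, symmetric] .
 from fun_cong[OF this, of "iE e"] show "x1 e = merge_halves \<G>1 C.\<E>' C.z' e"
  using x1(1) by (cases "e:edges \<G>1") (simp_all add: push_forward_inj[OF C.conD(2)] merge_halves_outside orthant_def)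
qed

sublocale R1: positive_reduction g n a m d \<mu> \<G>1 C.\<E>' "C.\<phi>' \<phi>" \<C>1 r1 \<G>1' j1 P1 C.z' x1
 by unfold_locales (fact R.g R.u \<G>1 adm1 red1 z1 C.z'_pos x1_merge)+

lemma legs: "nlegs \<G> > 0" using stable_graphsD(5)[OF R.\<G>] by simp

lemmas reductions = stable_reduction_specialization[OF specialization_only_leg0[OF spec legs] R.o R.red red1]

lemma r1_r: "v:verts \<G> ==> r1 (iV v) = iV (r v)" using reductions(2) by simp

lemma core_spec: "specialization \<C> \<C>1 iV iE" using reductions(1) by (simp add: chains_specialization_def chains_specialization_axioms_def)

lemmas core = specializationD[OF core_spec]

lemma zc: "e:edges \<C> ==> b --> e:\<E> ==> R.zc z (e, b) = z (e, b)" by (simp add: R.zc_def)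

lemma zc_orthant: "R.zc z:orthant (edges R.G)"
proof -
 have "R.zc z h >= 0" for h using z_nonneg R.edges_G by (simp add: R.zc_def del: subdivide_simps)
 thus ?thesis unfolding orthant_def by (blast intro: R.zc_def[THEN trans] if_not_P)
qed

sublocale C': subdivided_contraction \<C> \<C>1 iV iE \<E> "R.zc z"
proof
 show "specialization \<C> \<C>1 iV iE" "wf_graph \<C>" "\<E> <= edges \<C>" by (fact core_spec R.St.P.wfG R.\<E>_core)+
 show "0 <= R.zc z h" if "h:edges R.G" for h using zc_orthant that unfolding orthant_def by blast
 fix e assume e: "e:edges \<C>"
 hence eG: "e:edges \<G>" using R.p by blast
 \<comment> \<open>If an edge of the core that survives in \<open>\<G>1\<close> were contracted
   between the cores, its ends would be identified and it would be a loop of \<open>\<G>1\<close>;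
   but loops are never pruned.\<close>
 have "e:iE`edges \<C>1 \<longleftrightarrow> e:iE`edges \<G>1"
 proof
  assume "e:iE`edges \<C>1" thus "e:iE`edges \<G>1" using R1.p by blast
 next
  assume "e:iE`edges \<G>1"
  then obtain e1 where e1: "e1:edges \<G>1" "e = iE e1" by blast
  show "e:iE`edges \<C>1"
  proof (rule ccontr)
   assume n: "e ~: iE`edges \<C>1"
   have "iV (src \<C> e) = iV (tgt \<C> e)" by (rule contraction_contracted[OF specialization_contraction[OF core_spec] wf_graphD(3)[OF R.St.P.wfG] e n])
   hence "src \<G>1 e1 = tgt \<G>1 e1" using C.conD(4)[OF e1(1)] R.p e1(2) by (auto simp: doubleton_eq_iff)
   hence "e1:edges \<C>1" using prunes_loop[OF R1.sr(7) one_leggedD(1)[OF R1.o], of e1] e1(1) by simp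
   thus False using n e1(2) by blast
  qed
 qed
 also have "... \<longleftrightarrow> (\<exists>b. (e, b):edges R.G0 & z (e, b) > 0)" by (rule z_pos[OF eG])
 also have "... \<longleftrightarrow> (\<exists>b. (e, b):edges R.G & R.zc z (e, b) > 0)" by (intro ex_cong1) (use e eG in "simp add: R.zc_def")
 finally show "e:iE`edges \<C>1 \<longleftrightarrow> (\<exists>b. (e, b):edges R.G & R.zc z (e, b) > 0)" .
qed

lemma C'_\<E>: "C'.\<E>' = C.\<E>'"
proof -
 have "e:C'.\<E>' \<longleftrightarrow> e:C.\<E>'" for e
 proof (cases "e:edges \<C>1")
  case True
  thus ?thesis using core(9)[OF True] R1.p unfolding C'.\<E>'_def C.\<E>'_def by (auto simp: zc)
 next
  case False thus ?thesis using R1.\<E>_core C'.\<E>'_edges by blast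
 qed
 thus ?thesis by blast
qed

lemma gV_core: assumes v: "v:verts R.G0" shows "map_sum r1 id (C.gV v) = C'.gV (map_sum r id v)"
proof (cases v)
 case (Inl u) thus ?thesis using v r1_r by auto
next
 case (Inr e)
 hence e: "e:\<E>" using v by auto
 hence eD: "e:edges \<C>" using R.\<E>_core by blast
 show ?thesis
 proof (cases "e:iE`C.\<E>'")
  case True
  then obtain e' where "e':C.\<E>'" "e = iE e'" by blast
  thus ?thesis using C.gV_Inr_exceptional[of e'] C'.gV_Inr_exceptional[of e'] Inr by (simp add: C'_\<E>)
 next
  case False
  have ends: "r1 (iV (src \<G> e)) = iV (src \<G> e)" "r1 (iV (tgt \<G> e)) = iV (tgt \<G> e)" using R.core_ends[OF eD] R.p(2) r1_r R.r_core by auto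
  show ?thesis using C.gV_Inr_other[OF False] C'.gV_Inr_other[of e] False Inr R.p eD ends by (simp add: C'_\<E> zc)
 qed
qed

lemma gE_core: assumes h: "h:edges (subdivide \<C>1 C.\<E>')" shows "C'.gE h = C.gE h"
proof -
 obtain e b where eb: "h = (e, b)" "e:edges \<C>1" using h by auto
 show ?thesis using core(9)[OF eb(2)] R.p R1.p unfolding eb(1) C'.gE_def C.gE_def C'_\<E> by (simp add: zc)
qed

lemma zc1: "R1.zc C.z' = C'.z'"
proof
 fix h show "R1.zc C.z' h = C'.z' h"
 proof (cases "h:edges (subdivide \<C>1 C.\<E>')")
  case True
  have "C'.gE h:edges R.G" using C'.gE_pos(1)[of h] True unfolding C'_\<E> by blast
  thus ?thesis using True R1.edges_G[OF True] gE_core[OF True] by (simp add: R1.zc_def C.z'_def C'.z'_def C'_\<E> R.zc_def del: subdivide_simps)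
 qed (simp add: R1.zc_def C'.z'_def C'_\<E> del: subdivide_simps)
qed

lemma D\<C>1: assumes w: "w:verts (subdivide \<C>1 C.\<E>')" shows "R1.D\<C> w = push_forward (verts R.G) C'.gV R.D\<C> w"
proof -
 let ?D = "adm_divisor \<G> (D_graph n a m \<G>) \<E> \<phi>"
 have fin: "finite (verts R.G0)" "finite (verts C.G')" "finite (verts R.G)"
  using subdivide_wf[OF R.wf R.A(4)] subdivide_wf[OF C.wf' C.\<E>'_edges] R.St.Q.wfG by (auto intro: wf_graphD(1) simp del: subdivide_simps)
 have "R1.D\<C> w = push_forward (verts C.G') (map_sum r1 id) (push_forward (verts R.G0) C.gV ?D) w"
  unfolding R1.D\<C>_push[OF w] by (rule push_forward_cong[OF refl]) (rule C.adm_divisor_push[OF D_graph_push])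
 also have "... = push_forward (verts R.G0) (map_sum r1 id \<circ> C.gV) ?D w" by (rule push_forward_comp[OF fin(1,2)]) (simp only: C.gV_verts)
 also have "... = push_forward (verts R.G0) (C'.gV \<circ> map_sum r id) ?D w" by (rule push_forward_cong) (simp_all only: comp_apply gV_core)
 also have "... = push_forward (verts R.G) C'.gV (push_forward (verts R.G0) (map_sum r id) ?D) w" by (rule push_forward_comp[symmetric, OF fin(1,3)]) (use R.r_in in auto)
 also have "... = push_forward (verts R.G) C'.gV R.D\<C> w" by (rule push_forward_cong[OF refl]) (rule R.D\<C>_push[symmetric])
 finally show ?thesis .
qed

text \<open>The straightened data of \<open>\<G>1\<close> are a specialization of those of
  \<open>\<G>\<close>, under which lengths are extended by zero. Hence the formula for
  \<open>\<G>\<close> gives the right point of the colimit on the faces of the cone as well.\<close>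

lemma glued: "(((\<G>1', R1.St.\<E>', R1.St.D'), R1.St.y), ((\<G>', R.St.\<E>', R.St.D'), R.y z)):glue (J_trop g \<mu>)"
proof -
 interpret SS: straightening_specialization \<G>' \<C> j P \<E> R.D\<C> R.\<nu> "leg \<G>' 0" \<G>1' \<C>1 j1 P1 C.\<E>' R1.D\<C> R1.\<nu> "leg \<G>1' 0" iV iE "R.zc z"
  unfolding straightening_specialization_def straightening_specialization_axioms_def
 proof (intro conjI allI impI reductions(1) R.St.straightening_axioms R1.St.straightening_axioms C'.subdivided_contraction_axioms)
  show "R.D\<C> (Inr e) = -1" if "e:\<E>" for e
  proof -
   have "Inr e:verts R.G" using that by simp
   have "flow_div R.G0 \<phi> (Inr e) = -1" using R.A(5) that by (simp add: pseudo_divisor_def adm_divisor_def)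
   have "R.D\<C> (Inr e) = (SUM v:{Inr e}. adm_divisor \<G> (D_graph n a m \<G>) \<E> \<phi> v)"
    unfolding R.D\<C>_push[OF \<open>Inr e:verts R.G\<close>] push_forward_def by (rule sum.cong) (use that in auto)
   thus ?thesis using R.A(5) that by (simp add: pseudo_divisor_def)
  qed
 qed (simp_all add: C'_\<E> D\<C>1 del: subdivide_simps)
 have "R.zc z = extend_zero (edges (subdivide \<C>1 C.\<E>')) C'.gE (R1.zc C.z')" using C'.z_extend[OF zc_orthant] unfolding zc1 C'_\<E> .
 hence y: "R.y z = extend_zero (edges (subdivide \<G>1' R1.St.\<E>')) SS.Y.sE R1.St.y" using SS.Y.path_lengths_extend_zero[of "R1.zc C.z'"] by simp
 have "extend_zero (edges (subdivide \<G>1' R1.St.\<E>')) SS.Y.sE:mors (J_trop g \<mu>) (\<G>1', R1.St.\<E>', R1.St.D') (\<G>', R.St.\<E>', R.St.D')"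
  using SS.compatible SS.D'_push unfolding J_trop_def by (auto simp del: subdivide_simps)
 from glue_morI[OF R1.t_objs R.t_objs this R1.y_J] show ?thesis unfolding y[symmetric] using R.y_orthant[of z] z_nonneg by (simp add: J_trop_def del: subdivide_simps)
qed

end

subsection \<open>The composition\<close>

lemma glue_cone_points: "(p, q):glue D ==> p:cone_points D ==> q:cone_points D"
 unfolding glue_def by (induction rule: rtrancl_induct) (auto simp: glue_step_def cone_points_def)

text \<open>Forgetting \<open>\<E>\<close> and \<open>\<phi>\<close> turns each gluing step into one
  of \<open>M_trop\<close>, so the image of a class is a single class, as \<open>the_elem\<close>
  requires.\<close>

lemma beta_trop_class:
 "beta_trop g n (colim_class (MA_trop g n a m \<mu>) ((\<G>, \<E>, \<phi>), x)) = colim_class (M_trop g (n + 1)) (\<G>, x)"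
proof -
 let ?F = "%((\<G>, \<E>, \<phi>), x). colim_class (M_trop g (n + 1)) (\<G>, x)" and ?MA = "MA_trop g n a m \<mu>"
 have orth: "x:orthant (edges \<G>)" "\<G>:stable_graphs g (n + 1)" if "(\<G>, \<E>, \<phi>):objs ?MA" "x:cone ?MA (\<G>, \<E>, \<phi>)" for \<G> \<E> \<phi> x
 proof -
  have o: "\<G>:stable_graphs g (n + 1)" "(\<E>, \<phi>):Adm \<G> (induced_polarization \<mu> \<G>) (D_graph n a m \<G>)" using that(1) by (simp_all add: MA_objs)
  show "\<G>:stable_graphs g (n + 1)" by (rule o)
  interpret admissible \<G> \<E> \<phi> by (rule Adm_admissible[OF stable_graphsD(1)[OF o(1)] o(2)])
  show "x:orthant (edges \<G>)" using K_cone_orthant that(2) by (auto simp: MA_trop_def)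
 qed
 have glued: "?F p = ?F q" if "(p, q):glue_step ?MA" for p q
 proof -
  from that have "\<exists>s y t f. (p, q) = ((s, y), (t, f y)) & s:objs ?MA & t:objs ?MA & f:mors ?MA s t & y:cone ?MA s & f y:cone ?MA t"
   unfolding glue_step_def mem_Collect_eq .
  then obtain s y t f where pq: "(p, q) = ((s, y), (t, f y))"
   and s: "s:objs ?MA" "t:objs ?MA" "f:mors ?MA s t" "y:cone ?MA s" "f y:cone ?MA t" by (elim exE conjE) (rule that; assumption)
  obtain \<G> \<E> \<phi> \<G>2 \<E>2 \<phi>2 where st: "s = (\<G>, \<E>, \<phi>)" "t = (\<G>2, \<E>2, \<phi>2)" by (cases s; cases t)
  obtain iV iE gV gE where f: "compatible_specialization \<G>2 \<E>2 \<G> \<E> iV iE gV gE" "f = extend_zero (edges \<G>) iE" using s(3) unfolding st MA_trop_def by auto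
  have "((\<G>, y), (\<G>2, f y)):glue (M_trop g (n + 1))"
   by (rule glue_morI) (use orth[of \<G> \<E> \<phi> y] orth[of \<G>2 \<E>2 \<phi>2 "f y"] s f st in "auto simp: M_trop_def compatible_specialization_def")
  thus ?thesis using pq unfolding st by (simp add: colim_class_eq_iff)
 qed
 have inv: "?F p = ?F q" if "(p, q):glue ?MA" for p q using that unfolding glue_def
 proof (induction rule: rtrancl_induct)
  case (step q r)
  hence "?F q = ?F r" using glued[of q r] glued[of r q] by (elim UnE converseE) simp_all
  with step.IH show ?case by (rule trans)
 qed simp
 let ?p = "((\<G>, \<E>, \<phi>), x)"
 have "the_elem (?F`colim_class ?MA ?p) = ?F ?p"
 proof (rule the_elem_image_unique)
  have "?p:colim_class ?MA ?p" by (simp add: mem_colim_class glue_def)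
  thus "colim_class ?MA ?p ~= {}" by blast
  fix q assume "q:colim_class ?MA ?p"
  thus "?F q = ?F ?p" unfolding mem_colim_class by (rule inv[symmetric])
 qed
 thus ?thesis by (simp only: beta_trop_def split)
qed

lemma int_functional_if: "(b ==> int_functional I L) ==> int_functional I (%x. if b then L x else 0)" by (cases b) (simp_all add: int_functional_zero)

theorem theorem3p13:
  fixes g n :: nat and a :: "nat \<Rightarrow> int" and m d :: int
    and \<mu> :: "(nat, nat) lgraph \<Rightarrow> nat \<Rightarrow> real"
  assumes "g \<ge> 1"
    and "d = (\<Sum>i\<le>n. a i) + m * (2 * int g - 2)"
    and "universal_polarization g d \<mu>"
  shows "cone_complex_morphism (MA_trop g n a m \<mu>) (J_trop g \<mu>)
           (alpha_trop g n a m \<mu> \<circ> beta_trop g n)"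
proof (rule cone_complex_morphismI[OF MA_trop_finite_face_diagram J_trop_finite_face_diagram])
 fix s assume s: "s:objs (MA_trop g n a m \<mu>)"
 obtain \<G> \<E> \<phi> where sd: "s = (\<G>, \<E>, \<phi>)" by (cases s)
 have \<G>: "\<G>:stable_graphs g (n + 1)" and adm: "(\<E>, \<phi>):Adm \<G> (induced_polarization \<mu> \<G>) (D_graph n a m \<G>)"
  using s unfolding sd MA_objs by blast+
 obtain \<C> r \<G>' j P where red: "stable_reduction (only_leg0 \<G>) \<C> r \<G>' j P" using stable_reduction_exists[OF one_legged_only_leg0[OF \<G> assms(1)]] by blast
 interpret R: admissible_reduction g n a m d \<mu> \<G> \<E> \<phi> \<C> r \<G>' j P by unfold_locales (fact assms \<G> adm red)+
 interpret K: admissible \<G> \<E> \<phi> by (rule Adm_admissible[OF R.wf adm])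
 \<comment> \<open>One cone \<open>?t\<close> and one linear map \<open>?h\<close> serve all points
   of the source cone, whatever lengths vanish there.\<close>
 let ?t = "(\<G>', R.St.\<E>', R.St.D')" and ?h = "%x. R.y (K.lift x)"
 have coneK: "cone (MA_trop g n a m \<mu>) s = K_cone \<G> \<E> \<phi>" "coords (MA_trop g n a m \<mu>) s = edges \<G>" by (simp_all add: sd MA_trop_def)
 have coneJ: "cone (J_trop g \<mu>) ?t = orthant (edges R.St.H)" "coords (J_trop g \<mu>) ?t = edges R.St.H" by (simp_all add: J_trop_def)
 have "cone_morphism (edges \<G>) (K_cone \<G> \<E> \<phi>) (edges R.St.H) (orthant (edges R.St.H)) ?h"
 proof (rule cone_morphismI)
  fix x assume x: "x:K_cone \<G> \<E> \<phi>"
  show "?h x:orthant (edges R.St.H)" by (rule R.y_orthant) (use K.K_coneD(1)[OF x] in "unfold flow_cone_def orthant_def, blast")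
  show "?h x e = 0" if "e ~: edges R.St.H" for e unfolding path_lengths_def using that by (rule if_not_P)
 next
  fix e assume e: "e:edges R.St.H"
  let ?L = "%x. \<Sum>q\<leftarrow>R.St.Q' e. if fst q:edges R.G then K.N (fst q) x else 0"
  have "int_functional (edges \<G>) ?L" by (intro int_functional_sum_list int_functional_if K.N(1) R.edges_G)
  moreover have "?h x e = ?L x" for x
  proof -
   have "R.zc (K.lift x) h = (if h:edges R.G then K.N h x else 0)" for h using R.edges_G[of h] by (simp add: R.zc_def K.lift_def del: subdivide_simps)
   thus ?thesis using e by (simp add: path_lengths_def del: subdivide_simps)
  qed
  ultimately show "\<exists>L. int_functional (edges \<G>) L & (ALL x:K_cone \<G> \<E> \<phi>. ?h x e = L x)" by blast
 qed
 moreover have "(alpha_trop g n a m \<mu> \<circ> beta_trop g n) (colim_class (MA_trop g n a m \<mu>) (s, x)) = colim_class (J_trop g \<mu>) (?t, ?h x)"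
  if x: "x:K_cone \<G> \<E> \<phi>" for x
 proof -
  note K = K.K_coneD[OF x]
  have xo: "x:orthant (edges \<G>)" using K.K_cone_orthant x by blast
  have step: "reduction_specialization g n a m d \<mu> \<G> \<E> \<phi> \<C> r \<G>' j P (K.lift x) \<G>1 iV iE x1 \<C>1 r1 \<G>1' j1 P1"
   if "specialization \<G> \<G>1 iV iE" "\<G>1:stable_graphs g (n + 1)" "x1:orthant (edges \<G>1)" "positive_lengths \<G>1 x1"
    "x = extend_zero (edges \<G>1) iE x1" "stable_reduction (only_leg0 \<G>1) \<C>1 r1 \<G>1' j1 P1" for \<G>1 iV iE x1 \<C>1 r1 \<G>1' j1 P1
   by unfold_locales (use that K in simp_all)
  let ?Q = "%c. \<exists>\<G>1 l t y. (\<G>1, l):colim_class (M_trop g (n + 1)) (\<G>, x) & positive_lengths \<G>1 l &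
     abel_relation g n a m \<mu> \<G>1 l t y & c = colim_class (J_trop g \<mu>) (t, y)"
  have "alpha_trop g n a m \<mu> (colim_class (M_trop g (n + 1)) (\<G>, x)) = colim_class (J_trop g \<mu>) (?t, ?h x)" unfolding alpha_trop_def
  proof (rule the_equality)
   \<comment> \<open>Existence: a positive representative is an actual curve, and its Abel image is
     glued to the value of \<open>?h\<close>.\<close>
   obtain \<G>1 iV iE x1 where 1: "\<G>1:stable_graphs g (n + 1)" "specialization \<G> \<G>1 iV iE"
    "x1:orthant (edges \<G>1)" "positive_lengths \<G>1 x1" "x = extend_zero (edges \<G>1) iE x1" "((\<G>, x), (\<G>1, x1)):glue (M_trop g (n + 1))"
    using positive_representative[OF \<G> xo] .
   obtain \<C>1 r1 \<G>1' j1 P1 where red1: "stable_reduction (only_leg0 \<G>1) \<C>1 r1 \<G>1' j1 P1"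
    using stable_reduction_exists[OF one_legged_only_leg0[OF 1(1) assms(1)]] by blast
   interpret S: reduction_specialization g n a m d \<mu> \<G> \<E> \<phi> \<C> r \<G>' j P "K.lift x" \<G>1 iV iE x1 \<C>1 r1 \<G>1' j1 P1
    by (rule step[OF 1(2,1,3-5) red1])
   have "colim_class (J_trop g \<mu>) (?t, ?h x) = colim_class (J_trop g \<mu>) ((\<G>1', S.R1.St.\<E>', S.R1.St.D'), S.R1.St.y)"
    using S.glued unfolding colim_class_eq_iff[symmetric] by (rule sym)
   thus "?Q (colim_class (J_trop g \<mu>) (?t, ?h x))" by (intro exI conjI) (use 1(4,6) S.R1.abel in "auto simp: mem_colim_class")
  next
   fix c assume "?Q c"
   then obtain \<G>1 l t y where gl: "((\<G>, x), (\<G>1, l)):glue (M_trop g (n + 1))" and lp: "positive_lengths \<G>1 l"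
    and ab: "abel_relation g n a m \<mu> \<G>1 l t y" and c: "c = colim_class (J_trop g \<mu>) (t, y)" by (auto simp: mem_colim_class)
   have "(\<G>1, l):cone_points (M_trop g (n + 1))" by (rule glue_cone_points[OF gl]) (use \<G> xo in "simp add: cone_points_def M_trop_def")
   hence \<G>1: "\<G>1:stable_graphs g (n + 1)" "l:orthant (edges \<G>1)" by (simp_all add: cone_points_def M_trop_def)
   \<comment> \<open>Uniqueness: any positive representative in the class is a specialization of
     \<open>\<G>\<close>, so the same comparison applies to it and to whatever stable reduction and
     reduction map were chosen for it.\<close>
   obtain iV iE where sp: "specialization \<G> \<G>1 iV iE" "x = extend_zero (edges \<G>1) iE l" using M_trop_glue_positive[OF gl \<G>1 lp] .
   obtain \<G>1' \<F> B where t: "t = (\<G>1', \<F>, B)" by (cases t)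
   obtain \<C>1 r1 j1 P1 \<sigma> where red1: "stable_reduction (only_leg0 \<G>1) \<C>1 r1 \<G>1' j1 P1"
    and \<sigma>: "curve_reduction_map \<G>1 l \<C>1 r1 \<G>1' j1 P1 \<sigma>" "(\<G>1', \<F>, B):objs (J_trop g \<mu>)" "y:cone (J_trop g \<mu>) (\<G>1', \<F>, B)"
     "merge_halves \<G>1' \<F> y = path_lengths \<G>1' P1 l"
     "pseudo_divisor_on_curve \<G>1' \<F> B y = (THE \<D>. curve_quasistable \<G>1' (path_lengths \<G>1' P1 l) (Vertex (leg \<G>1' 0)) (\<mu> \<G>1') \<D> &
      equivalent_divisors \<G>1' (path_lengths \<G>1' P1 l) (curve_push_forward \<sigma> (D_curve n a m \<G>1 l)) \<D>)"
    using ab unfolding t abel_relation_def split Let_def by blast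
   interpret S: reduction_specialization g n a m d \<mu> \<G> \<E> \<phi> \<C> r \<G>' j P "K.lift x" \<G>1 iV iE l \<C>1 r1 \<G>1' j1 P1
    by (rule step[OF sp(1) \<G>1 lp sp(2) red1])
   have "(t, y) = ((\<G>1', S.R1.St.\<E>', S.R1.St.D'), S.R1.St.y)" unfolding t using S.R1.abel_unique[OF \<sigma>] by simp
   thus "c = colim_class (J_trop g \<mu>) (?t, ?h x)" using S.glued unfolding c colim_class_eq_iff[symmetric] by (simp only:)
  qed
  thus ?thesis by (simp only: comp_apply sd beta_trop_class)
 qed
 ultimately show "EX t:objs (J_trop g \<mu>). \<exists>h. cone_morphism (coords (MA_trop g n a m \<mu>) s) (cone (MA_trop g n a m \<mu>) s)
   (coords (J_trop g \<mu>) t) (cone (J_trop g \<mu>) t) h & (ALL x:cone (MA_trop g n a m \<mu>) s.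
   (alpha_trop g n a m \<mu> \<circ> beta_trop g n) (colim_class (MA_trop g n a m \<mu>) (s, x)) = colim_class (J_trop g \<mu>) (t, h x))"
  unfolding coneK by (intro bexI[OF _ R.t_objs] exI[of _ ?h]) (simp only: coneJ, blast)
qed

end
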